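(* Let $L$ be a Niemeier lattice and let $\tau\in\operatorname{Aut}L$ be an automorphism of order $3$ such that $\operatorname{rank}L^{\tau}\in 6\mathbb{Z}$. Let $\widetilde V_L^{\tau}$ be the holomorphic vertex operator algebra (VOA) obtained from $(L,\tau)$ by Miyamoto's $\mathbb{Z}_3$-orbifold construction. If $\tau$ is contained in the Weyl group $G_0(L)$ of $L$, then $\widetilde V_L^{\tau}$ is isomorphic, as a VOA, to the lattice VOA associated to some Niemeier lattice.
   Context: A Niemeier lattice is a positive-definite even unimodular lattice $L$ of rank $24$; $L^\tau=\{x\in L\mid \tau(x)=x\}$. The Weyl group $G_0(L)\subset\operatorname{Aut}L$ is the subgroup generated by the reflections in the vectors $\alpha\in L$ with $\langle\alpha,\alpha\rangle=2$; it equals the product of the Weyl groups of the indecomposable components of the root lattice $Q$ generated by these vectors, and is trivial if $Q=\{0\}$. Miyamoto's $\mathbb{Z}_3$-orbifold construction. All VOAs are over $\mathbb{C}$. For a positive-definite even lattice $L$, put $\mathfrak h=L\otimes_{\mathbb Z}\mathbb C$ and let $V_L=M(1)\otimes\mathbb{C}\{L\}$ be the lattice VOA, spanned by the elements $h_k(-n_k)\cdots h_1(-n_1)1\otimes e^{\alpha}$ ($h_i\in\mathfrak h$, $n_i\in\mathbb{Z}_{>0}$, $\alpha\in L$). An automorphism $\tau$ of $L$ of odd order induces an automorphism of $V_L$ of the same order, also denoted $\tau$, by $h_k(-n_k)\cdots h_1(-n_1)1\otimes e^{\alpha}\mapsto(\tau h_k)(-n_k)\cdots(\tau h_1)(-n_1)1\otimes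 e^{\tau\alpha}$ (the twisted group algebra $\mathbb{C}\{L\}$ being defined by a $\tau$-invariant 2-cocycle). Let now $L$ be a Niemeier lattice, $|\tau|=3$ and $\operatorname{rank}L^\tau\in6\mathbb{Z}$. For $r=1,2$ let $V_L(\tau^r)$ be the unique irreducible $\tau^r$-twisted $V_L$-module; its weights lie in $\rho+\frac13\mathbb{Z}_{\ge0}$ with $\rho=\frac1{18}(24-\operatorname{rank}L^\tau)$. Let $V_L(\tau^r)_{\mathbb{Z}}$ be the sum of its integral-weight subspaces and $V_L^\tau$ the fixed-point subVOA of $V_L$ under $\tau$. Then $\widetilde V_L^\tau:=V_L^\tau\oplus V_L(\tau)_{\mathbb{Z}}\oplus V_L(\tau^2)_{\mathbb{Z}}$, equipped with the VOA structure of central charge $24$ given by Miyamoto's theorem, which extends the VOA structure of $V_L^\tau$ and its action on the two other summands; $\widetilde V_L^\tau$ is holomorphic, $C_2$-cofinite, and a $\mathbb{Z}_3$-graded simple current extension of $V_L^\tau$. *)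

theory Defs
  imports "HOL-Analysis.Analysis" "HOL-Library.Poly_Mapping" "HOL-Library.Multiset"
begin

section \<open>Niemeier lattices\<close>

text \<open>
  An abstract positive-definite lattice \<open>L\<close> of rank \<open>n\<close> is realised inside its Euclidean space
  \<open>L \<otimes> \<real> = \<real>\<^sup>n\<close>; its automorphisms are then the linear isometries of \<open>\<real>\<^sup>n\<close> that preserve \<open>L\<close>.
\<close>

definition full_lattice :: "'a::euclidean_space set \<Rightarrow> bool" where
  "full_lattice L \<longleftrightarrow>
     (\<exists>B. independent B \<and> span B = UNIV \<and>
          L = {(\<Sum>b\<in>B. of_int (k b) *\<^sub>R b) |k::'a \<Rightarrow> int. True})"

definition even_lattice :: "'a::euclidean_space set \<Rightarrow> bool" where
  "even_lattice L \<longleftrightarrow> full_lattice L \<and> (\<forall>x\<in>L. \<exists>k::int. x \<bullet> x = 2 * of_int k)"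

definition dual_lattice :: "'a::euclidean_space set \<Rightarrow> 'a set" where
  "dual_lattice L = {y. \<forall>x\<in>L. x \<bullet> y \<in> \<int>}"

definition niemeier_lattice :: "(real^24) set \<Rightarrow> bool" where
  "niemeier_lattice L \<longleftrightarrow> even_lattice L \<and> dual_lattice L = L"

definition lattice_aut :: "'a::euclidean_space set \<Rightarrow> ('a \<Rightarrow> 'a) set" where
  "lattice_aut L = {\<tau>. orthogonal_transformation \<tau> \<and> \<tau> ` L = L}"

definition fixed_sublattice :: "'a set \<Rightarrow> ('a \<Rightarrow> 'a) \<Rightarrow> 'a set" where
  "fixed_sublattice L \<tau> = {x\<in>L. \<tau> x = x}"

text \<open>A subgroup of a lattice is discrete, so its rank is the real dimension of its span.\<close>

definition lattice_rank :: "'a::euclidean_space set \<Rightarrow> nat" where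
  "lattice_rank L = dim L"

inductive_set weyl_group :: "'a::euclidean_space set \<Rightarrow> ('a \<Rightarrow> 'a) set"
  for L :: "'a set" where
  weyl_id: "id \<in> weyl_group L"
| weyl_reflection: "g \<in> weyl_group L \<Longrightarrow> \<alpha> \<in> L \<Longrightarrow> \<alpha> \<bullet> \<alpha> = 2 \<Longrightarrow>
    (\<lambda>x. x - (x \<bullet> \<alpha>) *\<^sub>R \<alpha>) \<circ> g \<in> weyl_group L"

text \<open>
  The cocycles defining the twisted group algebra \<open>\<complex>{L}\<close>, with
  \<open>e\<^sup>\<alpha> e\<^sup>\<beta> = \<epsilon>(\<alpha>,\<beta>) e\<^sup>\<alpha>\<^sup>+\<^sup>\<beta>\<close> and \<open>e\<^sup>\<alpha> e\<^sup>\<beta> = (-1)\<^bsup>\<langle>\<alpha>,\<beta>\<rangle>\<^esup> e\<^sup>\<beta> e\<^sup>\<alpha>\<close>.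
  The normalisation makes \<open>e\<^sup>0\<close> the unit.
\<close>

definition twisting_cocycle :: "'a::euclidean_space set \<Rightarrow> ('a \<Rightarrow> 'a \<Rightarrow> complex) \<Rightarrow> bool" where
  "twisting_cocycle L \<epsilon> \<longleftrightarrow>
     (\<forall>\<alpha>\<in>L. \<forall>\<beta>\<in>L. \<epsilon> \<alpha> \<beta> \<noteq> 0) \<and>
     (\<forall>\<alpha>\<in>L. \<epsilon> \<alpha> 0 = 1 \<and> \<epsilon> 0 \<alpha> = 1) \<and>
     (\<forall>\<alpha>\<in>L. \<forall>\<beta>\<in>L. \<forall>\<gamma>\<in>L. \<epsilon> \<alpha> \<beta> * \<epsilon> (\<alpha> + \<beta>) \<gamma> = \<epsilon> \<beta> \<gamma> * \<epsilon> \<alpha> (\<beta> + \<gamma>)) \<and>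
     (\<forall>\<alpha>\<in>L. \<forall>\<beta>\<in>L. \<epsilon> \<alpha> \<beta> = (-1) powi \<lfloor>\<alpha> \<bullet> \<beta>\<rfloor> * \<epsilon> \<beta> \<alpha>)"

definition invariant_cocycle :: "'a set \<Rightarrow> ('a \<Rightarrow> 'a) \<Rightarrow> ('a \<Rightarrow> 'a \<Rightarrow> complex) \<Rightarrow> bool" where
  "invariant_cocycle L \<tau> \<epsilon> \<longleftrightarrow> (\<forall>\<alpha>\<in>L. \<forall>\<beta>\<in>L. \<epsilon> (\<tau> \<alpha>) (\<tau> \<beta>) = \<epsilon> \<alpha> \<beta>)"


section \<open>Vertex operator algebras\<close>

text \<open>
  A VOA is carried by a subspace of an ambient complex vector space. The field
  \<open>vmode V u n\<close> is the mode \<open>u\<^sub>n\<close> in \<open>Y(u,z) = \<Sum>\<^sub>n u\<^sub>n z\<^bsup>-n-1\<^esup>\<close>.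
  All values outside the carrier are irrelevant.
\<close>

record 'v voa =
  vcar :: "'v set"
  vscale :: "complex \<Rightarrow> 'v \<Rightarrow> 'v"
  vmode :: "'v \<Rightarrow> int \<Rightarrow> 'v \<Rightarrow> 'v"
  vac :: 'v
  conf :: 'v

definition vweight :: "'v voa \<Rightarrow> complex \<Rightarrow> 'v set" where
  "vweight V \<mu> = {v \<in> vcar V. vmode V (conf V) 1 v = vscale V \<mu> v}"

text \<open>
  \<open>borcherds\<close> is the component form of the Jacobi identity; its sums over \<open>j :: nat\<close> are finite
  because of \<open>truncation\<close>. The constant \<open>c\<close> is the central charge, and \<open>L(n) = \<omega>\<^bsub>n+1\<^esub>\<close>.
\<close>

locale vertex_operator_algebra = vector_space "vscale V"
  for V :: "'v::ab_group_add voa" +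
  fixes c :: complex
  assumes subspace_vcar: "subspace (vcar V)"
    and vac_in: "vac V \<in> vcar V"
    and conf_in: "conf V \<in> vcar V"
    and mode_closed: "\<lbrakk>u \<in> vcar V; v \<in> vcar V\<rbrakk> \<Longrightarrow> vmode V u n v \<in> vcar V"
    and mode_add_left: "\<lbrakk>u \<in> vcar V; u' \<in> vcar V; v \<in> vcar V\<rbrakk>
      \<Longrightarrow> vmode V (u + u') n v = vmode V u n v + vmode V u' n v"
    and mode_add_right: "\<lbrakk>u \<in> vcar V; v \<in> vcar V; v' \<in> vcar V\<rbrakk>
      \<Longrightarrow> vmode V u n (v + v') = vmode V u n v + vmode V u n v'"
    and mode_scale_left: "\<lbrakk>u \<in> vcar V; v \<in> vcar V\<rbrakk>
      \<Longrightarrow> vmode V (vscale V a u) n v = vscale V a (vmode V u n v)"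
    and mode_scale_right: "\<lbrakk>u \<in> vcar V; v \<in> vcar V\<rbrakk>
      \<Longrightarrow> vmode V u n (vscale V a v) = vscale V a (vmode V u n v)"
    and truncation: "\<lbrakk>u \<in> vcar V; v \<in> vcar V\<rbrakk> \<Longrightarrow> \<exists>N. \<forall>n\<ge>N. vmode V u n v = 0"
    and vac_mode: "v \<in> vcar V \<Longrightarrow> vmode V (vac V) n v = (if n = -1 then v else 0)"
    and creation: "v \<in> vcar V \<Longrightarrow> vmode V v (-1) (vac V) = v"
    and creation_reg: "\<lbrakk>v \<in> vcar V; n \<ge> 0\<rbrakk> \<Longrightarrow> vmode V v n (vac V) = 0"
    and borcherds: "\<lbrakk>u \<in> vcar V; v \<in> vcar V; w \<in> vcar V\<rbrakk> \<Longrightarrow>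
      Sum_any (\<lambda>j::nat. vscale V (of_int p gchoose j)
          (vmode V (vmode V u (l + int j) v) (p + q - int j) w)) =
      Sum_any (\<lambda>j::nat. vscale V ((-1) ^ j * (of_int l gchoose j))
          (vmode V u (p + l - int j) (vmode V v (q + int j) w)
           - vscale V ((-1) powi l) (vmode V v (q + l - int j) (vmode V u (p + int j) w))))"
    and virasoro: "w \<in> vcar V \<Longrightarrow>
      vmode V (conf V) (m + 1) (vmode V (conf V) (n + 1) w)
       - vmode V (conf V) (n + 1) (vmode V (conf V) (m + 1) w) =
      vscale V (of_int (m - n)) (vmode V (conf V) (m + n + 1) w)
       + (if m + n = 0 then vscale V (of_int (m ^ 3 - m) / 12 * c) w else 0)"
    and translation: "\<lbrakk>u \<in> vcar V; v \<in> vcar V\<rbrakk> \<Longrightarrow>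
      vmode V (vmode V (conf V) 0 u) n v = vscale V (- of_int n) (vmode V u (n - 1) v)"
    and graded: "vcar V = span (\<Union>n::int. vweight V (of_int n))"
    and weight_finite: "\<exists>B. finite B \<and> vweight V (of_int (n::int)) \<subseteq> span B"
    and weight_bounded: "\<exists>N. \<forall>n<N. vweight V (of_int (n::int)) = {0}"

definition voa_isomorphic :: "'v::ab_group_add voa \<Rightarrow> 'w::ab_group_add voa \<Rightarrow> bool" where
  "voa_isomorphic V W \<longleftrightarrow>
     (\<exists>f. Vector_Spaces.linear (vscale V) (vscale W) f \<and> bij_betw f (vcar V) (vcar W) \<and>
          f (vac V) = vac W \<and> f (conf V) = conf W \<and>
          (\<forall>u\<in>vcar V. \<forall>v\<in>vcar V. \<forall>n. f (vmode V u n v) = vmode W (f u) n (f v)))"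

definition C2_cofinite :: "'v::ab_group_add voa \<Rightarrow> bool" where
  "C2_cofinite V \<longleftrightarrow>
     (\<exists>B. finite B \<and> B \<subseteq> vcar V \<and>
          vcar V \<subseteq> module.span (vscale V)
            (B \<union> {vmode V u (-2) v |u v. u \<in> vcar V \<and> v \<in> vcar V}))"

definition fixed_points :: "'v voa \<Rightarrow> ('v \<Rightarrow> 'v) \<Rightarrow> 'v set" where
  "fixed_points V g = {v \<in> vcar V. g v = v}"


section \<open>Twisted modules\<close>

text \<open>
  \<open>mmode M u n\<close> is the mode \<open>u\<^sub>n\<close> in \<open>Y\<^sub>M(u,z) = \<Sum>\<^sub>n u\<^sub>n z\<^bsup>-n-1\<^esup>\<close>, with rational \<open>n\<close>.
\<close>

record ('v, 'm) vmodule =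
  mcar :: "'m set"
  mscale :: "complex \<Rightarrow> 'm \<Rightarrow> 'm"
  mmode :: "'v \<Rightarrow> rat \<Rightarrow> 'm \<Rightarrow> 'm"

definition mweight :: "'v voa \<Rightarrow> ('v, 'm) vmodule \<Rightarrow> complex \<Rightarrow> 'm set" where
  "mweight V M \<mu> = {w \<in> mcar M. mmode M (conf V) 1 w = mscale M \<mu> w}"

definition eigenspace :: "'v voa \<Rightarrow> ('v \<Rightarrow> 'v) \<Rightarrow> nat \<Rightarrow> nat \<Rightarrow> 'v set" where
  "eigenspace V g T r = {u \<in> vcar V. g u = vscale V (cis (- 2 * pi * real r / real T)) u}"

text \<open>
  \<open>g\<close> is an automorphism of \<open>V\<close> with \<open>g\<^sup>T = 1\<close>. On the \<open>e\<^bsup>-2\<pi>ir/T\<^esup>\<close>-eigenspace of \<open>g\<close> the fields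
  have modes in \<open>r/T + \<int>\<close>. The opposite sign convention amounts to replacing \<open>g\<close> by its inverse.
  \<open>tw_borcherds\<close> is the component form of the twisted Jacobi identity. Ordinary modules are the
  case \<open>g = id\<close>, \<open>T = 1\<close>.
\<close>

locale twisted_module = vector_space "mscale M"
  for V :: "'v::ab_group_add voa" and g :: "'v \<Rightarrow> 'v" and T :: nat
    and M :: "('v, 'm::ab_group_add) vmodule" +
  assumes T_pos: "T > 0"
    and subspace_mcar: "subspace (mcar M)"
    and act_closed: "\<lbrakk>u \<in> vcar V; w \<in> mcar M\<rbrakk> \<Longrightarrow> mmode M u n w \<in> mcar M"
    and act_add_left: "\<lbrakk>u \<in> vcar V; u' \<in> vcar V; w \<in> mcar M\<rbrakk>
      \<Longrightarrow> mmode M (u + u') n w = mmode M u n w + mmode M u' n w"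
    and act_add_right: "\<lbrakk>u \<in> vcar V; w \<in> mcar M; w' \<in> mcar M\<rbrakk>
      \<Longrightarrow> mmode M u n (w + w') = mmode M u n w + mmode M u n w'"
    and act_scale_left: "\<lbrakk>u \<in> vcar V; w \<in> mcar M\<rbrakk>
      \<Longrightarrow> mmode M (vscale V a u) n w = mscale M a (mmode M u n w)"
    and act_scale_right: "\<lbrakk>u \<in> vcar V; w \<in> mcar M\<rbrakk>
      \<Longrightarrow> mmode M u n (mscale M a w) = mscale M a (mmode M u n w)"
    and act_truncation: "\<lbrakk>u \<in> vcar V; w \<in> mcar M\<rbrakk> \<Longrightarrow> \<exists>N. \<forall>n\<ge>N. mmode M u n w = 0"
    and act_exponents: "\<lbrakk>r < T; u \<in> eigenspace V g T r; w \<in> mcar M;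
        n - of_nat r / of_nat T \<notin> \<int>\<rbrakk> \<Longrightarrow> mmode M u n w = 0"
    and act_vac: "w \<in> mcar M \<Longrightarrow> mmode M (vac V) n w = (if n = -1 then w else 0)"
    and tw_borcherds: "\<lbrakk>r < T; u \<in> eigenspace V g T r; p - of_nat r / of_nat T \<in> \<int>;
        s < T; v \<in> eigenspace V g T s; q - of_nat s / of_nat T \<in> \<int>; w \<in> mcar M\<rbrakk> \<Longrightarrow>
      Sum_any (\<lambda>j::nat. mscale M (of_rat p gchoose j)
          (mmode M (vmode V u (l + int j) v) (p + q - of_nat j) w)) =
      Sum_any (\<lambda>j::nat. mscale M ((-1) ^ j * (of_int l gchoose j))
          (mmode M u (p + of_int l - of_nat j) (mmode M v (q + of_nat j) w)
           - mscale M ((-1) powi l)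
               (mmode M v (q + of_int l - of_nat j) (mmode M u (p + of_nat j) w))))"
    and mgraded: "mcar M = span (\<Union>\<mu>. mweight V M \<mu>)"
    and mweight_finite: "\<exists>B. finite B \<and> mweight V M \<mu> \<subseteq> span B"
    and mweight_bounded: "\<exists>N. \<forall>n\<ge>N. mweight V M (\<mu> - of_nat n / of_nat T) = {0}"

definition submodule :: "'v voa \<Rightarrow> ('v, 'm::ab_group_add) vmodule \<Rightarrow> 'm set \<Rightarrow> bool" where
  "submodule V M N \<longleftrightarrow> N \<subseteq> mcar M \<and> module.subspace (mscale M) N \<and>
     (\<forall>u\<in>vcar V. \<forall>n. \<forall>w\<in>N. mmode M u n w \<in> N)"

definition irreducible_twisted_module ::
    "'v::ab_group_add voa \<Rightarrow> ('v \<Rightarrow> 'v) \<Rightarrow> nat \<Rightarrow> ('v, 'm::ab_group_add) vmodule \<Rightarrow> bool" where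
  "irreducible_twisted_module V g T M \<longleftrightarrow> twisted_module V g T M \<and> mcar M \<noteq> {0} \<and>
     (\<forall>N. submodule V M N \<longrightarrow> N = {0} \<or> N = mcar M)"

definition module_isomorphic ::
    "'v voa \<Rightarrow> ('v, 'm::ab_group_add) vmodule \<Rightarrow> ('v, 'n::ab_group_add) vmodule \<Rightarrow> bool" where
  "module_isomorphic V M N \<longleftrightarrow>
     (\<exists>f. Vector_Spaces.linear (mscale M) (mscale N) f \<and> bij_betw f (mcar M) (mcar N) \<and>
          (\<forall>u\<in>vcar V. \<forall>n. \<forall>w\<in>mcar M. f (mmode M u n w) = mmode N u n (f w)))"

definition adjoint_module :: "'v::zero voa \<Rightarrow> ('v, 'v) vmodule" where
  "adjoint_module V = \<lparr>mcar = vcar V, mscale = vscale V,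
     mmode = (\<lambda>u n. if n \<in> \<int> then vmode V u \<lfloor>n\<rfloor> else (\<lambda>_. 0))\<rparr>"

text \<open>
  \<open>V\<close> is irreducible over itself and every irreducible \<open>V\<close>-module is isomorphic to \<open>V\<close>.
  VOAs with finite-dimensional weight spaces and their irreducible modules have countable
  dimension, so it is no restriction to consider modules carried by subspaces
  of \<open>nat \<Rightarrow>\<^sub>0 complex\<close>.
\<close>

definition holomorphic_voa :: "'v::ab_group_add voa \<Rightarrow> bool" where
  "holomorphic_voa V \<longleftrightarrow>
     irreducible_twisted_module V id 1 (adjoint_module V) \<and>
     (\<forall>M :: ('v, nat \<Rightarrow>\<^sub>0 complex) vmodule.
        irreducible_twisted_module V id 1 M \<longrightarrow> module_isomorphic V M (adjoint_module V))"


section \<open>Lattice VOAs\<close>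

text \<open>
  \<open>e\<^sub>i\<close> is the standard orthonormal basis of \<open>\<real>\<^sup>n\<close>. The basis element \<open>(P, \<alpha>)\<close> stands for
  \<open>(\<Prod>(i,k)\<in>P. e\<^sub>i(-k-1)) 1 \<otimes> e\<^sup>\<alpha>\<close>, where \<open>P\<close> is a multiset, so \<open>(i,k)\<close> encodes the
  creation operator \<open>e\<^sub>i(-k-1)\<close>.
\<close>

type_synonym 'n fock = "(('n \<times> nat) multiset \<times> (real^'n)) \<Rightarrow>\<^sub>0 complex"

definition fock_scale :: "complex \<Rightarrow> ('b \<Rightarrow>\<^sub>0 complex) \<Rightarrow> ('b \<Rightarrow>\<^sub>0 complex)" where
  "fock_scale a v = Poly_Mapping.map ((*) a) v"

lemma lookup_fock_scale [simp]: "Poly_Mapping.lookup (fock_scale a v) b = a * Poly_Mapping.lookup v b"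
  by (auto simp: fock_scale_def Poly_Mapping.map.rep_eq when_def in_keys_iff)

lemma vector_space_fock_scale: "vector_space fock_scale"
  by unfold_locales (auto intro!: poly_mapping_eqI simp: lookup_add algebra_simps)

definition fock_lift :: "('b \<Rightarrow> ('c \<Rightarrow>\<^sub>0 complex)) \<Rightarrow> ('b \<Rightarrow>\<^sub>0 complex) \<Rightarrow> ('c \<Rightarrow>\<^sub>0 complex)" where
  "fock_lift f v = (\<Sum>b\<in>Poly_Mapping.keys v. fock_scale (Poly_Mapping.lookup v b) (f b))"

text \<open>
  \<open>heis h m\<close> is \<open>h(m)\<close>: multiplication for \<open>m < 0\<close>, the derivation with
  \<open>[e\<^sub>i(m), e\<^sub>i(-m)] = m\<close> for \<open>m > 0\<close>, and \<open>h(0) e\<^sup>\<alpha> = \<langle>h,\<alpha>\<rangle> e\<^sup>\<alpha>\<close>.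
\<close>

definition heis_basis :: "'n::finite \<Rightarrow> int \<Rightarrow> ('n \<times> nat) multiset \<times> (real^'n) \<Rightarrow> 'n fock" where
  "heis_basis i m = (\<lambda>(P, \<alpha>).
     if m < 0 then Poly_Mapping.single (add_mset (i, nat (- m) - 1) P, \<alpha>) 1
     else if m = 0 then Poly_Mapping.single (P, \<alpha>) (of_real (\<alpha> $ i))
     else Poly_Mapping.single (P - {#(i, nat m - 1)#}, \<alpha>)
            (of_int m * of_nat (count P (i, nat m - 1))))"

definition heis :: "real^'n::finite \<Rightarrow> int \<Rightarrow> 'n fock \<Rightarrow> 'n fock" where
  "heis h m v = (\<Sum>i\<in>UNIV. fock_scale (of_real (h $ i)) (fock_lift (heis_basis i m) v))"

text \<open>
  \<open>exp_coeff A k\<close> is the coefficient of \<open>x\<^sup>k\<close> in \<open>exp (\<Sum>\<^sub>n\<^sub>\<ge>\<^sub>1 A\<^sub>n x\<^sup>n / n)\<close> for commuting linear operators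
  \<open>A\<^sub>n\<close>; the recursion is obtained by applying \<open>x d/dx\<close>.
\<close>

fun exp_coeff :: "(nat \<Rightarrow> ('b \<Rightarrow>\<^sub>0 complex) \<Rightarrow> ('b \<Rightarrow>\<^sub>0 complex)) \<Rightarrow> nat
    \<Rightarrow> ('b \<Rightarrow>\<^sub>0 complex) \<Rightarrow> ('b \<Rightarrow>\<^sub>0 complex)" where
  "exp_coeff A 0 v = v"
| "exp_coeff A (Suc k) v =
     fock_scale (1 / of_nat (Suc k)) (\<Sum>j\<le>k. A (Suc j) (exp_coeff A (k - j) v))"

text \<open>
  The modes of
  \<open>Y(e\<^sup>\<alpha>,z) = exp (\<Sum>\<^sub>n\<^sub>\<ge>\<^sub>1 \<alpha>(-n) z\<^sup>n / n) exp (- \<Sum>\<^sub>n\<^sub>\<ge>\<^sub>1 \<alpha>(n) z\<^bsup>-n\<^esup> / n) e\<^sub>\<alpha> z\<^bsup>\<alpha>(0)\<^esup>\<close>,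
  where \<open>e\<^sub>\<alpha> z\<^bsup>\<alpha>(0)\<^esup> (u \<otimes> e\<^sup>\<beta>) = \<epsilon>(\<alpha>,\<beta>) z\<^bsup>\<langle>\<alpha>,\<beta>\<rangle>\<^esup> u \<otimes> e\<^sup>\<alpha>\<^sup>+\<^sup>\<beta>\<close>. Below, \<open>k\<close> is the power of \<open>z\<^sup>-\<^sup>1\<close> taken from the
  second exponential and \<open>p\<close> the power of \<open>z\<close> taken from the first; the sum over \<open>k\<close> is finite.
\<close>

definition exp_mode :: "(real^'n \<Rightarrow> real^'n \<Rightarrow> complex) \<Rightarrow> real^'n::finite
    \<Rightarrow> int \<Rightarrow> 'n fock \<Rightarrow> 'n fock" where
  "exp_mode \<epsilon> \<alpha> n = fock_lift (\<lambda>(P, \<beta>).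
     Sum_any (\<lambda>k::nat. let p = int k - \<lfloor>\<alpha> \<bullet> \<beta>\<rfloor> - n - 1 in
       if p < 0 then 0
       else exp_coeff (\<lambda>m. heis \<alpha> (- int m)) (nat p)
              (exp_coeff (\<lambda>m v. - heis \<alpha> (int m) v) k
                (Poly_Mapping.single (P, \<alpha> + \<beta>) (\<epsilon> \<alpha> \<beta>)))))"

text \<open>The modes of \<open>(1/k!) (d/dz)\<^sup>k a(z)\<close> and of the normally ordered product \<open>:a(z) b(z):\<close>.\<close>

definition deriv_field :: "nat \<Rightarrow> (int \<Rightarrow> ('b \<Rightarrow>\<^sub>0 complex) \<Rightarrow> ('b \<Rightarrow>\<^sub>0 complex))
    \<Rightarrow> int \<Rightarrow> ('b \<Rightarrow>\<^sub>0 complex) \<Rightarrow> ('b \<Rightarrow>\<^sub>0 complex)" where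
  "deriv_field k a n v = fock_scale ((-1) ^ k * (of_int n gchoose k)) (a (n - int k) v)"

definition normal_product :: "(int \<Rightarrow> 'v \<Rightarrow> 'v) \<Rightarrow> (int \<Rightarrow> 'v \<Rightarrow> 'v)
    \<Rightarrow> int \<Rightarrow> 'v \<Rightarrow> 'v::comm_monoid_add" where
  "normal_product a b n v =
     Sum_any (\<lambda>j::nat. a (- 1 - int j) (b (n + int j) v)) + Sum_any (\<lambda>j::nat. b (n - 1 - int j) (a (int j) v))"

text \<open>
  The operators \<open>e\<^sub>i(-k-1)\<close> commute, and the iterated normally ordered products below do not depend
  on the order of the factors, so any enumeration of the multiset may be used.
\<close>

definition mset_list :: "'b multiset \<Rightarrow> 'b list" where
  "mset_list P = (SOME xs. mset xs = P)"

definition lattice_field :: "(real^'n \<Rightarrow> real^'n \<Rightarrow> complex)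
    \<Rightarrow> ('n::finite \<times> nat) multiset \<times> (real^'n) \<Rightarrow> int \<Rightarrow> 'n fock \<Rightarrow> 'n fock" where
  "lattice_field \<epsilon> = (\<lambda>(P, \<alpha>).
     foldr (\<lambda>(i, k) F. normal_product (deriv_field k (heis (axis i 1))) F)
       (mset_list P) (exp_mode \<epsilon> \<alpha>))"

definition lattice_voa :: "(real^'n) set \<Rightarrow> (real^'n \<Rightarrow> real^'n \<Rightarrow> complex)
    \<Rightarrow> ('n::finite) fock voa" where
  "lattice_voa L \<epsilon> = \<lparr>
     vcar = {v. \<forall>b\<in>Poly_Mapping.keys v. snd b \<in> L},
     vscale = fock_scale,
     vmode = (\<lambda>u n w. fock_lift (\<lambda>b. lattice_field \<epsilon> b n w) u),
     vac = Poly_Mapping.single ({#}, 0) 1,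
     conf = (\<Sum>i\<in>UNIV. Poly_Mapping.single ({#(i, 0), (i, 0)#}, 0) (1/2))\<rparr>"

text \<open>
  \<open>h\<^sub>1(-n\<^sub>1) \<dots> h\<^sub>k(-n\<^sub>k) 1 \<otimes> e\<^sup>\<alpha> \<mapsto> (\<tau> h\<^sub>1)(-n\<^sub>1) \<dots> (\<tau> h\<^sub>k)(-n\<^sub>k) 1 \<otimes> e\<^bsup>\<tau>\<alpha>\<^esup>\<close>
\<close>

definition induced_aut :: "(real^'n \<Rightarrow> real^'n) \<Rightarrow> 'n::finite fock \<Rightarrow> 'n fock" where
  "induced_aut \<tau> = fock_lift (\<lambda>(P, \<alpha>).
     foldr (\<lambda>(i, k). heis (\<tau> (axis i 1)) (- int k - 1)) (mset_list P)
       (Poly_Mapping.single ({#}, \<tau> \<alpha>) 1))"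


section \<open>Miyamoto's \<open>\<int>\<^sub>3\<close>-orbifold construction\<close>

definition integral_part :: "'v voa \<Rightarrow> ('v, 'm::ab_group_add) vmodule \<Rightarrow> 'm set" where
  "integral_part V M = module.span (mscale M) (\<Union>n::int. mweight V M (of_int n))"

definition orbifold_sector :: "'v::ab_group_add voa \<Rightarrow> ('v \<Rightarrow> 'v) \<Rightarrow> ('v, 'm1::ab_group_add) vmodule
    \<Rightarrow> ('v, 'm2::ab_group_add) vmodule \<Rightarrow> nat \<Rightarrow> ('v \<times> 'm1 \<times> 'm2) set" where
  "orbifold_sector V g M1 M2 i =
     (if i = 0 then fixed_points V g \<times> {0} \<times> {0}
      else if i = 1 then {0} \<times> integral_part V M1 \<times> {0}
      else {0} \<times> {0} \<times> integral_part V M2)"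

text \<open>
  \<open>W\<close> is \<open>V\<^sup>g \<oplus> (M\<^sub>1)\<^sub>\<int> \<oplus> (M\<^sub>2)\<^sub>\<int>\<close> with a holomorphic, \<open>C\<^sub>2\<close>-cofinite, \<open>\<int>\<^sub>3\<close>-graded VOA structure of
  central charge 24 extending the VOA structure of \<open>V\<^sup>g\<close> and its action on the other two summands.
  For \<open>V\<close> the VOA of a Niemeier lattice, \<open>g\<close> induced by an isometry of order 3, and \<open>M\<^sub>1\<close>, \<open>M\<^sub>2\<close> its
  irreducible twisted modules, the summands are simple current modules of \<open>V\<^sup>g\<close>, which makes such
  a structure unique up to isomorphism.
\<close>

definition miyamoto_orbifold :: "'v::ab_group_add voa \<Rightarrow> ('v \<Rightarrow> 'v) \<Rightarrow> ('v, 'm1::ab_group_add) vmodule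
    \<Rightarrow> ('v, 'm2::ab_group_add) vmodule \<Rightarrow> ('v \<times> 'm1 \<times> 'm2) voa \<Rightarrow> bool" where
  "miyamoto_orbifold V g M1 M2 W \<longleftrightarrow>
     vcar W = fixed_points V g \<times> integral_part V M1 \<times> integral_part V M2 \<and>
     (\<forall>a x y z. vscale W a (x, y, z) = (vscale V a x, mscale M1 a y, mscale M2 a z)) \<and>
     vac W = (vac V, 0, 0) \<and> conf W = (conf V, 0, 0) \<and>
     (\<forall>u \<in> fixed_points V g. \<forall>(x, y, z) \<in> vcar W. \<forall>n.
        vmode W (u, 0, 0) n (x, y, z) =
          (vmode V u n x, mmode M1 u (of_int n) y, mmode M2 u (of_int n) z)) \<and>
     (\<forall>i<3. \<forall>j<3. \<forall>a \<in> orbifold_sector V g M1 M2 i. \<forall>b \<in> orbifold_sector V g M1 M2 j. \<forall>n.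
        vmode W a n b \<in> orbifold_sector V g M1 M2 ((i + j) mod 3)) \<and>
     vertex_operator_algebra W 24 \<and> holomorphic_voa W \<and> C2_cofinite W"

end

theory Submission
  imports Defs "HOL-Computational_Algebra.Fundamental_Theorem_Algebra"
begin

text \<open>
  An element \<open>\<tau>\<close> of order three in the Weyl group is a product of Coxeter elements of mutually
  orthogonal subsystems of type \<open>A\<^sub>2\<close>. For a root \<open>a\<close> in one of them the vectors
  \<open>E\<^bsub>\<plusminus>a\<^esub> = e\<^bsup>\<plusminus>a\<^esup> + e\<^bsup>\<plusminus>\<tau>a\<^esup> + e\<^bsup>\<plusminus>\<tau>\<tau>a\<^esup>\<close> are fixed by \<open>\<tau>\<close>, commute like Heisenberg generators, and yield the
  conformal vector of the plane spanned by \<open>a\<close> and \<open>\<tau>a\<close>. Together with the \<open>h(-1)1\<close>, \<open>h\<close> orthogonal to these planes,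
  they generate a Heisenberg subalgebra of rank 24 in \<open>V\<^sub>L\<^sup>\<tau>\<close>, hence in the orbifold, with
  the same conformal vector.

  A simple VOA \<open>V\<close> with such a subalgebra is the sum of the generalised eigenspaces of its zero modes.
  Each is an irreducible Heisenberg module generated by a vector \<open>e\<^sub>\<alpha>\<close> of weight
  \<open>\<langle>\<alpha>,\<alpha>\<rangle>/2\<close>, and the eigenvalues \<open>\<alpha>\<close> form a group. Given \<open>\<mu>\<close> in its dual, Li's operator \<open>\<Delta>(\<mu>,z)\<close>
  deforms the adjoint module to an irreducible module with eigenvalues shifted by \<open>\<mu>\<close>; if \<open>V\<close> is
  holomorphic, this is \<open>V\<close> again, so the group is self-dual. Integrality and positivity of the weights make
  it an even unimodular lattice in a real form, and the leading coefficients of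
  \<open>Y(e\<^sub>\<alpha>,z) e\<^sub>\<beta>\<close> are the cocycle of an isomorphism with a lattice VOA.
\<close>

section \<open>Joint generalised eigenspaces\<close>

text \<open>The source of the orbit sums is a change of Cartan subalgebra in sl_3. The Coxeter
  element of A_2 fixes nothing in the Cartan subalgebra it acts on, but permutes the six root
  vectors in two orbits, and the two orbit sums span another Cartan subalgebra, fixed pointwise. The
  orbifold can then be analysed through this fixed Heisenberg algebra, without formulas for products
  of twisted sectors.

  The obstacle is that the orbifold is given with neither an invariant form nor a real structure:
  the zero modes are not known to be diagonalisable, nor their eigenvalues to be real.
  Finite-dimensional weight spaces and the lower bound on weights take their place. An eigenvalue of
  negative norm would have multiples of arbitrarily low weight; a nonzero one of norm zero would put
  infinitely many eigenvalues into weight zero; a nilpotent part of a zero mode would act on powers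
  of a vector of weight zero like differentiation on polynomials of every degree. Reality comes
  last: orthogonal eigenvalues, scaled to norm one, give coordinates in which all eigenvalues are
  real.\<close>

lemma Sum_any_eq_sum:
  assumes "\<And>j. j \<ge> N \<Longrightarrow> f j = 0"
  shows "Sum_any f = sum f {..<N::nat}"
  by (rule Sum_any.expand_superset) (use assms in \<open>auto simp: not_less[symmetric]\<close>)

lemma Sum_any_eq_0th:
  assumes "\<And>j. j > 0 \<Longrightarrow> f j = 0"
  shows "Sum_any f = f (0::nat)"
  using Sum_any_eq_sum[of 1 f] assms by simp

context vector_space
begin

text \<open>Indexing the relation by positions lets the family repeat itself; a repetition is itself
  a relation. The finite-dimensionality arguments below run through this lemma: a polynomial
  relation for one operator, or a contradiction with a family that is independent and too
  long.\<close>

lemma finite_span_relation: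
  assumes "finite B" and "\<And>k. k \<le> card B \<Longrightarrow> f k \<in> span B"
  shows "\<exists>x :: nat \<Rightarrow> 'a. (\<exists>k\<le>card B. x k \<noteq> 0) \<and> (\<Sum>k\<le>card B. scale (x k) (f k)) = 0"
proof (cases "inj_on f {..card B}")
  case False
  then obtain i j where ij: "i \<le> card B" "j \<le> card B" "i \<noteq> j" "f i = f j"
    unfolding inj_on_def by auto
  define x :: "nat \<Rightarrow> 'a" where "x = (\<lambda>k. if k = i then 1 else if k = j then -1 else 0)"
  have "(\<Sum>k\<le>card B. scale (x k) (f k)) = (\<Sum>k\<in>{i,j}. scale (x k) (f k))"
    by (rule sum.mono_neutral_right) (use ij in \<open>auto simp: x_def\<close>)
  also have "\<dots> = 0" using ij by (simp add: x_def)
  finally show ?thesis using ij by (intro exI[of _ x]) (auto simp: x_def)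
next
  case True
  have "dependent (f ` {..card B})"
  proof (rule ccontr)
    assume "independent (f ` {..card B})"
    from independent_span_bound[OF assms(1) this] assms(2)
    have "card (f ` {..card B}) \<le> card B" by auto
    thus False using True by (simp add: card_image)
  qed
  then obtain u where u: "\<exists>v\<in>f ` {..card B}. u v \<noteq> 0" "(\<Sum>v\<in>f ` {..card B}. scale (u v) v) = 0"
    by (auto simp: dependent_finite)
  from u(2) have "(\<Sum>k\<le>card B. scale (u (f k)) (f k)) = 0"
    by (simp add: sum.reindex[OF True])
  with u(1) show ?thesis by (intro exI[of _ "\<lambda>k. u (f k)"]) auto
qed

end

text \<open>Linearity is required on \<open>C\<close> only, because modes of a VOA have arbitrary
  values outside the carrier. The instances are the Heisenberg zero modes, the operator
  \<open>L0\<close> and its deformation, and the mode -1 of a vector of weight zero.\<close>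

locale commuting_family = vector_space scale
  for scale :: "complex \<Rightarrow> 'v::ab_group_add \<Rightarrow> 'v" (infixr \<open>\<cdot>\<close> 75) +
  fixes C :: "'v set" and T :: "'i \<Rightarrow> 'v \<Rightarrow> 'v"
  assumes C_sub: "subspace C"
    and T_in: "v \<in> C \<Longrightarrow> T i v \<in> C"
    and T_add: "v \<in> C \<Longrightarrow> w \<in> C \<Longrightarrow> T i (v + w) = T i v + T i w"
    and T_scale: "v \<in> C \<Longrightarrow> T i (a \<cdot> v) = a \<cdot> T i v"
    and T_comm: "v \<in> C \<Longrightarrow> T i (T j v) = T j (T i v)"
begin

definition sh :: "'i \<Rightarrow> complex \<Rightarrow> 'v \<Rightarrow> 'v" where "sh i c v = T i v - c \<cdot> v"

lemma C0 [simp]: "0 \<in> C" using C_sub subspace_0 by blast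
lemma C_add: "v \<in> C \<Longrightarrow> w \<in> C \<Longrightarrow> v + w \<in> C" using C_sub subspace_add by blast
lemma C_scale: "v \<in> C \<Longrightarrow> a \<cdot> v \<in> C" using C_sub subspace_scale by blast
lemma C_diff: "v \<in> C \<Longrightarrow> w \<in> C \<Longrightarrow> v - w \<in> C" using C_sub subspace_diff by blast
lemma T_zero [simp]: "T i 0 = 0" using T_scale[of 0 i 0] by simp
lemma T_diff: "v \<in> C \<Longrightarrow> w \<in> C \<Longrightarrow> T i (v - w) = T i v - T i w"
  using T_add[of "v - w" w i] C_diff by (simp add: algebra_simps)

lemma sh_in: "v \<in> C \<Longrightarrow> sh i c v \<in> C" by (simp add: sh_def C_diff T_in C_scale)
lemma sh_add: "v \<in> C \<Longrightarrow> w \<in> C \<Longrightarrow> sh i c (v + w) = sh i c v + sh i c w"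
  by (simp add: sh_def T_add scale_right_distrib)
lemma sh_scale: "v \<in> C \<Longrightarrow> sh i c (a \<cdot> v) = a \<cdot> sh i c v"
  by (simp add: sh_def T_scale scale_right_diff_distrib mult.commute)
lemma sh_comm: "v \<in> C \<Longrightarrow> sh i c (sh j d v) = sh j d (sh i c v)"
  by (simp add: sh_def T_diff T_in C_scale T_scale T_comm[of v i j] scale_right_diff_distrib mult.commute)
lemma sh_zero [simp]: "sh i c 0 = 0" by (simp add: sh_def)
lemma sh_T: "v \<in> C \<Longrightarrow> sh i c (T j v) = T j (sh i c v)"
  by (simp add: sh_def T_diff T_in C_scale T_scale T_comm[of v i j])

lemma shp_in: "v \<in> C \<Longrightarrow> (sh i c ^^ k) v \<in> C" by (induction k) (auto simp: sh_in)
lemma shp_zero [simp]: "(sh i c ^^ k) 0 = 0" by (induction k) auto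
lemma shp_add: "v \<in> C \<Longrightarrow> w \<in> C \<Longrightarrow> (sh i c ^^ k) (v + w) = (sh i c ^^ k) v + (sh i c ^^ k) w"
  by (induction k) (auto simp: sh_add shp_in)
lemma shp_scale: "v \<in> C \<Longrightarrow> (sh i c ^^ k) (a \<cdot> v) = a \<cdot> (sh i c ^^ k) v"
  by (induction k) (auto simp: sh_scale shp_in)
lemma shp_sh: "v \<in> C \<Longrightarrow> (sh i c ^^ k) (sh j d v) = sh j d ((sh i c ^^ k) v)"
  by (induction k) (auto simp: sh_comm shp_in)
lemma shp_T: "v \<in> C \<Longrightarrow> (sh i c ^^ k) (T j v) = T j ((sh i c ^^ k) v)"
  by (induction k) (auto simp: sh_T shp_in)
lemma shp_mono: "(sh i c ^^ k) v = 0 \<Longrightarrow> k \<le> l \<Longrightarrow> (sh i c ^^ l) v = 0"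
  by (metis funpow_add le_add_diff_inverse2 o_apply shp_zero)
lemma shp_sum: "(\<And>x. x \<in> A \<Longrightarrow> f x \<in> C) \<Longrightarrow> (sh i c ^^ k) (sum f A) = (\<Sum>x\<in>A. (sh i c ^^ k) (f x))"
proof (induction A rule: infinite_finite_induct)
  case (insert x F)
  have "sum f F \<in> C" using insert.prems by (intro subspace_sum[OF C_sub]) auto
  then show ?case using insert by (simp add: shp_add)
qed auto

text \<open>Generalised, since diagonalisability is not known at this stage. The set
  \<open>I\<close> of operators already taken into account lets \<open>decompose\<close> add one
  operator at a time.\<close>

definition geig :: "'i set \<Rightarrow> ('i \<Rightarrow> complex) \<Rightarrow> 'v set" where
  "geig I l = {v \<in> C. \<forall>i\<in>I. \<exists>k. (sh i (l i) ^^ k) v = 0}"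

lemma geigD: "v \<in> geig I l \<Longrightarrow> v \<in> C" by (simp add: geig_def)

lemma geig_subspace: "subspace (geig I l)"
proof (rule subspaceI)
  show "0 \<in> geig I l" by (simp add: geig_def exI[of _ 0])
next
  fix v w assume "v \<in> geig I l" "w \<in> geig I l"
  then show "v + w \<in> geig I l"
    unfolding geig_def
  proof (safe intro!: C_add)
    fix i assume i: "i \<in> I" "\<forall>i\<in>I. \<exists>k. (sh i (l i) ^^ k) v = 0" "\<forall>i\<in>I. \<exists>k. (sh i (l i) ^^ k) w = 0"
      and C: "v \<in> C" "w \<in> C"
    then obtain k k' where "(sh i (l i) ^^ k) v = 0" "(sh i (l i) ^^ k') w = 0" by blast
    hence "(sh i (l i) ^^ (max k k')) v = 0" "(sh i (l i) ^^ (max k k')) w = 0"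
      by (auto intro: shp_mono)
    hence "(sh i (l i) ^^ (max k k')) (v + w) = 0" using C by (simp add: shp_add)
    thus "\<exists>k. (sh i (l i) ^^ k) (v + w) = 0" by blast
  qed
next
  fix c v assume "v \<in> geig I l"
  then show "c \<cdot> v \<in> geig I l"
    unfolding geig_def by (auto simp: C_scale shp_scale)
qed

lemma geig_0 [simp]: "0 \<in> geig I l" using subspace_0[OF geig_subspace] .

lemma geig_T: "v \<in> geig I l \<Longrightarrow> T j v \<in> geig I l"
  unfolding geig_def by (auto simp: T_in shp_T) (metis T_zero)

lemma geig_sh: "v \<in> geig I l \<Longrightarrow> sh j c v \<in> geig I l"
  unfolding sh_def by (intro subspace_diff[OF geig_subspace] geig_T subspace_scale[OF geig_subspace])

lemma geig_shp: "v \<in> geig I l \<Longrightarrow> (sh j c ^^ k) v \<in> geig I l"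
  by (induction k) (auto intro: geig_sh)

text \<open>On an eigenvector with eigenvalue \<open>c\<close> the operator
  \<open>sh i (l i)\<close> is the nonzero scalar \<open>c - l i\<close>, so none of its powers can
  kill a nonzero vector.\<close>

lemma geig_sh_inj:
  assumes "v \<in> geig I l" "i \<in> I" "l i \<noteq> c" "sh i c v = 0"
  shows "v = 0"
proof -
  have v: "v \<in> C" using assms geigD by blast
  have T: "T i v = c \<cdot> v" using assms(4) by (simp add: sh_def)
  have "(sh i (l i) ^^ k) v = (c - l i) ^ k \<cdot> v" for k
    using v by (induction k) (simp_all add: sh_scale C_scale sh_def[of i "l i" v] T scale_left_diff_distrib[symmetric])
  moreover obtain k where "(sh i (l i) ^^ k) v = 0" using assms unfolding geig_def by blast
  ultimately show ?thesis using assms(3) by (metis power_eq_0_iff right_minus_eq scale_eq_0_iff)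
qed

lemma geig_shp_inj:
  assumes "v \<in> geig I l" "i \<in> I" "l i \<noteq> c" "(sh i c ^^ k) v = 0"
  shows "v = 0"
  using assms(4)
proof (induction k)
  case (Suc k)
  then have "(sh i c ^^ k) v = 0" using geig_sh_inj[OF geig_shp[OF assms(1)] assms(2,3)] by simp
  then show ?case using Suc by blast
qed simp

text \<open>A power of \<open>sh i (m i)\<close> kills the summand of label \<open>m\<close> and is
  injective on the summand of a label that differs from \<open>m\<close> at \<open>i\<close>. This
  removes one summand from the relation and gives an induction on its length.\<close>

lemma geig_direct:
  assumes "finite F" "\<And>l. l \<in> F \<Longrightarrow> w l \<in> geig UNIV l" "sum w F = 0" "l \<in> F"
  shows "w l = 0"
  using assms
proof (induction "card F" arbitrary: F w l rule: less_induct)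
  case less
  show ?case
  proof (cases "F = {l}")
    case True then show ?thesis using less.prems by simp
  next
    case False
    then obtain m where m: "m \<in> F" "m \<noteq> l" using less.prems(4) by blast
    then obtain i where i: "l i \<noteq> m i" by (metis ext)
    obtain k where k: "(sh i (m i) ^^ k) (w m) = 0"
      using less.prems(2)[OF m(1)] unfolding geig_def by blast
    let ?w = "\<lambda>x. (sh i (m i) ^^ k) (w x)"
    have "(\<Sum>x\<in>F. ?w x) = 0"
      using shp_sum[of F w k i "m i"] less.prems geigD by fastforce
    then have s: "sum ?w (F - {m}) = 0"
      using k m(1) less.prems(1) by (simp add: sum.remove)
    have "?w l = 0"
    proof (rule less.hyps[of "F - {m}"])
      show "card (F - {m}) < card F" using less.prems(1) m(1) by (metis card_Diff1_less)
    qed (use less.prems m s geig_shp in auto)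
    then show ?thesis using geig_shp_inj[OF less.prems(2)[OF less.prems(4)] UNIV_I i] by blast
  qed
qed

text \<open>The family of homogeneous components. Its uniqueness is \<open>geig_direct\<close>; its
  existence is recorded separately by \<open>decomposed\<close>, since a vector of \<open>C\<close>
  need not be a finite sum of generalised eigenvectors.\<close>

definition comp :: "'v \<Rightarrow> ('i \<Rightarrow> complex) \<Rightarrow> 'v" where
  "comp v = (THE f. (\<forall>l. f l \<in> geig UNIV l) \<and> finite {l. f l \<noteq> 0} \<and> Sum_any f = v)"

lemma comp_unique:
  assumes "\<And>l. f l \<in> geig UNIV l" "finite {l. f l \<noteq> 0}" "Sum_any f = v"
  shows "comp v = f"
  unfolding comp_def
proof (rule the_equality)
  show "(\<forall>l. f l \<in> geig UNIV l) \<and> finite {l. f l \<noteq> 0} \<and> Sum_any f = v" using assms by blast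
next
  fix g assume g: "(\<forall>l. g l \<in> geig UNIV l) \<and> finite {l. g l \<noteq> 0} \<and> Sum_any g = v"
  let ?F = "{l. f l \<noteq> 0} \<union> {l. g l \<noteq> 0}"
  have "Sum_any f = sum f ?F" "Sum_any g = sum g ?F"
    using assms(2) g by (auto intro!: Sum_any.expand_superset)
  then have "(\<Sum>l\<in>?F. g l - f l) = 0" using g assms(3) by (simp add: sum_subtractf)
  then have "g l - f l = 0" if "l \<in> ?F" for l
    using geig_direct[of ?F "\<lambda>l. g l - f l" l] g assms(1,2) that
    by (auto intro: subspace_diff[OF geig_subspace])
  then have "g l = f l" for l by (cases "l \<in> ?F") auto
  then show "g = f" by blast
qed

lemma comp_homog:
  assumes "v \<in> geig UNIV l"
  shows "comp v = (\<lambda>m. if m = l then v else 0)"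
proof (rule comp_unique)
  show "finite {m. (if m = l then v else 0) \<noteq> 0}" by (rule finite_subset[of _ "{l}"]) auto
  have "Sum_any (\<lambda>m. if m = l then v else 0) = sum (\<lambda>m. if m = l then v else 0) {l}"
    by (rule Sum_any.expand_superset) auto
  then show "Sum_any (\<lambda>m. if m = l then v else 0) = v" by simp
qed (use assms in auto)

definition decomposed :: "'v \<Rightarrow> bool" where
  "decomposed v \<longleftrightarrow> (\<forall>l. comp v l \<in> geig UNIV l) \<and> finite {l. comp v l \<noteq> 0} \<and> Sum_any (comp v) = v"

lemma decomposed_add:
  assumes "decomposed v" "decomposed w"
  shows "comp (v + w) = (\<lambda>l. comp v l + comp w l)" "decomposed (v + w)"
proof -
  have fin: "finite {l. comp v l + comp w l \<noteq> 0}"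
    using assms unfolding decomposed_def
    by (auto intro!: rev_finite_subset[of "{l. comp v l \<noteq> 0} \<union> {l. comp w l \<noteq> 0}"])
  have sum: "Sum_any (\<lambda>l. comp v l + comp w l) = v + w"
    using Sum_any.distrib[of "comp v" "comp w"] assms unfolding decomposed_def by simp
  show *: "comp (v + w) = (\<lambda>l. comp v l + comp w l)"
    using assms by (intro comp_unique fin sum subspace_add[OF geig_subspace]) (auto simp: decomposed_def)
  show "decomposed (v + w)" unfolding decomposed_def *
    using assms fin sum by (auto simp: decomposed_def intro: subspace_add[OF geig_subspace])
qed

lemma decomposed_scale:
  assumes "decomposed v"
  shows "comp (a \<cdot> v) = (\<lambda>l. a \<cdot> comp v l)" "decomposed (a \<cdot> v)"
proof -
  have fin: "finite {l. a \<cdot> comp v l \<noteq> 0}"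
    using assms unfolding decomposed_def
    by (auto intro!: rev_finite_subset[of "{l. comp v l \<noteq> 0}"])
  have f: "finite {l. comp v l \<noteq> 0}" using assms by (simp add: decomposed_def)
  have "Sum_any (\<lambda>l. a \<cdot> comp v l) = (\<Sum>l\<in>{l. comp v l \<noteq> 0}. a \<cdot> comp v l)"
    by (rule Sum_any.expand_superset) (use f in auto)
  also have "\<dots> = a \<cdot> Sum_any (comp v)" by (simp add: Sum_any.expand_set scale_sum_right)
  finally have sum: "Sum_any (\<lambda>l. a \<cdot> comp v l) = a \<cdot> v"
    using assms by (simp add: decomposed_def)
  show *: "comp (a \<cdot> v) = (\<lambda>l. a \<cdot> comp v l)"
    using assms by (intro comp_unique fin sum subspace_scale[OF geig_subspace]) (auto simp: decomposed_def)
  show "decomposed (a \<cdot> v)" unfolding decomposed_def *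
    using assms fin sum by (auto simp: decomposed_def intro: subspace_scale[OF geig_subspace])
qed

lemma decomposed_homog: "v \<in> geig UNIV l \<Longrightarrow> decomposed v"
proof -
  assume v: "v \<in> geig UNIV l"
  have "Sum_any (\<lambda>m. if m = l then v else 0) = sum (\<lambda>m. if m = l then v else 0) {l}"
    by (rule Sum_any.expand_superset) auto
  moreover have "finite {m. (if m = l then v else 0) \<noteq> 0}" by (rule finite_subset[of _ "{l}"]) auto
  ultimately show ?thesis using v by (simp add: decomposed_def comp_homog[OF v])
qed

lemma span_comp:
  assumes "\<And>l. subspace (N l)" "\<And>l. N l \<subseteq> geig UNIV l" "w \<in> span (\<Union>l. N l)"
  shows "decomposed w \<and> comp w l \<in> N l"
  using assms(3)
proof (induction rule: span_induct_alt)
  case base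
  show ?case using decomposed_homog[of 0] comp_homog[of 0] subspace_0[OF assms(1)] by simp
next
  case (step c x y)
  then obtain m where m: "x \<in> N m" by blast
  then have "x \<in> geig UNIV m" using assms(2) by blast
  then have "decomposed x" "comp x l \<in> N l"
    using m subspace_0[OF assms(1)] by (auto simp: decomposed_homog comp_homog)
  then show ?case using step.IH
    by (auto simp: decomposed_add decomposed_scale intro!: subspace_add[OF assms(1)] subspace_scale[OF assms(1)])
qed

text \<open>Comparing components turns a spanning statement about a graded family into membership in
  one piece. It serves both the grading by weight and the grading by eigenvalues of the zero
  modes.\<close>

lemma homog_span_extract:
  assumes "\<And>l. subspace (N l)" "\<And>l. N l \<subseteq> geig UNIV l" "w \<in> span (\<Union>l. N l)" "w \<in> geig UNIV l"
  shows "w \<in> N l"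
  using span_comp[of N w l, OF assms(1-3)] comp_homog[OF assms(4)] by simp

section \<open>Generalised eigenspace decomposition from polynomial relations\<close>

definition poly_act :: "'i \<Rightarrow> complex poly \<Rightarrow> 'v \<Rightarrow> 'v" where
  "poly_act i p v = (\<Sum>k\<le>degree p. coeff p k \<cdot> (T i ^^ k) v)"

lemma Tp_in: "v \<in> C \<Longrightarrow> (T i ^^ k) v \<in> C" by (induction k) (auto simp: T_in)

lemma Tp_sh: "v \<in> C \<Longrightarrow> (T i ^^ k) (sh i c v) = (T i ^^ Suc k) v - c \<cdot> (T i ^^ k) v"
proof (induction k)
  case (Suc k)
  then show ?case by (simp add: T_diff T_scale C_scale Tp_in T_in)
qed (simp add: sh_def)

lemma poly_act_bound: "degree p \<le> n \<Longrightarrow> poly_act i p v = (\<Sum>k\<le>n. coeff p k \<cdot> (T i ^^ k) v)"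
  unfolding poly_act_def by (rule sum.mono_neutral_left) (auto simp: coeff_eq_0)

lemma poly_act_root:
  assumes v: "v \<in> C"
  shows "poly_act i ([:-c, 1:] * q) v = poly_act i q (sh i c v)"
proof -
  let ?n = "degree q"
  let ?f = "\<lambda>k. (T i ^^ k) v"
  have "degree ([:-c, 1:] * q) \<le> Suc ?n" using degree_mult_le[of "[:-c,1:]" q] by simp
  then have "poly_act i ([:-c, 1:] * q) v = (\<Sum>k\<le>Suc ?n. coeff ([:-c, 1:] * q) k \<cdot> ?f k)"
    by (rule poly_act_bound)
  also have "\<dots> = (\<Sum>k\<le>Suc ?n. (case k of 0 \<Rightarrow> 0 | Suc j \<Rightarrow> coeff q j) \<cdot> ?f k) - (\<Sum>k\<le>Suc ?n. (c * coeff q k) \<cdot> ?f k)"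
    by (simp only: sum_subtractf[symmetric] scale_left_diff_distrib[symmetric]) (simp add: coeff_pCons split: nat.splits)
  also have "(\<Sum>k\<le>Suc ?n. (case k of 0 \<Rightarrow> 0 | Suc j \<Rightarrow> coeff q j) \<cdot> ?f k) = (\<Sum>k\<le>?n. coeff q k \<cdot> ?f (Suc k))"
    by (subst sum.atMost_Suc_shift) simp
  also have "(\<Sum>k\<le>Suc ?n. (c * coeff q k) \<cdot> ?f k) = (\<Sum>k\<le>?n. coeff q k \<cdot> c \<cdot> ?f k)"
    by (simp add: coeff_eq_0 mult.commute)
  also have "(\<Sum>k\<le>?n. coeff q k \<cdot> ?f (Suc k)) - \<dots> = poly_act i q (sh i c v)"
    by (simp only: poly_act_def sum_subtractf[symmetric] Tp_sh[OF v] scale_right_diff_distrib)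
  finally show ?thesis .
qed

text \<open>On vectors killed by a power of \<open>sh i d\<close> the operator \<open>sh i c\<close>
  is the nonzero scalar \<open>d - c\<close> plus the nilpotent \<open>sh i d\<close>; solving for
  the scalar part leaves a problem of the same kind with smaller \<open>k\<close>.\<close>

lemma sh_surj_geig:
  assumes S: "subspace S" "S \<subseteq> C" "\<And>v. v \<in> S \<Longrightarrow> T i v \<in> S"
    and w: "w \<in> S" "(sh i d ^^ k) w = 0" "c \<noteq> d"
  shows "\<exists>u\<in>S. (sh i d ^^ k) u = 0 \<and> sh i c u = w"
  using w(1,2)
proof (induction k arbitrary: w)
  case 0
  then show ?case by (intro bexI[of _ 0]) auto
next
  case (Suc k)
  let ?w = "sh i d w"
  have wS: "?w \<in> S" using Suc.prems S unfolding sh_def by (auto intro: subspace_diff subspace_scale)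
  moreover have "(sh i d ^^ k) ?w = 0" using Suc.prems by (simp add: funpow_swap1)
  ultimately obtain u where u: "u \<in> S" "(sh i d ^^ k) u = 0" "sh i c u = ?w" using Suc.IH by blast
  let ?v = "(1/(d - c)) \<cdot> (w - u)"
  have C: "w \<in> C" "u \<in> C" using Suc.prems u S by auto
  have "sh i c w = (d - c) \<cdot> w + ?w" by (simp add: sh_def algebra_simps)
  moreover have "sh i c w = sh i c (w - u) + sh i c u"
    using sh_add[of "w - u" u i c] C C_diff by simp
  ultimately have *: "sh i c (w - u) = (d - c) \<cdot> w"
    using u(3) by simp
  have "sh i c ?v = w" using w(3) C by (simp add: sh_scale C_diff *)
  moreover have "(sh i d ^^ Suc k) (w - u) = 0"
  proof -
    have "(sh i d ^^ Suc k) u = 0" using u(2) by simp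
    then show ?thesis using C Suc.prems(2) shp_add[of "w - u" u "Suc k" i d] C_diff by simp
  qed
  then have "(sh i d ^^ Suc k) ?v = 0" using C C_diff by (simp add: shp_scale del: funpow.simps)
  moreover have "?v \<in> S" using Suc.prems u S by (auto intro: subspace_scale subspace_diff)
  ultimately show ?case by blast
qed

text \<open>One root \<open>c\<close> of \<open>p\<close> is split off at a time. By induction
  \<open>sh i c v\<close> is decomposed, and it remains to lift this decomposition back through
  \<open>sh i c\<close>, which is onto on every piece except the one for \<open>c\<close>.\<close>

lemma poly_act_decompose:
  assumes S: "subspace S" "S \<subseteq> C" "\<And>v. v \<in> S \<Longrightarrow> T i v \<in> S"
    and "v \<in> S" "p \<noteq> 0" "poly_act i p v = 0"
  shows "v \<in> span (\<Union>c. {w \<in> S. \<exists>k. (sh i c ^^ k) w = 0})"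
  using assms(4-)
proof (induction "degree p" arbitrary: p v)
  case 0
  then obtain a where "p = [:a:]" by (metis degree_eq_zeroE)
  then show ?case using 0 by (simp add: poly_act_def span_zero)
next
  case (Suc n)
  have "\<not> constant (poly p)" using Suc.hyps(2) by (simp add: constant_degree)
  then obtain c where "poly p c = 0" using fundamental_theorem_of_algebra by blast
  then obtain q where q: "p = [:-c, 1:] * q" by (auto simp: poly_eq_0_iff_dvd elim: dvdE)
  have q0: "q \<noteq> 0" using q Suc.prems by auto
  have dq: "n = degree q" using Suc.hyps(2) q q0 by (simp add: degree_mult_eq del: mult_pCons_left)
  have vC: "v \<in> C" using Suc.prems S by blast
  let ?v = "sh i c v"
  have "?v \<in> S" using Suc.prems S unfolding sh_def by (auto intro: subspace_diff subspace_scale)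
  moreover have "poly_act i q ?v = 0" using Suc.prems(3) poly_act_root[OF vC] q by simp
  ultimately have IH: "?v \<in> span (\<Union>c. {w \<in> S. \<exists>k. (sh i c ^^ k) w = 0})"
    using Suc.hyps(1)[OF dq] q0 by blast
  let ?X = "\<Union>c. {w \<in> S. \<exists>k. (sh i c ^^ k) w = 0}"
  \<comment> \<open>Modulo the image of \<open>span ?X\<close> under \<open>sh i c\<close>, every
    decomposed vector is a generalised eigenvector for \<open>c\<close>.\<close>
  have "y \<in> span ?X \<and> (\<exists>u\<in>span ?X. u \<in> S \<and> (\<exists>k. (sh i c ^^ k) (y - sh i c u) = 0))" if "y \<in> span ?X" for y
    using that
  proof (induction rule: span_induct_alt)
    case base
    show ?case by (intro conjI bexI[of _ 0]) (auto simp: span_zero subspace_0[OF S(1)])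
  next
    case (step a x y)
    then obtain u k where u: "u \<in> span ?X" "u \<in> S" "(sh i c ^^ k) (y - sh i c u) = 0"
      and ySp: "y \<in> span ?X" by blast
    have axy: "a \<cdot> x + y \<in> span ?X" using step(1) ySp by (intro span_add span_scale) (rule span_base)
    obtain d l where x: "x \<in> S" "(sh i d ^^ l) x = 0" using step by blast
    have ySC: "y \<in> C"
    proof -
      have "?X \<subseteq> S" by auto
      then have "y \<in> span S" using ySp span_mono by blast
      then have "y \<in> S" using S(1) span_eq_iff by blast
      then show ?thesis using S by blast
    qed
    show ?case
    proof (cases "c = d")
      case True
      let ?m = "max k l"
      have "(sh i c ^^ ?m) (y - sh i c u) = 0" "(sh i c ^^ ?m) x = 0"
        using u x True by (auto intro: shp_mono)
      then have "(sh i c ^^ ?m) (a \<cdot> x + (y - sh i c u)) = 0"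
        using x u S ySC by (subst shp_add) (auto simp: shp_scale intro!: C_scale C_diff sh_in)
      then have "(sh i c ^^ ?m) (a \<cdot> x + y - sh i c u) = 0" by (simp add: algebra_simps)
      then show ?thesis using u(1,2) axy by (intro conjI bexI[of _ u] exI[of _ "?m"]) simp_all
    next
      case False
      obtain z where z: "z \<in> S" "(sh i d ^^ l) z = 0" "sh i c z = x"
        using sh_surj_geig[OF S, of x l d c] x False by blast
      have "a \<cdot> x + y - sh i c (u + a \<cdot> z) = y - sh i c u"
        using z u S by (simp add: sh_add sh_scale C_scale subset_iff)
      moreover have "u + a \<cdot> z \<in> span ?X"
        using u z by (intro span_add span_scale) (auto intro!: span_base)
      moreover have "u + a \<cdot> z \<in> S" using u z S by (auto intro: subspace_add subspace_scale)
      moreover have "(sh i c ^^ k) (a \<cdot> x + y - sh i c (u + a \<cdot> z)) = 0"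
        using u(3) calculation(1) by (simp only:)
      ultimately show ?thesis using axy by blast
    qed
  qed
  from this[OF IH] obtain u k where u: "u \<in> span ?X" "u \<in> S" "(sh i c ^^ k) (?v - sh i c u) = 0" by blast
  have uC: "u \<in> C" using u S by blast
  have "?v - sh i c u = sh i c (v - u)"
    using sh_add[of "v - u" u i c] vC uC C_diff by simp
  then have "(sh i c ^^ Suc k) (v - u) = 0" using u(3) by (simp add: funpow_swap1)
  moreover have "v - u \<in> S" using Suc.prems u S by (auto intro: subspace_diff)
  ultimately have "v - u \<in> ?X" by blast
  then have "v - u \<in> span ?X" by (rule span_base)
  then have "v - u + u \<in> span ?X" using u(1) by (rule span_add)
  then show ?case by simp
qed

lemma poly_relation:
  assumes "finite B" "\<And>k. (T i ^^ k) v \<in> span B"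
  shows "\<exists>p. p \<noteq> 0 \<and> poly_act i p v = 0"
proof -
  obtain x where x: "\<exists>k\<le>card B. x k \<noteq> 0" "(\<Sum>k\<le>card B. x k \<cdot> (T i ^^ k) v) = 0"
    using finite_span_relation[OF assms(1), of "\<lambda>k. (T i ^^ k) v"] assms(2) by blast
  define p where "p = (\<Sum>k\<le>card B. monom (x k) k)"
  have c: "coeff p k = (if k \<le> card B then x k else 0)" for k
    by (simp add: p_def coeff_sum)
  have "degree p \<le> card B" by (intro degree_le) (simp add: c)
  then have "poly_act i p v = (\<Sum>k\<le>card B. coeff p k \<cdot> (T i ^^ k) v)" by (rule poly_act_bound)
  also have "\<dots> = 0" using x(2) by (simp add: c)
  finally have "poly_act i p v = 0" .
  moreover have "p \<noteq> 0" using x(1) c by (metis coeff_0)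
  ultimately show ?thesis by blast
qed

text \<open>Induction on the operators: \<open>geig I l\<close> meets \<open>S\<close> in a subspace
  that is stable under the next operator, because the operators commute, and the iterates of one
  vector inside the span of the finite set \<open>B\<close> satisfy a polynomial relation.\<close>

lemma decompose:
  assumes "finite I" and S: "subspace S" "S \<subseteq> C" "\<And>i v. v \<in> S \<Longrightarrow> T i v \<in> S"
    and B: "finite B" "S \<subseteq> span B"
  shows "S \<subseteq> span (\<Union>l. geig I l \<inter> S)"
  using assms(1)
proof (induction I rule: finite_induct)
  case empty
  then show ?case using S by (auto simp: geig_def intro!: span_base)
next
  case (insert i I)
  have "geig I l \<inter> S \<subseteq> span (\<Union>l. geig (insert i I) l \<inter> S)" for l
  proof
    fix v assume v: "v \<in> geig I l \<inter> S"
    let ?S = "geig I l \<inter> S"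
    have sS: "subspace ?S" using geig_subspace S(1) subspace_inter by blast
    have "(T i ^^ k) v \<in> S" for k using v S(3) by (induction k) auto
    then have "(T i ^^ k) v \<in> span B" for k using B(2) by blast
    from poly_relation[OF B(1) this] obtain p where p: "p \<noteq> 0" "poly_act i p v = 0" by blast
    have "v \<in> span (\<Union>c. {w \<in> ?S. \<exists>k. (sh i c ^^ k) w = 0})"
    proof (rule poly_act_decompose[OF sS _ _ v p])
      show "?S \<subseteq> C" using S(2) by blast
      show "T i x \<in> ?S" if "x \<in> ?S" for x using that S(3) geig_T by blast
    qed
    also have "\<dots> \<subseteq> span (\<Union>l. geig (insert i I) l \<inter> S)"
    proof (rule span_mono, safe)
      fix c w k assume w: "w \<in> geig I l" "w \<in> S" "(sh i c ^^ k) w = 0"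
      then have "w \<in> geig (insert i I) (l(i := c))"
        using insert.hyps(2) unfolding geig_def by auto
      then show "w \<in> (\<Union>l. geig (insert i I) l \<inter> S)" using w by blast
    qed
    finally show "v \<in> span (\<Union>l. geig (insert i I) l \<inter> S)" .
  qed
  then have "(\<Union>l. geig I l \<inter> S) \<subseteq> span (\<Union>l. geig (insert i I) l \<inter> S)" by blast
  then have "span (\<Union>l. geig I l \<inter> S) \<subseteq> span (\<Union>l. geig (insert i I) l \<inter> S)"
    by (rule span_minimal) (rule subspace_span)
  then show ?case using insert.IH by blast
qed

text \<open>For each operator in turn take the last nonzero iterate of \<open>sh i (l i)\<close>; by
  commutation it still satisfies the eigenvector equations obtained before.\<close>

lemma common_eigenvector:
  assumes "finite I" and S: "\<And>i v. v \<in> S \<Longrightarrow> sh i (l i) v \<in> S"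
    and "v \<in> S" "v \<in> geig UNIV l" "v \<noteq> 0"
  shows "\<exists>a\<in>S. a \<in> geig UNIV l \<and> a \<noteq> 0 \<and> (\<forall>i\<in>I. sh i (l i) a = 0)"
  using assms(1)
proof (induction I rule: finite_induct)
  case empty
  then show ?case using assms by blast
next
  case (insert i I)
  then obtain a where a: "a \<in> S" "a \<in> geig UNIV l" "a \<noteq> 0" "\<forall>i\<in>I. sh i (l i) a = 0" by blast
  have ex: "\<exists>k. (sh i (l i) ^^ k) a = 0" using a(2) unfolding geig_def by blast
  define k where "k = (LEAST k. (sh i (l i) ^^ k) a = 0)"
  have k: "(sh i (l i) ^^ k) a = 0" unfolding k_def using ex by (rule LeastI_ex)
  then obtain m where m: "k = Suc m" using a(3) by (cases k) auto
  let ?b = "(sh i (l i) ^^ m) a"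
  have "?b \<noteq> 0" using not_less_Least[of m "\<lambda>k. (sh i (l i) ^^ k) a = 0"] m unfolding k_def by simp
  moreover have "?b \<in> S" using a(1) S by (induction m) auto
  moreover have "?b \<in> geig UNIV l" using a(2) geig_shp by blast
  moreover have "sh j (l j) ?b = 0" if "j \<in> insert i I" for j
  proof (cases "j = i")
    case True then show ?thesis using k m by simp
  next
    case False
    then have "sh j (l j) a = 0" using a(4) that by blast
    then show ?thesis using shp_sh[of a m i "l i" j "l j"] a(2) geigD by simp
  qed
  ultimately show ?case by blast
qed

text \<open>Supplies a vector on which the operators act nontrivially while every product of two of
  them is zero. Each operator lowers the sum \<open>d\<close> of the nilpotency degrees, so a vector
  of least \<open>d\<close> among those not killed by all operators is mapped into the common
  kernel.\<close>

lemma nilpotent_layer: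
  fixes S :: "'v set"
  assumes fin: "finite (UNIV :: 'i set)"
    and S: "S \<subseteq> geig UNIV (\<lambda>_. 0)" "\<And>i v. v \<in> S \<Longrightarrow> T i v \<in> S"
    and v: "v \<in> S" "T i v \<noteq> 0"
  shows "\<exists>w\<in>S. (\<exists>i. T i w \<noteq> 0) \<and> (\<forall>i j. T i (T j w) = 0)"
proof -
  define e where "e = (\<lambda>i w. LEAST k. (T i ^^ k) w = 0)"
  define d where "d = (\<lambda>w. \<Sum>i\<in>UNIV. e i w)"
  have shT: "sh i 0 = T i" for i by (simp add: sh_def fun_eq_iff)
  have nil: "\<exists>k. (T i ^^ k) w = 0" if "w \<in> S" for i w
    using that S(1) unfolding geig_def by (auto simp: shT)
  have e0: "(T i ^^ e i w) w = 0" if "w \<in> S" for i w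
    unfolding e_def using nil[OF that] by (rule LeastI_ex)
  have ele: "e i w \<le> k" if "(T i ^^ k) w = 0" for i w k
    unfolding e_def using that by (rule Least_le)
  have SC: "w \<in> S \<Longrightarrow> w \<in> C" for w using S(1) geigD by blast
  have Tpz: "(T i ^^ k) 0 = 0" for i k by (induction k) auto
  have TpT: "(T i ^^ k) (T j w) = T j ((T i ^^ k) w)" if "w \<in> S" for i j k w
    using shp_T[OF SC[OF that], where k=k and i=i and c=0 and j=j] by (simp add: shT)
  have dT: "d (T j w) < d w" if w: "w \<in> S" "w \<noteq> 0" for j w
  proof -
    have le: "e i (T j w) \<le> e i w" for i
      using TpT[OF w(1), where i=i and k="e i w" and j=j] e0[OF w(1), of i] by (intro ele) simp
    have "e j w \<noteq> 0" using e0[OF w(1), of j] w(2) by (metis funpow_0)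
    then obtain m where m: "e j w = Suc m" by (metis not0_implies_Suc)
    have "(T j ^^ m) (T j w) = 0" using e0[OF w(1), of j] m by (simp add: funpow_swap1)
    then have "e j (T j w) < e j w" using ele[where i=j and k=m and w="T j w"] m by simp
    then show ?thesis unfolding d_def using le fin
      by (intro sum_strict_mono_ex1) auto
  qed
  let ?P = "\<lambda>w. w \<in> S \<and> (\<exists>i. T i w \<noteq> 0)"
  have "?P v" using v by blast
  then obtain w where w: "?P w" "\<And>y. ?P y \<Longrightarrow> d w \<le> d y"
    using ex_has_least_nat[of ?P v d] by blast
  have w0: "w \<noteq> 0" using w by auto
  have "T i (T j w) = 0" for i j
    using w(2)[of "T j w"] dT[of w j] w(1) w0 S(2) by (meson leD)
  then show ?thesis using w(1) by blast
qed

end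

section \<open>Simple vertex operator algebras\<close>

context vertex_operator_algebra
begin

abbreviation Y :: "'v \<Rightarrow> int \<Rightarrow> 'v \<Rightarrow> 'v" where "Y \<equiv> vmode V"
abbreviation sc :: "complex \<Rightarrow> 'v \<Rightarrow> 'v" (infixr \<open>\<odot>\<close> 75) where "a \<odot> v \<equiv> vscale V a v"
abbreviation car :: "'v set" where "car \<equiv> vcar V"
abbreviation wt :: "int \<Rightarrow> 'v set" where "wt n \<equiv> vweight V (of_int n)"
abbreviation L0 :: "'v \<Rightarrow> 'v" where "L0 \<equiv> vmode V (conf V) 1"

lemma car_zero [simp]: "0 \<in> car" using subspace_vcar subspace_0 by blast
lemma car_add: "v \<in> car \<Longrightarrow> w \<in> car \<Longrightarrow> v + w \<in> car" using subspace_vcar subspace_add by blast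
lemma car_scale: "v \<in> car \<Longrightarrow> a \<odot> v \<in> car" using subspace_vcar subspace_scale by blast
lemma car_diff: "v \<in> car \<Longrightarrow> w \<in> car \<Longrightarrow> v - w \<in> car" using subspace_vcar subspace_diff by blast
lemma car_neg: "v \<in> car \<Longrightarrow> - v \<in> car" using subspace_vcar subspace_neg by blast
lemma car_sum: "(\<And>x. x \<in> A \<Longrightarrow> f x \<in> car) \<Longrightarrow> sum f A \<in> car" using subspace_vcar subspace_sum by blast

lemmas car_intros = car_add car_scale car_diff car_neg car_sum mode_closed vac_in conf_in

lemma mode_zero_left [simp]: "v \<in> car \<Longrightarrow> Y 0 n v = 0"
  using mode_scale_left[of 0 v 0 n] by simp
lemma mode_zero_right [simp]: "v \<in> car \<Longrightarrow> Y v n 0 = 0"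
  using mode_scale_right[of v 0 n 0] by simp
lemma mode_diff_left: "u \<in> car \<Longrightarrow> v \<in> car \<Longrightarrow> w \<in> car \<Longrightarrow> Y (u - v) n w = Y u n w - Y v n w"
  using mode_add_left[of "u - v" v w n] by (simp add: car_diff)
lemma mode_diff_right: "u \<in> car \<Longrightarrow> v \<in> car \<Longrightarrow> w \<in> car \<Longrightarrow> Y u n (v - w) = Y u n v - Y u n w"
  using mode_add_right[of u "v - w" w n] by (simp add: car_diff)
lemma mode_sum_left: "(\<And>x. x \<in> A \<Longrightarrow> f x \<in> car) \<Longrightarrow> w \<in> car \<Longrightarrow> Y (sum f A) n w = (\<Sum>x\<in>A. Y (f x) n w)"
  by (induction A rule: infinite_finite_induct) (auto simp: mode_add_left car_sum)
lemma mode_sum_right: "(\<And>x. x \<in> A \<Longrightarrow> f x \<in> car) \<Longrightarrow> w \<in> car \<Longrightarrow> Y w n (sum f A) = (\<Sum>x\<in>A. Y w n (f x))"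
  by (induction A rule: infinite_finite_induct) (auto simp: mode_add_right car_sum)

lemma truncation_nat: "u \<in> car \<Longrightarrow> v \<in> car \<Longrightarrow> \<exists>N::nat. \<forall>j\<ge>N. Y u (l + int j) v = 0"
proof -
  assume "u \<in> car" "v \<in> car"
  then obtain N where N: "\<And>n. n \<ge> N \<Longrightarrow> Y u n v = 0" using truncation by blast
  show ?thesis by (rule exI[of _ "nat (N - l)"]) (auto intro!: N)
qed

text \<open>A single cutoff \<open>N\<close> for all three truncations makes both sides ordinary
  finite sums, which can be split and reindexed.\<close>

lemma borcherds_fin:
  assumes "u \<in> car" "v \<in> car" "w \<in> car"
    and "\<And>j. j \<ge> N \<Longrightarrow> Y u (l + int j) v = 0" "\<And>j. j \<ge> N \<Longrightarrow> Y v (q + int j) w = 0"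
      "\<And>j. j \<ge> N \<Longrightarrow> Y u (p + int j) w = 0"
  shows "(\<Sum>j<N. (of_int p gchoose j) \<odot> Y (Y u (l + int j) v) (p + q - int j) w) =
    (\<Sum>j<N. ((-1) ^ j * (of_int l gchoose j)) \<odot> (Y u (p + l - int j) (Y v (q + int j) w)
         - ((-1) powi l) \<odot> Y v (q + l - int j) (Y u (p + int j) w)))"
  using borcherds[OF assms(1-3), of p l q] assms
  by (subst (asm) (1 2) Sum_any_eq_sum[of N]) auto

lemma commutator:
  assumes "u \<in> car" "v \<in> car" "w \<in> car" "\<And>j. j \<ge> N \<Longrightarrow> Y u (int j) v = 0"
  shows "Y u p (Y v q w) - Y v q (Y u p w) =
     (\<Sum>j<N. (of_int p gchoose j) \<odot> Y (Y u (int j) v) (p + q - int j) w)"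
  using borcherds[OF assms(1-3), of p 0 q] assms
  by (subst (asm) Sum_any_eq_sum[of N]) (auto simp: gbinomial_0_left Sum_any_eq_0th)

lemma zero_mode_derivation:
  assumes "u \<in> car" "v \<in> car" "w \<in> car"
  shows "Y u 0 (Y v n w) = Y (Y u 0 v) n w + Y v n (Y u 0 w)"
proof -
  obtain N where N: "\<And>j. j \<ge> N \<Longrightarrow> Y u (0 + int j) v = 0" using truncation_nat[OF assms(1,2)] by blast
  have "Y u 0 (Y v n w) - Y v n (Y u 0 w) = (\<Sum>j<Suc N. (of_int 0 gchoose j) \<odot> Y (Y u (int j) v) (0 + n - int j) w)"
    using N by (intro commutator assms) auto
  also have "\<dots> = Y (Y u 0 v) n w"
    by (subst sum.lessThan_Suc_shift) (simp add: gbinomial_0_left)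
  finally show ?thesis by (simp add: algebra_simps)
qed

lemma iterate:
  assumes "u \<in> car" "v \<in> car" "w \<in> car"
  shows "Y (Y u l v) q w = Sum_any (\<lambda>j::nat. ((-1) ^ j * (of_int l gchoose j)) \<odot>
     (Y u (l - int j) (Y v (q + int j) w) - ((-1) powi l) \<odot> Y v (q + l - int j) (Y u (int j) w)))"
  using borcherds[OF assms, of 0 l q] by (simp add: gbinomial_0_left Sum_any_eq_0th)

lemma L0_mode:
  assumes "v \<in> car" "w \<in> car"
  shows "L0 (Y v n w) = Y (L0 v) n w - of_int (n + 1) \<odot> Y v n w + Y v n (L0 w)"
proof -
  obtain N where N: "\<And>j. j \<ge> N \<Longrightarrow> Y (conf V) (0 + int j) v = 0" using truncation_nat[OF conf_in assms(1)] by blast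
  \<comment> \<open>With upper index 1 only the L(-1) term and the L(0) term of the commutator
    survive.\<close>
  have z: "(1::complex) gchoose (Suc (Suc j)) = 0" for j
    using binomial_gbinomial[of 1 "Suc (Suc j)", where 'a = complex] by simp
  have "L0 (Y v n w) - Y v n (L0 w) = (\<Sum>j<Suc (Suc N). (of_int 1 gchoose j) \<odot> Y (Y (conf V) (int j) v) (1 + n - int j) w)"
    using N by (intro commutator assms conf_in) auto
  also have "\<dots> = Y (Y (conf V) 0 v) (1 + n) w + Y (L0 v) n w"
    by (simp add: sum.lessThan_Suc_shift z del: sum.lessThan_Suc)
  also have "Y (Y (conf V) 0 v) (1 + n) w = - of_int (n + 1) \<odot> Y v n w"
    using translation[of v w "1 + n"] assms by (simp add: add.commute)
  finally show ?thesis by (simp add: algebra_simps)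
qed

lemma wtD: "v \<in> vweight V a \<Longrightarrow> v \<in> car" by (simp add: vweight_def)

lemma subspace_vweight: "subspace (vweight V a)"
  by (rule subspaceI) (auto simp: vweight_def car_intros conf_in mode_add_right mode_scale_right
      scale_right_distrib mult.commute)

lemma wt_mode:
  assumes "v \<in> wt a" "w \<in> wt b"
  shows "Y v n w \<in> wt (a + b - n - 1)"
proof -
  have C: "v \<in> car" "w \<in> car" using assms wtD by auto
  have "L0 (Y v n w) = of_int a \<odot> Y v n w - of_int (n + 1) \<odot> Y v n w + of_int b \<odot> Y v n w"
    using L0_mode[OF C, of n] assms C by (simp add: vweight_def mode_scale_left mode_scale_right)
  also have "\<dots> = of_int (a + b - n - 1) \<odot> Y v n w"
    by (simp only: scale_left_diff_distrib[symmetric] scale_left_distrib[symmetric]) (simp add: algebra_simps)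
  finally show ?thesis using C by (simp add: vweight_def mode_closed)
qed

text \<open>A single operator, indexed by \<open>unit\<close>, so that a weight becomes a constant
  label and the extraction lemma for joint eigenspaces applies to the grading by weight.\<close>

sublocale L0: commuting_family "vscale V" "vcar V" "\<lambda>_::unit. vmode V (conf V) 1"
  by unfold_locales
    (auto simp: subspace_vcar mode_closed conf_in mode_add_right mode_scale_right)

lemma wt_geig: "vweight V a \<subseteq> L0.geig UNIV (\<lambda>_. a)"
proof
  fix v assume "v \<in> vweight V a"
  then have "v \<in> car" "(L0.sh () a ^^ 1) v = 0" by (auto simp: vweight_def L0.sh_def)
  then show "v \<in> L0.geig UNIV (\<lambda>_. a)"
    unfolding L0.geig_def by (intro CollectI conjI ballI exI[of _ 1]) (auto simp: L0.sh_def)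
qed

lemma weight_extract:
  assumes N: "\<And>m. subspace (N m)" "\<And>m. N m \<subseteq> wt m" and w: "w \<in> span (\<Union>m. N m)" "w \<in> wt k"
  shows "w \<in> N k"
proof -
  \<comment> \<open>Labels that are not integral weights get the zero space.\<close>
  define M where "M = (\<lambda>l::unit \<Rightarrow> complex. if l () \<in> \<int> then N \<lfloor>Re (l ())\<rfloor> else {0})"
  have MN: "M (\<lambda>_. of_int m) = N m" for m by (simp add: M_def)
  have "w \<in> M (\<lambda>_. of_int k)"
  proof (rule L0.homog_span_extract)
    show "subspace (M l)" for l by (simp add: M_def N subspace_single_0)
    show "M l \<subseteq> L0.geig UNIV l" for l
    proof (cases "l () \<in> \<int>")
      case True
      then obtain m where m: "l () = of_int m" by (auto elim: Ints_cases)
      then have "l = (\<lambda>_. of_int m)" by (auto simp: fun_eq_iff)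
      then show ?thesis using MN N(2)[of m] wt_geig[of "of_int m"] by auto
    qed (simp add: M_def)
    have "(\<Union>m. N m) \<subseteq> (\<Union>l. M l)" using MN by blast
    then show "w \<in> span (\<Union>l. M l)" using w(1) span_mono by blast
    show "w \<in> L0.geig UNIV (\<lambda>_. of_int k)" using w(2) wt_geig by blast
  qed
  then show ?thesis by (simp add: MN)
qed

lemma vac_wt: "vac V \<in> wt 0"
  using creation_reg[OF conf_in, of 1] vac_in by (simp add: vweight_def)

lemma conf_mode0_wt: "v \<in> wt a \<Longrightarrow> Y (conf V) n v \<in> wt (a + 1 - n)"
proof -
  assume v: "v \<in> wt a"
  have "conf V \<in> wt 2"
  proof -
    have "L0 (conf V) = 2 \<odot> conf V"
    proof -
      \<comment> \<open>The relation [L(0), L(-2)] = 2 L(-2) on the vacuum; creation turns L(-2)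
        applied to the vacuum into \<open>conf V\<close>.\<close>
      have "Y (conf V) (0 + 1) (Y (conf V) (-2 + 1) (vac V)) - Y (conf V) (-2 + 1) (Y (conf V) (0 + 1) (vac V))
        = of_int (0 - (-2)) \<odot> Y (conf V) (0 + -2 + 1) (vac V) + 0"
        using virasoro[OF vac_in, of 0 "-2"] by (simp only: if_False) simp
      then show ?thesis using creation[OF conf_in] creation_reg[OF conf_in, of 1] conf_in by simp
    qed
    then show ?thesis by (simp add: vweight_def conf_in)
  qed
  from wt_mode[OF this v, of n] show ?thesis by (simp add: algebra_simps)
qed

section \<open>Cyclic submodules, annihilators and simplicity\<close>

definition gen :: "'v \<Rightarrow> 'v set" where
  "gen a = span {Y v n a |v n. v \<in> car}"

lemma gen_car: "a \<in> car \<Longrightarrow> gen a \<subseteq> car"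
  unfolding gen_def by (rule span_minimal[OF _ subspace_vcar]) (auto intro: mode_closed)

lemma gen_self: "a \<in> car \<Longrightarrow> a \<in> gen a"
  unfolding gen_def using vac_mode[of a "-1"] vac_in by (intro span_base CollectI exI[of _ "vac V"] exI[of _ "-1"]) simp

text \<open>Associativity: a product of two modes applied to \<open>a\<close> reduces to single
  modes applied to \<open>a\<close>. The induction descends in \<open>q\<close> from the point
  \<open>M\<close> beyond which \<open>Y v q a\<close> vanishes.\<close>

lemma gen_closed:
  assumes a: "a \<in> car" and u: "u \<in> car" and w: "w \<in> gen a"
  shows "Y u p w \<in> gen a"
proof -
  have sub: "subspace (gen a)" unfolding gen_def by (rule subspace_span)
  have base: "Y v n a \<in> gen a" if "v \<in> car" for v n
    unfolding gen_def using that by (intro span_base) blast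
  have main: "\<forall>p. Y u p (Y v q a) \<in> gen a" if v: "v \<in> car" for v q
  proof -
    obtain M where M: "\<And>n. n \<ge> M \<Longrightarrow> Y v n a = 0" using truncation[OF v a] by blast
    obtain K where K: "\<And>n. n \<ge> K \<Longrightarrow> Y u n a = 0" using truncation[OF u a] by blast
    have "\<forall>p. Y u p (Y v (M - int d) a) \<in> gen a" for d
    proof (induction d rule: less_induct)
      case (less d)
      show ?case
      proof
        fix p
        define q where "q = M - int d"
        \<comment> \<open>With \<open>K\<close> as the outer index of the Borcherds identity all
          terms in which \<open>u\<close> acts first on \<open>a\<close> vanish. What is left starts
          with \<open>Y u p (Y v q a)\<close> and continues with terms of larger
          \<open>q\<close>.\<close>
        define l where "l = p - K"
        obtain N where N: "\<And>j. j \<ge> N \<Longrightarrow> Y u (l + int j) v = 0" using truncation_nat[OF u v] by blast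
        define N' where "N' = Suc (max N d)"
        have "(\<Sum>j<N'. (of_int K gchoose j) \<odot> Y (Y u (l + int j) v) (K + q - int j) a) =
          (\<Sum>j<N'. ((-1) ^ j * (of_int l gchoose j)) \<odot> (Y u (K + l - int j) (Y v (q + int j) a)
           - ((-1) powi l) \<odot> Y v (q + l - int j) (Y u (K + int j) a)))"
          by (rule borcherds_fin[OF u v a]) (auto simp: N'_def q_def N M K)
        also have "\<dots> = (\<Sum>j<N'. ((-1) ^ j * (of_int l gchoose j)) \<odot> Y u (p - int j) (Y v (q + int j) a))"
          by (simp add: K v l_def)
        also have "\<dots> = Y u p (Y v q a) +
            (\<Sum>j<max N d. ((-1) ^ Suc j * (of_int l gchoose Suc j)) \<odot> Y u (p - int (Suc j)) (Y v (q + int (Suc j)) a))"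
          unfolding N'_def by (subst sum.lessThan_Suc_shift) simp
        finally have eq: "Y u p (Y v q a) =
            (\<Sum>j<N'. (of_int K gchoose j) \<odot> Y (Y u (l + int j) v) (K + q - int j) a) -
            (\<Sum>j<max N d. ((-1) ^ Suc j * (of_int l gchoose Suc j)) \<odot> Y u (p - int (Suc j)) (Y v (q + int (Suc j)) a))"
          by (simp add: algebra_simps)
        have IH: "Y u p' (Y v (q + int (Suc j)) a) \<in> gen a" for p' j
        proof (cases "Suc j \<le> d")
          case True
          then have "q + int (Suc j) = M - int (d - Suc j)" by (simp add: q_def)
          then show ?thesis using less.IH[of "d - Suc j"] True by (simp only: diff_less)
        next
          case False
          then have "Y v (q + int (Suc j)) a = 0" by (intro M) (simp add: q_def)
          then show ?thesis using u subspace_0[OF sub] by simp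
        qed
        show "Y u p (Y v (M - int d) a) \<in> gen a"
          unfolding q_def[symmetric] eq
          by (intro subspace_diff[OF sub] subspace_sum[OF sub] subspace_scale[OF sub] base IH mode_closed u v)
      qed
    qed
    note * = this
    show ?thesis
    proof (cases "q \<ge> M")
      case True then show ?thesis using M u subspace_0[OF sub] by simp
    next
      case False
      then have "q = M - int (nat (M - q))" by simp
      then show ?thesis using * by metis
    qed
  qed
  have "w \<in> car \<and> Y u p w \<in> gen a"
    using w unfolding gen_def
  proof (induction rule: span_induct_alt)
    case base
    then show ?case using u by (simp add: span_zero)
  next
    case (step c x y)
    obtain v n where x: "x = Y v n a" "v \<in> car" using step(1) by blast
    then have xc: "x \<in> car" using a mode_closed by simp
    have "Y u p x \<in> span {Y v n a |v n. v \<in> car}" using main[OF x(2)] x(1) unfolding gen_def by blast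
    moreover have "Y u p (c \<odot> x + y) = c \<odot> Y u p x + Y u p y"
      using xc step.IH u by (simp add: mode_add_right mode_scale_right car_scale)
    ultimately show ?case using step.IH xc by (simp only: car_add car_scale) (intro conjI span_add span_scale; simp)
  qed
  then show ?thesis by blast
qed

text \<open>Locality: from the index \<open>K\<close> on, the products of \<open>a\<close> with
  \<open>w\<close> vanish, so one side of the Borcherds identity is zero and
  \<open>Y a n (Y w q v)\<close> becomes a combination of terms with larger \<open>q\<close>, which
  vanish by induction.\<close>

lemma annihilator_closed:
  assumes a: "a \<in> car" and w: "w \<in> car" and v: "v \<in> car" and ann: "\<And>n. Y a n v = 0"
  shows "Y a n (Y w q v) = 0"
proof -
  obtain M where M: "\<And>n. n \<ge> M \<Longrightarrow> Y w n v = 0" using truncation[OF w v] by blast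
  obtain K where K: "\<And>j. j \<ge> K \<Longrightarrow> Y a (0 + int j) w = 0" using truncation_nat[OF a w] by blast
  have "\<forall>n. Y a n (Y w (M - int d) v) = 0" for d
  proof (induction d rule: less_induct)
    case (less d)
    show ?case
    proof
      fix n
      define q where "q = M - int d"
      define N where "N = Suc d"
      have l1: "Y a (int K + int j) w = 0" for j using K[of "K + j"] by simp
      have "(\<Sum>j<N. (of_int (n - int K) gchoose j) \<odot> Y (Y a (int K + int j) w) (n - int K + q - int j) v) =
          (\<Sum>j<N. ((-1) ^ j * (of_int (int K) gchoose j)) \<odot> (Y a (n - int K + int K - int j) (Y w (q + int j) v)
           - ((-1) powi (int K)) \<odot> Y w (q + int K - int j) (Y a (n - int K + int j) v)))"
        by (rule borcherds_fin[OF a w v]) (auto simp: N_def q_def M ann l1)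
      then have "0 = (\<Sum>j<N. ((-1) ^ j * (of_int (int K) gchoose j)) \<odot> Y a (n - int j) (Y w (q + int j) v))"
        using v w by (simp add: ann l1)
      also have "\<dots> = Y a n (Y w q v) +
          (\<Sum>j<d. ((-1) ^ Suc j * (of_int (int K) gchoose Suc j)) \<odot> Y a (n - int (Suc j)) (Y w (q + int (Suc j)) v))"
        unfolding N_def by (subst sum.lessThan_Suc_shift) simp
      also have "(\<Sum>j<d. ((-1) ^ Suc j * (of_int (int K) gchoose Suc j)) \<odot> Y a (n - int (Suc j)) (Y w (q + int (Suc j)) v)) = 0"
      proof (rule sum.neutral, rule ballI)
        fix j assume j: "j \<in> {..<d}"
        then have "q + int (Suc j) = M - int (d - Suc j)" by (simp add: q_def)
        then show "((-1) ^ Suc j * (of_int (int K) gchoose Suc j)) \<odot> Y a (n - int (Suc j)) (Y w (q + int (Suc j)) v) = 0"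
          using less.IH[of "d - Suc j"] j by (simp only:) simp
      qed
      finally show "Y a n (Y w (M - int d) v) = 0" by (simp add: q_def)
    qed
  qed
  note * = this
  show ?thesis
  proof (cases "q \<ge> M")
    case True then show ?thesis using M a by simp
  next
    case False
    then have "q = M - int (nat (M - q))" by simp
    then show ?thesis using * by metis
  qed
qed

end

locale simple_voa = vertex_operator_algebra +
  assumes nontrivial: "vcar V \<noteq> {0}"
    and simple: "\<lbrakk>subspace N; N \<subseteq> vcar V; \<And>u n w. u \<in> vcar V \<Longrightarrow> w \<in> N \<Longrightarrow> vmode V u n w \<in> N\<rbrakk>
      \<Longrightarrow> N = {0} \<or> N = vcar V"
begin

lemma gen_all: "a \<in> car \<Longrightarrow> a \<noteq> 0 \<Longrightarrow> gen a = car"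
  using simple[of "gen a"] gen_car gen_closed gen_self subspace_span unfolding gen_def by blast

lemma vac_nonzero: "vac V \<noteq> 0"
proof
  assume "vac V = 0"
  then have "v = 0" if "v \<in> car" for v using creation[OF that] that by simp
  then show False using nontrivial car_zero by blast
qed

text \<open>The vectors annihilated by all modes of \<open>a\<close> form an ideal. If it contained
  \<open>b\<close> it would contain the vacuum, and creation would give
  \<open>a = 0\<close>.\<close>

lemma mode_nonzero:
  assumes "a \<in> car" "b \<in> car" "a \<noteq> 0" "b \<noteq> 0"
  shows "\<exists>n. Y a n b \<noteq> 0"
proof (rule ccontr)
  assume "\<not> ?thesis"
  then have b: "\<And>n. Y a n b = 0" by blast
  let ?N = "{v \<in> car. \<forall>n. Y a n v = 0}"
  have "subspace ?N"
    by (rule subspaceI) (use assms(1) in \<open>auto simp: car_intros mode_add_right mode_scale_right\<close>)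
  moreover have "Y u n w \<in> ?N" if "u \<in> car" "w \<in> ?N" for u n w
    using that annihilator_closed[OF assms(1), of u w] by (auto intro: mode_closed)
  ultimately have "?N = {0} \<or> ?N = car" by (intro simple) auto
  then have "vac V \<in> ?N" using b assms(2,4) vac_in by blast
  then show False using creation[OF assms(1)] assms(3) by auto
qed

text \<open>A Schur argument. If L(-1) kills \<open>a\<close>, translation leaves only the mode -1
  of \<open>a\<close>, which then commutes with every mode. It has an eigenvector in the
  finite-dimensional weight-zero space, its eigenspace is an ideal, and the vacuum reads off the
  scalar.\<close>

lemma translation_invariant_scalar:
  assumes a: "a \<in> wt 0" and "Y (conf V) 0 a = 0"
  shows "\<exists>c. a = c \<odot> vac V"
proof -
  have aC: "a \<in> car" using a wtD by blast
  have z: "Y a n v = 0" if "n \<noteq> -1" "v \<in> car" for n v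
  proof -
    have "- of_int (n + 1) \<odot> Y a n v = 0"
      using translation[OF aC that(2), of "n + 1"] assms(2) that(2) by (simp del: of_int_add)
    then show ?thesis using that(1) by (metis add_eq_0_iff2 neg_equal_0_iff_equal of_int_eq_0_iff scale_eq_0_iff)
  qed
  have comm: "Y a (-1) (Y v q w) = Y v q (Y a (-1) w)" if "v \<in> car" "w \<in> car" for v q w
    using commutator[OF aC that, of 0 "-1" q] z that(1) by simp
  interpret S: commuting_family "vscale V" car "\<lambda>_::unit. Y a (-1)"
    by unfold_locales (auto simp: subspace_vcar mode_closed aC mode_add_right mode_scale_right)
  obtain B where B: "finite B" "wt 0 \<subseteq> span B" using weight_finite by blast
  have st: "Y a (-1) v \<in> wt 0" if "v \<in> wt 0" for v using wt_mode[OF a that, of "-1"] by simp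
  have "wt 0 \<subseteq> span (\<Union>l. S.geig UNIV l \<inter> wt 0)"
    by (rule S.decompose) (use B st subspace_vweight wtD in auto)
  then have "\<exists>l. \<exists>v \<in> S.geig UNIV l \<inter> wt 0. v \<noteq> 0"
  proof (rule contrapos_pp)
    assume "\<not> (\<exists>l. \<exists>v \<in> S.geig UNIV l \<inter> wt 0. v \<noteq> 0)"
    then have "(\<Union>l. S.geig UNIV l \<inter> wt 0) \<subseteq> {0}" by blast
    then have "span (\<Union>l. S.geig UNIV l \<inter> wt 0) \<subseteq> {0}"
      by (rule span_minimal) (rule subspace_single_0)
    then show "\<not> wt 0 \<subseteq> span (\<Union>l. S.geig UNIV l \<inter> wt 0)" using vac_wt vac_nonzero by blast
  qed
  then obtain l v where v: "v \<in> S.geig UNIV l" "v \<in> wt 0" "v \<noteq> 0" by blast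
  have "S.sh i (l i) w \<in> wt 0" if "w \<in> wt 0" for i w
    using that st subspace_vweight unfolding S.sh_def by (intro subspace_diff subspace_scale) auto
  then obtain b where b: "b \<in> wt 0" "b \<noteq> 0" "S.sh () (l ()) b = 0"
    using S.common_eigenvector[of UNIV "wt 0" l v] v by auto
  let ?c = "l ()"
  let ?N = "{w \<in> car. Y a (-1) w = ?c \<odot> w}"
  have "subspace ?N"
    by (rule subspaceI) (use aC in \<open>auto simp: car_intros mode_add_right mode_scale_right scale_right_distrib mult.commute\<close>)
  moreover have "Y u n w \<in> ?N" if "u \<in> car" "w \<in> ?N" for u n w
    using that by (auto simp: mode_closed comm mode_scale_right)
  ultimately have "?N = {0} \<or> ?N = car" by (intro simple) auto
  moreover have "b \<in> ?N" using b wtD by (simp add: S.sh_def)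
  ultimately have "vac V \<in> ?N" using b vac_in by blast
  then have "a = ?c \<odot> vac V" using creation[OF aC] by simp
  then show ?thesis by blast
qed

end

section \<open>A full Heisenberg subalgebra in a simple vertex operator algebra\<close>

text \<open>Bilinear rather than Hermitian: lowest weights are half of \<open>bil l l\<close>, and
  \<open>l\<close> is not yet known to lie in a real form.\<close>

definition bil :: "complex^'n \<Rightarrow> complex^'n \<Rightarrow> complex" where
  "bil l m = (\<Sum>i\<in>UNIV. l $ i * m $ i)"

lemma bil_commute: "bil l m = bil m l" by (simp add: bil_def mult.commute)
lemma bil_add_left: "bil (l + l') m = bil l m + bil l' m"
  by (simp add: bil_def sum.distrib algebra_simps)
lemma bil_add_right: "bil m (l + l') = bil m l + bil m l'"
  by (simp add: bil_def sum.distrib algebra_simps)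
lemma bil_diff_left: "bil (l - l') m = bil l m - bil l' m"
  by (simp add: bil_def sum_subtractf algebra_simps)
lemma bil_scale_left: "bil (c *s l) m = c * bil l m"
  by (simp add: bil_def sum_distrib_left algebra_simps)
lemma bil_scale_right: "bil m (c *s l) = c * bil m l"
  by (simp add: bil_def sum_distrib_left algebra_simps)
lemma bil_0 [simp]: "bil 0 m = 0" "bil m 0 = 0" by (simp_all add: bil_def)

lemma gbinomial_minus_one: "((-1::complex) gchoose j) = (-1) ^ j"
proof -
  have "of_nat j gchoose j = (1::complex)" using binomial_gbinomial[of j j, where 'a = complex] by simp
  then show ?thesis using gbinomial_negated_upper[of "-1::complex" j] by simp
qed

text \<open>The last axiom says that the Sugawara vector of the Heisenberg fields is the whole
  conformal vector, with a factor 2 to avoid halves. It expresses \<open>L0\<close> by Heisenberg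
  modes alone, which is what determines the eigenvalue spaces.\<close>

locale heisenberg_voa = simple_voa V c
  for V :: "'v::ab_group_add voa" and c :: complex +
  fixes t :: "'n::finite \<Rightarrow> 'v"
  assumes t_car: "t i \<in> vcar V"
    and t_prod: "n \<ge> 0 \<Longrightarrow> vmode V (t i) n (t j) = (if n = 1 \<and> i = j then vac V else 0)"
    and conf_t: "vscale V 2 (conf V) = (\<Sum>i\<in>UNIV. vmode V (t i) (-1) (t i))"
begin

abbreviation h :: "'n \<Rightarrow> int \<Rightarrow> 'v \<Rightarrow> 'v" where "h i \<equiv> vmode V (t i)"
abbreviation T :: "'n \<Rightarrow> 'v \<Rightarrow> 'v" where "T i \<equiv> vmode V (t i) 0"

lemma h_in: "w \<in> car \<Longrightarrow> h i n w \<in> car" by (intro mode_closed t_car)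

lemma h_comm:
  assumes "w \<in> car"
  shows "h i m (h j n w) = h j n (h i m w) + (if i = j \<and> m + n = 0 then of_int m \<odot> w else 0)"
proof -
  have "h i m (h j n w) - h j n (h i m w) =
     (\<Sum>k<2. (of_int m gchoose k) \<odot> Y (Y (t i) (int k) (t j)) (m + n - int k) w)"
    by (intro commutator t_car assms) (auto simp: t_prod)
  also have "\<dots> = (if i = j \<and> m + n = 0 then of_int m \<odot> w else 0)"
    using assms by (auto simp: t_prod numeral_2_eq_2 vac_mode)
  finally show ?thesis by (simp add: algebra_simps)
qed

text \<open>The iterate formula for h(-1)t. Its binomial signs cancel because
  \<open>(-1) gchoose k\<close> is \<open>(-1) ^ k\<close>, and both halves of the normally ordered
  square stay under one sum.\<close>

lemma conf_mode:
  assumes w: "w \<in> car"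
  shows "2 \<odot> Y (conf V) m w = (\<Sum>i\<in>UNIV. Sum_any (\<lambda>k::nat. h i (-1 - int k) (h i (m + int k) w) + h i (m - 1 - int k) (h i (int k) w)))"
proof -
  have "2 \<odot> Y (conf V) m w = (\<Sum>i\<in>UNIV. Y (h i (-1) (t i)) m w)"
    using w by (simp add: mode_scale_left[symmetric] conf_in conf_t mode_sum_left t_car mode_closed)
  also have "\<dots> = (\<Sum>i\<in>UNIV. Sum_any (\<lambda>k::nat. h i (-1 - int k) (h i (m + int k) w) + h i (m - 1 - int k) (h i (int k) w)))"
  proof (intro sum.cong refl)
    fix i
    have one: "(-1) ^ j * (-1) ^ j = (1::complex)" for j :: nat by (simp add: power_mult_distrib[symmetric])
    have "Y (h i (-1) (t i)) m w = Sum_any (\<lambda>k::nat. ((-1) ^ k * (of_int (-1) gchoose k)) \<odot>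
       (h i (-1 - int k) (h i (m + int k) w) - ((-1) powi (-1)) \<odot> h i (m + -1 - int k) (h i (int k) w)))"
      by (rule iterate[OF t_car t_car w])
    also have "\<dots> = Sum_any (\<lambda>k::nat. 1 \<odot> (h i (-1 - int k) (h i (m + int k) w) - (-1) \<odot> h i (m - 1 - int k) (h i (int k) w)))"
      by (simp only: gbinomial_minus_one of_int_minus of_int_1 one power_int_minus power_int_1_right inverse_minus_eq inverse_1 add_uminus_conv_diff)
    finally show "Y (h i (-1) (t i)) m w = Sum_any (\<lambda>k::nat. h i (-1 - int k) (h i (m + int k) w) + h i (m - 1 - int k) (h i (int k) w))"
      by (simp only: scale_one scale_minus_left diff_minus_eq_add)
  qed
  finally show ?thesis .
qed

lemma t_wt: "t j \<in> wt 1"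
proof -
  have "2 \<odot> L0 (t j) = (\<Sum>i\<in>UNIV. Sum_any (\<lambda>k::nat. h i (-1 - int k) (h i (1 + int k) (t j)) + h i (1 - 1 - int k) (h i (int k) (t j))))"
    by (rule conf_mode[OF t_car])
  also have "\<dots> = (\<Sum>i\<in>UNIV. \<Sum>k<2. h i (-1 - int k) (h i (1 + int k) (t j)) + h i (1 - 1 - int k) (h i (int k) (t j)))"
    by (intro sum.cong refl Sum_any_eq_sum) (auto simp: t_prod t_car)
  also have "\<dots> = (\<Sum>i\<in>UNIV. if i = j then 2 \<odot> t j else 0)"
    by (intro sum.cong refl)
      (auto simp: t_prod t_car numeral_2_eq_2 creation scale_left_distrib[of 1 1, simplified])
  finally have "2 \<odot> L0 (t j) = 2 \<odot> t j" by simp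
  then have "L0 (t j) = t j" by (simp add: scale_cancel_left)
  then show ?thesis by (simp add: vweight_def t_car)
qed

lemma h_wt: "w \<in> wt b \<Longrightarrow> h i n w \<in> wt (b - n)"
  using wt_mode[OF t_wt] by (metis add.commute add_diff_cancel_right' diff_diff_eq)

sublocale Tf: commuting_family "vscale V" "vcar V" "\<lambda>i. vmode V (t i) 0"
proof unfold_locales
  show "vmode V (t i) 0 (vmode V (t j) 0 v) = vmode V (t j) 0 (vmode V (t i) 0 v)" if "v \<in> car" for v i j
    using h_comm[OF that, of i 0 j 0] by simp
qed (auto simp: subspace_vcar mode_closed t_car mode_add_right mode_scale_right)

text \<open>Generalised eigenspaces of the zero modes; \<open>G_eq\<close> shows later that they are
  honest eigenspaces.\<close>

definition G :: "complex^'n \<Rightarrow> 'v set" where "G l = Tf.geig UNIV (\<lambda>i. l $ i)"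

lemma G_car: "a \<in> G l \<Longrightarrow> a \<in> car" unfolding G_def by (rule Tf.geigD)
lemma G_sub: "subspace (G l)" unfolding G_def by (rule Tf.geig_subspace)
lemma G_0 [simp]: "0 \<in> G l" unfolding G_def by simp
lemma G_T: "a \<in> G l \<Longrightarrow> T i a \<in> G l" unfolding G_def by (rule Tf.geig_T)
lemma G_iff: "a \<in> G l \<longleftrightarrow> a \<in> car \<and> (\<forall>i. \<exists>k. (Tf.sh i (l $ i) ^^ k) a = 0)"
  unfolding G_def Tf.geig_def by simp
lemma geig_G: "Tf.geig UNIV f = G (\<chi> i. f i)"
  unfolding G_def by (rule arg_cong[where f = "Tf.geig UNIV"]) (simp add: fun_eq_iff)

lemma T_h: "w \<in> car \<Longrightarrow> T i (h j n w) = h j n (T i w)"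
  using h_comm[of w i 0 j n] by (auto split: if_splits)

lemma h_G: "w \<in> G l \<Longrightarrow> h i n w \<in> G l"
proof -
  assume w: "w \<in> G l"
  have C: "w \<in> car" using w G_car by blast
  have sh: "Tf.sh j c (h i n v) = h i n (Tf.sh j c v)" if "v \<in> car" for j c v
    using that by (simp add: Tf.sh_def T_h mode_diff_right t_car h_in car_scale mode_scale_right)
  have "(Tf.sh j c ^^ k) (h i n w) = h i n ((Tf.sh j c ^^ k) w)" for j c k
    using C by (induction k) (simp_all add: sh Tf.shp_in)
  then show ?thesis using w unfolding G_iff by (auto simp: h_in) (metis mode_zero_right t_car)
qed

lemma homog_extract:
  assumes "\<And>l. subspace (N l)" "\<And>l. N l \<subseteq> G l" "w \<in> span (\<Union>l. N l)" "w \<in> G l"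
  shows "w \<in> N l"
proof -
  have "(\<Union>l. N l) \<subseteq> (\<Union>f. N (\<chi> i. f i))"
  proof safe
    fix x l assume "x \<in> N l"
    then have "x \<in> N (\<chi> i. l $ i)" by simp
    then show "x \<in> (\<Union>f. N (\<chi> i. f i))" by blast
  qed
  then have "w \<in> span (\<Union>f. N (\<chi> i. f i))" using assms(3) span_mono by blast
  then have "w \<in> N (\<chi> i. l $ i)"
    using assms by (intro Tf.homog_span_extract[where N = "\<lambda>f. N (\<chi> i. f i)"]) (auto simp: geig_G)
  then show ?thesis by simp
qed

lemma wt_decomp: "wt n \<subseteq> span (\<Union>l. G l \<inter> wt n)"
proof -
  obtain B where B: "finite B" "wt n \<subseteq> span B" using weight_finite by blast
  have "wt n \<subseteq> span (\<Union>f. Tf.geig UNIV f \<inter> wt n)"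
    by (rule Tf.decompose) (use B h_wt[of _ n _ 0] subspace_vweight wtD in auto)
  also have "(\<Union>f. Tf.geig UNIV f \<inter> wt n) \<subseteq> (\<Union>l. G l \<inter> wt n)"
  proof safe
    fix x f assume "x \<in> Tf.geig UNIV f" "x \<in> wt n"
    then have "x \<in> G (\<chi> i. f i) \<inter> wt n" by (simp add: geig_G)
    then show "x \<in> (\<Union>l. G l \<inter> wt n)" by blast
  qed
  then have "span (\<Union>f. Tf.geig UNIV f \<inter> wt n) \<subseteq> span (\<Union>l. G l \<inter> wt n)" by (rule span_mono)
  finally show ?thesis .
qed

lemma car_decomp_wt: "car \<subseteq> span (\<Union>l. span (\<Union>n. G l \<inter> wt n))"
proof -
  have "(\<Union>n. wt n) \<subseteq> span (\<Union>l. span (\<Union>n. G l \<inter> wt n))"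
  proof safe
    fix x n assume "x \<in> wt n"
    then have "x \<in> span (\<Union>l. G l \<inter> wt n)" using wt_decomp by blast
    also have "\<dots> \<subseteq> span (\<Union>l. span (\<Union>n. G l \<inter> wt n))"
      by (rule span_mono) (auto intro: span_base)
    finally show "x \<in> span (\<Union>l. span (\<Union>n. G l \<inter> wt n))" .
  qed
  then show ?thesis unfolding graded by (rule span_minimal) (rule subspace_span)
qed

lemma G_wt_span: "w \<in> G l \<Longrightarrow> w \<in> span (\<Union>n. G l \<inter> wt n)"
proof (rule homog_extract[where N = "\<lambda>l. span (\<Union>n. G l \<inter> wt n)"])
  show "span (\<Union>n. G l \<inter> wt n) \<subseteq> G l" for l
    by (rule span_minimal[OF _ G_sub]) auto
  show "w \<in> G l \<Longrightarrow> w \<in> span (\<Union>l. span (\<Union>n. G l \<inter> wt n))" using car_decomp_wt G_car by blast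
qed (rule subspace_span)

lemma car_decomp: "car = span (\<Union>l. G l)"
proof
  have "(\<Union>l. span (\<Union>n. G l \<inter> wt n)) \<subseteq> (\<Union>l. G l)"
    using span_minimal[OF _ G_sub] by (intro UN_mono) auto
  then show "car \<subseteq> span (\<Union>l. G l)" using car_decomp_wt span_mono by blast
  show "span (\<Union>l. G l) \<subseteq> car" by (rule span_minimal[OF _ subspace_vcar]) (auto intro: G_car)
qed

text \<open>Zero modes are derivations, so shifting by \<open>x + y\<close> on a product obeys a
  Leibniz rule with the shifts \<open>x\<close> and \<open>y\<close> on the factors, and nilpotency
  degrees add.\<close>

lemma G_mode:
  assumes a: "a \<in> G l" and b: "b \<in> G m"
  shows "Y a n b \<in> G (l + m)"
proof -
  have C: "a \<in> car" "b \<in> car" using a b G_car by auto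
  have leib: "Tf.sh i (x + y) (Y v n w) = Y (Tf.sh i x v) n w + Y v n (Tf.sh i y w)"
    if "v \<in> car" "w \<in> car" for i x y v w
    using that by (simp add: Tf.sh_def zero_mode_derivation t_car mode_diff_left mode_diff_right h_in
        car_scale mode_scale_left mode_scale_right scale_left_distrib algebra_simps)
  have "(Tf.sh i (x + y) ^^ (k + k')) (Y v n w) = 0"
    if "v \<in> car" "w \<in> car" "(Tf.sh i x ^^ k) v = 0" "(Tf.sh i y ^^ k') w = 0" for i x y k k' v w
    using that
  proof (induction "k + k'" arbitrary: k k' v w)
    case 0
    then show ?case by simp
  next
    case (Suc d)
    have 1: "(Tf.sh i (x + y) ^^ d) (Y (Tf.sh i x v) n w) = 0"
    proof (cases k)
      case 0
      then show ?thesis using Suc.prems by simp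
    next
      case (Suc k1)
      then have "(Tf.sh i x ^^ k1) (Tf.sh i x v) = 0" using Suc.prems by (simp add: funpow_swap1)
      then show ?thesis using Suc.hyps(1)[of k1 k' "Tf.sh i x v" w] Suc.prems Suc.hyps(2) Suc Tf.sh_in by simp
    qed
    have 2: "(Tf.sh i (x + y) ^^ d) (Y v n (Tf.sh i y w)) = 0"
    proof (cases k')
      case 0
      then show ?thesis using Suc.prems by simp
    next
      case (Suc k1)
      then have "(Tf.sh i y ^^ k1) (Tf.sh i y w) = 0" using Suc.prems by (simp add: funpow_swap1)
      then show ?thesis using Suc.hyps(1)[of k k1 v "Tf.sh i y w"] Suc.prems Suc.hyps(2) Suc Tf.sh_in by simp
    qed
    have "(Tf.sh i (x + y) ^^ Suc d) (Y v n w) = (Tf.sh i (x + y) ^^ d) (Tf.sh i (x + y) (Y v n w))"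
      by (simp add: funpow_swap1)
    also have "\<dots> = 0"
      using 1 2 Suc.prems by (simp add: leib Tf.shp_add mode_closed Tf.sh_in)
    finally show ?case using Suc.hyps(2) by simp
  qed
  then show ?thesis using a b C unfolding G_iff
    by (auto simp: mode_closed) blast
qed

text \<open>By simplicity the modes of all vectors applied to \<open>a\<close> span the carrier;
  keeping the part of the right eigenvalue restricts the acting vectors to
  \<open>G (m - l)\<close>.\<close>

lemma G_gen:
  assumes a: "a \<in> G l" "a \<noteq> 0" and w: "w \<in> G m"
  shows "w \<in> span {Y v n a |v n. v \<in> G (m - l)}"
proof -
  define N where "N = (\<lambda>m. span {Y v n a |v n. v \<in> G (m - l)})"
  have aC: "a \<in> car" using a G_car by blast
  have "Y v n a \<in> span (\<Union>m. N m)" if "v \<in> car" for v n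
  proof -
    have "v \<in> span (\<Union>l. G l)" using that car_decomp by blast
    then have "v \<in> car \<and> Y v n a \<in> span (\<Union>m. N m)"
    proof (induction rule: span_induct_alt)
      case base
      then show ?case using aC by (simp add: span_zero)
    next
      case (step c x y)
      then obtain k where k: "x \<in> G k" by blast
      then have "Y x n a \<in> N (k + l)" unfolding N_def by (intro span_base) auto
      then have "Y x n a \<in> span (\<Union>m. N m)" by (intro span_base) blast
      then show ?case using step k aC G_car
        by (auto simp: mode_add_left mode_scale_left car_scale car_add intro!: span_add span_scale)
    qed
    then show ?thesis by blast
  qed
  then have "gen a \<subseteq> span (\<Union>m. N m)"
    unfolding gen_def by (intro span_minimal subspace_span) blast
  moreover have "w \<in> gen a" using gen_all[OF aC a(2)] w G_car by blast
  ultimately have "w \<in> span (\<Union>m. N m)" by blast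
  moreover have "N k \<subseteq> G k" for k
    unfolding N_def using G_mode[of _ "k - l" a l, OF _ a(1)] by (intro span_minimal G_sub) auto
  ultimately have "w \<in> N m" using w homog_extract[of N w m] unfolding N_def by (simp add: subspace_span)
  then show ?thesis by (simp add: N_def)
qed

lemma T_vac: "T i (vac V) = 0" using creation_reg[OF t_car] by simp

lemma vac_G: "vac V \<in> G 0"
  unfolding G_iff using vac_in by (auto simp: T_vac Tf.sh_def intro!: exI[of _ 1])

definition Lam :: "(complex^'n) set" where "Lam = {l. G l \<noteq> {0}}"

lemma Lam_I: "a \<in> G l \<Longrightarrow> a \<noteq> 0 \<Longrightarrow> l \<in> Lam" unfolding Lam_def by blast
lemma Lam_E: "l \<in> Lam \<Longrightarrow> \<exists>a. a \<in> G l \<and> a \<noteq> 0" unfolding Lam_def using G_0 by blast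

lemma Lam_0: "0 \<in> Lam" using vac_G vac_nonzero Lam_I by blast

text \<open>If \<open>G (m - l)\<close> were zero, nothing nonzero in \<open>G m\<close> could be
  reached from \<open>G l\<close>, against \<open>G_gen\<close>.\<close>

lemma Lam_diff: "l \<in> Lam \<Longrightarrow> m \<in> Lam \<Longrightarrow> m - l \<in> Lam"
proof (rule ccontr)
  assume "l \<in> Lam" "m \<in> Lam" "m - l \<notin> Lam"
  from Lam_E[OF this(1)] Lam_E[OF this(2)] obtain a b
    where ab: "a \<in> G l" "a \<noteq> 0" "b \<in> G m" "b \<noteq> 0" by (elim exE conjE)
  have "v = 0" if "v \<in> G (m - l)" for v using that \<open>m - l \<notin> Lam\<close> Lam_I[OF that] by argo
  then have "{Y v n a |v n. v \<in> G (m - l)} \<subseteq> {0}" using G_car[OF ab(1)] by fastforce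
  then have "span {Y v n a |v n. v \<in> G (m - l)} \<subseteq> {0}" using subspace_single_0 span_minimal by blast
  then show False using G_gen[OF ab(1,2,3)] ab(4) by blast
qed

lemma Lam_neg: "l \<in> Lam \<Longrightarrow> - l \<in> Lam" using Lam_diff[OF _ Lam_0] by simp
lemma Lam_add: "l \<in> Lam \<Longrightarrow> m \<in> Lam \<Longrightarrow> l + m \<in> Lam"
  using Lam_diff[OF Lam_neg[of l], of m] by (simp add: add.commute)

lemma Lam_mult: "l \<in> Lam \<Longrightarrow> of_nat n *s l \<in> Lam"
proof (induction n)
  case 0
  then show ?case using Lam_0 by (simp add: vec_eq_iff[of "0 *s l"])
next
  case (Suc n)
  have "of_nat (Suc n) *s l = l + of_nat n *s l" by (simp add: vec_eq_iff algebra_simps)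
  then show ?case using Suc Lam_add by simp
qed

lemma conf_mode1_singular:
  assumes w: "w \<in> car" and sing: "\<And>i j. j \<ge> 1 \<Longrightarrow> h i j w = 0"
  shows "2 \<odot> L0 w = (\<Sum>i\<in>UNIV. T i (T i w))"
proof -
  have "2 \<odot> L0 w = (\<Sum>i\<in>UNIV. Sum_any (\<lambda>k::nat. h i (-1 - int k) (h i (1 + int k) w) + h i (1 - 1 - int k) (h i (int k) w)))"
    by (rule conf_mode[OF w])
  also have "\<dots> = (\<Sum>i\<in>UNIV. T i (T i w))"
  proof (intro sum.cong refl)
    fix i
    show "Sum_any (\<lambda>k::nat. h i (-1 - int k) (h i (1 + int k) w) + h i (1 - 1 - int k) (h i (int k) w)) = T i (T i w)"
      by (subst Sum_any_eq_0th) (auto simp: sing t_car)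
  qed
  finally show ?thesis .
qed

text \<open>At the lowest weight occurring in \<open>G l\<close> all positive modes act as zero, and
  the commuting zero modes have a common eigenvector. On it the Sugawara formula leaves only the
  squares of the zero modes, so its weight is \<open>bil l l / 2\<close>.\<close>

lemma lowest_vector:
  assumes "l \<in> Lam"
  obtains k e where "e \<in> G l" "e \<in> wt k" "e \<noteq> 0" "\<And>i. T i e = l $ i \<odot> e" "\<And>i j. j \<ge> 1 \<Longrightarrow> h i j e = 0"
    "bil l l = 2 * of_int k" "\<And>m. m < k \<Longrightarrow> G l \<inter> wt m = {0}"
proof -
  obtain a where a: "a \<in> G l" "a \<noteq> 0" using assms Lam_E by blast
  have "\<exists>n. G l \<inter> wt n \<noteq> {0}"
  proof (rule ccontr)
    assume "\<not> ?thesis"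
    then have "(\<Union>n. G l \<inter> wt n) \<subseteq> {0}" by blast
    then have "span (\<Union>n. G l \<inter> wt n) \<subseteq> {0}" by (rule span_minimal) (rule subspace_single_0)
    then show False using G_wt_span[OF a(1)] a(2) by blast
  qed
  then obtain n where n: "G l \<inter> wt n \<noteq> {0}" by blast
  obtain N where N: "\<And>n. n < N \<Longrightarrow> wt n = {0}" using weight_bounded by blast
  have nN: "n \<ge> N"
  proof (rule ccontr)
    assume "\<not> n \<ge> N"
    then have "wt n = {0}" by (intro N) simp
    then have "G l \<inter> wt n = {0}" using G_0[of l] by blast
    then show False using n by contradiction
  qed
  define d where "d = (LEAST d. G l \<inter> wt (N + int d) \<noteq> {0})"
  have ex: "G l \<inter> wt (N + int (nat (n - N))) \<noteq> {0}" using n nN by simp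
  define k where "k = N + int d"
  have k: "G l \<inter> wt k \<noteq> {0}" unfolding k_def d_def by (rule LeastI[of _ "nat (n - N)"]) (rule ex)
  have low: "G l \<inter> wt m = {0}" if "m < k" for m
  proof (cases "m < N")
    case True then show ?thesis using N[OF True] G_0[of l] by auto
  next
    case False
    then have "m = N + int (nat (m - N))" "nat (m - N) < d" using that k_def by auto
    then show ?thesis using not_less_Least[of "nat (m - N)" "\<lambda>d. G l \<inter> wt (N + int d) \<noteq> {0}"] unfolding d_def by simp
  qed
  let ?S = "G l \<inter> wt k"
  have S: "subspace ?S" using G_sub subspace_vweight subspace_inter by blast
  obtain v where v: "v \<in> ?S" "v \<noteq> 0" using k subspace_0[OF S] by blast
  have "Tf.sh i (l $ i) w \<in> ?S" if "w \<in> ?S" for i w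
    unfolding Tf.sh_def using that h_wt[of w k i 0]
    by (intro subspace_diff[OF S] subspace_scale[OF S]) (auto intro: G_T)
  then obtain e where e: "e \<in> ?S" "e \<noteq> 0" "\<And>i. Tf.sh i (l $ i) e = 0"
    using Tf.common_eigenvector[of UNIV ?S "\<lambda>i. l $ i" v] v by (auto simp: geig_G)
  have T: "T i e = l $ i \<odot> e" for i using e(3)[of i] by (simp add: Tf.sh_def)
  have sing: "h i j e = 0" if "j \<ge> 1" for i j
  proof -
    have "h i j e \<in> G l \<inter> wt (k - j)" using e(1) h_G h_wt by blast
    then show ?thesis using low[of "k - j"] that by auto
  qed
  have eC: "e \<in> car" using e(1) wtD by blast
  have "(2 * of_int k) \<odot> e = 2 \<odot> L0 e" using e(1) by (simp add: vweight_def)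
  also have "\<dots> = (\<Sum>i\<in>UNIV. T i (T i e))" by (rule conf_mode1_singular[OF eC sing])
  also have "\<dots> = bil l l \<odot> e" using eC by (simp add: T mode_scale_right t_car bil_def scale_sum_left)
  finally have "bil l l = 2 * of_int k" using e(2) by (metis scale_cancel_right)
  then show ?thesis using that[of e k] e T sing low by blast
qed

text \<open>The \<open>n\<close>-fold multiple of \<open>l\<close> has lowest weight
  \<open>n * n * k\<close>; for negative \<open>k\<close> these values would fall below the bound on
  the weights.\<close>

lemma Lam_norm_nonneg: "l \<in> Lam \<Longrightarrow> \<exists>k::int. bil l l = 2 * of_int k \<and> k \<ge> 0"
proof -
  assume l: "l \<in> Lam"
  obtain k where k: "bil l l = 2 * of_int k" by (rule lowest_vector[OF l])
  obtain N where N: "\<And>n. n < N \<Longrightarrow> wt n = {0}" using weight_bounded by blast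
  have "k \<ge> 0"
  proof (rule ccontr)
    assume "\<not> k \<ge> 0"
    \<comment> \<open>Large enough that \<open>n * n\<close> exceeds the absolute value of the bound
      \<open>N\<close>.\<close>
    define n where "n = nat (\<bar>N\<bar> + 1)"
    obtain k' e' where k': "bil (of_nat n *s l) (of_nat n *s l) = 2 * of_int k'" "e' \<in> wt k'" "e' \<noteq> 0"
      by (rule lowest_vector[OF Lam_mult[OF l, of n]])
    have "of_int (2 * k') = (of_int (2 * (int n * int n * k)) :: complex)"
      using k'(1) k by (simp add: bil_scale_left bil_scale_right algebra_simps)
    then have "2 * k' = 2 * (int n * int n * k)" unfolding of_int_eq_iff .
    then have "k' = int n * int n * k" by simp
    moreover have "int n * int n * k \<le> - (int n * int n)" using \<open>\<not> k \<ge> 0\<close> mult_left_mono[of k "-1" "int n * int n"] by simp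
    moreover have "int n \<le> int n * int n" by (metis of_nat_mult of_nat_le_iff le_square)
    ultimately have "k' < N" unfolding n_def by linarith
    then show False using N k'(2,3) by blast
  qed
  then show ?thesis using k by blast
qed

text \<open>Vectors with distinct labels are independent, and the weight space has finite
  dimension.\<close>

lemma finite_labels: "finite {l. G l \<inter> wt n \<noteq> {0}}"
proof (rule ccontr)
  obtain B where B: "finite B" "wt n \<subseteq> span B" using weight_finite by blast
  assume "infinite {l. G l \<inter> wt n \<noteq> {0}}"
  then obtain S where S: "S \<subseteq> {l. G l \<inter> wt n \<noteq> {0}}" "finite S" "card S = Suc (card B)"
    using infinite_arbitrarily_large by blast
  then obtain l where l: "bij_betw l {..card B} S"
    using ex_bij_betw_nat_finite[of S] by (auto simp: lessThan_Suc_atMost atLeast0LessThan)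
  have "\<exists>a. a \<in> G (l k) \<inter> wt n \<and> a \<noteq> 0" if "k \<le> card B" for k
  proof -
    have "G (l k) \<inter> wt n \<noteq> {0}" using S(1) bij_betwE[OF l] that by blast
    then show ?thesis using subspace_0[OF subspace_inter[OF G_sub subspace_vweight], of "l k" "of_int n"] by blast
  qed
  then obtain a where a: "\<And>k. k \<le> card B \<Longrightarrow> a k \<in> G (l k) \<inter> wt n \<and> a k \<noteq> 0" by metis
  obtain x where x: "\<exists>k\<le>card B. x k \<noteq> 0" "(\<Sum>k\<le>card B. x k \<odot> a k) = 0"
    using finite_span_relation[OF B(1), of a] a B(2) by blast
  define f where "f = (\<lambda>k i. l k $ i)"
  have inj: "inj_on f {..card B}"
  proof (rule inj_onI)
    fix j k assume jk: "j \<in> {..card B}" "k \<in> {..card B}" "f j = f k"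
    then have "l j = l k" by (simp add: f_def fun_eq_iff vec_eq_iff)
    then show "j = k" using jk bij_betw_imp_inj_on[OF l] by (simp add: inj_on_def)
  qed
  define w where "w = (\<lambda>m. x (the_inv_into {..card B} f m) \<odot> a (the_inv_into {..card B} f m))"
  have wf: "w (f k) = x k \<odot> a k" if "k \<le> card B" for k
    using that by (simp add: w_def the_inv_into_f_f[OF inj])
  obtain k where k: "k \<le> card B" "x k \<noteq> 0" using x(1) by blast
  have "w (f k) = 0"
  proof (rule Tf.geig_direct[of "f ` {..card B}"])
    show "w m \<in> Tf.geig UNIV m" if m: "m \<in> f ` {..card B}" for m
    proof -
      obtain j where j: "m = f j" "j \<le> card B" using m by auto
      have "a j \<in> Tf.geig UNIV (f j)" using a[OF j(2)] by (simp add: f_def G_def)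
      then show ?thesis using wf j subspace_scale[OF Tf.geig_subspace] by simp
    qed
    show "sum w (f ` {..card B}) = 0" using x(2) wf by (simp add: sum.reindex[OF inj])
  qed (use k in auto)
  then show False using wf k a[OF k(1)] by simp
qed

text \<open>Otherwise all multiples of \<open>l\<close> would have their lowest vectors in weight
  zero, which gives infinitely many labels there.\<close>

lemma Lam_norm_zero:
  assumes l: "l \<in> Lam" and 0: "bil l l = 0"
  shows "l = 0"
proof (rule ccontr)
  assume l0: "l \<noteq> 0"
  have "G (of_nat n *s l) \<inter> wt 0 \<noteq> {0}" for n :: nat
  proof -
    obtain k e where k: "e \<in> G (of_nat n *s l)" "e \<in> wt k" "e \<noteq> 0" "bil (of_nat n *s l) (of_nat n *s l) = 2 * of_int k"
      by (rule lowest_vector[OF Lam_mult[OF l, of n]])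
    then have "k = 0" using 0 by (simp add: bil_scale_left bil_scale_right)
    then show ?thesis using k by blast
  qed
  then have "range (\<lambda>n::nat. of_nat n *s l) \<subseteq> {l. G l \<inter> wt 0 \<noteq> {0}}" by blast
  then have "finite (range (\<lambda>n::nat. of_nat n *s l))" using finite_labels finite_subset by blast
  moreover have "inj (\<lambda>n::nat. of_nat n *s l)"
  proof (rule injI)
    fix m n :: nat assume eq: "of_nat m *s l = of_nat n *s l"
    obtain i where i: "l $ i \<noteq> 0" using l0 by (auto simp: vec_eq_iff)
    have "of_nat m * l $ i = of_nat n * l $ i"
      using arg_cong[OF eq, of "\<lambda>v. v $ i"] by (simp only: vector_smult_component)
    then show "m = n" using i by simp
  qed
  ultimately show False using finite_imageD infinite_UNIV_nat by blast
qed

end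

context vector_space
begin

lemma subspace_Sum_any: "subspace N \<Longrightarrow> (\<And>j. f j \<in> N) \<Longrightarrow> Sum_any f \<in> N"
  unfolding Sum_any.expand_set by (rule subspace_sum)

end

context heisenberg_voa
begin

section \<open>Weight zero and semisimplicity of the zero modes\<close>

lemma G_wt_low:
  assumes "a \<in> G l" "a \<in> wt n" "a \<noteq> 0"
  shows "\<exists>k. bil l l = 2 * of_int k \<and> 0 \<le> k \<and> k \<le> n"
proof -
  have l: "l \<in> Lam" using assms Lam_I by blast
  obtain k e where "e \<in> G l" "e \<in> wt k" "e \<noteq> 0" "\<And>i. T i e = l $ i \<odot> e" "\<And>i j. j \<ge> 1 \<Longrightarrow> h i j e = 0"
    and k: "bil l l = 2 * of_int k" "\<And>m. m < k \<Longrightarrow> G l \<inter> wt m = {0}" by (rule lowest_vector[OF l]) blast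
  obtain k' where k': "bil l l = 2 * of_int k'" "k' \<ge> 0" using Lam_norm_nonneg[OF l] by blast
  have "k = k'" using k(1) k'(1) by simp
  moreover have "k \<le> n" using k(2)[of n] assms by force
  ultimately show ?thesis using k' by blast
qed

lemma wt_neg: "n < 0 \<Longrightarrow> wt n = {0}"
proof -
  assume n: "n < 0"
  have "(\<Union>l. G l \<inter> wt n) \<subseteq> {0}" using G_wt_low[where n=n] n by fastforce
  then have "span (\<Union>l. G l \<inter> wt n) \<subseteq> {0}" by (rule span_minimal) (rule subspace_single_0)
  then show ?thesis using wt_decomp[of n] subspace_0[OF subspace_vweight[of "of_int n"]] by blast
qed

lemma h_wt0: "a \<in> wt 0 \<Longrightarrow> n > 0 \<Longrightarrow> h i n a = 0"
  using h_wt[of a 0 i n] wt_neg[of "- n"] by simp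

lemma wt0_G0: "wt 0 \<subseteq> G 0"
proof -
  have "(\<Union>l. G l \<inter> wt 0) \<subseteq> G 0"
  proof safe
    fix a l assume a: "a \<in> G l" "a \<in> vweight V (of_int 0)"
    show "a \<in> G 0"
    proof (cases "a = 0")
      case False
      then have "bil l l = 0" using G_wt_low[of a l 0] a by fastforce
      then have "l = 0" using Lam_norm_zero[OF Lam_I] a(1) False by blast
      then show ?thesis using a by simp
    qed simp
  qed
  then have "span (\<Union>l. G l \<inter> wt 0) \<subseteq> G 0" by (rule span_minimal) (rule G_sub)
  then show ?thesis using wt_decomp[of 0] by blast
qed

text \<open>In the Sugawara formula for L(-1) every term has a nonnegative Heisenberg mode acting
  first on \<open>a\<close>: positive ones would lead to negative weight, and the zero modes vanish
  by hypothesis.\<close>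

lemma wt0_invariant_scalar:
  assumes a: "a \<in> wt 0" and T: "\<And>i. T i a = 0"
  shows "\<exists>c. a = c \<odot> vac V"
proof (rule translation_invariant_scalar[OF a])
  have aC: "a \<in> car" using a wtD by blast
  have z: "h i (int k) a = 0" for i k using h_wt0[OF a, of "int k" i] T[of i] by (cases "k = 0") auto
  have "2 \<odot> Y (conf V) 0 a = 0" unfolding conf_mode[OF aC] by (simp add: z t_car)
  then show "Y (conf V) 0 a = 0" by simp
qed

text \<open>Were a zero mode nonzero in weight zero, some \<open>w\<close> there would be mapped by
  \<open>T i\<close> to a nonzero multiple of the vacuum. Then \<open>T i\<close> acts on the powers
  \<open>p k\<close> of \<open>w\<close> like differentiation on polynomials, and the powers would
  be independent in a finite-dimensional space.\<close>

lemma T_wt0: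
  assumes a: "a \<in> wt 0"
  shows "T i a = 0"
proof (rule ccontr)
  assume "T i a \<noteq> 0"
  have sub: "wt 0 \<subseteq> Tf.geig UNIV (\<lambda>_. 0)" using wt0_G0 by (simp add: G_def)
  have st: "T j v \<in> wt 0" if "v \<in> wt 0" for j v using h_wt[OF that, of j 0] by simp
  obtain w i where w: "w \<in> wt 0" "T i w \<noteq> 0" "\<And>i j. T i (T j w) = 0"
    using Tf.nilpotent_layer[OF finite sub st a \<open>T i a \<noteq> 0\<close>] by blast
  obtain c where c: "T i w = c \<odot> vac V" using wt0_invariant_scalar[OF st[OF w(1)], of i] w(3) by blast
  have c0: "c \<noteq> 0" using c w(2) by auto
  have wC: "w \<in> car" using w(1) wtD by blast
  define p where "p = (\<lambda>k. (Y w (-1) ^^ k) (vac V))"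
  have p0: "p 0 = vac V" and pS: "p (Suc k) = Y w (-1) (p k)" for k by (simp_all add: p_def)
  have pwt: "p k \<in> wt 0" for k
  proof (induction k)
    case (Suc k)
    then show ?case using wt_mode[OF w(1) Suc, of "-1"] by (simp add: pS)
  qed (simp only: p0 vac_wt)
  have pC: "p k \<in> car" for k using pwt wtD by blast
  have Tp: "T i (p (Suc k)) = (of_nat (Suc k) * c) \<odot> p k" for k
  proof (induction k)
    case 0
    have "T i (p 1) = Y (T i w) (-1) (vac V) + Y w (-1) (T i (vac V))"
      using zero_mode_derivation[OF t_car wC vac_in, of i "-1"] by (simp add: pS p0)
    then show ?case using wC by (simp add: T_vac c mode_scale_left vac_in vac_mode p0)
  next
    case (Suc k)
    have "T i (p (Suc (Suc k))) = Y (T i w) (-1) (p (Suc k)) + Y w (-1) (T i (p (Suc k)))"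
      using zero_mode_derivation[OF t_car wC pC, of i "-1" "Suc k"] by (simp add: pS)
    also have "\<dots> = c \<odot> p (Suc k) + (of_nat (Suc k) * c) \<odot> p (Suc k)"
      unfolding Suc using wC pC pC[of "Suc k"] by (simp only: c mode_scale_left mode_scale_right vac_in vac_mode pS[symmetric]) simp
    also have "\<dots> = (of_nat (Suc (Suc k)) * c) \<odot> p (Suc k)"
      unfolding scale_left_distrib[symmetric] by (rule arg_cong[where f = "\<lambda>a. a \<odot> p (Suc k)"]) (simp add: algebra_simps)
    finally show ?case .
  qed
  \<comment> \<open>Applying \<open>T i\<close> lowers the degree of a relation by one and
    multiplies each coefficient of positive degree by a nonzero factor.\<close>
  have indep: "\<forall>k\<le>d. x k = 0" if "(\<Sum>k\<le>d. x k \<odot> p k) = 0" for d x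
    using that
  proof (induction d arbitrary: x)
    case 0
    then show ?case using vac_nonzero by (simp add: p0)
  next
    case (Suc d)
    have "(\<Sum>k\<le>d. (x (Suc k) * (of_nat (Suc k) * c)) \<odot> p k) = (\<Sum>k\<le>Suc d. x k \<odot> T i (p k))"
      by (subst sum.atMost_Suc_shift) (simp add: Tp p0 T_vac del: of_nat_Suc)
    also have "\<dots> = T i (\<Sum>k\<le>Suc d. x k \<odot> p k)"
      using pC by (simp add: mode_sum_right car_scale t_car mode_scale_right mode_add_right car_sum)
    also have "\<dots> = 0" using Suc.prems t_car by simp
    finally have "\<forall>k\<le>d. x (Suc k) * (of_nat (Suc k) * c) = 0"
      using Suc.IH[of "\<lambda>k. x (Suc k) * (of_nat (Suc k) * c)"] by blast
    then have x: "x (Suc k) = 0" if "k \<le> d" for k using that c0 by (simp del: of_nat_Suc)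
    have "(\<Sum>k\<le>Suc d. x k \<odot> p k) = x 0 \<odot> p 0"
      by (subst sum.atMost_Suc_shift) (simp add: x)
    then have "x 0 = 0" using Suc.prems vac_nonzero by (simp add: p0)
    then show ?case using x by (metis Suc_le_mono not0_implies_Suc)
  qed
  obtain B where B: "finite B" "wt 0 \<subseteq> span B" using weight_finite by blast
  then obtain x where "\<exists>k\<le>card B. x k \<noteq> 0" "(\<Sum>k\<le>card B. x k \<odot> p k) = 0"
    using finite_span_relation[OF B(1), of p] pwt by blast
  then show False using indep by blast
qed

lemma wt0_scalar: "a \<in> wt 0 \<Longrightarrow> \<exists>c. a = c \<odot> vac V"
  using wt0_invariant_scalar T_wt0 by blast

text \<open>Induction on the weight through the Sugawara formula: positive modes lead to smaller
  weight, so a vector with \<open>T i (T i x) = 0\<close> for all \<open>i\<close> lies in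
  \<open>N\<close> and is killed by the zero modes. A nilpotent layer would contradict this, so the
  zero modes vanish on the whole weight space.\<close>

lemma G0_wt_minimal:
  assumes N: "subspace N" "N \<subseteq> car" "vac V \<in> N" "\<And>i n w. w \<in> N \<Longrightarrow> h i n w \<in> N"
    and w: "w \<in> G 0" "w \<in> wt (int n)"
  shows "w \<in> N \<and> (\<forall>i. T i w = 0)"
  using w
proof (induction n arbitrary: w rule: less_induct)
  case (less n)
  show ?case
  proof (cases "n = 0")
    case True
    then have w0: "w \<in> wt 0" using less.prems by simp
    then show ?thesis using wt0_scalar[OF w0] T_wt0[OF w0] N(1,3) subspace_scale by blast
  next
    case False
    define N' where "N' = {w \<in> N. \<forall>i. T i w = 0}"
    have sN': "subspace N'"
      using N(1,2) unfolding N'_def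
      by (intro subspaceI) (auto simp: subspace_0 subspace_add subspace_scale mode_add_right mode_scale_right t_car subset_iff)
    have hN': "h i m x \<in> N'" if "x \<in> N'" for i m x
      using that N(2,4) T_h[of x _ i m] t_car unfolding N'_def by auto
    have IH: "h i m x \<in> N'" if "x \<in> G 0" "x \<in> wt (int n)" "m > 0" for i m x
    proof -
      have hx: "h i m x \<in> G 0" "h i m x \<in> wt (int n - m)" using that h_G h_wt by blast+
      show ?thesis
      proof (cases "m \<le> int n")
        case True
        then have "int n - m = int (nat (int n - m))" "nat (int n - m) < n" using that(3) False by auto
        then show ?thesis using less.IH[of "nat (int n - m)" "h i m x"] hx unfolding N'_def by simp
      next
        case False
        then have "h i m x = 0" using hx wt_neg[of "int n - m"] by simp
        then show ?thesis using subspace_0[OF sN'] by simp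
      qed
    qed
    have step: "x \<in> N'" if x: "x \<in> G 0" "x \<in> wt (int n)" and TT: "\<And>i. T i (T i x) = 0" for x
    proof -
      have xC: "x \<in> car" using x wtD by blast
      have "(2 * of_nat n) \<odot> x = 2 \<odot> L0 x" using x(2) by (simp add: vweight_def)
      also have "\<dots> \<in> N'"
        unfolding conf_mode[OF xC]
      proof (intro subspace_sum[OF sN'] subspace_Sum_any[OF sN'] subspace_add[OF sN'])
        fix i and k :: nat
        show "h i (- 1 - int k) (h i (1 + int k) x) \<in> N'" by (intro hN' IH x) simp
        show "h i (1 - 1 - int k) (h i (int k) x) \<in> N'"
        proof (cases "k = 0")
          case True then show ?thesis using TT subspace_0[OF sN'] by simp
        next
          case False then show ?thesis by (intro hN' IH x) simp
        qed
      qed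
      finally have *: "(2 * of_nat n) \<odot> x \<in> N'" .
      have "x = (1 / (2 * of_nat n)) \<odot> (2 * of_nat n) \<odot> x" using False by simp
      also have "\<dots> \<in> N'" by (rule subspace_scale[OF sN' *])
      finally show ?thesis .
    qed
    let ?S = "G 0 \<inter> wt (int n)"
    have TS: "T i x = 0" if xS: "x \<in> ?S" for i x
    proof (rule ccontr)
      assume nz: "T i x \<noteq> 0"
      have "\<exists>w\<in>?S. (\<exists>i. T i w \<noteq> 0) \<and> (\<forall>i j. T i (T j w) = 0)"
      proof (rule Tf.nilpotent_layer[OF finite _ _ xS nz])
        show "?S \<subseteq> Tf.geig UNIV (\<lambda>_. 0)" by (auto simp: G_def)
        show "T i v \<in> ?S" if "v \<in> ?S" for i v using that h_wt[of v "int n" i 0] G_T by auto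
      qed
      then obtain y i where y: "y \<in> ?S" "T i y \<noteq> 0" "\<And>i j. T i (T j y) = 0" by blast
      then have "y \<in> N'" using step by blast
      then show False using y(2) unfolding N'_def by blast
    qed
    then have "w \<in> N'" using less.prems step[of w] t_car by simp
    then show ?thesis unfolding N'_def by blast
  qed
qed

lemma G0_minimal:
  assumes N: "subspace N" "N \<subseteq> car" "vac V \<in> N" "\<And>i n w. w \<in> N \<Longrightarrow> h i n w \<in> N"
    and w: "w \<in> G 0"
  shows "w \<in> N \<and> (\<forall>i. T i w = 0)"
proof -
  let ?N = "{w \<in> N. \<forall>i. T i w = 0}"
  have sN: "subspace ?N"
    using N(1,2)
    by (intro subspaceI) (auto simp: subspace_0 subspace_add subspace_scale mode_add_right mode_scale_right t_car subset_iff)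
  have "(\<Union>n. G 0 \<inter> wt n) \<subseteq> ?N"
  proof safe
    fix x n i assume x: "x \<in> G 0" "x \<in> vweight V (of_int n)"
    have "x \<in> N \<and> (\<forall>i. T i x = 0)"
    proof (cases "n < 0")
      case True
      then have "x = 0" using wt_neg[OF True] x(2) by blast
      then show ?thesis using subspace_0[OF N(1)] t_car by simp
    next
      case False
      then show ?thesis using G0_wt_minimal[OF N x(1), of "nat n"] x(2) by simp
    qed
    then show "x \<in> N" "T i x = 0" by auto
  qed
  then have "span (\<Union>n. G 0 \<inter> wt n) \<subseteq> ?N" by (rule span_minimal) (rule sN)
  then show ?thesis using G_wt_span[OF w] by blast
qed

lemma T_G0: "w \<in> G 0 \<Longrightarrow> T i w = 0"
  using G0_minimal[of car w] subspace_vcar vac_in h_in by blast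

text \<open>\<open>G l\<close> is generated by \<open>G 0\<close> from a genuine eigenvector, and
  the zero modes kill \<open>G 0\<close>; the derivation property carries the eigenvalue
  along.\<close>

lemma T_G:
  assumes w: "w \<in> G l"
  shows "T i w = l $ i \<odot> w"
proof (cases "w = 0")
  case True then show ?thesis using t_car by simp
next
  case False
  then have l: "l \<in> Lam" using w Lam_I by blast
  obtain k e where "e \<in> wt k" and e: "e \<in> G l" "e \<noteq> 0" "\<And>i. T i e = l $ i \<odot> e"
    by (rule lowest_vector[OF l]) blast
  have eC: "e \<in> car" using e G_car by blast
  have "w \<in> span {Y v n e |v n. v \<in> G (l - l)}" by (rule G_gen[OF e(1,2) w])
  also have "\<dots> \<subseteq> {w \<in> car. T i w = l $ i \<odot> w}"
  proof (rule span_minimal)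
    show "{Y v n e |v n. v \<in> G (l - l)} \<subseteq> {w \<in> car. T i w = l $ i \<odot> w}"
    proof safe
      fix v n assume "v \<in> G (l - l)"
      then have v: "v \<in> G 0" "v \<in> car" using G_car by auto
      show "Y v n e \<in> car" using v eC by (intro mode_closed)
      show "T i (Y v n e) = l $ i \<odot> Y v n e"
        using v eC e(3) T_G0[OF v(1)] by (simp add: zero_mode_derivation t_car mode_scale_right)
    qed
    show "subspace {w \<in> car. T i w = l $ i \<odot> w}"
      by (rule subspaceI) (auto simp: t_car car_intros mode_add_right mode_scale_right scale_right_distrib mult.commute)
  qed
  finally show ?thesis by blast
qed

lemma G_eq: "G l = {w \<in> car. \<forall>i. T i w = l $ i \<odot> w}"
proof safe
  fix w assume "w \<in> car" "\<forall>i. T i w = l $ i \<odot> w"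
  then show "w \<in> G l" unfolding G_iff by (intro conjI allI exI[of _ 1]) (auto simp: Tf.sh_def)
qed (auto simp: T_G G_car)

text \<open>The vectors all of whose modes preserve \<open>N\<close> include the vacuum and, by the
  iterate formula, are stable under the Heisenberg modes. Hence they include \<open>G 0\<close>,
  which generates \<open>G l\<close> from \<open>e\<close>.\<close>

lemma G_minimal:
  assumes N: "subspace N" "N \<subseteq> car" "\<And>i n w. w \<in> N \<Longrightarrow> h i n w \<in> N"
    and e: "e \<in> N" "e \<in> G l" "e \<noteq> 0"
  shows "G l \<subseteq> N"
proof
  fix w assume w: "w \<in> G l"
  let ?M = "{v \<in> car. \<forall>n. \<forall>x\<in>N. Y v n x \<in> N}"
  have sM: "subspace ?M"
    using N(1,2) by (intro subspaceI)
      (auto simp: car_intros subspace_0 subspace_add subspace_scale mode_add_left mode_scale_left subset_iff)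
  have vM: "vac V \<in> ?M" using N(1,2) vac_in by (auto simp: vac_mode subset_iff subspace_0)
  have hM: "h i m v \<in> ?M" if v: "v \<in> ?M" for i m v
  proof (intro CollectI conjI allI ballI)
    show "h i m v \<in> car" using v h_in by blast
    fix n x assume x: "x \<in> N"
    show "Y (h i m v) n x \<in> N"
      unfolding iterate[OF t_car, of v x i m n, OF _ subsetD[OF N(2) x], OF CollectD[OF v, THEN conjunct1]]
      using v x N(3) by (intro subspace_Sum_any[OF N(1)] subspace_scale[OF N(1)] subspace_diff[OF N(1)]) auto
  qed
  have "G 0 \<subseteq> ?M"
  proof
    fix v assume "v \<in> G 0"
    then show "v \<in> ?M" using G0_minimal[OF sM _ vM hM, of v] by blast
  qed
  then have "{Y v n e |v n. v \<in> G (l - l)} \<subseteq> N" using e(1) by auto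
  then have "span {Y v n e |v n. v \<in> G (l - l)} \<subseteq> N" by (rule span_minimal) (rule N(1))
  then show "w \<in> N" using G_gen[OF e(2,3) w] by blast
qed

section \<open>Eigenvalue spaces as Heisenberg Fock modules\<close>

definition cre :: "('n \<times> nat) list \<Rightarrow> 'v \<Rightarrow> 'v" where
  "cre xs = foldr (\<lambda>(i, k). h i (- int k - 1)) xs"

lemma cre_simps [simp]: "cre [] e = e" "cre ((i, k) # xs) e = h i (- int k - 1) (cre xs e)"
  by (simp_all add: cre_def)

lemma cre_car: "e \<in> car \<Longrightarrow> cre xs e \<in> car"
  by (induction xs) (auto simp: h_in)

lemma cre_G: "e \<in> G l \<Longrightarrow> cre xs e \<in> G l"
  by (induction xs) (auto simp: h_G)

lemma cre_wt: "e \<in> wt k \<Longrightarrow> cre xs e \<in> wt (k + (\<Sum>(i, m)\<leftarrow>xs. int m + 1))"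
proof (induction xs)
  case (Cons x xs)
  obtain i m where x: "x = (i, m)" by force
  show ?case using h_wt[OF Cons.IH[OF Cons.prems], of i "- int m - 1"] by (simp add: x algebra_simps)
qed simp

text \<open>Negative modes prolong a word of creation operators; the others are commuted through the
  word until they reach \<open>e\<close>.\<close>

lemma h_cre_span:
  assumes e: "e \<in> G l" and sing: "\<And>i j. j \<ge> 1 \<Longrightarrow> h i j e = 0"
    and w: "w \<in> span {cre xs e |xs. True}"
  shows "h i n w \<in> span {cre xs e |xs. True}"
proof -
  let ?N = "span {cre xs e |xs. True}"
  have eC: "e \<in> car" using e G_car by blast
  have NC: "?N \<subseteq> car" by (rule span_minimal[OF _ subspace_vcar]) (auto intro: cre_car eC)
  have neg: "h i n w \<in> ?N" if "w \<in> ?N" "n < 0" for i n w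
  proof -
    have "w \<in> car \<and> h i n w \<in> ?N" using that(1)
    proof (induction rule: span_induct_alt)
      case base
      then show ?case using t_car by (simp add: span_zero)
    next
      case (step c x y)
      then obtain xs where x: "x = cre xs e" by blast
      have "h i n x = cre ((i, nat (- n) - 1) # xs) e" using that(2) by (simp add: x)
      then have "h i n x \<in> ?N" by (intro span_base) blast
      moreover have "x \<in> car" using x cre_car eC by simp
      ultimately show ?case using step
        by (simp add: mode_add_right mode_scale_right t_car car_scale car_add) (intro span_add span_scale; simp)
    qed
    then show ?thesis by blast
  qed
  have base: "h i n (cre xs e) \<in> ?N" if "n \<ge> 0" for i n xs
  proof (induction xs)
    case Nil
    have "e = cre [] e" by simp
    then have "e \<in> ?N" by (intro span_base) blast
    then show ?case using that sing[of n i] T_G[OF e, of i] by (cases "n = 0") (auto simp: span_zero intro: span_scale)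
  next
    case (Cons x xs)
    obtain j k where x: "x = (j, k)" by force
    have c: "cre xs e \<in> ?N" by (intro span_base) blast
    have "h i n (h j (- int k - 1) (cre xs e)) = h j (- int k - 1) (h i n (cre xs e)) +
       (if i = j \<and> n + (- int k - 1) = 0 then of_int n \<odot> cre xs e else 0)"
      by (rule h_comm[OF cre_car[OF eC]])
    also have "\<dots> \<in> ?N" using neg[OF Cons.IH] c by (intro span_add) (auto intro: span_scale span_zero)
    finally show ?case by (simp add: x)
  qed
  show ?thesis
  proof (cases "n < 0")
    case True then show ?thesis using neg w by blast
  next
    case False
    have "w \<in> car \<and> h i n w \<in> ?N" using w
    proof (induction rule: span_induct_alt)
      case base
      then show ?case using t_car by (simp add: span_zero)
    next
      case (step c x y)
      then obtain xs where x: "x = cre xs e" by blast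
      have "h i n x \<in> ?N" using base[of n i xs] False x by simp
      moreover have "x \<in> car" using x cre_car eC by simp
      ultimately show ?case using step
        by (simp add: mode_add_right mode_scale_right t_car car_scale car_add) (intro span_add span_scale; simp)
    qed
    then show ?thesis by blast
  qed
qed

lemma G_eq_cre_span:
  assumes e: "e \<in> G l" "e \<noteq> 0" and sing: "\<And>i j. j \<ge> 1 \<Longrightarrow> h i j e = 0"
  shows "G l = span {cre xs e |xs. True}"
proof
  let ?N = "span {cre xs e |xs. True}"
  have "e = cre [] e" by simp
  then have "e \<in> ?N" by (intro span_base) blast
  moreover have "?N \<subseteq> car" by (rule span_minimal[OF _ subspace_vcar]) (auto intro: cre_car G_car e)
  ultimately show "G l \<subseteq> ?N" using h_cre_span[OF e(1) sing] by (intro G_minimal[OF subspace_span _ _ _ e(1,2)]) auto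
  show "?N \<subseteq> G l" by (rule span_minimal[OF _ G_sub]) (auto intro: cre_G e)
qed

text \<open>Every nonempty word of creation operators raises the weight strictly, so in weight
  \<open>k\<close> only multiples of \<open>e\<close> are left.\<close>

lemma lowest_unique:
  assumes e: "e \<in> G l" "e \<in> wt k" "e \<noteq> 0" and sing: "\<And>i j. j \<ge> 1 \<Longrightarrow> h i j e = 0"
    and x: "x \<in> G l" "x \<in> wt k"
  shows "\<exists>c. x = c \<odot> e"
proof -
  define N where "N = (\<lambda>m. if m = k then span {e} else if m > k then wt m else {0})"
  have "x \<in> span {cre xs e |xs. True}" using x G_eq_cre_span[OF e(1,3) sing] by blast
  also have "\<dots> \<subseteq> span (\<Union>m. N m)"
  proof (rule span_mono, safe)
    fix xs :: "('n \<times> nat) list"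
    show "cre xs e \<in> (\<Union>m. N m)"
    proof (cases xs)
      case Nil
      have "e \<in> N k" by (simp add: N_def span_base)
      then show ?thesis using Nil by auto
    next
      case (Cons y ys)
      define s where "s = (\<Sum>(i, m)\<leftarrow>xs. int m + 1)"
      have "(\<Sum>(i, m)\<leftarrow>ys. int m + 1) \<ge> 0" by (rule sum_list_nonneg) auto
      then have "s > 0" unfolding s_def Cons by (cases y) simp
      moreover have "cre xs e \<in> wt (k + s)" using cre_wt[OF e(2)] unfolding s_def .
      ultimately have "cre xs e \<in> N (k + s)" unfolding N_def by simp
      then show ?thesis by blast
    qed
  qed
  finally have "x \<in> span (\<Union>m. N m)" .
  moreover have "subspace (N m)" "N m \<subseteq> wt m" for m
    unfolding N_def using e(2) subspace_vweight span_minimal[of "{e}" "wt k"] subspace_0[OF subspace_vweight]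
    by (auto simp: subspace_span subspace_single_0)
  ultimately have "x \<in> N k" using x(2) weight_extract[of N x k] by blast
  then show ?thesis by (auto simp: N_def span_singleton)
qed

end

section \<open>Shifting the Heisenberg weights\<close>

text \<open>Vandermonde for the upper index \<open>x - 1\<close> split as -1 and \<open>x\<close>.
  Together with \<open>gbinomial_weighted_sum\<close> it evaluates the coefficient sums in
  \<open>Q_rec\<close>.\<close>

lemma gbinomial_alternating_sum:
  assumes "c \<ge> 1"
  shows "(\<Sum>j=1..c. (-1) ^ (j+1) * (x gchoose (c - j))) = ((x - 1 :: complex) gchoose (c - 1))"
proof -
  have "(x - 1) gchoose (c - 1) = (\<Sum>k=0..c-1. ((-1) gchoose k) * (x gchoose (c - 1 - k)))"
    by (subst gbinomial_Vandermonde) simp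
  also have "\<dots> = (\<Sum>j=1..c. (-1) ^ (j+1) * (x gchoose (c - j)))"
    using assms
    by (intro sum.reindex_bij_witness[of _ "\<lambda>j. j - 1" "\<lambda>k. k + 1"])
      (auto simp: gbinomial_minus_one)
  finally show ?thesis by simp
qed

lemma gbinomial_negative: "((- of_nat i - 1) gchoose d) = (-1) ^ d * (of_nat ((i + d) choose i) :: complex)"
proof -
  have "((- of_nat i - 1 :: complex) gchoose d) = (-1) ^ d * ((of_nat d - (- of_nat i - 1) - 1) gchoose d)"
    by (rule gbinomial_negated_upper)
  also have "of_nat d - (- of_nat i - 1) - 1 = (of_nat (i + d) :: complex)" by simp
  also have "of_nat (i + d) gchoose d = (of_nat ((i + d) choose d) :: complex)"
    by (simp add: binomial_gbinomial)
  also have "(i + d) choose d = (i + d) choose i" using binomial_symmetric[of d "i + d"] by simp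
  finally show ?thesis .
qed

text \<open>Vandermonde with one upper index equal to \<open>- i - 1\<close>, whose binomials are up
  to sign the numbers \<open>j choose i\<close>.\<close>

lemma gbinomial_weighted_sum:
  assumes "i \<le> c"
  shows "(\<Sum>j=i..c. (-1) ^ (i+j) * of_nat (j choose i) * (x gchoose (c - j))) = ((x - of_nat i - 1 :: complex) gchoose (c - i))"
proof -
  have "(x - of_nat i - 1) gchoose (c - i) = (\<Sum>k=0..c-i. ((- of_nat i - 1) gchoose k) * (x gchoose (c - i - k)))"
    by (subst gbinomial_Vandermonde) (simp add: algebra_simps)
  also have "\<dots> = (\<Sum>j=i..c. (-1) ^ (i+j) * of_nat (j choose i) * (x gchoose (c - j)))"
    using assms
    by (intro sum.reindex_bij_witness[of _ "\<lambda>j. j - i" "\<lambda>k. k + i"])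
      (auto simp: gbinomial_negative power_add add.commute simp flip: power_mult_distrib)
  finally show ?thesis by simp
qed

lemma sum_triangle_swap:
  "(\<Sum>j=1..s. \<Sum>a\<le>s - j. f j a) = (\<Sum>a\<le>s. \<Sum>j=1..s - a. (f j a :: 'a :: comm_monoid_add))"
  for s :: nat
  unfolding sum.Sigma[OF finite_atLeastAtMost ballI[OF finite_atMost]] sum.Sigma[OF finite_atMost ballI[OF finite_atLeastAtMost]]
  by (rule sum.reindex_bij_witness[of _ prod.swap prod.swap]) auto

lemma sum_triangle_shift:
  "(\<Sum>b\<le>s. \<Sum>i=1..b. g i (b - i)) = (\<Sum>a\<le>s. \<Sum>i=1..s - a. (g i a :: 'a :: comm_monoid_add))"
  for s :: nat
  unfolding sum.Sigma[OF finite_atMost ballI[OF finite_atLeastAtMost]]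
  by (rule sum.reindex_bij_witness[of _ "\<lambda>(a, i). (a + i, i)" "\<lambda>(b, i). (b - i, i)"]) auto

lemma sum_triangle_inner:
  "(\<Sum>j=1..s. \<Sum>i=1..j. f j i) = (\<Sum>i=1..s. \<Sum>j=i..s. (f j i :: 'a :: comm_monoid_add))"
  for s :: nat
  unfolding sum.Sigma[OF finite_atLeastAtMost ballI[OF finite_atLeastAtMost]]
  by (rule sum.reindex_bij_witness[of _ prod.swap prod.swap]) auto

locale shifted_heisenberg_voa = heisenberg_voa V c t
  for V :: "'v::ab_group_add voa" and c :: complex and t :: "'n::finite \<Rightarrow> 'v" +
  fixes mu :: "complex^'n"
  assumes mu_int: "l \<in> Lam \<Longrightarrow> bil mu l \<in> \<int>"
    and mu_fin: "finite {l \<in> Lam. Re (bil l l) / 2 + Re (bil mu l) \<le> C}"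
begin

definition tm :: 'v where "tm = (\<Sum>i\<in>UNIV. mu $ i \<odot> t i)"

lemma tm_car: "tm \<in> car" unfolding tm_def by (intro car_sum car_scale t_car)

lemma tm_mode: "w \<in> car \<Longrightarrow> Y tm n w = (\<Sum>i\<in>UNIV. mu $ i \<odot> h i n w)"
  unfolding tm_def by (simp add: mode_sum_left car_scale t_car mode_scale_left)

lemma tm_wt: "w \<in> wt b \<Longrightarrow> Y tm n w \<in> wt (b - n)"
  using wtD[of w] by (subst tm_mode) (auto intro!: subspace_sum[OF subspace_vweight] subspace_scale[OF subspace_vweight] h_wt simp del: of_int_diff)

lemma tm_G: "w \<in> G l \<Longrightarrow> Y tm n w \<in> G l"
  using G_car[of w] by (subst tm_mode) (auto intro!: subspace_sum[OF G_sub] subspace_scale[OF G_sub] h_G)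

lemma tm_G0: "w \<in> G l \<Longrightarrow> Y tm 0 w = bil mu l \<odot> w"
  using G_car[of w] by (simp add: tm_mode T_G bil_def scale_sum_left)

definition A :: "nat \<Rightarrow> 'v \<Rightarrow> 'v" where "A j v = (-1) ^ Suc j \<odot> Y tm (int j) v"

text \<open>\<open>D k\<close> is the coefficient of \<open>x\<^sup>k\<close> in \<open>exp (\<Sum>\<^sub>n\<^sub>\<ge>\<^sub>1 - (-x)\<^sup>n tm(n) / n)\<close>, the exponential factor of
  Li's operator \<open>\<Delta>(tm, 1/x)\<close>.\<close>

fun D :: "nat \<Rightarrow> 'v \<Rightarrow> 'v" where
  "D 0 v = v"
| "D (Suc k) v = (1 / of_nat (Suc k)) \<odot> (\<Sum>j\<le>k. A (Suc j) (D (k - j) v))"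

lemma A_car: "v \<in> car \<Longrightarrow> A j v \<in> car" unfolding A_def by (intro car_scale mode_closed tm_car)
lemma A_G: "v \<in> G l \<Longrightarrow> A j v \<in> G l" unfolding A_def by (intro subspace_scale[OF G_sub] tm_G)
lemma A_wt: "v \<in> wt b \<Longrightarrow> A j v \<in> wt (b - int j)"
  unfolding A_def by (intro subspace_scale[OF subspace_vweight] tm_wt)
lemma A_add: "v \<in> car \<Longrightarrow> w \<in> car \<Longrightarrow> A j (v + w) = A j v + A j w"
  unfolding A_def by (simp add: mode_add_right tm_car scale_right_distrib)
lemma A_scale: "v \<in> car \<Longrightarrow> A j (a \<odot> v) = a \<odot> A j v"
  unfolding A_def by (simp add: mode_scale_right tm_car mult.commute)
lemma A_sum: "(\<And>x. x \<in> S \<Longrightarrow> f x \<in> car) \<Longrightarrow> A j (sum f S) = (\<Sum>x\<in>S. A j (f x))"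
  unfolding A_def by (simp add: mode_sum_right tm_car scale_sum_right)

lemma D_sub:
  assumes "subspace N" "\<And>j v. v \<in> N \<Longrightarrow> A j v \<in> N" "v \<in> N"
  shows "D k v \<in> N"
proof (induction k rule: less_induct)
  case (less k)
  then show ?case
    using assms by (cases k) (auto intro!: subspace_scale[OF assms(1)] subspace_sum[OF assms(1)])
qed

lemma D_car: "v \<in> car \<Longrightarrow> D k v \<in> car" by (rule D_sub[OF subspace_vcar A_car])
lemma D_G: "v \<in> G l \<Longrightarrow> D k v \<in> G l" by (rule D_sub[OF G_sub A_G])

lemma D_wt: "v \<in> wt b \<Longrightarrow> D k v \<in> wt (b - int k)"
proof (induction k rule: less_induct)
  case (less k)
  show ?case
  proof (cases k)
    case (Suc k')
    have "A (Suc j) (D (k' - j) v) \<in> wt (b - int (Suc k'))" if "j \<le> k'" for j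
    proof -
      have "b - int (k' - j) - int (Suc j) = b - int k" using that Suc by simp
      then have "A (Suc j) (D (k' - j) v) \<in> wt (b - int (Suc k'))"
        using A_wt[OF less.IH[OF _ less.prems], of "k' - j" "Suc j"] Suc by (simp only: less_Suc_eq_le diff_le_self)
      then show ?thesis .
    qed
    then show ?thesis unfolding D.simps Suc
      by (intro subspace_scale[OF subspace_vweight] subspace_sum[OF subspace_vweight]) simp
  qed (use less in simp)
qed

lemma D_add: "v \<in> car \<Longrightarrow> w \<in> car \<Longrightarrow> D k (v + w) = D k v + D k w"
proof (induction k rule: less_induct)
  case (less k)
  show ?case
  proof (cases k)
    case (Suc k')
    have "A (Suc j) (D (k' - j) (v + w)) = A (Suc j) (D (k' - j) v) + A (Suc j) (D (k' - j) w)" for j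
      using less Suc by (simp add: A_add D_car)
    then show ?thesis using Suc by (simp add: sum.distrib scale_right_distrib)
  qed simp
qed

lemma D_scale: "v \<in> car \<Longrightarrow> D k (a \<odot> v) = a \<odot> D k v"
proof (induction k rule: less_induct)
  case (less k)
  show ?case
  proof (cases k)
    case (Suc k')
    have "A (Suc j) (D (k' - j) (a \<odot> v)) = a \<odot> A (Suc j) (D (k' - j) v)" for j
      using less Suc by (simp add: A_scale D_car)
    then show ?thesis using Suc by (simp add: scale_sum_right[symmetric] mult.commute)
  qed simp
qed

lemma D_0 [simp]: "D k 0 = 0" using D_scale[of 0 k 0] by simp

lemma D_zero_wt: "v \<in> wt b \<Longrightarrow> int k > b \<Longrightarrow> D k v = 0"
  using D_wt[of v b k] wt_neg[of "b - int k"] by simp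

lemma D_eventually_zero: "v \<in> car \<Longrightarrow> \<exists>K. \<forall>k\<ge>K. D k v = 0"
proof -
  assume v: "v \<in> car"
  then have "v \<in> span (\<Union>n. wt n)" using graded by simp
  then have "v \<in> car \<and> (\<exists>K. \<forall>k\<ge>K. D k v = 0)"
  proof (induction rule: span_induct_alt)
    case base
    then show ?case by simp
  next
    case (step a x y)
    then obtain n where n: "x \<in> wt n" by blast
    then have xC: "x \<in> car" using wtD by blast
    obtain K where K: "\<forall>k\<ge>K. D k y = 0" using step by blast
    have "D k (a \<odot> x + y) = 0" if "k \<ge> max K (nat n + 1)" for k
    proof -
      have "D k x = 0" by (rule D_zero_wt[OF n]) (use that in linarith)
      then show ?thesis using that K step xC by (simp add: D_add D_scale car_scale)
    qed
    then have "\<forall>k\<ge>max K (nat n + 1). D k (a \<odot> x + y) = 0" by blast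
    then show ?case using step xC by (blast intro: car_add car_scale)
  qed
  then show ?thesis by blast
qed

text \<open>The recursion without its denominator. A family satisfying it is determined by its value
  at \<open>k = 0\<close>, which is how \<open>D_mode\<close> identifies its two sides.\<close>

lemma D_rec: "of_nat k \<odot> D k v = (\<Sum>j=1..k. A j (D (k - j) v))"
proof (cases k)
  case (Suc k')
  have "(\<Sum>j=1..k. A j (D (k - j) v)) = (\<Sum>j\<le>k'. A (Suc j) (D (k' - j) v))"
    unfolding Suc by (rule sum.reindex_bij_witness[of _ Suc "\<lambda>j. j - 1"]) auto
  then show ?thesis using Suc by (simp del: of_nat_Suc)
qed simp

text \<open>The commutator formula for the modes of \<open>tm\<close>. Its term \<open>i = 0\<close>
  is evaluated by \<open>tm_G0\<close> and kept apart, since it brings in \<open>bil mu l\<close>;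
  the terms with \<open>i \<ge> 1\<close> give operators \<open>A i\<close> again.\<close>

lemma A_commutator:
  assumes z: "z \<in> G l" and w: "w \<in> car" and j: "j \<ge> 1"
  shows "A j (Y z n w) - Y z n (A j w) = ((-1) ^ (j+1) * bil mu l) \<odot> Y z (n + int j) w
    + (\<Sum>i=1..j. ((-1) ^ (i+j) * of_nat (j choose i)) \<odot> Y (A i z) (n + int j - int i) w)"
proof -
  have zC: "z \<in> car" using z G_car by blast
  obtain N where N: "\<And>k. k \<ge> N \<Longrightarrow> Y tm (0 + int k) z = 0" using truncation_nat[OF tm_car zC] by blast
  define M where "M = max N (Suc j)"
  have gb: "(of_int (int j) :: complex) gchoose i = of_nat (j choose i)" for i
    by (simp add: binomial_gbinomial)
  have "Y tm (int j) (Y z n w) - Y z n (Y tm (int j) w) =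
      (\<Sum>i<M. (of_int (int j) gchoose i) \<odot> Y (Y tm (int i) z) (int j + n - int i) w)"
    by (rule commutator[OF tm_car zC w]) (use N M_def in auto)
  also have "\<dots> = (\<Sum>i\<le>j. of_nat (j choose i) \<odot> Y (Y tm (int i) z) (int j + n - int i) w)"
    unfolding gb by (rule sum.mono_neutral_right) (auto simp: M_def)
  also have "\<dots> = Y (Y tm 0 z) (int j + n) w + (\<Sum>i=1..j. of_nat (j choose i) \<odot> Y (Y tm (int i) z) (int j + n - int i) w)"
    by (simp add: sum.atLeast_Suc_atMost atMost_atLeast0)
  finally have eq: "Y tm (int j) (Y z n w) - Y z n (Y tm (int j) w) = bil mu l \<odot> Y z (n + int j) w
      + (\<Sum>i=1..j. of_nat (j choose i) \<odot> Y (Y tm (int i) z) (n + int j - int i) w)"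
    using zC w by (simp add: tm_G0[OF z] mode_scale_left add.commute)
  have "A j (Y z n w) - Y z n (A j w) = (-1) ^ Suc j \<odot> (Y tm (int j) (Y z n w) - Y z n (Y tm (int j) w))"
    unfolding A_def using w zC by (simp add: mode_scale_right mode_closed tm_car scale_right_diff_distrib del: power_Suc)
  also have "\<dots> = ((-1) ^ (j+1) * bil mu l) \<odot> Y z (n + int j) w
      + (\<Sum>i=1..j. ((-1) ^ Suc j * of_nat (j choose i)) \<odot> Y (Y tm (int i) z) (n + int j - int i) w)"
    unfolding eq by (simp add: scale_right_distrib scale_sum_right)
  also have "(\<Sum>i=1..j. ((-1) ^ Suc j * of_nat (j choose i)) \<odot> Y (Y tm (int i) z) (n + int j - int i) w)
     = (\<Sum>i=1..j. ((-1) ^ (i+j) * of_nat (j choose i)) \<odot> Y (A i z) (n + int j - int i) w)"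
  proof (intro sum.cong refl)
    fix i
    have "(-1) ^ (i + j) * (-1) ^ Suc i = ((-1) ^ Suc j :: complex)"
      by (simp add: power_add power_mult_distrib[symmetric])
    then show "((-1) ^ Suc j * of_nat (j choose i)) \<odot> Y (Y tm (int i) z) (n + int j - int i) w =
      ((-1) ^ (i+j) * of_nat (j choose i)) \<odot> Y (A i z) (n + int j - int i) w"
      unfolding A_def using zC w
      by (simp add: mode_scale_left mode_closed tm_car mult.commute mult.left_commute del: power_Suc)
  qed
  finally show ?thesis .
qed

text \<open>With \<open>k = bil mu l\<close>, the vector \<Delta>(z + z')u is the sum of the
  \<open>(z + z')^(k - a) D a u\<close>. Expanding in powers of z' gives these binomials, and
  \<open>Q k u s n\<close> collects the terms with \<open>z^(k - s)\<close> in the mode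
  \<open>n\<close>.\<close>

definition Q :: "complex \<Rightarrow> 'v \<Rightarrow> nat \<Rightarrow> int \<Rightarrow> 'v \<Rightarrow> 'v" where
  "Q k u s n w = (\<Sum>a\<le>s. ((k - of_nat a) gchoose (s - a)) \<odot> Y (D a u) (n + int (s - a)) w)"

text \<open>The counterpart of \<open>D_rec\<close> for the deformed field: commutators with the
  \<open>A j\<close> yield the same recursion in \<open>s\<close>. Terms containing
  \<open>A i (D a u)\<close> are regrouped by \<open>b = a + i\<close> and summed by
  \<open>D_rec\<close> for \<open>u\<close>.\<close>

lemma Q_rec:
  assumes u: "u \<in> G l" and w: "w \<in> car"
  defines "k \<equiv> bil mu l"
  shows "of_nat s \<odot> Q k u s n w = (\<Sum>j=1..s. A j (Q k u (s - j) n w) - Q k u (s - j) n (A j w))"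
proof -
  have uC: "u \<in> car" using u G_car by blast
  have DC: "D a u \<in> car" for a using D_car uC by blast
  have AC: "A j (Q k u s' n w) - Q k u s' n (A j w) =
     (\<Sum>a\<le>s'. ((k - of_nat a) gchoose (s' - a)) \<odot>
       (((-1) ^ (j+1) * k) \<odot> Y (D a u) (n + int (s' - a) + int j) w
       + (\<Sum>i=1..j. ((-1) ^ (i+j) * of_nat (j choose i)) \<odot> Y (A i (D a u)) (n + int (s' - a) + int j - int i) w)))"
    if "j \<ge> 1" for j s'
  proof -
    have "A j (Q k u s' n w) - Q k u s' n (A j w) =
      (\<Sum>a\<le>s'. ((k - of_nat a) gchoose (s' - a)) \<odot> (A j (Y (D a u) (n + int (s' - a)) w) - Y (D a u) (n + int (s' - a)) (A j w)))"
      unfolding Q_def using DC w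
      by (simp add: A_sum A_scale mode_closed car_scale scale_right_diff_distrib sum_subtractf)
    then show ?thesis unfolding A_commutator[OF D_G[OF u] w that] k_def .
  qed
  let ?E = "\<lambda>a. Y (D a u) (n + int (s - a)) w"
  let ?H = "\<lambda>i a. Y (A i (D a u)) (n + int (s - a) - int i) w"
  have "(\<Sum>j=1..s. A j (Q k u (s - j) n w) - Q k u (s - j) n (A j w)) =
    (\<Sum>j=1..s. \<Sum>a\<le>s - j. (((k - of_nat a) gchoose (s - j - a)) * ((-1) ^ (j+1) * k)) \<odot> ?E a
       + (\<Sum>i=1..j. ((-1) ^ (i+j) * of_nat (j choose i) * ((k - of_nat a) gchoose (s - j - a))) \<odot> ?H i a))"
  proof (intro sum.cong refl)
    fix j assume j: "j \<in> {1..s}"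
    then have j1: "j \<ge> 1" by simp
    show "A j (Q k u (s - j) n w) - Q k u (s - j) n (A j w) =
      (\<Sum>a\<le>s - j. (((k - of_nat a) gchoose (s - j - a)) * ((-1) ^ (j+1) * k)) \<odot> ?E a
       + (\<Sum>i=1..j. ((-1) ^ (i+j) * of_nat (j choose i) * ((k - of_nat a) gchoose (s - j - a))) \<odot> ?H i a))"
      unfolding AC[OF j1]
    proof (intro sum.cong refl)
      fix a assume "a \<in> {..s - j}"
      then have "n + int (s - j - a) + int j = n + int (s - a)" using j by auto
      then show "((k - of_nat a) gchoose (s - j - a)) \<odot>
         (((-1) ^ (j+1) * k) \<odot> Y (D a u) (n + int (s - j - a) + int j) w
         + (\<Sum>i=1..j. ((-1) ^ (i+j) * of_nat (j choose i)) \<odot> Y (A i (D a u)) (n + int (s - j - a) + int j - int i) w)) =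
         (((k - of_nat a) gchoose (s - j - a)) * ((-1) ^ (j+1) * k)) \<odot> ?E a
       + (\<Sum>i=1..j. ((-1) ^ (i+j) * of_nat (j choose i) * ((k - of_nat a) gchoose (s - j - a))) \<odot> ?H i a)"
        by (simp only: scale_right_distrib scale_sum_right scale_scale mult.commute mult.left_commute)
    qed
  qed
  also have "\<dots> = (\<Sum>a\<le>s. \<Sum>j=1..s-a. (((k - of_nat a) gchoose (s - j - a)) * ((-1) ^ (j+1) * k)) \<odot> ?E a
       + (\<Sum>i=1..j. ((-1) ^ (i+j) * of_nat (j choose i) * ((k - of_nat a) gchoose (s - j - a))) \<odot> ?H i a))"
    by (rule sum_triangle_swap)
  also have "\<dots> = (\<Sum>a\<le>s. (if a < s then k * ((k - of_nat a - 1) gchoose (s - a - 1)) else 0) \<odot> ?E a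
       + (\<Sum>i=1..s-a. ((k - of_nat a - of_nat i - 1) gchoose (s - a - i)) \<odot> ?H i a))"
  proof (intro sum.cong refl)
    fix a assume "a \<in> {..s}"
    have sc: "s - j - a = s - a - j" for j by simp
    have 1: "(\<Sum>j=1..s-a. ((k - of_nat a) gchoose (s - j - a)) * ((-1) ^ (j+1) * k)) = (if a < s then k * ((k - of_nat a - 1) gchoose (s - a - 1)) else 0)"
    proof (cases "a < s")
      case True
      have "(\<Sum>j=1..s-a. ((k - of_nat a) gchoose (s - j - a)) * ((-1) ^ (j+1) * k)) = k * (\<Sum>j=1..s-a. (-1) ^ (j+1) * ((k - of_nat a) gchoose (s - a - j)))"
        unfolding sc sum_distrib_left by (simp only: mult.assoc mult.commute mult.left_commute)
      also have "\<dots> = k * ((k - of_nat a - 1) gchoose (s - a - 1))"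
        using True by (subst gbinomial_alternating_sum) auto
      finally show ?thesis using True by simp
    qed simp
    have 2: "(\<Sum>j=1..s-a. \<Sum>i=1..j. ((-1) ^ (i+j) * of_nat (j choose i) * ((k - of_nat a) gchoose (s - j - a))) \<odot> ?H i a) =
      (\<Sum>i=1..s-a. ((k - of_nat a - of_nat i - 1) gchoose (s - a - i)) \<odot> ?H i a)"
      unfolding sum_triangle_inner sc
      by (intro sum.cong refl) (simp only: scale_sum_left[symmetric] gbinomial_weighted_sum atLeastAtMost_iff)
    show "(\<Sum>j=1..s-a. (((k - of_nat a) gchoose (s - j - a)) * ((-1) ^ (j+1) * k)) \<odot> ?E a
       + (\<Sum>i=1..j. ((-1) ^ (i+j) * of_nat (j choose i) * ((k - of_nat a) gchoose (s - j - a))) \<odot> ?H i a)) =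
       (if a < s then k * ((k - of_nat a - 1) gchoose (s - a - 1)) else 0) \<odot> ?E a
       + (\<Sum>i=1..s-a. ((k - of_nat a - of_nat i - 1) gchoose (s - a - i)) \<odot> ?H i a)"
      unfolding sum.distrib 2 scale_sum_left[symmetric] 1 ..
  qed
  also have "\<dots> = (\<Sum>a\<le>s. (if a < s then k * ((k - of_nat a - 1) gchoose (s - a - 1)) else 0) \<odot> ?E a)
       + (\<Sum>a\<le>s. \<Sum>i=1..s-a. ((k - of_nat a - of_nat i - 1) gchoose (s - a - i)) \<odot> ?H i a)"
    by (rule sum.distrib)
  also have "(\<Sum>a\<le>s. \<Sum>i=1..s-a. ((k - of_nat a - of_nat i - 1) gchoose (s - a - i)) \<odot> ?H i a) =
     (\<Sum>b\<le>s. \<Sum>i=1..b. ((k - of_nat (b - i) - of_nat i - 1) gchoose (s - (b - i) - i)) \<odot> ?H i (b - i))"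
    by (rule sum_triangle_shift[symmetric])
  also have "\<dots> = (\<Sum>b\<le>s. (((k - of_nat b - 1) gchoose (s - b)) * of_nat b) \<odot> ?E b)"
  proof (intro sum.cong refl)
    fix b assume b: "b \<in> {..s}"
    have "(\<Sum>i=1..b. ((k - of_nat (b - i) - of_nat i - 1) gchoose (s - (b - i) - i)) \<odot> ?H i (b - i)) =
      (\<Sum>i=1..b. ((k - of_nat b - 1) gchoose (s - b)) \<odot> Y (A i (D (b - i) u)) (n + int (s - b)) w)"
    proof (intro sum.cong refl)
      fix i assume i: "i \<in> {1..b}"
      then have "s - (b - i) - i = s - b" "n + int (s - (b - i)) - int i = n + int (s - b)"
        "k - of_nat (b - i) - of_nat i - 1 = k - of_nat b - 1"
        using b by (auto simp: of_nat_diff)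
      then show "((k - of_nat (b - i) - of_nat i - 1) gchoose (s - (b - i) - i)) \<odot> ?H i (b - i) =
        ((k - of_nat b - 1) gchoose (s - b)) \<odot> Y (A i (D (b - i) u)) (n + int (s - b)) w" by (simp only:)
    qed
    also have "\<dots> = ((k - of_nat b - 1) gchoose (s - b)) \<odot> Y (of_nat b \<odot> D b u) (n + int (s - b)) w"
      unfolding D_rec scale_sum_right[symmetric] using w DC A_car by (subst mode_sum_left) auto
    also have "\<dots> = (((k - of_nat b - 1) gchoose (s - b)) * of_nat b) \<odot> ?E b"
      using w DC by (simp add: mode_scale_left)
    finally show "(\<Sum>i=1..b. ((k - of_nat (b - i) - of_nat i - 1) gchoose (s - (b - i) - i)) \<odot> ?H i (b - i)) = \<dots>" .
  qed
  also have "(\<Sum>a\<le>s. (if a < s then k * ((k - of_nat a - 1) gchoose (s - a - 1)) else 0) \<odot> ?E a) + \<dots> =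
    (\<Sum>a\<le>s. (of_nat s * ((k - of_nat a) gchoose (s - a))) \<odot> ?E a)"
    unfolding sum.distrib[symmetric] scale_left_distrib[symmetric]
  proof (intro sum.cong refl arg_cong2[where f = "vscale V"])
    fix a assume a: "a \<in> {..s}"
    \<comment> \<open>Put \<open>x = k - a\<close>. The part \<open>x\<close> of \<open>k\<close> is
      treated by absorption and the part \<open>a\<close> by Pascal's rule; together they give
      \<open>(s - a) + a = s\<close> times one binomial.\<close>
    show "(if a < s then k * ((k - of_nat a - 1) gchoose (s - a - 1)) else 0) + ((k - of_nat a - 1) gchoose (s - a)) * of_nat a =
      of_nat s * ((k - of_nat a) gchoose (s - a))"
    proof (cases "a < s")
      case True
      define m where "m = s - a - 1"
      have m: "s - a = Suc m" "s = a + Suc m" using True m_def by auto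
      define x where "x = k - of_nat a"
      have e1: "of_nat (Suc m) * (x gchoose Suc m) = x * ((x - 1) gchoose m)" by (rule gbinomial_absorption)
      have e2: "x gchoose Suc m = ((x - 1) gchoose m) + ((x - 1) gchoose Suc m)"
        using gbinomial_Suc_Suc[of "x - 1" m] by simp
      have "of_nat s * (x gchoose Suc m) = of_nat a * (x gchoose Suc m) + x * ((x - 1) gchoose m)"
        unfolding e1[symmetric] m(2) by (simp add: algebra_simps)
      also have "\<dots> = (x + of_nat a) * ((x - 1) gchoose m) + ((x - 1) gchoose Suc m) * of_nat a"
        unfolding e2 by (simp add: algebra_simps)
      finally show ?thesis using True m(1) by (simp add: x_def)
    next
      case False
      then show ?thesis using a by simp
    qed
  qed
  also have "\<dots> = of_nat s \<odot> Q k u s n w"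
    unfolding Q_def by (simp add: scale_sum_right)
  finally show ?thesis by simp
qed

lemma Q_car: "u \<in> car \<Longrightarrow> w \<in> car \<Longrightarrow> Q k u s n w \<in> car"
  unfolding Q_def by (intro car_sum car_scale mode_closed D_car)

lemma Q_sum_right: "u \<in> car \<Longrightarrow> (\<And>x. x \<in> S \<Longrightarrow> f x \<in> car) \<Longrightarrow> Q k u s n (sum f S) = (\<Sum>x\<in>S. Q k u s n (f x))"
  unfolding Q_def by (subst sum.swap) (simp add: mode_sum_right D_car scale_sum_right)

lemma Q_scale_right: "u \<in> car \<Longrightarrow> w \<in> car \<Longrightarrow> Q k u s n (a \<odot> w) = a \<odot> Q k u s n w"
  unfolding Q_def by (simp add: mode_scale_right D_car scale_sum_right mult.commute)

text \<open>The component form of \<open>\<Delta>(z) Y(u, z\<^sub>0) = Y(\<Delta>(z + z\<^sub>0) u, z\<^sub>0) \<Delta>(z)\<close>.\<close>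

lemma D_mode:
  assumes u: "u \<in> G l" and v: "v \<in> car"
  shows "D k (Y u n v) = (\<Sum>s\<le>k. Q (bil mu l) u s n (D (k - s) v))"
proof (induction k rule: less_induct)
  case (less k)
  have uC: "u \<in> car" using u G_car by blast
  let ?Q = "Q (bil mu l) u"
  let ?R = "\<lambda>k. \<Sum>s\<le>k. ?Q s n (D (k - s) v)"
  have DC: "D a v \<in> car" for a using D_car v by blast
  show ?case
  proof (cases "k = 0")
    case True
    then show ?thesis by (simp add: Q_def)
  next
    case False
    \<comment> \<open>Writing \<open>k = s + (k - s)\<close> lets \<open>Q_rec\<close> act on the
      field and \<open>D_rec\<close> on the vector, as in a Leibniz rule; the terms in which
      \<open>A j\<close> stands inside \<open>Q\<close> then cancel.\<close>
    have "of_nat k \<odot> ?R k = (\<Sum>s\<le>k. of_nat s \<odot> ?Q s n (D (k - s) v) + ?Q s n (of_nat (k - s) \<odot> D (k - s) v))"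
      unfolding scale_sum_right
    proof (intro sum.cong refl)
      fix s assume "s \<in> {..k}"
      then have "(of_nat k :: complex) = of_nat s + of_nat (k - s)" by (simp add: of_nat_diff)
      then show "of_nat k \<odot> ?Q s n (D (k - s) v) = of_nat s \<odot> ?Q s n (D (k - s) v) + ?Q s n (of_nat (k - s) \<odot> D (k - s) v)"
        by (simp only: scale_left_distrib Q_scale_right[OF uC DC])
    qed
    also have "\<dots> = (\<Sum>s\<le>k. \<Sum>j=1..s. A j (?Q (s - j) n (D (k - s) v)) - ?Q (s - j) n (A j (D (k - s) v)))
       + (\<Sum>s\<le>k. \<Sum>j=1..k-s. ?Q s n (A j (D (k - s - j) v)))"
      unfolding sum.distrib D_rec Q_rec[OF u DC]
      by (intro arg_cong2[where f = plus] sum.cong refl Q_sum_right[OF uC] A_car DC)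
    also have "(\<Sum>s\<le>k. \<Sum>j=1..s. A j (?Q (s - j) n (D (k - s) v)) - ?Q (s - j) n (A j (D (k - s) v))) =
      (\<Sum>s\<le>k. \<Sum>j=1..s. A j (?Q (s - j) n (D (k - (s - j) - j) v)) - ?Q (s - j) n (A j (D (k - (s - j) - j) v)))"
      by (intro sum.cong refl) simp
    also have "\<dots> = (\<Sum>s\<le>k. \<Sum>j=1..k-s. A j (?Q s n (D (k - s - j) v)) - ?Q s n (A j (D (k - s - j) v)))"
      by (rule sum_triangle_shift)
    also have "\<dots> + (\<Sum>s\<le>k. \<Sum>j=1..k-s. ?Q s n (A j (D (k - s - j) v))) = (\<Sum>s\<le>k. \<Sum>j=1..k-s. A j (?Q s n (D (k - s - j) v)))"
      by (simp add: sum_subtractf)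
    also have "\<dots> = (\<Sum>j=1..k. \<Sum>s\<le>k-j. A j (?Q s n (D (k - s - j) v)))"
      by (rule sum_triangle_swap[symmetric])
    also have "\<dots> = (\<Sum>j=1..k. A j (?R (k - j)))"
      by (intro sum.cong refl) (simp add: A_sum Q_car uC DC diff_commute add.commute)
    also have "\<dots> = (\<Sum>j=1..k. A j (D (k - j) (Y u n v)))"
      using less False by (intro sum.cong refl) auto
    also have "\<dots> = of_nat k \<odot> D k (Y u n v)" by (rule D_rec[symmetric])
    finally show ?thesis using False by (simp add: scale_cancel_left)
  qed
qed

end

context heisenberg_voa
begin

lemma car_induct [consumes 1, case_names homogeneous add]:
  assumes "u \<in> car" "\<And>l u. u \<in> G l \<Longrightarrow> P u"
    "\<And>u v. u \<in> car \<Longrightarrow> v \<in> car \<Longrightarrow> P u \<Longrightarrow> P v \<Longrightarrow> P (u + v)"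
  shows "P u"
proof -
  have "u \<in> span (\<Union>l. G l)" using assms(1) car_decomp by simp
  then have "u \<in> car \<and> P u"
  proof (induction rule: span_induct_alt)
    case base
    show ?case using assms(2)[of 0 0] by simp
  next
    case (step c x y)
    then obtain l where "x \<in> G l" by blast
    then have "c \<odot> x \<in> G l" by (rule subspace_scale[OF G_sub])
    then show ?case using step.IH assms(2)[of "c \<odot> x" l] assms(3)[of "c \<odot> x" y] G_car[of "c \<odot> x" l] car_add by blast
  qed
  then show ?thesis by blast
qed

lemma car_decomposed: "u \<in> car \<Longrightarrow> Tf.decomposed u"
  by (induction rule: car_induct) (auto simp: G_def intro: Tf.decomposed_homog Tf.decomposed_add)

lemma Sum_any_scale:
  assumes "finite {x. f x \<noteq> 0}"
  shows "Sum_any (\<lambda>x. a \<odot> f x) = a \<odot> Sum_any f"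
proof -
  have "Sum_any (\<lambda>x. a \<odot> f x) = (\<Sum>x\<in>{x. f x \<noteq> 0}. a \<odot> f x)"
    by (rule Sum_any.expand_superset) (use assms in auto)
  then show ?thesis by (simp add: Sum_any.expand_set scale_sum_right)
qed

end

section \<open>The deformed action and its Borcherds identity\<close>

context shifted_heisenberg_voa
begin

definition kap :: "complex^'n \<Rightarrow> int" where "kap l = \<lfloor>Re (bil mu l)\<rfloor>"

lemma kap: "l \<in> Lam \<Longrightarrow> bil mu l = of_int (kap l)"
  using mu_int[of l] unfolding kap_def by (auto elim!: Ints_cases)

lemma kap_add: "l \<in> Lam \<Longrightarrow> m \<in> Lam \<Longrightarrow> kap (l + m) = kap l + kap m"
  using kap[of l] kap[of m] kap[OF Lam_add[of l m]] by (simp add: bil_add_right flip: of_int_add)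

text \<open>The modes of Y(\<Delta>(z)u, z) for \<open>u\<close> in \<open>G l\<close>: the factor
  \<open>z^(kap l - k)\<close> in front of \<open>D k u\<close> moves the mode number by
  \<open>kap l - k\<close>.\<close>

definition tinn :: "'v \<Rightarrow> complex^'n \<Rightarrow> int \<Rightarrow> 'v \<Rightarrow> 'v" where
  "tinn u l n w = Sum_any (\<lambda>k. Y (D k u) (n + kap l - int k) w)"

text \<open>Extended from the eigenvalue spaces by components, since the exponent
  \<open>kap l\<close> depends on the eigenvalue.\<close>

definition tact :: "'v \<Rightarrow> int \<Rightarrow> 'v \<Rightarrow> 'v" where
  "tact u n w = Sum_any (\<lambda>f. tinn (Tf.comp u f) (\<chi> i. f i) n w)"

lemma tinn_fin: "u \<in> car \<Longrightarrow> w \<in> car \<Longrightarrow> finite {k. Y (D k u) (n + kap l - int k) w \<noteq> 0}"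
proof -
  assume uw: "u \<in> car" "w \<in> car"
  obtain K where K: "\<forall>k\<ge>K. D k u = 0" using D_eventually_zero[OF uw(1)] by blast
  have "{k. Y (D k u) (n + kap l - int k) w \<noteq> 0} \<subseteq> {..<K}"
  proof
    fix k assume "k \<in> {k. Y (D k u) (n + kap l - int k) w \<noteq> 0}"
    then show "k \<in> {..<K}" using K uw(2) by (cases "k < K") auto
  qed
  then show ?thesis using finite_subset by blast
qed

lemma tinn_add: "u \<in> car \<Longrightarrow> v \<in> car \<Longrightarrow> w \<in> car \<Longrightarrow> tinn (u + v) l n w = tinn u l n w + tinn v l n w"
  unfolding tinn_def by (simp add: D_add D_car mode_add_left Sum_any.distrib tinn_fin)

lemma tinn_scale: "u \<in> car \<Longrightarrow> w \<in> car \<Longrightarrow> tinn (a \<odot> u) l n w = a \<odot> tinn u l n w"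
  unfolding tinn_def by (simp add: D_scale D_car mode_scale_left Sum_any_scale tinn_fin)

lemma tinn_0 [simp]: "w \<in> car \<Longrightarrow> tinn 0 l n w = 0"
  unfolding tinn_def by simp

lemma comp_car: "u \<in> car \<Longrightarrow> Tf.comp u f \<in> car"
  using car_decomposed[of u] Tf.geigD unfolding Tf.decomposed_def by blast

lemma comp_fin: "u \<in> car \<Longrightarrow> finite {f. Tf.comp u f \<noteq> 0}"
  using car_decomposed[of u] unfolding Tf.decomposed_def by blast

lemma tact_fin: "u \<in> car \<Longrightarrow> w \<in> car \<Longrightarrow> finite {f. tinn (Tf.comp u f) (\<chi> i. f i) n w \<noteq> 0}"
  by (rule finite_subset[OF _ comp_fin[of u]]) auto

lemma tact_add_left: "u \<in> car \<Longrightarrow> v \<in> car \<Longrightarrow> w \<in> car \<Longrightarrow> tact (u + v) n w = tact u n w + tact v n w"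
  unfolding tact_def
  by (simp add: Tf.decomposed_add car_decomposed tinn_add comp_car Sum_any.distrib tact_fin)

lemma tact_scale_left: "u \<in> car \<Longrightarrow> w \<in> car \<Longrightarrow> tact (a \<odot> u) n w = a \<odot> tact u n w"
  unfolding tact_def
  by (simp add: Tf.decomposed_scale car_decomposed tinn_scale comp_car Sum_any_scale tact_fin)

lemma tact_G:
  assumes u: "u \<in> G l" and K: "\<And>k. k \<ge> K \<Longrightarrow> D k u = 0" and w: "w \<in> car"
  shows "tact u n w = (\<Sum>k<K. Y (D k u) (n + kap l - int k) w)"
proof -
  have c: "Tf.comp u = (\<lambda>m. if m = (\<lambda>i. l $ i) then u else 0)"
    using u unfolding G_def by (rule Tf.comp_homog)
  have "tact u n w = (\<Sum>f\<in>{\<lambda>i. l $ i}. tinn (Tf.comp u f) (\<chi> i. f i) n w)"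
    unfolding tact_def by (rule Sum_any.expand_superset) (use w in \<open>auto simp: c split: if_splits\<close>)
  also have "\<dots> = tinn u l n w" by (simp add: c)
  also have "\<dots> = (\<Sum>k<K. Y (D k u) (n + kap l - int k) w)"
    unfolding tinn_def by (rule Sum_any_eq_sum) (use K w in auto)
  finally show ?thesis .
qed

lemma tact_G_ex:
  assumes u: "u \<in> G l"
  shows "\<exists>K. (\<forall>k\<ge>K. D k u = 0) \<and> (\<forall>n. \<forall>w\<in>car. tact u n w = (\<Sum>k<K. Y (D k u) (n + kap l - int k) w))"
proof -
  obtain K where K: "\<forall>k\<ge>K. D k u = 0" using D_eventually_zero[OF G_car[OF u]] by blast
  then show ?thesis using tact_G[OF u, of K] by blast
qed

lemma tact_closed: "u \<in> car \<Longrightarrow> w \<in> car \<Longrightarrow> tact u n w \<in> car"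
proof (induction rule: car_induct)
  case (homogeneous l u)
  then obtain K where K: "\<forall>n. \<forall>w\<in>car. tact u n w = (\<Sum>k<K. Y (D k u) (n + kap l - int k) w)"
    using tact_G_ex[OF homogeneous(1)] by blast
  then show ?case using homogeneous G_car[OF homogeneous(1)]
    by (simp add: car_sum mode_closed D_car)
qed (simp add: tact_add_left car_add)

lemma tact_add_right: "u \<in> car \<Longrightarrow> w \<in> car \<Longrightarrow> w' \<in> car \<Longrightarrow> tact u n (w + w') = tact u n w + tact u n w'"
proof (induction rule: car_induct)
  case (homogeneous l u)
  then obtain K where K: "\<forall>n. \<forall>w\<in>car. tact u n w = (\<Sum>k<K. Y (D k u) (n + kap l - int k) w)"
    using tact_G_ex[OF homogeneous(1)] by blast
  then show ?case using homogeneous G_car[OF homogeneous(1)]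
    by (simp add: car_add mode_add_right D_car sum.distrib)
qed (simp add: tact_add_left car_add algebra_simps)

lemma tact_scale_right: "u \<in> car \<Longrightarrow> w \<in> car \<Longrightarrow> tact u n (a \<odot> w) = a \<odot> tact u n w"
proof (induction rule: car_induct)
  case (homogeneous l u)
  then obtain K where K: "\<forall>n. \<forall>w\<in>car. tact u n w = (\<Sum>k<K. Y (D k u) (n + kap l - int k) w)"
    using tact_G_ex[OF homogeneous(1)] by blast
  then show ?case using homogeneous G_car[OF homogeneous(1)]
    by (simp add: car_scale mode_scale_right D_car scale_sum_right)
qed (simp add: tact_add_left car_scale scale_right_distrib)

lemma tact_0_right: "u \<in> car \<Longrightarrow> tact u n 0 = 0"
  using tact_scale_right[of u 0 n 0] by simp

lemma truncation_family:
  assumes "\<And>a. a < (K::nat) \<Longrightarrow> f a \<in> car" "w \<in> car"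
  shows "\<exists>N. \<forall>a<K. \<forall>n\<ge>N. Y (f a) n w = 0"
  using assms(1)
proof (induction K)
  case (Suc K)
  then obtain N where N: "\<forall>a<K. \<forall>n\<ge>N. Y (f a) n w = 0" by auto
  obtain N' where N': "\<forall>n\<ge>N'. Y (f K) n w = 0" using truncation[of "f K" w] Suc.prems assms(2) by auto
  then have "\<forall>a<Suc K. \<forall>n\<ge>max N N'. Y (f a) n w = 0" using N by (auto simp: less_Suc_eq)
  then show ?case by blast
qed simp

lemma tact_truncation: "u \<in> car \<Longrightarrow> w \<in> car \<Longrightarrow> \<exists>N. \<forall>n\<ge>N. tact u n w = 0"
proof (induction rule: car_induct)
  case (homogeneous l u)
  then obtain K where K: "\<forall>n. \<forall>w\<in>car. tact u n w = (\<Sum>k<K. Y (D k u) (n + kap l - int k) w)"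
    using tact_G_ex[OF homogeneous(1)] by blast
  obtain N where N: "\<forall>a<K. \<forall>n\<ge>N. Y (D a u) n w = 0"
    using truncation_family[of K "\<lambda>a. D a u" w] D_car G_car homogeneous by blast
  have "tact u n w = 0" if "n \<ge> N - kap l + int K" for n
    using K homogeneous(2) N that by (auto intro!: sum.neutral)
  then show ?case by blast
next
  case (add u v)
  then obtain N N' where "\<forall>n\<ge>N. tact u n w = 0" "\<forall>n\<ge>N'. tact v n w = 0" by blast
  then have "\<forall>n\<ge>max N N'. tact (u + v) n w = 0" using add by (simp add: tact_add_left)
  then show ?case by blast
qed

lemma kap_0 [simp]: "kap 0 = 0" by (simp add: kap_def)

lemma tact_vac: "w \<in> car \<Longrightarrow> tact (vac V) n w = (if n = -1 then w else 0)"
proof -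
  assume w: "w \<in> car"
  have "tact (vac V) n w = (\<Sum>k<1. Y (D k (vac V)) (n + kap 0 - int k) w)"
    by (rule tact_G[OF vac_G _ w]) (rule D_zero_wt[OF vac_wt], simp)
  then show ?thesis using w by (simp add: vac_mode)
qed

text \<open>\<open>D_mode\<close> as a sum over a box of pairs \<open>(a, b)\<close> that does not
  depend on \<open>k\<close>, so that the sums over \<open>a\<close>, \<open>b\<close> and
  \<open>k\<close> can be interchanged.\<close>

lemma D_mode_box:
  assumes u: "u \<in> G l" and v: "v \<in> car" and Ka: "\<And>a. a \<ge> Ka \<Longrightarrow> D a u = 0" and Kb: "\<And>b. b \<ge> Kb \<Longrightarrow> D b v = 0"
  shows "D k (Y u n v) = (\<Sum>a<Ka. \<Sum>b<Kb. if a + b \<le> k then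
     ((bil mu l - of_nat a) gchoose (k - a - b)) \<odot> Y (D a u) (n + int (k - a - b)) (D b v) else 0)"
proof -
  let ?f = "\<lambda>a b. ((bil mu l - of_nat a) gchoose (k - a - b)) \<odot> Y (D a u) (n + int (k - a - b)) (D b v)"
  let ?S = "{(a, b). a + b \<le> k}"
  have finS: "finite ?S" by (rule finite_subset[of _ "{..k} \<times> {..k}"]) auto
  have "D k (Y u n v) = (\<Sum>(s, a)\<in>Sigma {..k} (\<lambda>s. {..s}). ((bil mu l - of_nat a) gchoose (s - a)) \<odot> Y (D a u) (n + int (s - a)) (D (k - s) v))"
    unfolding D_mode[OF u v] Q_def by (rule sum.Sigma) auto
  also have "\<dots> = (\<Sum>(a, b)\<in>?S. ?f a b)"
    by (rule sum.reindex_bij_witness[of _ "\<lambda>(a, b). (k - b, a)" "\<lambda>(s, a). (a, k - s)"])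
      (auto simp: diff_diff_cancel diff_commute)
  also have "\<dots> = (\<Sum>(a, b)\<in>?S \<inter> ({..<Ka} \<times> {..<Kb}). ?f a b)"
  proof (rule sum.mono_neutral_right[OF finS])
    show "\<forall>i\<in>?S - ?S \<inter> ({..<Ka} \<times> {..<Kb}). (case i of (a, b) \<Rightarrow> ?f a b) = 0"
    proof
      fix i assume i: "i \<in> ?S - ?S \<inter> ({..<Ka} \<times> {..<Kb})"
      obtain a b where ab: "i = (a, b)" by force
      then have "D a u = 0 \<or> D b v = 0" using i Ka[of a] Kb[of b] by auto
      then show "(case i of (a, b) \<Rightarrow> ?f a b) = 0" unfolding ab using D_car[OF G_car[OF u]] D_car[OF v] by auto
    qed
  qed auto
  also have "\<dots> = (\<Sum>i\<in>{..<Ka} \<times> {..<Kb}. if i \<in> ?S then (case i of (a, b) \<Rightarrow> ?f a b) else 0)"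
    by (subst Int_commute) (rule sum.inter_restrict, simp)
  also have "\<dots> = (\<Sum>(a, b)\<in>{..<Ka} \<times> {..<Kb}. if a + b \<le> k then ?f a b else 0)"
    by (intro sum.cong refl) auto
  also have "\<dots> = (\<Sum>a<Ka. \<Sum>b<Kb. if a + b \<le> k then ?f a b else 0)"
    by (rule sum.cartesian_product[symmetric])
  finally show ?thesis .
qed

text \<open>The two sides of the Borcherds identity for \<open>tact\<close>, cut off after
  \<open>M\<close> terms. Equality for all large \<open>M\<close> passes to sums of vectors,
  although the least admissible cutoff depends on them.\<close>

definition blhs :: "'v \<Rightarrow> 'v \<Rightarrow> 'v \<Rightarrow> int \<Rightarrow> int \<Rightarrow> int \<Rightarrow> nat \<Rightarrow> 'v" where
  "blhs u v w p l q M = (\<Sum>j<M. (of_int p gchoose j) \<odot> tact (Y u (l + int j) v) (p + q - int j) w)"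

definition brhs :: "'v \<Rightarrow> 'v \<Rightarrow> 'v \<Rightarrow> int \<Rightarrow> int \<Rightarrow> int \<Rightarrow> nat \<Rightarrow> 'v" where
  "brhs u v w p l q M = (\<Sum>j<M. ((-1) ^ j * (of_int l gchoose j)) \<odot> (tact u (p + l - int j) (tact v (q + int j) w)
         - ((-1) powi l) \<odot> tact v (q + l - int j) (tact u (p + int j) w)))"

text \<open>Both sides reduce to a double sum over \<open>a\<close> and \<open>b\<close> of one side
  of the original identity for \<open>D a u\<close> and \<open>D b v\<close>, with the shifted
  indices \<open>pa a\<close> and \<open>qb b\<close>. On the right this is expansion followed by
  \<open>borcherds_fin\<close>; on the left \<open>D_mode\<close> contributes a second binomial, and
  Vandermonde merges the two.\<close>

lemma tact_borcherds_homogeneous: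
  assumes u: "u \<in> G m" and v: "v \<in> G m'" and w: "w \<in> car" and m: "m \<in> Lam" "m' \<in> Lam"
  shows "\<exists>N. \<forall>M\<ge>N. blhs u v w p l q M = brhs u v w p l q M"
proof -
  have C: "u \<in> car" "v \<in> car" using u v G_car by auto
  have DC: "D a u \<in> car" "D a v \<in> car" for a using D_car C by auto
  obtain Ka where Ka: "\<forall>k\<ge>Ka. D k u = 0" "\<forall>n. \<forall>w\<in>car. tact u n w = (\<Sum>k<Ka. Y (D k u) (n + kap m - int k) w)"
    using tact_G_ex[OF u] by blast
  obtain Kb where Kb: "\<forall>k\<ge>Kb. D k v = 0" "\<forall>n. \<forall>w\<in>car. tact v n w = (\<Sum>k<Kb. Y (D k v) (n + kap m' - int k) w)"
    using tact_G_ex[OF v] by blast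
  obtain N1 where N1: "\<forall>a<Ka. \<forall>n\<ge>N1. Y (D a u) n w = 0" using truncation_family[of Ka "\<lambda>a. D a u" w] DC w by blast
  obtain N2 where N2: "\<forall>a<Kb. \<forall>n\<ge>N2. Y (D a v) n w = 0" using truncation_family[of Kb "\<lambda>a. D a v" w] DC w by blast
  have "\<forall>b. \<exists>N. \<forall>a<Ka. \<forall>n\<ge>N. Y (D a u) n (D b v) = 0" using truncation_family[of Ka "\<lambda>a. D a u"] DC by blast
  then obtain N3 where N3: "\<And>b. \<forall>a<Ka. \<forall>n\<ge>N3 b. Y (D a u) n (D b v) = 0" by metis
  define N3m where "N3m = Max (insert 0 (N3 ` {..<Kb}))"
  have N3': "Y (D a u) n (D b v) = 0" if "a < Ka" "b < Kb" "n \<ge> N3m" for a b n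
  proof -
    have "N3 b \<le> N3m" unfolding N3m_def using that(2) by (intro Max_ge) auto
    then show ?thesis using N3 that by auto
  qed
  define N where "N = nat (max (max (N1 - p - kap m + int Ka) (N2 - q - kap m' + int Kb)) (N3m - l))"
  have "blhs u v w p l q M = brhs u v w p l q M" if M: "M \<ge> N" for M
  proof -
    define pa where "pa = (\<lambda>a::nat. p + kap m - int a)"
    define qb where "qb = (\<lambda>b::nat. q + kap m' - int b)"
    have z1: "Y (D a u) (pa a + int j) w = 0" if "a < Ka" "j \<ge> M" for a j
      using N1 that M by (auto simp: pa_def N_def)
    have z2: "Y (D b v) (qb b + int j) w = 0" if "b < Kb" "j \<ge> M" for b j
      using N2 that M by (auto simp: qb_def N_def)
    have z3: "Y (D a u) (l + int j) (D b v) = 0" if "a < Ka" "b < Kb" "j \<ge> M" for a b j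
      using that M by (intro N3') (auto simp: N_def)
    let ?B = "\<lambda>a b. \<Sum>j<M. (of_int (pa a) gchoose j) \<odot> Y (Y (D a u) (l + int j) (D b v)) (pa a + qb b - int j) w"
    have "brhs u v w p l q M = (\<Sum>j<M. ((-1) ^ j * (of_int l gchoose j)) \<odot>
        (\<Sum>a<Ka. \<Sum>b<Kb. Y (D a u) (pa a + l - int j) (Y (D b v) (qb b + int j) w)
         - ((-1) powi l) \<odot> Y (D b v) (qb b + l - int j) (Y (D a u) (pa a + int j) w)))"
      unfolding brhs_def
    proof (intro sum.cong refl arg_cong[where f = "\<lambda>x. _ \<odot> x"])
      fix j
      have tv: "tact v (q + int j) w = (\<Sum>b<Kb. Y (D b v) (qb b + int j) w)"
        using Kb(2) w by (simp add: qb_def algebra_simps)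
      have tu: "tact u (p + int j) w = (\<Sum>a<Ka. Y (D a u) (pa a + int j) w)"
        using Ka(2) w by (simp add: pa_def algebra_simps)
      have "tact u (p + l - int j) (tact v (q + int j) w) = (\<Sum>a<Ka. \<Sum>b<Kb. Y (D a u) (pa a + l - int j) (Y (D b v) (qb b + int j) w))"
      proof -
        have "tact v (q + int j) w \<in> car" using tact_closed C w by blast
        then have "tact u (p + l - int j) (tact v (q + int j) w) = (\<Sum>a<Ka. Y (D a u) (pa a + l - int j) (tact v (q + int j) w))"
          using Ka(2) by (simp add: pa_def algebra_simps)
        then show ?thesis unfolding tv using DC w by (simp add: mode_sum_right mode_closed)
      qed
      moreover have "tact v (q + l - int j) (tact u (p + int j) w) = (\<Sum>a<Ka. \<Sum>b<Kb. Y (D b v) (qb b + l - int j) (Y (D a u) (pa a + int j) w))"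
      proof -
        have "tact u (p + int j) w \<in> car" using tact_closed C w by blast
        then have "tact v (q + l - int j) (tact u (p + int j) w) = (\<Sum>b<Kb. Y (D b v) (qb b + l - int j) (tact u (p + int j) w))"
          using Kb(2) by (simp add: qb_def algebra_simps)
        also have "\<dots> = (\<Sum>b<Kb. \<Sum>a<Ka. Y (D b v) (qb b + l - int j) (Y (D a u) (pa a + int j) w))"
          unfolding tu using DC w by (simp add: mode_sum_right mode_closed)
        finally show ?thesis by (subst sum.swap)
      qed
      ultimately show "tact u (p + l - int j) (tact v (q + int j) w) - ((-1) powi l) \<odot> tact v (q + l - int j) (tact u (p + int j) w)
        = (\<Sum>a<Ka. \<Sum>b<Kb. Y (D a u) (pa a + l - int j) (Y (D b v) (qb b + int j) w)
         - ((-1) powi l) \<odot> Y (D b v) (qb b + l - int j) (Y (D a u) (pa a + int j) w))"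
        by (simp add: sum_subtractf scale_sum_right)
    qed
    also have "\<dots> = (\<Sum>a<Ka. \<Sum>b<Kb. \<Sum>j<M. ((-1) ^ j * (of_int l gchoose j)) \<odot>
        (Y (D a u) (pa a + l - int j) (Y (D b v) (qb b + int j) w)
         - ((-1) powi l) \<odot> Y (D b v) (qb b + l - int j) (Y (D a u) (pa a + int j) w)))"
      unfolding scale_sum_right by (subst sum.swap, rule sum.cong[OF refl], rule sum.swap)
    also have "\<dots> = (\<Sum>a<Ka. \<Sum>b<Kb. ?B a b)"
    proof (rule sum.cong[OF refl], rule sum.cong[OF refl])
      fix a b assume ab: "a \<in> {..<Ka}" "b \<in> {..<Kb}"
      show "(\<Sum>j<M. ((-1) ^ j * (of_int l gchoose j)) \<odot>
        (Y (D a u) (pa a + l - int j) (Y (D b v) (qb b + int j) w)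
         - ((-1) powi l) \<odot> Y (D b v) (qb b + l - int j) (Y (D a u) (pa a + int j) w))) = ?B a b"
        by (rule borcherds_fin[symmetric, OF DC w]) (use ab z1 z2 z3 in auto)
    qed
    finally have R: "brhs u v w p l q M = (\<Sum>a<Ka. \<Sum>b<Kb. ?B a b)" .
    have "\<exists>K. \<forall>k\<ge>K. \<forall>j<M. D k (Y u (l + int j) v) = 0"
    proof (induction M)
      case (Suc M)
      obtain K where "\<forall>k\<ge>K. \<forall>j<M. D k (Y u (l + int j) v) = 0" using Suc by blast
      moreover obtain K' where "\<forall>k\<ge>K'. D k (Y u (l + int M) v) = 0"
        using D_eventually_zero mode_closed C by blast
      ultimately have "\<forall>k\<ge>max K K'. \<forall>j<Suc M. D k (Y u (l + int j) v) = 0" by (auto simp: less_Suc_eq)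
      then show ?case by blast
    qed simp
    then obtain K' where K': "\<forall>k\<ge>K'. \<forall>j<M. D k (Y u (l + int j) v) = 0" by blast
    \<comment> \<open>Beyond \<open>K'\<close> all \<open>D k (Y u (l + int j) v)\<close> vanish;
      the other entry leaves room for every \<open>c < M\<close> after \<open>a + b\<close> is
      subtracted.\<close>
    define K where "K = max K' (Ka + Kb + M)"
    let ?H = "\<lambda>a b J. Y (Y (D a u) (l + int J) (D b v)) (pa a + qb b - int J) w"
    have "blhs u v w p l q M = (\<Sum>j<M. \<Sum>a<Ka. \<Sum>b<Kb. \<Sum>c<M. ((of_int p gchoose j) * (of_int (kap m - int a) gchoose c)) \<odot> ?H a b (j + c))"
      unfolding blhs_def
    proof (intro sum.cong refl)
      fix j assume j: "j \<in> {..<M}"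
      have uv: "Y u (l + int j) v \<in> G (m + m')" by (rule G_mode[OF u v])
      have "tact (Y u (l + int j) v) (p + q - int j) w = (\<Sum>k<K. Y (D k (Y u (l + int j) v)) (p + q - int j + kap (m + m') - int k) w)"
        by (rule tact_G[OF uv _ w]) (use K' j K_def in auto)
      also have "\<dots> = (\<Sum>k<K. \<Sum>a<Ka. \<Sum>b<Kb. if a + b \<le> k then
          (of_int (kap m - int a) gchoose (k - a - b)) \<odot> ?H a b (j + (k - a - b)) else 0)"
      proof (intro sum.cong refl)
        fix k
        let ?g = "\<lambda>a b. if a + b \<le> k then (of_int (kap m - int a) gchoose (k - a - b)) \<odot> Y (D a u) (l + int j + int (k - a - b)) (D b v) else 0"
        have gC: "?g a b \<in> car" for a b using DC by (auto intro!: car_scale mode_closed)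
        have "D k (Y u (l + int j) v) = (\<Sum>a<Ka. \<Sum>b<Kb. ?g a b)"
        proof -
          have bm: "bil mu m - of_nat a = of_int (kap m - int a)" for a using kap[OF m(1)] by simp
          show ?thesis using D_mode_box[OF u C(2), of Ka Kb k "l + int j"] Ka(1) Kb(1) by (simp only: bm)
        qed
        then have "Y (D k (Y u (l + int j) v)) (p + q - int j + kap (m + m') - int k) w =
          (\<Sum>a<Ka. \<Sum>b<Kb. Y (?g a b) (p + q - int j + kap (m + m') - int k) w)"
          using gC w by (simp only: mode_sum_left car_sum)
        also have "\<dots> = (\<Sum>a<Ka. \<Sum>b<Kb. if a + b \<le> k then
          (of_int (kap m - int a) gchoose (k - a - b)) \<odot> ?H a b (j + (k - a - b)) else 0)"
        proof (intro sum.cong refl)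
          fix a b
          show "Y (?g a b) (p + q - int j + kap (m + m') - int k) w = (if a + b \<le> k then
            (of_int (kap m - int a) gchoose (k - a - b)) \<odot> ?H a b (j + (k - a - b)) else 0)"
          proof (cases "a + b \<le> k")
            case True
            then have "p + q - int j + kap (m + m') - int k = pa a + qb b - int (j + (k - a - b))"
              by (simp add: kap_add[OF m] pa_def qb_def of_nat_diff)
            note idx = this
            have "l + int j + int (k - a - b) = l + int (j + (k - a - b))" by simp
            then show ?thesis unfolding idx using True DC w by (simp only: mode_scale_left[OF mode_closed[OF DC] w] if_True)
          next
            case False
            then show ?thesis using w by simp
          qed
        qed
        finally show "Y (D k (Y u (l + int j) v)) (p + q - int j + kap (m + m') - int k) w = \<dots>" .
      qed
      also have "\<dots> = (\<Sum>a<Ka. \<Sum>b<Kb. \<Sum>k<K. if a + b \<le> k then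
          (of_int (kap m - int a) gchoose (k - a - b)) \<odot> ?H a b (j + (k - a - b)) else 0)"
        by (subst sum.swap, rule sum.cong[OF refl], rule sum.swap)
      also have "\<dots> = (\<Sum>a<Ka. \<Sum>b<Kb. \<Sum>c<M. (of_int (kap m - int a) gchoose c) \<odot> ?H a b (j + c))"
      proof (rule sum.cong[OF refl], rule sum.cong[OF refl])
        fix a b assume ab: "a \<in> {..<Ka}" "b \<in> {..<Kb}"
        let ?e = "\<lambda>c. (of_int (kap m - int a) gchoose c) \<odot> ?H a b (j + c)"
        have "(\<Sum>k<K. if a + b \<le> k then ?e (k - a - b) else 0) = (\<Sum>k\<in>{a+b..<K}. ?e (k - a - b))"
          by (rule sum.mono_neutral_cong_right) auto
        also have "\<dots> = (\<Sum>c<K - a - b. ?e c)"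
          by (rule sum.reindex_bij_witness[of _ "\<lambda>c. c + a + b" "\<lambda>k. k - a - b"]) auto
        also have "\<dots> = (\<Sum>c<M. ?e c)"
        proof (rule sum.mono_neutral_right)
          show "{..<M} \<subseteq> {..<K - a - b}" using ab by (auto simp: K_def)
          show "\<forall>c\<in>{..<K - a - b} - {..<M}. ?e c = 0" using ab z3[of a b "j + _"] w by auto
        qed simp
        finally show "(\<Sum>k<K. if a + b \<le> k then ?e (k - a - b) else 0) = (\<Sum>c<M. ?e c)" .
      qed
      finally show "(of_int p gchoose j) \<odot> tact (Y u (l + int j) v) (p + q - int j) w =
        (\<Sum>a<Ka. \<Sum>b<Kb. \<Sum>c<M. ((of_int p gchoose j) * (of_int (kap m - int a) gchoose c)) \<odot> ?H a b (j + c))"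
        by (simp only: scale_sum_right scale_scale)
    qed
    also have "\<dots> = (\<Sum>a<Ka. \<Sum>b<Kb. \<Sum>j<M. \<Sum>c<M. ((of_int p gchoose j) * (of_int (kap m - int a) gchoose c)) \<odot> ?H a b (j + c))"
      by (subst sum.swap, rule sum.cong[OF refl], rule sum.swap)
    also have "\<dots> = (\<Sum>a<Ka. \<Sum>b<Kb. ?B a b)"
    proof (rule sum.cong[OF refl], rule sum.cong[OF refl])
      fix a b assume ab: "a \<in> {..<Ka}" "b \<in> {..<Kb}"
      let ?e = "\<lambda>j c. ((of_int p gchoose j) * (of_int (kap m - int a) gchoose c)) \<odot> ?H a b (j + c)"
      have "(\<Sum>j<M. \<Sum>c<M. ?e j c) = (\<Sum>(j, c)\<in>{..<M} \<times> {..<M}. ?e j c)"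
        by (rule sum.cartesian_product)
      \<comment> \<open>Outside this triangle the product of \<open>D a u\<close> with
        \<open>D b v\<close> has passed its truncation bound.\<close>
      also have "\<dots> = (\<Sum>(j, c)\<in>{(j, c). j + c < M}. ?e j c)"
      proof (rule sum.mono_neutral_right)
        show "\<forall>i\<in>{..<M} \<times> {..<M} - {(j, c). j + c < M}. (case i of (j, c) \<Rightarrow> ?e j c) = 0"
        proof
          fix i assume i: "i \<in> {..<M} \<times> {..<M} - {(j, c). j + c < M}"
          obtain j c where jc: "i = (j, c)" by force
          then have "M \<le> j + c" using i by auto
          then have "Y (D a u) (l + int (j + c)) (D b v) = 0" using ab by (intro z3) auto
          then show "(case i of (j, c) \<Rightarrow> ?e j c) = 0" unfolding jc using w by simp
        qed
      qed auto
      also have "\<dots> = (\<Sum>J<M. \<Sum>j\<le>J. ?e j (J - j))" by (rule sum.triangle_reindex)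
      also have "\<dots> = (\<Sum>J<M. (of_int (pa a) gchoose J) \<odot> ?H a b J)"
      proof (intro sum.cong refl)
        fix J
        have "(\<Sum>j\<le>J. ?e j (J - j)) = (\<Sum>j\<le>J. (of_int p gchoose j) * (of_int (kap m - int a) gchoose (J - j))) \<odot> ?H a b J"
          unfolding scale_sum_left by (intro sum.cong refl) simp
        also have "(\<Sum>j\<le>J. (of_int p gchoose j) * (of_int (kap m - int a) gchoose (J - j))) = (of_int (pa a) gchoose J :: complex)"
          using gbinomial_Vandermonde[of "of_int p :: complex" "of_int (kap m - int a)" J]
          by (simp add: atMost_atLeast0 pa_def algebra_simps)
        finally show "(\<Sum>j\<le>J. ?e j (J - j)) = (of_int (pa a) gchoose J) \<odot> ?H a b J" .
      qed
      finally show "(\<Sum>j<M. \<Sum>c<M. ?e j c) = ?B a b" .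
    qed
    finally show ?thesis using R by simp
  qed
  then show ?thesis by blast
qed

lemma blhs_add:
  assumes "u \<in> car" "u' \<in> car" "v \<in> car" "w \<in> car"
  shows "blhs (u + u') v w p l q M = blhs u v w p l q M + blhs u' v w p l q M"
    "blhs v (u + u') w p l q M = blhs v u w p l q M + blhs v u' w p l q M"
  using assms unfolding blhs_def
  by (simp_all add: mode_add_left mode_add_right mode_closed tact_add_left scale_right_distrib sum.distrib)

lemma brhs_add:
  assumes "u \<in> car" "u' \<in> car" "v \<in> car" "w \<in> car"
  shows "brhs (u + u') v w p l q M = brhs u v w p l q M + brhs u' v w p l q M"
    "brhs v (u + u') w p l q M = brhs v u w p l q M + brhs v u' w p l q M"
  using assms unfolding brhs_def sum.distrib[symmetric]
  by (auto intro!: sum.cong simp: tact_add_left tact_add_right tact_closed scale_right_distrib[symmetric])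
    (simp_all add: scale_right_distrib algebra_simps)

lemma tact_borcherds_fin:
  assumes "u \<in> car" "v \<in> car" "w \<in> car"
  shows "\<exists>N. \<forall>M\<ge>N. blhs u v w p l q M = brhs u v w p l q M"
  using assms
proof (induction rule: car_induct)
  case (homogeneous m u)
  show ?case using homogeneous(2,1,3)
  proof (induction rule: car_induct)
    case (homogeneous m' v)
    show ?case
    proof (cases "u = 0 \<or> v = 0")
      case True
      then have "blhs u v w p l q M = brhs u v w p l q M" for M
        using homogeneous G_car[OF homogeneous(1)] G_car[OF homogeneous(2)] tact_scale_left[of 0 w 0] tact_scale_left[of 0 _ 0]
        by (auto simp: blhs_def brhs_def tact_closed tact_0_right)
      then show ?thesis by blast
    next
      case False
      then show ?thesis using tact_borcherds_homogeneous homogeneous Lam_I by blast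
    qed
  next
    case (add v v')
    then obtain N N' where "\<forall>M\<ge>N. blhs u v w p l q M = brhs u v w p l q M"
      "\<forall>M\<ge>N'. blhs u v' w p l q M = brhs u v' w p l q M" by blast
    then have "\<forall>M\<ge>max N N'. blhs u (v + v') w p l q M = brhs u (v + v') w p l q M"
      using add G_car by (simp add: blhs_add brhs_add)
    then show ?case by blast
  qed
next
  case (add u u')
  then obtain N N' where "\<forall>M\<ge>N. blhs u v w p l q M = brhs u v w p l q M"
    "\<forall>M\<ge>N'. blhs u' v w p l q M = brhs u' v w p l q M" by blast
  then have "\<forall>M\<ge>max N N'. blhs (u + u') v w p l q M = brhs (u + u') v w p l q M"
    using add by (simp add: blhs_add brhs_add)
  then show ?case by blast
qed

end

section \<open>Weights and irreducibility of the deformed module\<close>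

context shifted_heisenberg_voa
begin

lemma t_conf1: "h j 1 (conf V) = t j"
proof -
  have "2 \<odot> h j 1 (conf V) = (\<Sum>i\<in>UNIV. h j 1 (h i (-1) (t i)))"
    by (simp add: mode_scale_right[symmetric] t_car conf_in conf_t mode_sum_right h_in)
  also have "\<dots> = (\<Sum>i\<in>UNIV. if i = j then 2 \<odot> t j else 0)"
    by (intro sum.cong refl)
      (auto simp: h_comm[OF t_car, of j 1 _ "-1"] t_prod t_car creation scale_left_distrib[of 1 1, simplified])
  finally show ?thesis by (simp add: scale_cancel_left)
qed

lemma t_conf2: "h j 2 (conf V) = 0"
proof -
  have "2 \<odot> h j 2 (conf V) = (\<Sum>i\<in>UNIV. h j 2 (h i (-1) (t i)))"
    by (simp add: mode_scale_right[symmetric] t_car conf_in conf_t mode_sum_right h_in)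
  also have "\<dots> = 0"
    by (rule sum.neutral) (simp add: h_comm[OF t_car, of j 2 _ "-1"] t_prod t_car)
  finally show ?thesis by simp
qed

lemma conf_G0: "conf V \<in> G 0"
proof -
  have "2 \<odot> conf V \<in> G 0" unfolding conf_t
  proof (intro subspace_sum[OF G_sub] h_G)
    fix i
    have "h i (-1) (vac V) \<in> G 0" by (rule h_G[OF vac_G])
    then show "t i \<in> G 0" by (simp add: creation t_car)
  qed
  then have "(1/2) \<odot> 2 \<odot> conf V \<in> G 0" by (rule subspace_scale[OF G_sub])
  then show ?thesis by simp
qed

lemma conf_wt: "conf V \<in> wt 2"
  using conf_mode0_wt[OF vac_wt, of "-1"] creation[OF conf_in] by simp

text \<open>\<Delta> applied to the conformal vector stops after the quadratic term:
  \<open>D 1\<close> gives \<open>tm\<close> and \<open>D 2\<close> gives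
  \<open>bil mu mu / 2\<close> times the vacuum. On \<open>G l\<close> the weights are thus shifted
  by \<open>bil mu l + bil mu mu / 2\<close>.\<close>

lemma tact_conf:
  assumes w: "w \<in> car"
  shows "tact (conf V) 1 w = L0 w + Y tm 0 w + (bil mu mu / 2) \<odot> w"
proof -
  have D1: "D 1 (conf V) = tm"
    by (simp add: A_def tm_mode conf_in t_conf1) (simp add: tm_def)
  have tt: "Y tm 1 tm = bil mu mu \<odot> vac V"
  proof -
    have "h i 1 tm = mu $ i \<odot> vac V" for i
      unfolding tm_def by (simp add: mode_sum_right t_car car_scale mode_scale_right t_prod if_distrib[of "vscale V _"] cong: if_cong)
    then show ?thesis by (simp add: tm_mode tm_car bil_def scale_sum_left)
  qed
  have A2: "A 2 (conf V) = 0" unfolding A_def by (simp add: tm_mode conf_in t_conf2)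
  have D2: "D 2 (conf V) = (bil mu mu / 2) \<odot> vac V"
  proof -
    have "of_nat 2 \<odot> D 2 (conf V) = (\<Sum>j=1..2. A j (D (2 - j) (conf V)))" by (rule D_rec)
    also have "\<dots> = A 1 tm + A 2 (conf V)"
      using D1 by (simp add: numeral_2_eq_2)
    also have "\<dots> = bil mu mu \<odot> vac V" unfolding A2 by (simp add: A_def tt)
    finally have "(1/2) \<odot> (2 \<odot> D 2 (conf V)) = (1/2) \<odot> bil mu mu \<odot> vac V" by simp
    then show ?thesis by simp
  qed
  have "tact (conf V) 1 w = (\<Sum>k<3. Y (D k (conf V)) (1 + kap 0 - int k) w)"
    by (rule tact_G[OF conf_G0 _ w]) (rule D_zero_wt[OF conf_wt], simp)
  also have "\<dots> = L0 w + Y (D 1 (conf V)) 0 w + Y (D 2 (conf V)) (-1) w"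
    by (simp add: eval_nat_numeral)
  also have "\<dots> = L0 w + Y tm 0 w + (bil mu mu / 2) \<odot> w"
    unfolding D1 D2 using w by (simp add: mode_scale_left vac_in vac_mode)
  finally show ?thesis .
qed

definition tL0 :: "'v \<Rightarrow> 'v" where "tL0 w = L0 w + Y tm 0 w + (bil mu mu / 2) \<odot> w"

definition twt :: "complex \<Rightarrow> 'v set" where "twt x = {w \<in> car. tL0 w = x \<odot> w}"

lemma tL0_homogeneous:
  "w \<in> G l \<Longrightarrow> w \<in> wt n \<Longrightarrow> tL0 w = (of_int n + bil mu l + bil mu mu / 2) \<odot> w"
  by (simp add: tL0_def tm_G0 vweight_def scale_left_distrib)

lemma tL0_car: "w \<in> car \<Longrightarrow> tL0 w \<in> car"
  unfolding tL0_def by (intro car_intros tm_car)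
lemma tL0_add: "v \<in> car \<Longrightarrow> w \<in> car \<Longrightarrow> tL0 (v + w) = tL0 v + tL0 w"
  unfolding tL0_def by (simp add: mode_add_right tm_car conf_in scale_right_distrib add_ac)
lemma tL0_scale: "w \<in> car \<Longrightarrow> tL0 (a \<odot> w) = a \<odot> tL0 w"
  unfolding tL0_def by (simp add: mode_scale_right tm_car conf_in scale_right_distrib mult.commute)

lemma subspace_twt: "subspace (twt x)"
  unfolding twt_def
proof (rule subspaceI)
  show "0 \<in> {w \<in> car. tL0 w = x \<odot> w}" using tL0_scale[of 0 0] by simp
qed (auto simp: car_add car_scale tL0_add tL0_scale scale_right_distrib mult.commute)

definition sect :: "complex \<Rightarrow> ((complex^'n) \<times> int) set" where
  "sect x = {(l, n). G l \<inter> wt n \<noteq> {0} \<and> of_int n + bil mu l + bil mu mu / 2 = x}"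

text \<open>For fixed \<open>x\<close> the weight \<open>n\<close> is determined by
  \<open>l\<close>, and since \<open>n\<close> is at least \<open>bil l l / 2\<close>, only labels
  covered by \<open>mu_fin\<close> occur. Finite dimension and the lower bound both follow from
  this.\<close>

lemma sect_props:
  assumes "(l, n) \<in> sect x"
  shows "l \<in> Lam" "Re (bil l l) / 2 + Re (bil mu l) \<le> Re x - Re (bil mu mu / 2)"
    "n = \<lfloor>Re (x - bil mu l - bil mu mu / 2)\<rfloor>"
proof -
  obtain a where a: "a \<in> G l" "a \<in> wt n" "a \<noteq> 0"
    using assms subspace_0[OF subspace_vweight] unfolding sect_def by fastforce
  show "l \<in> Lam" using a Lam_I by blast
  obtain k where k: "bil l l = 2 * of_int k" "k \<le> n" using G_wt_low[OF a] by blast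
  have x: "of_int n + bil mu l + bil mu mu / 2 = x" using assms by (simp add: sect_def)
  show "Re (bil l l) / 2 + Re (bil mu l) \<le> Re x - Re (bil mu mu / 2)" using k x[symmetric] by simp
  show "n = \<lfloor>Re (x - bil mu l - bil mu mu / 2)\<rfloor>" using x[symmetric] by simp
qed

lemma finite_sect: "finite (sect x)"
proof (rule finite_subset)
  let ?S = "{l \<in> Lam. Re (bil l l) / 2 + Re (bil mu l) \<le> Re x - Re (bil mu mu / 2)}"
  show "sect x \<subseteq> (\<lambda>l. (l, \<lfloor>Re (x - bil mu l - bil mu mu / 2)\<rfloor>)) ` ?S"
    using sect_props by fastforce
  show "finite ((\<lambda>l. (l, \<lfloor>Re (x - bil mu l - bil mu mu / 2)\<rfloor>)) ` ?S)" using mu_fin by (rule finite_imageI)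
qed

lemma car_homog_span: "car \<subseteq> span (\<Union>(l, n). G l \<inter> wt n)"
proof -
  have "span (\<Union>n. G l \<inter> wt n) \<subseteq> span (\<Union>(l, n). G l \<inter> wt n)" for l by (rule span_mono) blast
  then have "(\<Union>l. span (\<Union>n. G l \<inter> wt n)) \<subseteq> span (\<Union>(l, n). G l \<inter> wt n)" by blast
  then have "span (\<Union>l. span (\<Union>n. G l \<inter> wt n)) \<subseteq> span (\<Union>(l, n). G l \<inter> wt n)"
    by (rule span_minimal) (rule subspace_span)
  then show ?thesis using car_decomp_wt by blast
qed

lemma twt_span: "w \<in> twt x \<Longrightarrow> w \<in> span (\<Union>(l, n)\<in>sect x. G l \<inter> wt n)"
proof -
  assume w: "w \<in> twt x"
  interpret S: commuting_family "vscale V" car "\<lambda>_::unit. tL0"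
    by unfold_locales (auto simp: subspace_vcar tL0_car tL0_add tL0_scale)
  have tg: "twt y \<subseteq> S.geig UNIV (\<lambda>_. y)" for y
  proof
    fix v assume "v \<in> twt y"
    then show "v \<in> S.geig UNIV (\<lambda>_. y)"
      unfolding S.geig_def by (intro CollectI conjI ballI exI[of _ 1]) (auto simp: S.sh_def twt_def)
  qed
  define N where "N = (\<lambda>f::unit \<Rightarrow> complex. span (\<Union>(l, n)\<in>sect (f ()). G l \<inter> wt n))"
  have "w \<in> N (\<lambda>_. x)"
  proof (rule S.homog_span_extract)
    show "subspace (N f)" for f by (simp add: N_def subspace_span)
    show "N f \<subseteq> S.geig UNIV f" for f
    proof -
      have "(\<Union>(l, n)\<in>sect (f ()). G l \<inter> wt n) \<subseteq> twt (f ())"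
        using tL0_homogeneous wtD by (auto simp: twt_def sect_def)
      then have "N f \<subseteq> twt (f ())" unfolding N_def by (rule span_minimal) (rule subspace_twt)
      moreover have "(\<lambda>_. f ()) = f" by (auto simp: fun_eq_iff)
      ultimately show ?thesis using tg[of "f ()"] by simp
    qed
    have "G l \<inter> wt n \<subseteq> (\<Union>f. N f)" for l n
    proof
      fix a assume a: "a \<in> G l \<inter> wt n"
      let ?x = "of_int n + bil mu l + bil mu mu / 2"
      have "a \<in> N (\<lambda>_. ?x)"
      proof (cases "a = 0")
        case True then show ?thesis by (simp add: N_def span_zero)
      next
        case False
        then have "(l, n) \<in> sect ?x" using a by (auto simp: sect_def)
        then show ?thesis unfolding N_def using a by (intro span_base) blast
      qed
      then show "a \<in> (\<Union>f. N f)" by blast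
    qed
    then have "(\<Union>(l, n). G l \<inter> wt n) \<subseteq> (\<Union>f. N f)" by blast
    then have "span (\<Union>(l, n). G l \<inter> wt n) \<subseteq> span (\<Union>f. N f)" by (rule span_mono)
    then show "w \<in> span (\<Union>f. N f)" using car_homog_span w by (auto simp: twt_def)
    show "w \<in> S.geig UNIV (\<lambda>_. x)" using w tg by blast
  qed
  then show ?thesis by (simp add: N_def)
qed

lemma twt_finite: "\<exists>B. finite B \<and> twt x \<subseteq> span B"
proof -
  have "\<forall>n::int. \<exists>B. finite B \<and> wt n \<subseteq> span B" using weight_finite by blast
  then obtain B where B: "\<And>n::int. finite (B n)" "\<And>n. wt n \<subseteq> span (B n)" by metis
  let ?B = "\<Union>(l, n)\<in>sect x. B n"
  have "(\<Union>(l, n)\<in>sect x. G l \<inter> wt n) \<subseteq> span ?B"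
  proof safe
    fix l n a assume "(l, n) \<in> sect x" "a \<in> vweight V (of_int n)"
    then show "a \<in> span ?B" using B(2)[of n] span_mono[of "B n" ?B] by blast
  qed
  then have "span (\<Union>(l, n)\<in>sect x. G l \<inter> wt n) \<subseteq> span ?B" by (rule span_minimal) (rule subspace_span)
  then have "twt x \<subseteq> span ?B" using twt_span by blast
  moreover have "finite ?B" using finite_sect B(1) by auto
  ultimately show ?thesis by blast
qed

lemma twt_bounded: "\<exists>N::nat. \<forall>n\<ge>N. twt (x - of_nat n) = {0}"
proof -
  let ?r = "\<lambda>l. Re (bil l l) / 2 + Re (bil mu l)"
  let ?C = "Re x - Re (bil mu mu / 2)"
  let ?S = "{l \<in> Lam. ?r l \<le> ?C}"
  have fin: "finite (?r ` ?S)" using mu_fin by (rule finite_imageI)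
  obtain b where b: "\<And>y. y \<in> ?r ` ?S \<Longrightarrow> b \<le> y" using bdd_below_finite[OF fin] unfolding bdd_below_def by blast
  obtain N :: nat where N: "real N > ?C - b" using reals_Archimedean2 by blast
  have "twt (x - of_nat n) = {0}" if n: "n \<ge> N" for n
  proof -
    have "sect (x - of_nat n) = {}"
    proof (rule ccontr)
      assume "sect (x - of_nat n) \<noteq> {}"
      then obtain l m where lm: "(l, m) \<in> sect (x - of_nat n)" by auto
      from sect_props[OF lm] have l: "l \<in> Lam" "?r l \<le> ?C - real n" by auto
      then have "l \<in> ?S" by simp
      then have "b \<le> ?r l" using b by blast
      then show False using l N n by linarith
    qed
    then have "twt (x - of_nat n) \<subseteq> {0}" using twt_span[of _ "x - of_nat n"] by auto
    then show ?thesis using subspace_0[OF subspace_twt] by blast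
  qed
  then show ?thesis by blast
qed

lemma car_twt: "car = span (\<Union>x. twt x)"
proof
  have "G l \<inter> wt n \<subseteq> (\<Union>x. twt x)" for l n
    using tL0_homogeneous wtD unfolding twt_def by blast
  then have "(\<Union>(l, n). G l \<inter> wt n) \<subseteq> (\<Union>x. twt x)" by blast
  then show "car \<subseteq> span (\<Union>x. twt x)" using car_homog_span span_mono by blast
  show "span (\<Union>x. twt x) \<subseteq> car" by (rule span_minimal[OF _ subspace_vcar]) (auto simp: twt_def)
qed

text \<open>The deformation is unitriangular: \<open>Y u n\<close> is a deformed mode of
  \<open>u\<close> minus modes of the vectors \<open>D (Suc k) u\<close>, which have smaller weight.
  Induction on the weight recovers the original modes, and simplicity applies.\<close>

lemma tact_submodule:
  assumes N: "subspace N" "N \<subseteq> car" "\<And>u n w. u \<in> car \<Longrightarrow> w \<in> N \<Longrightarrow> tact u n w \<in> N"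
  shows "N = {0} \<or> N = car"
proof (rule simple[OF N(1,2)])
  have hom: "\<forall>u n. u \<in> G l \<and> u \<in> wt (int b) \<longrightarrow> (\<forall>w\<in>N. Y u n w \<in> N)" for l b
  proof (induction b rule: less_induct)
    case (less b)
    show ?case
    proof (intro allI impI ballI)
      fix u n w assume u: "u \<in> G l \<and> u \<in> wt (int b)" and w: "w \<in> N"
      have wC: "w \<in> car" using w N by blast
      have uC: "u \<in> car" using u wtD by blast
      have "tact u (n - kap l) w = (\<Sum>k<Suc b. Y (D k u) (n - kap l + kap l - int k) w)"
        by (rule tact_G[OF conjunct1[OF u] _ wC]) (rule D_zero_wt[OF conjunct2[OF u]], simp)
      also have "\<dots> = Y u n w + (\<Sum>k<b. Y (D (Suc k) u) (n - int (Suc k)) w)"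
        by (subst sum.lessThan_Suc_shift) simp
      finally have eq: "Y u n w = tact u (n - kap l) w - (\<Sum>k<b. Y (D (Suc k) u) (n - int (Suc k)) w)"
        by simp
      have "Y (D (Suc k) u) m w \<in> N" if "k < b" for k m
      proof -
        have "D (Suc k) u \<in> wt (int b - int (Suc k))" by (rule D_wt) (use u in blast)
        moreover have "int b - int (Suc k) = int (b - Suc k)" using that by simp
        ultimately have "D (Suc k) u \<in> wt (int (b - Suc k))" by (simp only:)
        moreover have "D (Suc k) u \<in> G l" using D_G u by blast
        ultimately show ?thesis using less.IH[of "b - Suc k"] that w by simp
      qed
      then show "Y u n w \<in> N" unfolding eq
        using N(3)[OF uC w] by (intro subspace_diff[OF N(1)] subspace_sum[OF N(1)]) auto
    qed
  qed
  fix u n w assume u: "u \<in> car" and w: "w \<in> N"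
  have wC: "w \<in> car" using w N by blast
  have "G l \<inter> wt m \<subseteq> {u \<in> car. Y u n w \<in> N}" for l m
  proof
    fix u assume u: "u \<in> G l \<inter> wt m"
    show "u \<in> {u \<in> car. Y u n w \<in> N}"
    proof (cases "m < 0")
      case True
      then have "u = 0" using wt_neg u by blast
      then show ?thesis using wC subspace_0[OF N(1)] by simp
    next
      case False
      then have "u \<in> G l \<and> u \<in> wt (int (nat m))" using u by simp
      then show ?thesis using hom[of l "nat m"] w G_car by blast
    qed
  qed
  then have "(\<Union>(l, m). G l \<inter> wt m) \<subseteq> {u \<in> car. Y u n w \<in> N}" by blast
  moreover have "subspace {u \<in> car. Y u n w \<in> N}"
    using wC by (intro subspaceI)
      (auto simp: mode_add_left mode_scale_left car_add car_scale subspace_0[OF N(1)] subspace_add[OF N(1)] subspace_scale[OF N(1)])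
  ultimately have "span (\<Union>(l, m). G l \<inter> wt m) \<subseteq> {u \<in> car. Y u n w \<in> N}" by (rule span_minimal)
  then show "Y u n w \<in> N" using u car_homog_span by blast
qed

text \<open>The effect intended by the shift: on the deformed module every zero mode gains the
  corresponding coordinate of \<open>mu\<close>.\<close>

lemma tact_t: "w \<in> car \<Longrightarrow> tact (t i) 0 w = T i w + mu $ i \<odot> w"
proof -
  assume w: "w \<in> car"
  have tG: "t i \<in> G 0" using h_G[OF vac_G, of i "-1"] by (simp add: creation t_car)
  have "tact (t i) 0 w = (\<Sum>k<2. Y (D k (t i)) (0 + kap 0 - int k) w)"
    by (rule tact_G[OF tG _ w]) (rule D_zero_wt[OF t_wt], simp)
  also have "\<dots> = T i w + Y (D 1 (t i)) (-1) w" by (simp add: numeral_2_eq_2)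
  also have "D 1 (t i) = mu $ i \<odot> vac V"
    by (simp add: A_def tm_mode t_car t_prod if_distrib[of "vscale V _"] cong: if_cong)
  finally show ?thesis using w by (simp add: mode_scale_left vac_in vac_mode)
qed

lemma countable_span: "\<exists>s :: nat \<Rightarrow> 'v. car \<subseteq> span (range s)"
proof -
  have "\<forall>n::int. \<exists>B. finite B \<and> wt n \<subseteq> span B" using weight_finite by blast
  then obtain B where B: "\<And>n::int. finite (B n)" "\<And>n. wt n \<subseteq> span (B n)" by metis
  have "countable (insert 0 (\<Union>n. B n))" using B(1) by (simp add: countable_finite)
  then obtain s :: "nat \<Rightarrow> 'v" where s: "range s = insert 0 (\<Union>n. B n)"
    using range_from_nat_into[of "insert 0 (\<Union>n. B n)"] by blast
  have "wt n \<subseteq> span (range s)" for n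
    using B(2)[of n] span_mono[of "B n" "range s"] s by blast
  then have "(\<Union>n. wt n) \<subseteq> span (range s)" by blast
  then have "car \<subseteq> span (range s)" unfolding graded by (rule span_minimal) (rule subspace_span)
  then show ?thesis by blast
qed

text \<open>\<open>holomorphic_voa\<close> speaks of modules carried by
  \<open>nat \<Rightarrow>\<^sub>0 complex\<close>. The carrier has countable dimension, so
  \<open>ps\<close> can move the deformed module there; \<open>ph\<close> moves it back.\<close>

lemma countable_model:
  "\<exists>(ph :: (nat \<Rightarrow>\<^sub>0 complex) \<Rightarrow> 'v) ps. Vector_Spaces.linear fock_scale (vscale V) ph \<and>
     Vector_Spaces.linear (vscale V) fock_scale ps \<and> (\<forall>v\<in>car. ph (ps v) = v)"
proof -
  obtain s :: "nat \<Rightarrow> 'v" where s: "car \<subseteq> span (range s)" using countable_span by blast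
  define ph where "ph = (\<lambda>v :: nat \<Rightarrow>\<^sub>0 complex. \<Sum>k\<in>Poly_Mapping.keys v. Poly_Mapping.lookup v k \<odot> s k)"
  have ph: "ph v = (\<Sum>k\<in>K. Poly_Mapping.lookup v k \<odot> s k)" if "finite K" "Poly_Mapping.keys v \<subseteq> K" for v K
    unfolding ph_def using that by (intro sum.mono_neutral_left) (auto simp: in_keys_iff)
  interpret fs: vector_space "fock_scale :: complex \<Rightarrow> (nat \<Rightarrow>\<^sub>0 complex) \<Rightarrow> _" by (rule vector_space_fock_scale)
  interpret pr: vector_space_pair "fock_scale :: complex \<Rightarrow> (nat \<Rightarrow>\<^sub>0 complex) \<Rightarrow> _" "vscale V" ..
  have lin: "Vector_Spaces.linear fock_scale (vscale V) ph"
  proof unfold_locales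
    fix a b :: "nat \<Rightarrow>\<^sub>0 complex" and r
    let ?K = "Poly_Mapping.keys a \<union> Poly_Mapping.keys b"
    have "ph (a + b) = (\<Sum>k\<in>?K. Poly_Mapping.lookup (a + b) k \<odot> s k)"
      by (rule ph) (use Poly_Mapping.keys_add[of a b] in auto)
    also have "\<dots> = ph a + ph b"
      by (simp add: ph[of ?K a] ph[of ?K b] lookup_add scale_left_distrib sum.distrib)
    finally show "ph (a + b) = ph a + ph b" .
    have "ph (fock_scale r a) = (\<Sum>k\<in>Poly_Mapping.keys a. Poly_Mapping.lookup (fock_scale r a) k \<odot> s k)"
      by (rule ph) (auto simp: in_keys_iff)
    then show "ph (fock_scale r a) = r \<odot> ph a" by (simp add: ph_def scale_sum_right)
  qed
  have ran: "car \<subseteq> ph ` UNIV"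
  proof -
    have "s k = ph (Poly_Mapping.single k 1)" for k by (simp add: ph_def)
    then have "range s \<subseteq> range ph" by auto
    moreover have "subspace (range ph)" using pr.linear_subspace_image[OF lin fs.subspace_UNIV] .
    ultimately show ?thesis using s span_minimal by blast
  qed
  obtain ps where ps: "Vector_Spaces.linear (vscale V) fock_scale ps" "\<forall>v\<in>ph ` UNIV. ph (ps v) = v"
    using pr.linear_exists_right_inverse_on[OF lin fs.subspace_UNIV] by blast
  then show ?thesis using lin ran by blast
qed

text \<open>Holomorphy identifies the deformed module with \<open>V\<close>. The vacuum, on which
  the deformed zero modes act by \<open>mu\<close>, goes to a nonzero vector of
  \<open>G mu\<close>.\<close>

theorem shift_in_Lam:
  assumes hol: "holomorphic_voa V"
  shows "mu \<in> Lam"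
proof -
  obtain ph :: "(nat \<Rightarrow>\<^sub>0 complex) \<Rightarrow> 'v" and ps
    where ph: "Vector_Spaces.linear fock_scale (vscale V) ph"
      and ps: "Vector_Spaces.linear (vscale V) fock_scale ps"
      and inv: "\<And>v. v \<in> car \<Longrightarrow> ph (ps v) = v"
    using countable_model by blast
  interpret fs: vector_space "fock_scale :: complex \<Rightarrow> (nat \<Rightarrow>\<^sub>0 complex) \<Rightarrow> _" by (rule vector_space_fock_scale)
  interpret pr: vector_space_pair "vscale V" "fock_scale :: complex \<Rightarrow> (nat \<Rightarrow>\<^sub>0 complex) \<Rightarrow> _" ..
  interpret ph: Vector_Spaces.linear fock_scale "vscale V" ph by (rule ph)
  interpret ps: Vector_Spaces.linear "vscale V" fock_scale ps by (rule ps)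
  \<comment> \<open>Nonintegral modes are zero, as in \<open>adjoint_module\<close>.\<close>
  define M :: "('v, nat \<Rightarrow>\<^sub>0 complex) vmodule" where
    "M = \<lparr>mcar = ps ` car, mscale = fock_scale,
       mmode = (\<lambda>u n x. if n \<in> \<int> then ps (tact u \<lfloor>n\<rfloor> (ph x)) else 0)\<rparr>"
  have Mc: "mcar M = ps ` car" and Ms: "mscale M = fock_scale" by (simp_all add: M_def)
  have Mm: "mmode M u (of_int n) (ps w) = ps (tact u n w)" if "w \<in> car" for u n w
    using that by (simp add: M_def inv)
  have Mz: "n \<notin> \<int> \<Longrightarrow> mmode M u n x = 0" for u n x by (simp add: M_def)
  have inj: "ps v = ps w \<longleftrightarrow> v = w" if "v \<in> car" "w \<in> car" for v w using inv that by metis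
  have wts: "mweight V M x = ps ` twt x" for x
  proof -
    have "mmode M (conf V) 1 (ps w) = ps (tL0 w)" if "w \<in> car" for w
      using Mm[OF that, of "conf V" 1] tact_conf[OF that] by (simp add: tL0_def)
    then show ?thesis
      unfolding mweight_def Mc Ms twt_def by (auto simp: ps.scale[symmetric] inj car_scale tL0_car)
  qed
  have tw: "twisted_module V id 1 M"
  proof (unfold_locales, unfold Ms Mc)
    show "fs.subspace (ps ` car)" by (rule ps.subspace_image[OF subspace_vcar])
    show "mmode M u n w \<in> ps ` car" if "u \<in> car" "w \<in> ps ` car" for u n w
    proof (cases "n \<in> \<int>")
      case True
      then obtain m where "n = of_int m" by (auto elim: Ints_cases)
      then show ?thesis using that Mm tact_closed by auto
    next
      case False
      then show ?thesis using Mz ps.zero car_zero by (metis image_eqI)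
    qed
    show "mmode M (u + u') n w = mmode M u n w + mmode M u' n w"
      if "u \<in> car" "u' \<in> car" "w \<in> ps ` car" for u u' n w
    proof (cases "n \<in> \<int>")
      case True
      then obtain m where "n = of_int m" by (auto elim: Ints_cases)
      then show ?thesis using that by (auto simp: Mm tact_add_left ps.add)
    qed (simp add: Mz)
    show "mmode M u n (w + w') = mmode M u n w + mmode M u n w'"
      if "u \<in> car" "w \<in> ps ` car" "w' \<in> ps ` car" for u n w w'
    proof (cases "n \<in> \<int>")
      case True
      then obtain m where "n = of_int m" by (auto elim: Ints_cases)
      then show ?thesis using that by (auto simp: Mm tact_add_right ps.add[symmetric] car_add)
    qed (simp add: Mz)
    show "mmode M (vscale V a u) n w = fock_scale a (mmode M u n w)"
      if "u \<in> car" "w \<in> ps ` car" for u w a n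
    proof (cases "n \<in> \<int>")
      case True
      then obtain m where "n = of_int m" by (auto elim: Ints_cases)
      then show ?thesis using that by (auto simp: Mm tact_scale_left ps.scale)
    qed (simp add: Mz)
    show "mmode M u n (fock_scale a w) = fock_scale a (mmode M u n w)"
      if "u \<in> car" "w \<in> ps ` car" for u w n a
    proof (cases "n \<in> \<int>")
      case True
      then obtain m where "n = of_int m" by (auto elim: Ints_cases)
      then show ?thesis using that by (auto simp: Mm tact_scale_right ps.scale[symmetric] car_scale)
    qed (simp add: Mz)
    show "\<exists>N. \<forall>n\<ge>N. mmode M u n w = 0" if u: "u \<in> car" and w: "w \<in> ps ` car" for u w
    proof -
      obtain v where v: "w = ps v" "v \<in> car" using w by blast
      obtain N where N: "\<forall>n\<ge>N. tact u n v = 0" using tact_truncation[OF u v(2)] by blast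
      have "mmode M u n w = 0" if n: "n \<ge> of_int N" for n
      proof (cases "n \<in> \<int>")
        case True
        then obtain m where m: "n = of_int m" by (auto elim: Ints_cases)
        then have "N \<le> m" using n by simp
        then show ?thesis using m v N by (simp add: Mm ps.zero)
      qed (simp add: Mz)
      then show ?thesis by blast
    qed
    show "mmode M u n w = 0" if "n - of_nat r / of_nat 1 \<notin> \<int>" "r < 1" for r :: nat and u n w
      using that by (simp add: Mz)
    show "mmode M (vac V) n w = (if n = - 1 then w else 0)" if w: "w \<in> ps ` car" for w n
    proof (cases "n \<in> \<int>")
      case True
      then obtain m where m: "n = of_int m" by (auto elim: Ints_cases)
      moreover have "(of_int m = (-1::rat)) = (m = -1)" by (metis of_int_1 of_int_eq_iff of_int_minus)
      moreover obtain x where "w = ps x" "x \<in> car" using w by blast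
      ultimately show ?thesis using Mm[of x "vac V" m] by (simp add: tact_vac ps.zero)
    next
      case False
      then have "n \<noteq> -1" by auto
      then show ?thesis using False by (simp add: Mz)
    qed
    show "Sum_any (\<lambda>j. fock_scale (of_rat p gchoose j) (mmode M (Y u (l + int j) v) (p + q - of_nat j) w)) =
      Sum_any (\<lambda>j. fock_scale ((- 1) ^ j * (of_int l gchoose j))
          (mmode M u (p + of_int l - of_nat j) (mmode M v (q + of_nat j) w) -
           fock_scale ((- 1) powi l) (mmode M v (q + of_int l - of_nat j) (mmode M u (p + of_nat j) w))))"
      if r: "r < 1" "u \<in> eigenspace V id 1 r" "p - of_nat r / of_nat 1 \<in> \<int>"
        and s: "s < 1" "v \<in> eigenspace V id 1 s" "q - of_nat s / of_nat 1 \<in> \<int>"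
        and w: "w \<in> ps ` car" for r s :: nat and u p v q w l
    proof -
      have uv: "u \<in> car" "v \<in> car" using r s by (auto simp: eigenspace_def)
      obtain p' where p: "p = of_int p'" using r by (auto elim: Ints_cases)
      obtain q' where q: "q = of_int q'" using s by (auto elim: Ints_cases)
      obtain x where x: "w = ps x" "x \<in> car" using w by blast
      have cc: "tact u n y \<in> car" "tact v n y \<in> car" "tact (Y u k v) n y \<in> car" if "y \<in> car" for n y k
        using tact_closed uv mode_closed that by blast+
      have e1: "(of_int a + of_int b - of_nat j :: rat) = of_int (a + b - int j)" for a b j by simp
      have e2: "(of_int a + of_nat j :: rat) = of_int (a + int j)" for a j by simp
      have e3: "(of_rat (of_int a) :: complex) = of_int a" for a by simp
      let ?L = "\<lambda>j. (of_int p' gchoose j) \<odot> tact (Y u (l + int j) v) (p' + q' - int j) x"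
      let ?R = "\<lambda>j. ((- 1) ^ j * (of_int l gchoose j)) \<odot>
          (tact u (p' + l - int j) (tact v (q' + int j) x) - ((- 1) powi l) \<odot> tact v (q' + l - int j) (tact u (p' + int j) x))"
      have L: "fock_scale (of_rat p gchoose j) (mmode M (Y u (l + int j) v) (p + q - of_nat j) w) = ps (?L j)" for j
        unfolding p q e1 e3 x Mm[OF x(2)] by (simp add: ps.scale)
      have R: "fock_scale ((- 1) ^ j * (of_int l gchoose j))
          (mmode M u (p + of_int l - of_nat j) (mmode M v (q + of_nat j) w) -
           fock_scale ((- 1) powi l) (mmode M v (q + of_int l - of_nat j) (mmode M u (p + of_nat j) w))) = ps (?R j)" for j
        unfolding p q e1 e2 x using cc x(2) by (simp only: Mm ps.scale ps.diff)
      obtain N1 where N1: "\<And>j. j \<ge> N1 \<Longrightarrow> Y u (l + int j) v = 0" using truncation_nat[OF uv] by blast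
      obtain Nu where Nu: "\<And>n. n \<ge> Nu \<Longrightarrow> tact u n x = 0" using tact_truncation[OF uv(1) x(2)] by blast
      obtain Nv where Nv: "\<And>n. n \<ge> Nv \<Longrightarrow> tact v n x = 0" using tact_truncation[OF uv(2) x(2)] by blast
      obtain N2 where N2: "\<forall>M\<ge>N2. blhs u v x p' l q' M = brhs u v x p' l q' M"
        using tact_borcherds_fin[OF uv x(2)] by blast
      define N where "N = max (max N1 N2) (nat (max (Nu - p') (Nv - q')))"
      have zL: "?L j = 0" if "j \<ge> N" for j
        using that N1[of j] tact_scale_left[of 0 x 0] x(2) by (simp add: N_def)
      have zR: "?R j = 0" if "j \<ge> N" for j
      proof -
        have "Nu \<le> p' + int j" "Nv \<le> q' + int j" using that by (auto simp: N_def)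
        then show ?thesis using Nu[of "p' + int j"] Nv[of "q' + int j"] uv by (simp add: tact_0_right)
      qed
      have "Sum_any (\<lambda>j. ps (?L j)) = ps (blhs u v x p' l q' N)"
        unfolding blhs_def ps.sum by (rule Sum_any_eq_sum) (simp add: zL ps.zero)
      also have "\<dots> = ps (brhs u v x p' l q' N)" using N2 by (simp add: N_def)
      also have "\<dots> = Sum_any (\<lambda>j. ps (?R j))"
        unfolding brhs_def ps.sum by (rule Sum_any_eq_sum[symmetric]) (simp add: zR ps.zero del: mult_eq_0_iff scale_eq_0_iff)
      finally show ?thesis unfolding L R .
    qed
    show "ps ` car = fs.span (\<Union>x. mweight V M x)"
      unfolding wts image_UN[symmetric] ps.span_image car_twt[symmetric] ..
    show "\<exists>B. finite B \<and> mweight V M x \<subseteq> fs.span B" for x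
    proof -
      obtain B where B: "finite B" "twt x \<subseteq> span B" using twt_finite by blast
      then have "ps ` twt x \<subseteq> fs.span (ps ` B)" unfolding ps.span_image by blast
      then show ?thesis using B(1) unfolding wts by blast
    qed
    show "\<exists>N. \<forall>n\<ge>N. mweight V M (x - of_nat n / of_nat 1) = {0}" for x
    proof -
      obtain N :: nat where N: "\<forall>n\<ge>N. twt (x - of_nat n) = {0}" using twt_bounded by blast
      have "mweight V M (x - of_nat n / of_nat 1) = {0}" if "n \<ge> N" for n
        using N that unfolding wts by (simp add: ps.zero)
      then show ?thesis by blast
    qed
  qed (simp_all add: fs.scale_right_distrib fs.scale_left_distrib)
  have irr: "irreducible_twisted_module V id 1 M"
    unfolding irreducible_twisted_module_def
  proof (intro conjI allI impI tw)
    show "mcar M \<noteq> {0}"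
    proof
      assume "mcar M = {0}"
      then have "ps (vac V) = 0" using vac_in Mc by blast
      then show False using inj[of "vac V" 0] vac_nonzero vac_in by (simp add: ps.zero)
    qed
  next
    fix N assume N: "submodule V M N"
    let ?N = "{v \<in> car. ps v \<in> N}"
    have NM: "N \<subseteq> ps ` car" and sN: "fs.subspace N" and NY: "\<And>u n w. u \<in> car \<Longrightarrow> w \<in> N \<Longrightarrow> mmode M u n w \<in> N"
      using N unfolding submodule_def Mc Ms by auto
    have Neq: "N = ps ` ?N" using NM by blast
    have "?N = {0} \<or> ?N = car"
    proof (rule tact_submodule)
      show "subspace ?N"
        by (rule subspaceI) (auto simp: ps.zero ps.add ps.scale car_add car_scale fs.subspace_0[OF sN] fs.subspace_add[OF sN] fs.subspace_scale[OF sN])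
      show "tact u n w \<in> ?N" if "u \<in> car" "w \<in> ?N" for u n w
        using that NY[of u "ps w" "of_int n"] tact_closed by (auto simp: Mm)
    qed auto
    then show "N = {0} \<or> N = mcar M"
    proof
      assume "?N = {0}"
      then have "N = {0}" by (subst Neq) (simp only: image_insert image_empty ps.zero)
      then show ?thesis ..
    next
      assume "?N = car"
      then have "N = mcar M" by (subst Neq) (simp only: Mc)
      then show ?thesis ..
    qed
  qed
  have "module_isomorphic V M (adjoint_module V)"
    using hol irr unfolding holomorphic_voa_def by blast
  then obtain f where f: "Vector_Spaces.linear fock_scale (vscale V) f" "bij_betw f (ps ` car) car"
    "\<And>u n w. u \<in> car \<Longrightarrow> w \<in> ps ` car \<Longrightarrow> f (mmode M u n w) = mmode (adjoint_module V) u n (f w)"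
    unfolding module_isomorphic_def by (auto simp: Mc Ms adjoint_module_def)
  interpret f: Vector_Spaces.linear fock_scale "vscale V" f by (rule f(1))
  define b where "b = f (ps (vac V))"
  have bC: "b \<in> car" unfolding b_def using f(2) vac_in by (auto simp: bij_betw_def)
  have "b \<noteq> 0"
  proof
    assume "b = 0"
    then have eq: "f (ps (vac V)) = f (ps 0)" by (simp add: b_def ps.zero f.zero)
    have "inj_on f (ps ` car)" using f(2) by (simp add: bij_betw_def)
    then have "ps (vac V) = ps 0"
      by (rule inj_onD[where x = "ps (vac V)" and y = "ps 0", OF _ eq]) (use vac_in car_zero in blast)+
    then show False using inj[of "vac V" 0] vac_in vac_nonzero by simp
  qed
  moreover have "b \<in> G mu"
    unfolding G_eq
  proof (intro CollectI conjI allI bC)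
    fix i
    have "f (mmode M (t i) (of_int 0) (ps (vac V))) = mmode (adjoint_module V) (t i) (of_int 0) b"
      unfolding b_def using f(3)[OF t_car] vac_in by blast
    then have "f (ps (tact (t i) 0 (vac V))) = T i b"
      unfolding Mm[OF vac_in] by (simp add: adjoint_module_def)
    then show "T i b = mu $ i \<odot> b"
      by (simp add: tact_t vac_in T_vac ps.scale f.scale b_def)
  qed
  ultimately show ?thesis by (rule Lam_I[rotated])
qed

end

section \<open>Operators on the Fock space\<close>

interpretation fock: vector_space "fock_scale :: complex \<Rightarrow> ('b \<Rightarrow>\<^sub>0 complex) \<Rightarrow> _"
  by (rule vector_space_fock_scale)

lemma fock_scale_single [simp]: "fock_scale a (Poly_Mapping.single b c) = Poly_Mapping.single b (a * c)"
  by (rule poly_mapping_eqI) (simp add: lookup_single when_def)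

lemma fock_lift_superset:
  "finite K \<Longrightarrow> Poly_Mapping.keys v \<subseteq> K \<Longrightarrow> fock_lift f v = (\<Sum>b\<in>K. fock_scale (Poly_Mapping.lookup v b) (f b))"
  unfolding fock_lift_def by (intro sum.mono_neutral_left) (auto simp: in_keys_iff)

lemma fock_lift_add: "fock_lift f (u + v) = fock_lift f u + fock_lift f v"
proof -
  let ?K = "Poly_Mapping.keys u \<union> Poly_Mapping.keys v"
  show ?thesis
    using Poly_Mapping.keys_add[of u v]
    by (simp add: fock_lift_superset[of ?K] lookup_add fock.scale_left_distrib sum.distrib)
qed

lemma fock_lift_scale: "fock_lift f (fock_scale a v) = fock_scale a (fock_lift f v)"
proof -
  have "Poly_Mapping.keys (fock_scale a v) \<subseteq> Poly_Mapping.keys v" by (auto simp: in_keys_iff)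
  then show ?thesis
    by (simp add: fock_lift_superset[of "Poly_Mapping.keys v"] fock.scale_sum_right)
qed

lemma fock_lift_single [simp]: "fock_lift f (Poly_Mapping.single b c) = fock_scale c (f b)"
  by (cases "c = 0") (simp_all add: fock_lift_def)

lemma fock_lift_singles: "fock_lift (\<lambda>b. Poly_Mapping.single b 1) v = v"
  by (rule poly_mapping_eqI) (simp add: fock_lift_def lookup_sum lookup_single when_def in_keys_iff)

definition fock_linear :: "(('b \<Rightarrow>\<^sub>0 complex) \<Rightarrow> ('c \<Rightarrow>\<^sub>0 complex)) \<Rightarrow> bool" where
  "fock_linear A \<longleftrightarrow> (\<forall>u v. A (u + v) = A u + A v) \<and> (\<forall>c u. A (fock_scale c u) = fock_scale c (A u))"

lemma fock_linear_add: "fock_linear A \<Longrightarrow> A (u + v) = A u + A v" by (simp add: fock_linear_def)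
lemma fock_linear_scale: "fock_linear A \<Longrightarrow> A (fock_scale c u) = fock_scale c (A u)" by (simp add: fock_linear_def)
lemma fock_linear_0: "fock_linear A \<Longrightarrow> A 0 = 0" using fock_linear_scale[of A 0 0] by simp
lemma fock_linear_minus: "fock_linear A \<Longrightarrow> A (- u) = - A u" using fock_linear_scale[of A "-1" u] by simp
lemma fock_linear_diff: "fock_linear A \<Longrightarrow> A (u - v) = A u - A v"
  using fock_linear_add[of A u "- v"] fock_linear_minus[of A v] by simp
lemma fock_linear_sum: "fock_linear A \<Longrightarrow> A (sum f S) = (\<Sum>x\<in>S. A (f x))"
  by (induction S rule: infinite_finite_induct) (auto simp: fock_linear_0 fock_linear_add)

lemma fock_linear_lift [intro]: "fock_linear (fock_lift f)"
  by (simp add: fock_linear_def fock_lift_add fock_lift_scale)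

lemma fock_linear_eq:
  assumes "fock_linear A" "fock_linear B" "\<And>b. b \<in> Poly_Mapping.keys v \<Longrightarrow> A (Poly_Mapping.single b 1) = B (Poly_Mapping.single b 1)"
  shows "A v = B v"
proof -
  have v: "v = (\<Sum>b\<in>Poly_Mapping.keys v. fock_scale (Poly_Mapping.lookup v b) (Poly_Mapping.single b 1))"
    using fock_lift_singles[of v] unfolding fock_lift_def by simp
  show ?thesis
    by (subst (1 2) v) (simp only: fock_linear_sum[OF assms(1)] fock_linear_sum[OF assms(2)]
        fock_linear_scale[OF assms(1)] fock_linear_scale[OF assms(2)] assms(3) cong: sum.cong)
qed

abbreviation heisb :: "'n::finite \<Rightarrow> int \<Rightarrow> 'n fock \<Rightarrow> 'n fock" where
  "heisb i m \<equiv> fock_lift (heis_basis i m)"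

lemma fock_linear_heis [intro]: "fock_linear (heis a m)"
  unfolding fock_linear_def heis_def
  by (simp add: fock_lift_add fock_lift_scale fock.scale_right_distrib sum.distrib fock.scale_sum_right mult.commute)

lemma heis_axis: "heis (axis i 1) m v = heisb i m v"
proof -
  have "heis (axis i 1) m v = (\<Sum>j\<in>UNIV. if j = i then heisb j m v else 0)"
    unfolding heis_def by (intro sum.cong refl) (auto simp: axis_def)
  then show ?thesis by simp
qed

abbreviation fcre :: "'n::finite \<Rightarrow> nat \<Rightarrow> 'n fock \<Rightarrow> 'n fock" where
  "fcre j k \<equiv> fock_lift (heis_basis j (- int k - 1))"

lemma fcre_single: "fcre j k (Poly_Mapping.single (P, a) c) = Poly_Mapping.single (add_mset (j, k) P, a) c"
proof -
  have "nat (- (- int k - 1)) - 1 = k" by simp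
  then show ?thesis by (simp add: heis_basis_def)
qed

text \<open>The Heisenberg relation on the multiset basis. Removing an absent element leaves a
  multiset unchanged, but there the coefficient \<open>count\<close> is zero.\<close>

lemma heisb_fcre_pos:
  assumes "m > 0"
  shows "heisb i m (fcre j k v) = fcre j k (heisb i m v) + (if i = j \<and> m = int k + 1 then fock_scale (of_int m) v else 0)"
proof (rule fock_linear_eq[where A = "\<lambda>v. heisb i m (fcre j k v)"
      and B = "\<lambda>v. fcre j k (heisb i m v) + (if i = j \<and> m = int k + 1 then fock_scale (of_int m) v else 0)"])
  show "fock_linear (\<lambda>v. heisb i m (fcre j k v))" by (simp add: fock_linear_def fock_lift_add fock_lift_scale)
  show "fock_linear (\<lambda>v. fcre j k (heisb i m v) + (if i = j \<and> m = int k + 1 then fock_scale (of_int m) v else 0))"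
    by (cases "i = j \<and> m = int k + 1")
      (simp_all only: fock_linear_def fock_lift_add fock_lift_scale fock.scale_right_distrib fock.scale_scale mult.commute
        if_True if_False add_0_right add_0_left fock.scale_zero_right add_ac simp_thms)
  fix b :: "('a \<times> nat) multiset \<times> (real^'a)" assume "b \<in> Poly_Mapping.keys v"
  obtain P a where b: "b = (P, a)" by force
  let ?x = "(j, k)" and ?y = "(i, nat m - 1)"
  have eq: "(i = j \<and> m = int k + 1) \<longleftrightarrow> ?y = ?x" using assms by auto
  have h: "heisb i m (Poly_Mapping.single (Q, a) c) = Poly_Mapping.single (Q - {#?y#}, a) (c * (of_int m * of_nat (count Q ?y)))" for Q c
    using assms by (simp add: heis_basis_def)
  show "heisb i m (fcre j k (Poly_Mapping.single b 1)) = fcre j k (heisb i m (Poly_Mapping.single b 1)) +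
      (if i = j \<and> m = int k + 1 then fock_scale (of_int m) (Poly_Mapping.single b 1) else 0)"
  proof (cases "?y = ?x")
    case True
    show ?thesis
    proof (cases "count P ?x = 0")
      case c0: True
      then show ?thesis unfolding b fcre_single h eq using True by simp
    next
      case False
      then have "add_mset ?x (P - {#?x#}) = P" by (metis count_eq_zero_iff insert_DiffM)
      then show ?thesis unfolding b fcre_single h eq
        using True by (simp add: single_add[symmetric] algebra_simps)
    qed
  next
    case False
    show ?thesis
    proof (cases "count P ?y = 0")
      case True
      have "count (add_mset ?x P) ?y = 0" using True False by auto
      then show ?thesis unfolding b fcre_single h eq if_not_P[OF False] using True by simp
    next
      case c: False
      have "add_mset ?x P - {#?y#} = add_mset ?x (P - {#?y#})"
        using False by (metis diff_union_swap)
      moreover have "count (add_mset ?x P) ?y = count P ?y" using False by auto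
      ultimately show ?thesis unfolding b fcre_single h eq if_not_P[OF False] by (simp only: fcre_single add_0_right)
    qed
  qed
qed

lemma heisb_fcre_neg:
  assumes "m < 0"
  shows "heisb i m (fcre j k v) = fcre j k (heisb i m v)"
proof (rule fock_linear_eq[where A = "\<lambda>v. heisb i m (fcre j k v)" and B = "\<lambda>v. fcre j k (heisb i m v)"])
  fix b :: "('a \<times> nat) multiset \<times> (real^'a)" assume "b \<in> Poly_Mapping.keys v"
  obtain P a where b: "b = (P, a)" by force
  have h: "heisb i m (Poly_Mapping.single (Q, a) c) = Poly_Mapping.single (add_mset (i, nat (- m) - 1) Q, a) c" for Q c
    using assms by (simp add: heis_basis_def)
  show "heisb i m (fcre j k (Poly_Mapping.single b 1)) = fcre j k (heisb i m (Poly_Mapping.single b 1))"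
    unfolding b fcre_single h by (simp add: add_mset_commute)
qed (simp_all add: fock_linear_def fock_lift_add fock_lift_scale)

lemma heis_fcre_pos:
  "m > 0 \<Longrightarrow> heis a m (fcre j k v) = fcre j k (heis a m v) + (if m = int k + 1 then fock_scale (of_int m * of_real (a $ j)) v else 0)"
  unfolding heis_def heisb_fcre_pos
  by (simp add: fock.scale_right_distrib sum.distrib fock_linear_sum[OF fock_linear_lift] fock_lift_scale
      if_distrib[of "fock_scale _"] mult.commute cong: if_cong)

lemma heis_fcre_neg: "m < 0 \<Longrightarrow> heis a m (fcre j k v) = fcre j k (heis a m v)"
  unfolding heis_def heisb_fcre_neg
  by (simp add: fock_linear_sum[OF fock_linear_lift] fock_lift_scale)

lemma fock_linear_exp_coeff:
  assumes "\<And>m. fock_linear (A m)"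
  shows "fock_linear (exp_coeff A k)"
proof (induction k rule: less_induct)
  case (less k)
  show ?case
  proof (cases k)
    case 0
    then show ?thesis by (simp add: fock_linear_def)
  next
    case (Suc k')
    have "fock_linear (exp_coeff A (k' - j))" for j using less Suc by simp
    then show ?thesis unfolding Suc
      using assms by (simp add: fock_linear_def fock.scale_right_distrib sum.distrib fock.scale_sum_right mult.commute)
  qed
qed

abbreviation expm :: "real^'n::finite \<Rightarrow> nat \<Rightarrow> 'n fock \<Rightarrow> 'n fock" where
  "expm a \<equiv> exp_coeff (\<lambda>m. heis a (- int m))"
abbreviation expp :: "real^'n::finite \<Rightarrow> nat \<Rightarrow> 'n fock \<Rightarrow> 'n fock" where
  "expp a \<equiv> exp_coeff (\<lambda>m v. - heis a (int m) v)"

lemma fock_linear_expm [intro]: "fock_linear (expm a k)"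
  by (intro fock_linear_exp_coeff fock_linear_heis)

lemma expm_fcre: "expm a p (fcre j k v) = fcre j k (expm a p v)"
proof (induction p rule: less_induct)
  case (less p)
  show ?case
  proof (cases p)
    case (Suc p')
    have "heis a (- int (Suc s)) (expm a (p' - s) (fcre j k v)) = fcre j k (heis a (- int (Suc s)) (expm a (p' - s) v))" for s
      using less Suc heis_fcre_neg[of "- int (Suc s)"] by simp
    then show ?thesis unfolding Suc exp_coeff.simps
      by (simp only: fock_linear_sum[OF fock_linear_lift] fock_lift_scale)
  qed simp
qed

text \<open>The commutator of a(k+1) with e_j(-k-1) is \<open>(k + 1) * a $ j\<close>, and the
  exponent divides by \<open>k + 1\<close>; so the exponential passes a creation operator at the
  cost of one shifted term.\<close>

lemma expp_fcre:
  "expp a p (fcre j k v) = fcre j k (expp a p v) - (if k < p then fock_scale (of_real (a $ j)) (expp a (p - Suc k) v) else 0)"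
proof (induction p rule: less_induct)
  case (less p)
  show ?case
  proof (cases p)
    case (Suc q)
    let ?c = "of_real (a $ j) :: complex"
    let ?A = "\<lambda>m v. - heis a (int m) v"
    have Alin: "fock_linear (?A m)" for m using fock_linear_heis[of a "int m"] by (simp add: fock_linear_def)
    have trm: "?A (Suc s) (expp a (q - s) (fcre j k v)) =
        fcre j k (?A (Suc s) (expp a (q - s) v))
        - (if s = k then fock_scale (of_nat (Suc k) * ?c) (expp a (q - k) v) else 0)
        - (if k < q - s then fock_scale ?c (?A (Suc s) (expp a (q - s - Suc k) v)) else 0)" if "s \<le> q" for s
    proof -
      have "expp a (q - s) (fcre j k v) = fcre j k (expp a (q - s) v) - (if k < q - s then fock_scale ?c (expp a (q - s - Suc k) v) else 0)"
        by (rule less.IH) (use Suc in simp)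
      moreover have "?A (Suc s) (fcre j k x) = fcre j k (?A (Suc s) x) - (if s = k then fock_scale (of_nat (Suc k) * ?c) x else 0)" for x
      proof -
        have iff: "(int (Suc s) = int k + 1) = (s = k)" by auto
        have "heis a (int (Suc s)) (fcre j k x) = fcre j k (heis a (int (Suc s)) x) + (if s = k then fock_scale (of_nat (Suc s) * ?c) x else 0)"
          using heis_fcre_pos[of "int (Suc s)" a j k x] unfolding iff by simp
        then show ?thesis by (simp add: fock_linear_minus[OF fock_linear_lift])
      qed
      ultimately show ?thesis
        by (simp only: fock_linear_diff[OF Alin])
          (auto simp: fock_linear_scale[OF fock_linear_heis] fock_linear_0[OF fock_linear_heis])
    qed
    have "expp a p (fcre j k v) = fock_scale (1 / of_nat (Suc q)) (\<Sum>s\<le>q. ?A (Suc s) (expp a (q - s) (fcre j k v)))"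
      unfolding Suc by simp
    also have "(\<Sum>s\<le>q. ?A (Suc s) (expp a (q - s) (fcre j k v))) =
       (\<Sum>s\<le>q. fcre j k (?A (Suc s) (expp a (q - s) v)))
       - (\<Sum>s\<le>q. if s = k then fock_scale (of_nat (Suc k) * ?c) (expp a (q - k) v) else 0)
       - (\<Sum>s\<le>q. if k < q - s then fock_scale ?c (?A (Suc s) (expp a (q - s - Suc k) v)) else 0)"
      using trm by (simp add: sum_subtractf)
    also have "(\<Sum>s\<le>q. fcre j k (?A (Suc s) (expp a (q - s) v))) = fcre j k (\<Sum>s\<le>q. ?A (Suc s) (expp a (q - s) v))"
      by (simp only: fock_linear_sum[OF fock_linear_lift])
    also have "(\<Sum>s\<le>q. if s = k then fock_scale (of_nat (Suc k) * ?c) (expp a (q - k) v) else 0) =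
        (if k \<le> q then fock_scale (of_nat (Suc k) * ?c) (expp a (q - k) v) else 0)"
      by simp
    also have "(\<Sum>s\<le>q. if k < q - s then fock_scale ?c (?A (Suc s) (expp a (q - s - Suc k) v)) else 0) =
        (if k \<le> q then fock_scale (of_nat (q - k) * ?c) (expp a (q - k) v) else 0)"
    proof (cases "k < q")
      case True
      define r where "r = q - k - 1"
      have r: "q - k = Suc r" using True r_def by simp
      have "(\<Sum>s\<le>q. if k < q - s then fock_scale ?c (?A (Suc s) (expp a (q - s - Suc k) v)) else 0) =
        (\<Sum>s\<le>r. fock_scale ?c (?A (Suc s) (expp a (r - s) v)))"
        by (rule sum.mono_neutral_cong_right) (use True in \<open>auto simp: r_def add.commute\<close>)
      also have "\<dots> = fock_scale (of_nat (Suc r) * ?c) (expp a (Suc r) v)"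
        unfolding exp_coeff.simps fock.scale_scale fock.scale_sum_right by (simp add: field_simps del: of_nat_Suc)
      finally show ?thesis using True r by simp
    next
      case False
      then have "(\<Sum>s\<le>q. if k < q - s then fock_scale ?c (?A (Suc s) (expp a (q - s - Suc k) v)) else 0) = 0"
        by (intro sum.neutral) auto
      then show ?thesis using False by (cases "k = q") simp_all
    qed
    finally have "expp a p (fcre j k v) = fock_scale (1 / of_nat (Suc q)) (fcre j k (\<Sum>s\<le>q. ?A (Suc s) (expp a (q - s) v))
       - (if k \<le> q then fock_scale (of_nat (Suc k) * ?c) (expp a (q - k) v) else 0)
       - (if k \<le> q then fock_scale (of_nat (q - k) * ?c) (expp a (q - k) v) else 0))" .
    also have "\<dots> = fcre j k (expp a p v) - (if k < p then fock_scale ?c (expp a (p - Suc k) v) else 0)"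
    proof (cases "k \<le> q")
      case True
      \<comment> \<open>One part comes from the commutator with the creation operator, the other
        from the induction hypothesis; their sum \<open>q + 1\<close> cancels the leading
        fraction.\<close>
      have s: "(of_nat (Suc k) * ?c) + (of_nat (q - k) * ?c) = of_nat (Suc q) * ?c"
        using True by (simp add: of_nat_diff algebra_simps)
      have "fock_scale (1 / of_nat (Suc q)) (X - fock_scale (of_nat (Suc k) * ?c) (expp a (q - k) v) - fock_scale (of_nat (q - k) * ?c) (expp a (q - k) v))
        = fock_scale (1 / of_nat (Suc q)) X - fock_scale ?c (expp a (q - k) v)" for X
        unfolding diff_diff_eq fock.scale_left_distrib[symmetric] s fock.scale_right_diff_distrib fock.scale_scale
        by (simp del: of_nat_Suc)
      then show ?thesis using True unfolding Suc
        by (simp only: if_True exp_coeff.simps fock_lift_scale less_Suc_eq_le diff_Suc_Suc)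
    next
      case False
      then show ?thesis unfolding Suc
        by (simp add: fock_lift_scale)
    qed
    finally show ?thesis .
  qed simp
qed

lemma heis_pos_vacuum: "m > 0 \<Longrightarrow> heis a m (Poly_Mapping.single ({#}, b) c) = 0"
  unfolding heis_def by (simp add: heis_basis_def)

lemma expp_vacuum: "k > 0 \<Longrightarrow> expp a k (Poly_Mapping.single ({#}, b) c) = 0"
proof (induction k rule: less_induct)
  case (less k)
  then obtain q where k: "k = Suc q" by (cases k) auto
  have "- heis a (int (Suc s)) (expp a (q - s) (Poly_Mapping.single ({#}, b) c)) = 0" if "s \<le> q" for s
  proof (cases "s = q")
    case True
    then show ?thesis by (simp add: heis_pos_vacuum)
  next
    case False
    then have "expp a (q - s) (Poly_Mapping.single ({#}, b) c) = 0" using that k by (intro less.IH) auto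
    then show ?thesis by (simp add: fock_linear_0[OF fock_linear_heis])
  qed
  then show ?case unfolding k by simp
qed

lemma expp_eventually_zero: "\<exists>K. \<forall>k\<ge>K. expp a k (Poly_Mapping.single (P, b) c) = 0"
proof (induction P)
  case empty
  then show ?case using expp_vacuum by (metis One_nat_def less_eq_Suc_le)
next
  case (add x P)
  obtain j d where x: "x = (j, d)" by force
  obtain K where K: "\<forall>k\<ge>K. expp a k (Poly_Mapping.single (P, b) c) = 0" using add by blast
  have "expp a k (Poly_Mapping.single (add_mset x P, b) c) = 0" if "k \<ge> K + Suc d" for k
    unfolding x fcre_single[symmetric] expp_fcre using K that by (simp add: fock_linear_0[OF fock_linear_lift])
  then show ?case by blast
qed

text \<open>One summand of \<open>exp_mode\<close> on a basis vector, named so that its truncation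
  in \<open>k\<close> can be stated uniformly in \<open>n\<close>.\<close>

definition exp_term :: "(real^'n \<Rightarrow> real^'n \<Rightarrow> complex) \<Rightarrow> real^'n::finite \<Rightarrow> int \<Rightarrow> ('n \<times> nat) multiset \<times> (real^'n) \<Rightarrow> nat \<Rightarrow> 'n fock" where
  "exp_term \<epsilon> a n = (\<lambda>(P, b) k. let p = int k - \<lfloor>a \<bullet> b\<rfloor> - n - 1 in
       if p < 0 then 0 else expm a (nat p) (expp a k (Poly_Mapping.single (P, a + b) (\<epsilon> a b))))"

lemma exp_mode_single: "exp_mode \<epsilon> a n (Poly_Mapping.single (P, b) 1) = Sum_any (exp_term \<epsilon> a n (P, b))"
  unfolding exp_mode_def exp_term_def by simp

lemma exp_term_zero: "\<exists>K. \<forall>k\<ge>K. \<forall>n. exp_term \<epsilon> a n (P, b) k = 0"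
proof -
  obtain K where K: "\<forall>k\<ge>K. expp a k (Poly_Mapping.single (P, a + b) (\<epsilon> a b)) = 0" using expp_eventually_zero by blast
  then have "\<forall>k\<ge>K. \<forall>n. exp_term \<epsilon> a n (P, b) k = 0"
    unfolding exp_term_def by (auto simp: Let_def fock_linear_0[OF fock_linear_expm])
  then show ?thesis by blast
qed

text \<open>Together with the values on lowest vectors this relation determines
  \<open>exp_mode\<close>; the modes of \<open>ev a\<close> satisfy the same one by
  \<open>ev_mode_comm\<close>.\<close>

lemma exp_mode_fcre:
  "exp_mode \<epsilon> a n (fcre j k v) = fcre j k (exp_mode \<epsilon> a n v) - fock_scale (of_real (a $ j)) (exp_mode \<epsilon> a (n - int k - 1) v)"
proof (rule fock_linear_eq[where A = "\<lambda>v. exp_mode \<epsilon> a n (fcre j k v)"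
      and B = "\<lambda>v. fcre j k (exp_mode \<epsilon> a n v) - fock_scale (of_real (a $ j)) (exp_mode \<epsilon> a (n - int k - 1) v)"])
  have lin: "fock_linear (exp_mode \<epsilon> a n)" for n unfolding exp_mode_def by (rule fock_linear_lift)
  show "fock_linear (\<lambda>v. exp_mode \<epsilon> a n (fcre j k v))"
    using lin[of n] by (simp add: fock_linear_def fock_lift_add fock_lift_scale)
  show "fock_linear (\<lambda>v. fcre j k (exp_mode \<epsilon> a n v) - fock_scale (of_real (a $ j)) (exp_mode \<epsilon> a (n - int k - 1) v))"
    using lin[of n] lin[of "n - int k - 1"]
    by (simp add: fock_linear_def fock_lift_add fock_lift_scale fock.scale_right_distrib fock.scale_right_diff_distrib mult.commute algebra_simps)
  fix x :: "('a \<times> nat) multiset \<times> (real^'a)"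
  obtain P b where x: "x = (P, b)" by force
  let ?c = "of_real (a $ j) :: complex"
  let ?n = "n - int k - 1"
  have trm: "exp_term \<epsilon> a n (add_mset (j, k) P, b) k' = fcre j k (exp_term \<epsilon> a n (P, b) k')
     - (if k < k' then fock_scale ?c (exp_term \<epsilon> a ?n (P, b) (k' - Suc k)) else 0)" for k'
  proof -
    have p: "int (k' - Suc k) - \<lfloor>a \<bullet> b\<rfloor> - ?n - 1 = int k' - \<lfloor>a \<bullet> b\<rfloor> - n - 1" if "k < k'"
      using that by simp
    show ?thesis
    proof (cases "k < k'")
      case True
      show ?thesis
        unfolding exp_term_def Let_def split fcre_single[symmetric] expp_fcre p[OF True] if_P[OF True]
        by (cases "int k' - \<lfloor>a \<bullet> b\<rfloor> - n - 1 < 0")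
          (simp_all only: if_True if_False fock_linear_diff[OF fock_linear_expm] fock_linear_scale[OF fock_linear_expm]
            expm_fcre fock_linear_0[OF fock_linear_lift] fock.scale_zero_right diff_0_right)
    next
      case False
      show ?thesis
        unfolding exp_term_def Let_def split fcre_single[symmetric] expp_fcre if_not_P[OF False] diff_0_right
        by (simp add: expm_fcre fock_linear_0[OF fock_linear_lift])
    qed
  qed
  obtain K where K: "\<forall>k\<ge>K. \<forall>n. exp_term \<epsilon> a n (P, b) k = 0" using exp_term_zero by blast
  obtain K' where K': "\<forall>k'\<ge>K'. \<forall>n. exp_term \<epsilon> a n (add_mset (j, k) P, b) k' = 0" using exp_term_zero by blast
  define M where "M = max K K'"
  have "exp_mode \<epsilon> a n (fcre j k (Poly_Mapping.single x 1)) = Sum_any (exp_term \<epsilon> a n (add_mset (j, k) P, b))"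
    unfolding x fcre_single exp_mode_single ..
  also have "\<dots> = (\<Sum>k'<M + Suc k. exp_term \<epsilon> a n (add_mset (j, k) P, b) k')"
    by (rule Sum_any_eq_sum) (use K' M_def in auto)
  also have "\<dots> = fcre j k (\<Sum>k'<M + Suc k. exp_term \<epsilon> a n (P, b) k')
     - (\<Sum>k'<M + Suc k. if k < k' then fock_scale ?c (exp_term \<epsilon> a ?n (P, b) (k' - Suc k)) else 0)"
    unfolding trm sum_subtractf fock_linear_sum[OF fock_linear_lift] ..
  also have "(\<Sum>k'<M + Suc k. exp_term \<epsilon> a n (P, b) k') = Sum_any (exp_term \<epsilon> a n (P, b))"
    by (rule Sum_any_eq_sum[symmetric]) (use K M_def in auto)
  also have "(\<Sum>k'<M + Suc k. if k < k' then fock_scale ?c (exp_term \<epsilon> a ?n (P, b) (k' - Suc k)) else 0) =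
     (\<Sum>k'\<in>{Suc k..<M + Suc k}. fock_scale ?c (exp_term \<epsilon> a ?n (P, b) (k' - Suc k)))"
    by (rule sum.mono_neutral_cong_right) auto
  also have "\<dots> = (\<Sum>k'<M. fock_scale ?c (exp_term \<epsilon> a ?n (P, b) k'))"
    by (rule sum.reindex_bij_witness[of _ "\<lambda>k'. k' + Suc k" "\<lambda>k'. k' - Suc k"]) auto
  also have "\<dots> = fock_scale ?c (Sum_any (exp_term \<epsilon> a ?n (P, b)))"
    unfolding fock.scale_sum_right[symmetric]
    by (rule arg_cong[where f = "fock_scale ?c"], rule Sum_any_eq_sum[symmetric]) (use K M_def in auto)
  finally show "exp_mode \<epsilon> a n (fcre j k (Poly_Mapping.single x 1)) =
     fcre j k (exp_mode \<epsilon> a n (Poly_Mapping.single x 1)) - fock_scale ?c (exp_mode \<epsilon> a ?n (Poly_Mapping.single x 1))"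
    unfolding x exp_mode_single .
qed

lemma exp_mode_vacuum:
  "exp_mode \<epsilon> a n (Poly_Mapping.single ({#}, b) 1) =
    (let p = - \<lfloor>a \<bullet> b\<rfloor> - n - 1 in if p < 0 then 0 else expm a (nat p) (Poly_Mapping.single ({#}, a + b) (\<epsilon> a b)))"
proof -
  have "Sum_any (exp_term \<epsilon> a n ({#}, b)) = exp_term \<epsilon> a n ({#}, b) 0"
    by (rule Sum_any_eq_0th) (simp add: exp_term_def Let_def expp_vacuum fock_linear_0[OF fock_linear_expm])
  then show ?thesis unfolding exp_mode_single by (simp add: exp_term_def)
qed

lemma fock_induct [consumes 1, case_names single add]:
  fixes v :: "'b \<Rightarrow>\<^sub>0 complex"
  assumes "\<forall>b\<in>Poly_Mapping.keys v. Q b"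
    and "\<And>b c. Q b \<Longrightarrow> P (Poly_Mapping.single b c)" "\<And>u v. P u \<Longrightarrow> P v \<Longrightarrow> P (u + v)" "P 0"
  shows "P v"
proof -
  have v: "v = (\<Sum>b\<in>Poly_Mapping.keys v. Poly_Mapping.single b (Poly_Mapping.lookup v b))"
    using fock_lift_singles[of v] unfolding fock_lift_def by simp
  have "P (\<Sum>b\<in>S. Poly_Mapping.single b (Poly_Mapping.lookup v b))" if "S \<subseteq> Poly_Mapping.keys v" for S
    using finite_subset[OF that finite_keys] that
  proof (induction S rule: finite_induct)
    case (insert x S)
    then show ?case using assms by (auto intro!: assms(3))
  qed (use assms in auto)
  then show ?thesis by (subst v) blast
qed

section \<open>The isomorphism with a lattice VOA\<close>

definition cvec :: "real^'n \<Rightarrow> complex^'n" where "cvec x = (\<chi> i. complex_of_real (x $ i))"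

lemma cvec_nth [simp]: "cvec x $ i = of_real (x $ i)" by (simp add: cvec_def)
lemma cvec_add: "cvec (x + y) = cvec x + cvec y" by (simp add: vec_eq_iff)
lemma cvec_diff: "cvec (x - y) = cvec x - cvec y" by (simp add: vec_eq_iff)
lemma cvec_0 [simp]: "cvec 0 = 0" by (simp add: vec_eq_iff)
lemma cvec_inj: "cvec x = cvec y \<longleftrightarrow> x = y" by (simp add: vec_eq_iff)
lemma bil_cvec: "bil (cvec x) (cvec y) = of_real (x \<bullet> y)"
  by (simp add: bil_def inner_vec_def)

text \<open>The eigenvalues are assumed real here; \<open>real_form\<close> arranges this by a
  change of the Heisenberg generators.\<close>

locale lattice_heisenberg_voa = heisenberg_voa V c t
  for V :: "'v::ab_group_add voa" and c :: complex and t :: "'n::finite \<Rightarrow> 'v" +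
  fixes N :: "(real^'n) set"
  assumes Lam_N: "Lam = cvec ` N"
begin

lemma N_Lam: "a \<in> N \<longleftrightarrow> cvec a \<in> Lam" unfolding Lam_N by (auto simp: cvec_inj)
lemma N_0: "0 \<in> N" using Lam_0 by (simp add: N_Lam)
lemma N_diff: "a \<in> N \<Longrightarrow> b \<in> N \<Longrightarrow> a - b \<in> N" using Lam_diff by (simp add: N_Lam cvec_diff)
lemma N_add: "a \<in> N \<Longrightarrow> b \<in> N \<Longrightarrow> a + b \<in> N" using Lam_add by (simp add: N_Lam cvec_add)

definition qn :: "real^'n \<Rightarrow> int" where "qn a = \<lfloor>(a \<bullet> a) / 2\<rfloor>"

lemma qn: "a \<in> N \<Longrightarrow> a \<bullet> a = 2 * of_int (qn a)"
proof -
  assume "a \<in> N"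
  then obtain k :: int where "bil (cvec a) (cvec a) = 2 * of_int k" using Lam_norm_nonneg N_Lam by blast
  then have "complex_of_real (a \<bullet> a) = complex_of_real (2 * of_int k)" by (simp add: bil_cvec)
  then have "a \<bullet> a = 2 * of_int k" by (simp only: of_real_eq_iff)
  then show ?thesis by (simp add: qn_def)
qed

lemma inner_int: "a \<in> N \<Longrightarrow> b \<in> N \<Longrightarrow> a \<bullet> b = of_int \<lfloor>a \<bullet> b\<rfloor>"
proof -
  assume ab: "a \<in> N" "b \<in> N"
  have "2 * (a \<bullet> b) = (a + b) \<bullet> (a + b) - a \<bullet> a - b \<bullet> b" by (simp add: inner_add inner_commute)
  also have "\<dots> = 2 * of_int (qn (a + b) - qn a - qn b)" using qn ab N_add by simp
  finally have "a \<bullet> b = of_int (qn (a + b) - qn a - qn b)" by simp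
  then show ?thesis by (metis floor_of_int)
qed

lemma qn_add: "a \<in> N \<Longrightarrow> b \<in> N \<Longrightarrow> qn (a + b) = qn a + qn b + \<lfloor>a \<bullet> b\<rfloor>"
proof -
  assume ab: "a \<in> N" "b \<in> N"
  have "(a + b) \<bullet> (a + b) = a \<bullet> a + b \<bullet> b + 2 * (a \<bullet> b)" by (simp add: inner_add inner_commute)
  then have "2 * real_of_int (qn (a + b)) = 2 * of_int (qn a + qn b + \<lfloor>a \<bullet> b\<rfloor>)"
    using qn ab N_add inner_int[OF ab] by simp
  then have "real_of_int (qn (a + b)) = of_int (qn a + qn b + \<lfloor>a \<bullet> b\<rfloor>)" by (simp only: mult_cancel_left) simp
  then show ?thesis by (simp only: of_int_eq_iff)
qed

lemma ev_exists:
  assumes a: "a \<in> N"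
  shows "\<exists>e. e \<in> G (cvec a) \<and> e \<in> wt (qn a) \<and> e \<noteq> 0 \<and> (\<forall>i j. j \<ge> 1 \<longrightarrow> h i j e = 0) \<and> (a = 0 \<longrightarrow> e = vac V)"
proof (cases "a = 0")
  case True
  then show ?thesis using vac_G vac_wt vac_nonzero creation_reg[OF t_car] by (intro exI[of _ "vac V"]) (auto simp: qn_def)
next
  case False
  have l: "cvec a \<in> Lam" using a N_Lam by blast
  obtain k e where e: "e \<in> G (cvec a)" "e \<in> wt k" "e \<noteq> 0" "\<And>i j. j \<ge> 1 \<Longrightarrow> h i j e = 0"
    and k: "bil (cvec a) (cvec a) = 2 * of_int k"
    by (rule lowest_vector[OF l]) blast
  have "complex_of_int (2 * k) = of_int (2 * qn a)" using k qn[OF a] by (simp add: bil_cvec)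
  then have "k = qn a" unfolding of_int_eq_iff by simp
  then show ?thesis using e False by blast
qed

text \<open>A choice of lowest vectors. The normalisation at 0 is what makes \<open>del\<close>
  equal to 1 when one argument is 0.\<close>

definition ev :: "real^'n \<Rightarrow> 'v" where
  "ev a = (SOME e. e \<in> G (cvec a) \<and> e \<in> wt (qn a) \<and> e \<noteq> 0 \<and> (\<forall>i j. j \<ge> 1 \<longrightarrow> h i j e = 0) \<and> (a = 0 \<longrightarrow> e = vac V))"

lemma ev:
  assumes "a \<in> N"
  shows "ev a \<in> G (cvec a)" "ev a \<in> wt (qn a)" "ev a \<noteq> 0" "j \<ge> 1 \<Longrightarrow> h i j (ev a) = 0" "ev a \<in> car"
  using someI_ex[OF ev_exists[OF assms]] wtD[of "ev a" "of_int (qn a)"] unfolding ev_def[symmetric] by auto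

lemma ev_0: "ev 0 = vac V"
  using someI_ex[OF ev_exists[OF N_0]] unfolding ev_def[symmetric] by auto

lemma cre_perm_Cons:
  assumes e: "e \<in> car"
  shows "cre (xs @ (i, k) # zs) e = h i (- int k - 1) (cre (xs @ zs) e)"
proof (induction xs)
  case (Cons x xs)
  obtain j l where x: "x = (j, l)" by force
  have "h j (- int l - 1) (h i (- int k - 1) (cre (xs @ zs) e)) = h i (- int k - 1) (h j (- int l - 1) (cre (xs @ zs) e))"
    using h_comm[OF cre_car[OF e], of j "- int l - 1" i "- int k - 1"] by simp
  then show ?case using Cons by (simp add: x)
qed simp

lemma cre_perm: "e \<in> car \<Longrightarrow> mset xs = mset ys \<Longrightarrow> cre xs e = cre ys e"
proof (induction xs arbitrary: ys)
  case (Cons x xs)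
  obtain i k where x: "x = (i, k)" by force
  have "x \<in> set ys" using Cons.prems(2) by (metis list.set_intros(1) set_mset_mset)
  then obtain y1 y2 where ys: "ys = y1 @ x # y2" by (meson split_list)
  then have "mset xs = mset (y1 @ y2)" using Cons.prems(2) by simp
  then have "cre xs e = cre (y1 @ y2) e" using Cons by blast
  then show ?case unfolding ys x cre_perm_Cons[OF Cons.prems(1)] by simp
qed simp

text \<open>The enumeration \<open>mset_list\<close> is the one used in
  \<open>lattice_field\<close>, so the words on both sides agree literally; \<open>cre_perm\<close>
  makes the order immaterial.\<close>

definition crem :: "('n \<times> nat) multiset \<Rightarrow> 'v \<Rightarrow> 'v" where "crem P e = cre (mset_list P) e"

lemma mset_mset_list [simp]: "mset (mset_list P) = P"
  unfolding mset_list_def using ex_mset by (rule someI_ex)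

lemma crem_empty [simp]: "crem {#} e = e"
proof -
  have "mset_list {#} = ([] :: ('n \<times> nat) list)" using mset_mset_list[of "{#}"] by (simp del: mset_mset_list)
  then show ?thesis by (simp add: crem_def)
qed

lemma crem_mset: "e \<in> car \<Longrightarrow> crem (mset xs) e = cre xs e"
  unfolding crem_def by (rule cre_perm) simp_all

lemma crem_add [simp]:
  assumes "e \<in> car"
  shows "crem (add_mset (i, k) P) e = h i (- int k - 1) (crem P e)"
proof -
  have "crem (add_mset (i, k) P) e = cre ((i, k) # mset_list P) e"
    using crem_mset[OF assms, of "(i, k) # mset_list P"] by simp
  then show ?thesis by (simp add: crem_def)
qed

lemma crem_car: "e \<in> car \<Longrightarrow> crem P e \<in> car" unfolding crem_def by (rule cre_car)
lemma crem_G: "e \<in> G l \<Longrightarrow> crem P e \<in> G l" unfolding crem_def by (rule cre_G)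

definition Fb :: "('n \<times> nat) multiset \<times> (real^'n) \<Rightarrow> 'v" where
  "Fb = (\<lambda>(P, a). crem P (ev a))"

definition F :: "'n fock \<Rightarrow> 'v" where
  "F v = (\<Sum>b\<in>Poly_Mapping.keys v. Poly_Mapping.lookup v b \<odot> Fb b)"

lemma F_superset:
  "finite K \<Longrightarrow> Poly_Mapping.keys v \<subseteq> K \<Longrightarrow> F v = (\<Sum>b\<in>K. Poly_Mapping.lookup v b \<odot> Fb b)"
  unfolding F_def by (intro sum.mono_neutral_left) (auto simp: in_keys_iff)

lemma F_add: "F (u + v) = F u + F v"
proof -
  let ?K = "Poly_Mapping.keys u \<union> Poly_Mapping.keys v"
  show ?thesis
    using Poly_Mapping.keys_add[of u v]
    by (simp add: F_superset[of ?K] lookup_add scale_left_distrib sum.distrib)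
qed

lemma F_scale: "F (fock_scale a v) = a \<odot> F v"
proof -
  have "Poly_Mapping.keys (fock_scale a v) \<subseteq> Poly_Mapping.keys v" by (auto simp: in_keys_iff)
  then show ?thesis by (simp add: F_superset[of "Poly_Mapping.keys v"] scale_sum_right)
qed

lemma F_0 [simp]: "F 0 = 0" using F_scale[of 0 0] by simp
lemma F_minus: "F (- v) = - F v" using F_scale[of "-1" v] by simp
lemma F_diff: "F (u - v) = F u - F v" using F_add[of u "- v"] F_minus[of v] by simp
lemma F_sum: "F (sum f S) = (\<Sum>x\<in>S. F (f x))"
  by (induction S rule: infinite_finite_induct) (auto simp: F_add)
lemma F_single [simp]: "F (Poly_Mapping.single b a) = a \<odot> Fb b"
  by (cases "a = 0") (simp_all add: F_def)
lemma F_lift: "F (fock_lift f v) = (\<Sum>b\<in>Poly_Mapping.keys v. Poly_Mapping.lookup v b \<odot> F (f b))"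
  unfolding fock_lift_def by (simp add: F_sum F_scale)

definition FN :: "'n fock set" where "FN = {v. \<forall>b\<in>Poly_Mapping.keys v. snd b \<in> N}"

lemma FN_sub: "fock.subspace FN"
proof (rule fock.subspaceI)
  show "x + y \<in> FN" if "x \<in> FN" "y \<in> FN" for x y
    using that Poly_Mapping.keys_add[of x y] unfolding FN_def by blast
  show "fock_scale a x \<in> FN" if "x \<in> FN" for a x
    using that unfolding FN_def by (auto simp: in_keys_iff)
qed (simp add: FN_def)

lemmas FN_add = fock.subspace_add[OF FN_sub]
lemmas FN_scale = fock.subspace_scale[OF FN_sub]
lemmas FN_0 = fock.subspace_0[OF FN_sub]
lemmas FN_diff = fock.subspace_diff[OF FN_sub]
lemmas FN_sum = fock.subspace_sum[OF FN_sub]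
lemmas FN_Sum_any = fock.subspace_Sum_any[OF FN_sub]

lemma FN_single: "a \<in> N \<Longrightarrow> Poly_Mapping.single (P, a) x \<in> FN"
  by (simp add: FN_def)

lemma FN_lift:
  assumes "v \<in> FN" "\<And>P a. a \<in> N \<Longrightarrow> f (P, a) \<in> FN"
  shows "fock_lift f v \<in> FN"
  unfolding fock_lift_def
proof (intro FN_sum FN_scale)
  fix b assume "b \<in> Poly_Mapping.keys v"
  moreover obtain P a where b: "b = (P, a)" by force
  ultimately have "a \<in> N" using assms(1) by (auto simp: FN_def)
  then show "f b \<in> FN" unfolding b by (rule assms(2))
qed

lemma FN_induct [consumes 1, case_names single add]:
  assumes "v \<in> FN" "\<And>P a x. a \<in> N \<Longrightarrow> Q (Poly_Mapping.single (P, a) x)" "\<And>u v. Q u \<Longrightarrow> Q v \<Longrightarrow> Q (u + v)"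
  shows "Q v"
proof -
  have "Q 0" using assms(2)[OF N_0, of "{#}" 0] by simp
  moreover have "\<forall>b\<in>Poly_Mapping.keys v. snd b \<in> N" using assms(1) by (simp add: FN_def)
  ultimately show ?thesis
    by (intro fock_induct[where Q = "\<lambda>b. snd b \<in> N" and P = Q and v = v]) (auto intro: assms(2,3))
qed

lemma FN_linear_eq:
  assumes "v \<in> FN" "\<And>u v. u \<in> FN \<Longrightarrow> v \<in> FN \<Longrightarrow> A (u + v) = A u + A v" "\<And>c u. u \<in> FN \<Longrightarrow> A (fock_scale c u) = c \<odot> A u"
    "\<And>u v. u \<in> FN \<Longrightarrow> v \<in> FN \<Longrightarrow> B (u + v) = B u + B v" "\<And>c u. u \<in> FN \<Longrightarrow> B (fock_scale c u) = c \<odot> B u"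
    "\<And>P a. a \<in> N \<Longrightarrow> A (Poly_Mapping.single (P, a) 1) = B (Poly_Mapping.single (P, a) 1)"
  shows "A v = B v"
proof -
  have "v \<in> FN \<and> A v = B v" using assms(1)
  proof (induction rule: FN_induct)
    case (single P a x)
    have "Poly_Mapping.single (P, a) x = fock_scale x (Poly_Mapping.single (P, a) 1)" by simp
    then show ?case using single assms(3,5,6) FN_single by metis
  qed (auto simp: assms FN_add)
  then show ?thesis by blast
qed

lemma Fb_car: "a \<in> N \<Longrightarrow> Fb (P, a) \<in> car" unfolding Fb_def by (simp add: crem_car ev)
lemma Fb_G: "a \<in> N \<Longrightarrow> Fb (P, a) \<in> G (cvec a)" unfolding Fb_def by (simp add: crem_G ev)

lemma F_car: "v \<in> FN \<Longrightarrow> F v \<in> car"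
  by (induction rule: FN_induct) (auto simp: F_add car_add car_scale Fb_car)

lemma FN_heisb: "v \<in> FN \<Longrightarrow> heisb i m v \<in> FN"
  by (rule FN_lift) (auto simp: heis_basis_def intro: FN_single)

lemma FN_heis: "v \<in> FN \<Longrightarrow> heis a m v \<in> FN"
  unfolding heis_def by (intro FN_sum FN_scale FN_heisb)

lemma FN_expm: "v \<in> FN \<Longrightarrow> expm a k v \<in> FN"
proof (induction k rule: less_induct)
  case (less k)
  then show ?case by (cases k) (auto intro!: FN_scale FN_sum FN_heis)
qed

lemma FN_expp: "v \<in> FN \<Longrightarrow> expp a k v \<in> FN"
proof (induction k rule: less_induct)
  case (less k)
  then show ?case
    by (cases k) (auto intro!: FN_scale fock.subspace_neg[OF FN_sub] FN_sum FN_heis simp: sum_negf)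
qed

lemma FN_exp_mode: "a \<in> N \<Longrightarrow> v \<in> FN \<Longrightarrow> exp_mode \<epsilon> a n v \<in> FN"
  unfolding exp_mode_def
  by (rule FN_lift) (auto simp: Let_def intro!: FN_Sum_any FN_expm FN_expp FN_single N_add intro: FN_0)

text \<open>The coefficient agrees with the annihilation clause of \<open>heis_basis\<close>, which
  makes \<open>F\<close> commute with the positive modes.\<close>

lemma h_crem_pos:
  assumes e: "e \<in> car" "\<And>i j. j \<ge> 1 \<Longrightarrow> h i j e = 0" and m: "m > 0"
  shows "h i m (crem P e) = (of_int m * of_nat (count P (i, nat m - 1))) \<odot> crem (P - {#(i, nat m - 1)#}) e"
proof (induction P)
  case empty
  then show ?case using e m by simp
next
  case (add x P)
  obtain j k where x: "x = (j, k)" by force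
  let ?y = "(i, nat m - 1)"
  have c: "h i m (crem (add_mset x P) e) = h j (- int k - 1) (h i m (crem P e)) + (if i = j \<and> m + (- int k - 1) = 0 then of_int m \<odot> crem P e else 0)"
    unfolding x crem_add[OF e(1)] by (rule h_comm[OF crem_car[OF e(1)]])
  show ?case
  proof (cases "?y = x")
    case True
    then have ij: "i = j" "m = int k + 1" "?y = (j, k)" using x m by auto
    have "h j (- int k - 1) (h i m (crem P e)) = (of_int m * of_nat (count P x)) \<odot> crem P e"
    proof (cases "count P x = 0")
      case c0: True
      then show ?thesis unfolding add True by (simp add: t_car)
    next
      case False
      then have "P = add_mset x (P - {#x#})" by (metis count_eq_zero_iff insert_DiffM)
      then have "crem P e = h j (- int k - 1) (crem (P - {#x#}) e)" unfolding x using crem_add[OF e(1)] by metis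
      then show ?thesis unfolding add True by (simp add: mode_scale_right t_car crem_car e)
    qed
    moreover have "i = j \<and> m + (- int k - 1) = 0" using ij by simp
    ultimately have "h i m (crem (add_mset x P) e) = (of_int m * of_nat (count P x)) \<odot> crem P e + of_int m \<odot> crem P e"
      unfolding c by (simp only: if_True simp_thms)
    also have "\<dots> = (of_int m * of_nat (Suc (count P x))) \<odot> crem P e"
      unfolding scale_left_distrib[symmetric] by (rule arg_cong[where f = "\<lambda>a. a \<odot> crem P e"]) (simp add: algebra_simps)
    finally show ?thesis unfolding True by simp
  next
    case False
    then have n: "\<not> (i = j \<and> m + (- int k - 1) = 0)" using x m by auto
    have cc: "count (add_mset x P) ?y = count P ?y" using False by auto
    show ?thesis
    proof (cases "count P ?y = 0")
      case True
      then show ?thesis unfolding c add cc if_not_P[OF n] by (simp add: t_car)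
    next
      case c0: False
      have "add_mset x P - {#?y#} = add_mset x (P - {#?y#})" using False by (metis diff_union_swap)
      then show ?thesis unfolding c add cc if_not_P[OF n] by (simp only: x crem_add[OF e(1)])
        (simp add: mode_scale_right t_car crem_car e)
    qed
  qed
qed

lemma F_heisb: "v \<in> FN \<Longrightarrow> F (heisb i m v) = h i m (F v)"
proof (rule FN_linear_eq[where A = "\<lambda>v. F (heisb i m v)" and B = "\<lambda>v. h i m (F v)"])
  fix P a assume a: "a \<in> N"
  consider "m < 0" | "m = 0" | "m > 0" by linarith
  then show "F (heisb i m (Poly_Mapping.single (P, a) 1)) = h i m (F (Poly_Mapping.single (P, a) 1))"
  proof cases
    case 1
    then have "- int (nat (- m) - 1) - 1 = m" by simp
    then show ?thesis using 1 a by (simp add: heis_basis_def Fb_def ev)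
  next
    case 2
    then show ?thesis using T_G[OF Fb_G[OF a]] by (simp add: heis_basis_def)
  next
    case 3
    then show ?thesis using h_crem_pos[OF ev(5,4)[OF a] 3, of i P] a by (simp add: heis_basis_def Fb_def)
  qed
qed (simp_all add: fock_lift_add fock_lift_scale F_add F_scale mode_add_right mode_scale_right t_car F_car)

lemma F_heis: "v \<in> FN \<Longrightarrow> F (heis a m v) = (\<Sum>i\<in>UNIV. of_real (a $ i) \<odot> h i m (F v))"
  unfolding heis_def by (simp add: F_sum F_scale F_heisb)

text \<open>If \<open>P\<close> contained \<open>(i, k)\<close>, the coefficient of
  \<open>(P', a)\<close> in the image under the mode \<open>k + 1\<close> would come from the key
  \<open>(P, a)\<close> alone, with a positive integer factor, and so could not vanish.\<close>

lemma FN_heis_vacuum: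
  assumes v: "\<And>i m. m > 0 \<Longrightarrow> heisb i m v = 0" and b: "(P, a) \<in> Poly_Mapping.keys v"
  shows "P = {#}"
proof (rule ccontr)
  assume "P \<noteq> {#}"
  then obtain i k where x: "(i, k) \<in># P" by (metis multiset_nonemptyE prod.exhaust)
  define P' where "P' = P - {#(i, k)#}"
  have P: "P = add_mset (i, k) P'" using x by (simp add: P'_def)
  let ?m = "int k + 1"
  have m: "nat ?m - 1 = k" "nat ?m - Suc 0 = k" by simp_all
  have eq: "Q - {#(i, k)#} = P' \<and> count Q (i, k) \<noteq> 0 \<longleftrightarrow> Q = P" for Q
    using P by (metis add_mset_remove_trivial count_eq_zero_iff insert_DiffM union_single_eq_member)
  have "0 = Poly_Mapping.lookup (heisb i ?m v) (P', a)" using v[of ?m i] by simp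
  also have "\<dots> = (\<Sum>b\<in>Poly_Mapping.keys v. Poly_Mapping.lookup v b * Poly_Mapping.lookup (heis_basis i ?m b) (P', a))"
    by (simp add: fock_lift_def lookup_sum)
  also have "\<dots> = (\<Sum>b\<in>{(P, a)}. Poly_Mapping.lookup v b * Poly_Mapping.lookup (heis_basis i ?m b) (P', a))"
  proof (rule sum.mono_neutral_right)
    show "\<forall>b\<in>Poly_Mapping.keys v - {(P, a)}. Poly_Mapping.lookup v b * Poly_Mapping.lookup (heis_basis i ?m b) (P', a) = 0"
    proof
      fix b assume b: "b \<in> Poly_Mapping.keys v - {(P, a)}"
      obtain Q d where Q: "b = (Q, d)" by force
      have "\<not> (Q = P \<and> d = a)" using b Q by auto
      then have "\<not> (Q - {#(i, k)#} = P' \<and> count Q (i, k) \<noteq> 0 \<and> d = a)" using eq[of Q] by blast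
      then show "Poly_Mapping.lookup v b * Poly_Mapping.lookup (heis_basis i ?m b) (P', a) = 0"
        unfolding Q by (auto simp: heis_basis_def m lookup_single when_def)
    qed
  qed (use b in auto)
  also have "\<dots> = Poly_Mapping.lookup v (P, a) * (of_int ?m * of_nat (count P (i, k)))"
    by (simp add: heis_basis_def m lookup_single P)
  finally have "Poly_Mapping.lookup v (P, a) * (of_int ?m * of_nat (count P (i, k))) = 0" by simp
  moreover have "count P (i, k) \<noteq> 0" using x by simp
  moreover have "(of_int ?m :: complex) \<noteq> 0" unfolding of_int_eq_0_iff by simp
  moreover have "Poly_Mapping.lookup v (P, a) \<noteq> 0" using b by (simp add: in_keys_iff)
  ultimately show False by simp
qed

text \<open>Positive modes commute with \<open>F\<close> and lower the number of creation operators,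
  so by induction they kill the kernel. A vector killed by them is a multiple of the lowest basis
  vector, which \<open>F\<close> sends to the nonzero \<open>ev a\<close>.\<close>

lemma F_inj_fixed:
  assumes "v \<in> FN" "F v = 0" "\<forall>b\<in>Poly_Mapping.keys v. snd b = a \<and> size (fst b) \<le> d"
  shows "v = 0"
  using assms
proof (induction d arbitrary: v rule: less_induct)
  case (less d)
  have zero: "heisb i m v = 0" if m: "m > 0" for i m
  proof (cases d)
    case 0
    have "heis_basis i m b = 0" if b: "b \<in> Poly_Mapping.keys v" for b
    proof -
      have "fst b = {#}" using less.prems(3) b 0 by auto
      then show ?thesis using m by (cases b) (simp add: heis_basis_def)
    qed
    then show ?thesis by (simp add: fock_lift_def)
  next
    case (Suc d')
    show ?thesis
    proof (rule less.IH[of d'])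
      show "d' < d" using Suc by simp
      show "heisb i m v \<in> FN" using less.prems(1) FN_heisb by blast
      show "F (heisb i m v) = 0" using F_heisb[OF less.prems(1)] less.prems(2) t_car by simp
      show "\<forall>b\<in>Poly_Mapping.keys (heisb i m v). snd b = a \<and> size (fst b) \<le> d'"
      proof
        fix b assume "b \<in> Poly_Mapping.keys (heisb i m v)"
        then have "(\<Sum>x\<in>Poly_Mapping.keys v. Poly_Mapping.lookup v x * Poly_Mapping.lookup (heis_basis i m x) b) \<noteq> 0"
          by (simp add: fock_lift_def lookup_sum in_keys_iff)
        then obtain x where x: "x \<in> Poly_Mapping.keys v" "Poly_Mapping.lookup (heis_basis i m x) b \<noteq> 0"
          by (metis (no_types, lifting) mult_zero_right sum.neutral)
        obtain P e where P: "x = (P, e)" by force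
        have c0: "count P (i, nat m - 1) \<noteq> 0" and b: "b = (P - {#(i, nat m - 1)#}, e)"
          using x(2) m unfolding P by (auto simp: heis_basis_def lookup_single when_def split: if_splits)
        have "(i, nat m - 1) \<in># P" using c0 by (metis count_eq_zero_iff)
        then have "size (P - {#(i, nat m - 1)#}) < size P" by (simp add: size_Diff1_less)
        then show "snd b = a \<and> size (fst b) \<le> d'" using less.prems(3) x(1) b P Suc by fastforce
      qed
    qed
  qed
  have keys: "Poly_Mapping.keys v \<subseteq> {({#}, a)}"
  proof
    fix b assume b: "b \<in> Poly_Mapping.keys v"
    obtain P e where P: "b = (P, e)" by force
    have "P = {#}" using FN_heis_vacuum[of v P e] zero b P by blast
    then show "b \<in> {({#}, a)}" using less.prems(3) b P by auto
  qed
  show "v = 0"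
  proof (rule ccontr)
    assume "v \<noteq> 0"
    then have k: "Poly_Mapping.keys v = {({#}, a)}" using keys by (simp add: subset_singleton_iff)
    then have a: "a \<in> N" using less.prems(1) by (auto simp: FN_def)
    have "F v = Poly_Mapping.lookup v ({#}, a) \<odot> ev a" by (simp add: F_def k Fb_def)
    moreover have "Poly_Mapping.lookup v ({#}, a) \<noteq> 0" using k by (metis in_keys_iff insertI1)
    ultimately show False using less.prems(2) ev(3)[OF a] by simp
  qed
qed

text \<open>A kernel vector splits by lattice labels, and the images of the parts lie in distinct
  eigenvalue spaces, which are independent; \<open>F_inj_fixed\<close> then applies to each
  part.\<close>

lemma F_inj: "v \<in> FN \<Longrightarrow> F v = 0 \<Longrightarrow> v = 0"
proof -
  assume v: "v \<in> FN" and F0: "F v = 0"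
  define vp where "vp = (\<lambda>a. \<Sum>b\<in>{b \<in> Poly_Mapping.keys v. snd b = a}. Poly_Mapping.single b (Poly_Mapping.lookup v b))"
  let ?S = "snd ` Poly_Mapping.keys v"
  have "v = (\<Sum>b\<in>Poly_Mapping.keys v. Poly_Mapping.single b (Poly_Mapping.lookup v b))"
    using fock_lift_singles[of v] unfolding fock_lift_def by simp
  also have "\<dots> = (\<Sum>a\<in>?S. vp a)"
    unfolding vp_def by (rule sum.image_gen) simp
  finally have vs: "v = (\<Sum>a\<in>?S. vp a)" .
  have SN: "?S \<subseteq> N" using v by (auto simp: FN_def)
  have vpN: "vp a \<in> FN" if "a \<in> N" for a
    unfolding vp_def using that by (intro FN_sum) (auto intro!: FN_single)
  have keys: "Poly_Mapping.keys (vp a) \<subseteq> {b \<in> Poly_Mapping.keys v. snd b = a}" for a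
  proof
    fix b assume "b \<in> Poly_Mapping.keys (vp a)"
    then have "(\<Sum>x\<in>{b \<in> Poly_Mapping.keys v. snd b = a}. Poly_Mapping.lookup (Poly_Mapping.single x (Poly_Mapping.lookup v x)) b) \<noteq> 0"
      by (simp add: vp_def in_keys_iff lookup_sum)
    then obtain x where "x \<in> {b \<in> Poly_Mapping.keys v. snd b = a}" "Poly_Mapping.lookup (Poly_Mapping.single x (Poly_Mapping.lookup v x)) b \<noteq> 0"
      by (meson sum.not_neutral_contains_not_neutral)
    then show "b \<in> {b \<in> Poly_Mapping.keys v. snd b = a}" by (auto simp: lookup_single when_def split: if_splits)
  qed
  have FG: "F (vp a) \<in> G (cvec a)" if "a \<in> N" for a
    unfolding vp_def F_sum using that by (intro subspace_sum[OF G_sub]) (auto intro!: subspace_scale[OF G_sub] Fb_G)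
  have "vp a = 0" if a: "a \<in> ?S" for a
  proof -
    define f where "f = (\<lambda>a::real^'n. \<lambda>i. cvec a $ i)"
    have injf: "inj_on f ?S" by (rule inj_onI) (auto simp: f_def fun_eq_iff vec_eq_iff)
    define w where "w = (\<lambda>l. F (vp (the_inv_into ?S f l)))"
    have wf: "w (f b) = F (vp b)" if "b \<in> ?S" for b using that by (simp add: w_def the_inv_into_f_f[OF injf])
    have "w (f a) = 0"
    proof (rule Tf.geig_direct[of "f ` ?S"])
      show "w m \<in> Tf.geig UNIV m" if m: "m \<in> f ` ?S" for m
      proof -
        obtain b where b: "m = f b" "b \<in> ?S" using m by blast
        then show ?thesis using FG[of b] SN wf[of b] unfolding G_def f_def by auto
      qed
      have "sum w (f ` ?S) = (\<Sum>a\<in>?S. F (vp a))" by (simp add: sum.reindex[OF injf] wf)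
      also have "\<dots> = F v" by (subst vs) (simp only: F_sum)
      finally show "sum w (f ` ?S) = 0" using F0 by simp
    qed (use a in auto)
    then have Fz: "F (vp a) = 0" using wf a by simp
    define d where "d = Max (insert 0 ((\<lambda>b. size (fst b)) ` Poly_Mapping.keys v))"
    have "\<forall>b\<in>Poly_Mapping.keys (vp a). snd b = a \<and> size (fst b) \<le> d"
      using keys[of a] unfolding d_def by (auto intro!: Max_ge)
    then show ?thesis using F_inj_fixed[OF vpN Fz] a SN by blast
  qed
  then show "v = 0" using vs by (metis (no_types, lifting) sum.neutral)
qed

lemma F_surj: "F ` FN = car"
proof
  show "F ` FN \<subseteq> car" using F_car by blast
  have sub: "subspace (F ` FN)"
  proof (rule subspaceI)
    show "0 \<in> F ` FN" using FN_0 F_0 by (metis image_eqI)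
    show "x + y \<in> F ` FN" if "x \<in> F ` FN" "y \<in> F ` FN" for x y
      using that FN_add by (auto simp: F_add[symmetric])
    show "a \<odot> x \<in> F ` FN" if "x \<in> F ` FN" for a x
      using that FN_scale by (auto simp: F_scale[symmetric])
  qed
  have "G l \<subseteq> F ` FN" for l
  proof (cases "l \<in> Lam")
    case True
    then obtain a where a: "a \<in> N" "l = cvec a" using Lam_N by blast
    have "{cre xs (ev a) |xs. True} \<subseteq> F ` FN"
    proof safe
      fix xs
      have "cre xs (ev a) = F (Poly_Mapping.single (mset xs, a) 1)"
        using crem_mset[OF ev(5)[OF a(1)]] by (simp add: Fb_def)
      then show "cre xs (ev a) \<in> F ` FN" using FN_single[OF a(1)] by blast
    qed
    then have "span {cre xs (ev a) |xs. True} \<subseteq> F ` FN" by (rule span_minimal) (rule sub)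
    then show ?thesis using G_eq_cre_span[OF ev(1,3,4)[OF a(1)]] a by blast
  next
    case False
    then have "G l = {0}" unfolding Lam_def by blast
    then show ?thesis using subspace_0[OF sub] by simp
  qed
  then have "(\<Union>l. G l) \<subseteq> F ` FN" by blast
  then show "car \<subseteq> F ` FN" unfolding car_decomp by (rule span_minimal) (rule sub)
qed

section \<open>Products of lowest vectors\<close>

lemma ev_mode_comm:
  assumes a: "a \<in> N" and w: "w \<in> car"
  shows "h i m (Y (ev a) n w) = Y (ev a) n (h i m w) + of_real (a $ i) \<odot> Y (ev a) (m + n) w"
proof -
  have z: "Y (t i) (int j) (ev a) = 0" if "j \<ge> 1" for j using ev(4)[OF a] that by simp
  have "h i m (Y (ev a) n w) - Y (ev a) n (h i m w) = (\<Sum>j<1. (of_int m gchoose j) \<odot> Y (Y (t i) (int j) (ev a)) (m + n - int j) w)"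
    by (rule commutator[OF t_car ev(5)[OF a] w z])
  also have "\<dots> = of_real (a $ i) \<odot> Y (ev a) (m + n) w"
    using T_G[OF ev(1)[OF a], of i] w ev(5)[OF a] by (simp add: mode_scale_left)
  finally show ?thesis by (simp add: algebra_simps)
qed

lemma ev_ev_wt: "a \<in> N \<Longrightarrow> b \<in> N \<Longrightarrow> Y (ev a) n (ev b) \<in> wt (qn (a + b) - \<lfloor>a \<bullet> b\<rfloor> - n - 1)"
  using wt_mode[OF ev(2) ev(2), of a b n] qn_add[of a b] by (simp del: of_int_diff of_int_add)

lemma ev_ev_G: "a \<in> N \<Longrightarrow> b \<in> N \<Longrightarrow> Y (ev a) n (ev b) \<in> G (cvec (a + b))"
  using G_mode[OF ev(1) ev(1)] by (simp add: cvec_add)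

lemma G_wt_low_N:
  assumes "a \<in> N" "x \<in> G (cvec a)" "x \<in> wt k" "k < qn a"
  shows "x = 0"
proof (rule ccontr)
  assume "x \<noteq> 0"
  then obtain m where m: "bil (cvec a) (cvec a) = 2 * of_int m" "m \<le> k" using G_wt_low assms by blast
  have "complex_of_int (2 * m) = of_int (2 * qn a)" using m qn[OF assms(1)] by (simp add: bil_cvec)
  then have "m = qn a" unfolding of_int_eq_iff by simp
  then show False using m(2) assms(4) by simp
qed

text \<open>The product would have a weight below the minimum \<open>qn (a + b)\<close> of its
  eigenvalue space.\<close>

lemma ev_ev_zero: "a \<in> N \<Longrightarrow> b \<in> N \<Longrightarrow> n \<ge> - \<lfloor>a \<bullet> b\<rfloor> \<Longrightarrow> Y (ev a) n (ev b) = 0"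
  by (rule G_wt_low_N[OF N_add ev_ev_G ev_ev_wt]) auto

definition del :: "real^'n \<Rightarrow> real^'n \<Rightarrow> complex" where
  "del a b = (SOME x. Y (ev a) (- \<lfloor>a \<bullet> b\<rfloor> - 1) (ev b) = x \<odot> ev (a + b))"

lemma del: "a \<in> N \<Longrightarrow> b \<in> N \<Longrightarrow> Y (ev a) (- \<lfloor>a \<bullet> b\<rfloor> - 1) (ev b) = del a b \<odot> ev (a + b)"
proof -
  assume ab: "a \<in> N" "b \<in> N"
  have "Y (ev a) (- \<lfloor>a \<bullet> b\<rfloor> - 1) (ev b) \<in> wt (qn (a + b))"
    using ev_ev_wt[OF ab, of "- \<lfloor>a \<bullet> b\<rfloor> - 1"] by (simp del: of_int_diff of_int_add)
  then have "\<exists>x. Y (ev a) (- \<lfloor>a \<bullet> b\<rfloor> - 1) (ev b) = x \<odot> ev (a + b)"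
    using lowest_unique[OF ev(1,2,3,4)[OF N_add[OF ab]] ev_ev_G[OF ab]] by blast
  then show ?thesis unfolding del_def by (rule someI_ex)
qed

text \<open>The Sugawara formula with its zero-mode part moved to the left: above the lowest weight
  a vector is recovered from its images under the positive modes.\<close>

lemma L0_recursion:
  assumes x: "x \<in> G l" "x \<in> wt n" and K: "\<And>i k. k > K \<Longrightarrow> h i (int k) x = 0"
  shows "(of_int n - bil l l / 2) \<odot> x = (\<Sum>i\<in>UNIV. \<Sum>k<K. h i (-1 - int k) (h i (1 + int k) x))"
proof -
  have xC: "x \<in> car" using x wtD by blast
  have "(2 * of_int n) \<odot> x = 2 \<odot> L0 x" using x(2) by (simp add: vweight_def)
  also have "\<dots> = (\<Sum>i\<in>UNIV. Sum_any (\<lambda>k::nat. h i (-1 - int k) (h i (1 + int k) x) + h i (1 - 1 - int k) (h i (int k) x)))"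
    by (rule conf_mode[OF xC])
  also have "\<dots> = (\<Sum>i\<in>UNIV. \<Sum>k<Suc K. h i (-1 - int k) (h i (1 + int k) x) + h i (1 - 1 - int k) (h i (int k) x))"
  proof (intro sum.cong refl Sum_any_eq_sum)
    fix i and j :: nat assume j: "Suc K \<le> j"
    then show "h i (-1 - int j) (h i (1 + int j) x) + h i (1 - 1 - int j) (h i (int j) x) = 0"
      using K[of j i] K[of "Suc j" i] by (simp add: t_car)
  qed
  also have "\<dots> = (\<Sum>i\<in>UNIV. 2 \<odot> (\<Sum>k<K. h i (-1 - int k) (h i (1 + int k) x)) + T i (T i x))"
  proof (intro sum.cong refl)
    fix i
    have "(\<Sum>k<Suc K. h i (-1 - int k) (h i (1 + int k) x)) = (\<Sum>k<K. h i (-1 - int k) (h i (1 + int k) x))"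
      using K[of "Suc K" i] by (simp add: t_car)
    moreover have "(\<Sum>k<Suc K. h i (1 - 1 - int k) (h i (int k) x)) = T i (T i x) + (\<Sum>k<K. h i (-1 - int k) (h i (1 + int k) x))"
      by (subst sum.lessThan_Suc_shift) simp
    ultimately show "(\<Sum>k<Suc K. h i (-1 - int k) (h i (1 + int k) x) + h i (1 - 1 - int k) (h i (int k) x)) =
      2 \<odot> (\<Sum>k<K. h i (-1 - int k) (h i (1 + int k) x)) + T i (T i x)"
      unfolding sum.distrib by (simp add: scale_left_distrib[of 1 1, simplified])
  qed
  also have "\<dots> = 2 \<odot> (\<Sum>i\<in>UNIV. \<Sum>k<K. h i (-1 - int k) (h i (1 + int k) x)) + bil l l \<odot> x"
    using T_G[OF x(1)] xC by (simp add: sum.distrib scale_sum_right bil_def scale_sum_left mode_scale_right t_car)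
  finally have *: "2 \<odot> (\<Sum>i\<in>UNIV. \<Sum>k<K. h i (-1 - int k) (h i (1 + int k) x)) = (2 * of_int n) \<odot> x - bil l l \<odot> x"
    by (simp only: add_diff_cancel_right')
  have "(\<Sum>i\<in>UNIV. \<Sum>k<K. h i (-1 - int k) (h i (1 + int k) x)) = (1/2) \<odot> 2 \<odot> (\<Sum>i\<in>UNIV. \<Sum>k<K. h i (-1 - int k) (h i (1 + int k) x))"
    by simp
  also have "\<dots> = (of_int n - bil l l / 2) \<odot> x"
    unfolding * by (simp only: scale_right_diff_distrib scale_scale scale_left_diff_distrib) simp
  finally show ?thesis by simp
qed

text \<open>The product \<open>p\<close> levels above the lowest weight is determined by
  \<open>L0_recursion\<close>. By \<open>ev_mode_comm\<close> the positive modes lead to the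
  products at lower levels, and the outcome is the recursion that defines
  \<open>exp_coeff\<close>.\<close>

lemma ev_ev_mode:
  assumes ab: "a \<in> N" "b \<in> N"
  shows "Y (ev a) (- \<lfloor>a \<bullet> b\<rfloor> - 1 - int p) (ev b) = F (expm a p (Poly_Mapping.single ({#}, a + b) (del a b)))"
proof (induction p rule: less_induct)
  case (less p)
  let ?s = "Poly_Mapping.single ({#}, a + b) (del a b) :: 'n fock"
  have sN: "?s \<in> FN" by (rule FN_single[OF N_add[OF ab]])
  show ?case
  proof (cases p)
    case 0
    then show ?thesis using del[OF ab] by (simp add: Fb_def)
  next
    case (Suc q)
    let ?X = "\<lambda>p. Y (ev a) (- \<lfloor>a \<bullet> b\<rfloor> - 1 - int p) (ev b)"
    let ?x = "?X p"
    have hx: "h i (int j) ?x = of_real (a $ i) \<odot> Y (ev a) (int j + (- \<lfloor>a \<bullet> b\<rfloor> - 1 - int p)) (ev b)" if "j \<ge> 1" for i j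
    proof -
      have "h i (int j) (ev b) = 0" using ev(4)[OF ab(2)] that by simp
      then show ?thesis using ev_mode_comm[OF ab(1) ev(5)[OF ab(2)], of i "int j"] ev(5)[OF ab(1)] by simp
    qed
    have K: "h i (int k) ?x = 0" if "k > p" for i k
    proof -
      have "Y (ev a) (int k + (- \<lfloor>a \<bullet> b\<rfloor> - 1 - int p)) (ev b) = 0" by (rule ev_ev_zero[OF ab]) (use that in linarith)
      then show ?thesis using hx[of k i] that by simp
    qed
    have w: "?x \<in> wt (qn (a + b) + int p)"
      using ev_ev_wt[OF ab, of "- \<lfloor>a \<bullet> b\<rfloor> - 1 - int p"] by (simp del: of_int_diff of_int_add add: algebra_simps)
    have "(of_int (qn (a + b) + int p) - bil (cvec (a + b)) (cvec (a + b)) / 2) \<odot> ?x =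
      (\<Sum>i\<in>UNIV. \<Sum>k<p. h i (-1 - int k) (h i (1 + int k) ?x))"
      by (rule L0_recursion[OF ev_ev_G[OF ab] w K])
    moreover have "of_int (qn (a + b) + int p) - bil (cvec (a + b)) (cvec (a + b)) / 2 = (of_nat p :: complex)"
      unfolding bil_cvec qn[OF N_add[OF ab]] by simp
    ultimately have "of_nat p \<odot> ?x = (\<Sum>i\<in>UNIV. \<Sum>k<p. h i (-1 - int k) (h i (1 + int k) ?x))" by (simp only:)
    also have "\<dots> = (\<Sum>k\<le>q. \<Sum>i\<in>UNIV. of_real (a $ i) \<odot> h i (- int (Suc k)) (?X (q - k)))"
    proof (subst sum.swap, unfold Suc lessThan_Suc_atMost, intro sum.cong refl)
      fix k i assume k: "k \<in> {..q}"
      have i1: "int (Suc k) + (- \<lfloor>a \<bullet> b\<rfloor> - 1 - int (Suc q)) = - \<lfloor>a \<bullet> b\<rfloor> - 1 - int (q - k)" using k by simp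
      have i2: "1 + int k = int (Suc k)" "- 1 - int k = - int (Suc k)" by simp_all
      have "h i (int (Suc k)) (?X (Suc q)) = of_real (a $ i) \<odot> ?X (q - k)"
        using hx[of "Suc k" i] unfolding Suc i1 by simp
      then show "h i (-1 - int k) (h i (1 + int k) (?X (Suc q))) = of_real (a $ i) \<odot> h i (- int (Suc k)) (?X (q - k))"
        unfolding i2 using ab by (simp add: mode_scale_right t_car mode_closed ev)
    qed
    also have "\<dots> = (\<Sum>k\<le>q. F (heis a (- int (Suc k)) (expm a (q - k) ?s)))"
    proof (intro sum.cong refl)
      fix k assume "k \<in> {..q}"
      have IH: "?X (q - k) = F (expm a (q - k) ?s)" by (rule less.IH) (simp add: Suc)
      show "(\<Sum>i\<in>UNIV. of_real (a $ i) \<odot> h i (- int (Suc k)) (?X (q - k))) = F (heis a (- int (Suc k)) (expm a (q - k) ?s))"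
        unfolding IH by (rule F_heis[OF FN_expm[OF sN], symmetric])
    qed
    also have "\<dots> = of_nat p \<odot> F (expm a p ?s)"
      unfolding Suc exp_coeff.simps F_scale F_sum by (simp del: of_nat_Suc)
    finally show ?thesis using Suc by (simp add: scale_cancel_left del: of_nat_Suc exp_coeff.simps)
  qed
qed

text \<open>Induction on the creation operators: both sides satisfy the same commutation relation
  and agree on lowest vectors by \<open>ev_ev_mode\<close>.\<close>

lemma F_exp_mode:
  assumes a: "a \<in> N" and w: "w \<in> FN"
  shows "F (exp_mode del a n w) = Y (ev a) n (F w)"
proof -
  have lin: "fock_linear (exp_mode del a n)" for n unfolding exp_mode_def by (rule fock_linear_lift)
  have base: "F (exp_mode del a n (Poly_Mapping.single (P, b) 1)) = Y (ev a) n (Fb (P, b))" if b: "b \<in> N" for P b n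
  proof (induction P arbitrary: n)
    case empty
    let ?p = "- \<lfloor>a \<bullet> b\<rfloor> - n - 1"
    show ?case
    proof (cases "?p < 0")
      case True
      then have "Y (ev a) n (ev b) = 0" by (intro ev_ev_zero[OF a b]) simp
      then show ?thesis using True by (simp add: exp_mode_vacuum Let_def Fb_def)
    next
      case False
      then have "n = - \<lfloor>a \<bullet> b\<rfloor> - 1 - int (nat ?p)" by simp
      then have "Y (ev a) n (ev b) = F (expm a (nat ?p) (Poly_Mapping.single ({#}, a + b) (del a b)))"
        using ev_ev_mode[OF a b, of "nat ?p"] by simp
      then show ?thesis using False by (simp add: exp_mode_vacuum Let_def Fb_def)
    qed
  next
    case (add x P)
    obtain j k where x: "x = (j, k)" by force
    have FbC: "Fb (P, b) \<in> car" using Fb_car b by blast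
    have eN: "exp_mode del a n (Poly_Mapping.single (P, b) 1) \<in> FN" for n by (intro FN_exp_mode a FN_single b)
    have "F (exp_mode del a n (Poly_Mapping.single (add_mset x P, b) 1)) =
      h j (- int k - 1) (Y (ev a) n (Fb (P, b))) - of_real (a $ j) \<odot> Y (ev a) (n - int k - 1) (Fb (P, b))"
      unfolding x fcre_single[symmetric] exp_mode_fcre F_diff F_scale F_heisb[OF eN] add ..
    also have "h j (- int k - 1) (Y (ev a) n (Fb (P, b))) = Y (ev a) n (h j (- int k - 1) (Fb (P, b))) + of_real (a $ j) \<odot> Y (ev a) (- int k - 1 + n) (Fb (P, b))"
      by (rule ev_mode_comm[OF a FbC])
    also have "- int k - 1 + n = n - int k - 1" by simp
    also have "h j (- int k - 1) (Fb (P, b)) = Fb (add_mset x P, b)"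
      using ev(5)[OF b] by (simp add: Fb_def x)
    finally show ?case by simp
  qed
  show ?thesis using w
  proof (rule FN_linear_eq[where A = "\<lambda>w. F (exp_mode del a n w)" and B = "\<lambda>w. Y (ev a) n (F w)"])
    fix P b assume "b \<in> N"
    then show "F (exp_mode del a n (Poly_Mapping.single (P, b) 1)) = Y (ev a) n (F (Poly_Mapping.single (P, b) 1))"
      using base by simp
  qed (simp_all add: fock_linear_add[OF lin] fock_linear_scale[OF lin] F_add F_scale mode_add_right mode_scale_right F_car ev a)
qed

end

lemma minus_one_powi_neg: "(-1::complex) powi (- int k - 1) = (-1) ^ Suc k"
proof -
  have "- int k - 1 = - int (Suc k)" by simp
  then have "(-1::complex) powi (- int k - 1) = inverse ((-1) ^ Suc k)"
    by (simp only: power_int_minus power_int_of_nat)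
  also have "\<dots> = (-1) ^ Suc k" by (cases "even k") simp_all
  finally show ?thesis .
qed

text \<open>One binomial in two roles: as coefficient of a divided derivative and as coefficient in
  the iterate formula. Their equality makes the normally ordered product the field of
  h(-k-1)v.\<close>

lemma gbinomial_minus_one_minus:
  "(-1) ^ k * (of_int (- 1 - int j) gchoose k) = (of_nat ((j + k) choose k) :: complex)"
  "(-1) ^ j * (of_int (- int k - 1) gchoose j) = (of_nat ((j + k) choose k) :: complex)"
proof -
  have one: "(-1) ^ m * ((-1) ^ m * x) = (x :: complex)" for m x
    by (simp add: mult.assoc[symmetric] power_mult_distrib[symmetric])
  have "(j + k) choose j = (j + k) choose k" using binomial_symmetric[of j "j + k"] by simp
  moreover have "of_int (- 1 - int j) = (- of_nat j - 1 :: complex)" by simp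
  ultimately show "(-1) ^ k * (of_int (- 1 - int j) gchoose k) = (of_nat ((j + k) choose k) :: complex)"
    by (simp only: gbinomial_negative one)
  have "of_int (- int k - 1) = (- of_nat k - 1 :: complex)" by simp
  then show "(-1) ^ j * (of_int (- int k - 1) gchoose j) = (of_nat ((j + k) choose k) :: complex)"
    by (simp only: gbinomial_negative one add.commute)
qed

context lattice_heisenberg_voa
begin

lemma eventually_zero_via_F:
  assumes "v \<in> car" "w \<in> car" "\<And>n. B n \<in> FN" "\<And>n. F (B n) = Y v n w"
  shows "\<exists>J. \<forall>n\<ge>J. B n = 0"
proof -
  obtain J where "\<forall>n\<ge>J. Y v n w = 0" using truncation[OF assms(1,2)] by blast
  then have "\<forall>n\<ge>J. B n = 0" using F_inj[OF assms(3)] assms(4) by simp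
  then show ?thesis by blast
qed

text \<open>The iterate formula at index \<open>- k - 1\<close> is the normally ordered product with
  the k-th divided derivative of the Heisenberg field. After truncation both are finite sums,
  matched by shifting one index by \<open>k\<close>.\<close>

lemma F_normal_product:
  fixes k :: nat and i :: 'n
  assumes v: "v \<in> car" and w: "w \<in> FN"
    and B: "\<And>n w. w \<in> FN \<Longrightarrow> B n w \<in> FN" "\<And>n w. w \<in> FN \<Longrightarrow> F (B n w) = Y v n (F w)"
  defines "R \<equiv> normal_product (deriv_field k (heis (axis i 1))) B"
  shows "R n w \<in> FN" "F (R n w) = Y (h i (- int k - 1) v) n (F w)"
proof -
  let ?A = "deriv_field k (heis (axis i 1))"
  have A: "?A m x = fock_scale ((-1) ^ k * (of_int m gchoose k)) (heisb i (m - int k) x)" for m x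
    by (simp add: deriv_field_def heis_axis)
  have AN: "?A m x \<in> FN" if "x \<in> FN" for m x unfolding A by (intro FN_scale FN_heisb that)
  show "R n w \<in> FN" unfolding R_def normal_product_def by (intro FN_add FN_Sum_any AN B w)
  have FA: "F (?A m x) = ((-1) ^ k * (of_int m gchoose k)) \<odot> h i (m - int k) (F x)" if "x \<in> FN" for m x
    unfolding A F_scale F_heisb[OF that] ..
  have FC: "F w \<in> car" using w F_car by blast
  obtain J1 where J1: "\<forall>n\<ge>J1. B n w = 0"
    using eventually_zero_via_F[OF v FC, of "\<lambda>n. B n w"] B w by blast
  obtain J2 where J2: "\<forall>n\<ge>J2. heisb i n w = 0"
    using eventually_zero_via_F[OF t_car FC, of "\<lambda>n. heisb i n w" i] FN_heisb F_heisb w by blast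
  \<comment> \<open>Linearity of \<open>B\<close> is not among the hypotheses, so its value at 0 is
    found through the injectivity of \<open>F\<close>.\<close>
  have B0: "B n 0 = 0" for n using F_inj[OF B(1)[OF FN_0]] B(2)[OF FN_0, of n] v by simp
  define M where "M = nat (max (max (J1 - n) J2) 0)"
  have z1: "B (n + int j) w = 0" if "j \<ge> M" for j using J1 that by (simp add: M_def)
  have z2: "heisb i (int j) w = 0" if "j \<ge> M" for j using J2 that by (simp add: M_def)
  let ?f1 = "\<lambda>j::nat. ?A (- 1 - int j) (B (n + int j) w)"
  let ?f2 = "\<lambda>j::nat. B (n - 1 - int j) (?A (int j) w)"
  have s1: "Sum_any ?f1 = (\<Sum>j<M. ?f1 j)"
    by (rule Sum_any_eq_sum) (simp add: z1 A fock_linear_0[OF fock_linear_lift])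
  \<comment> \<open>For \<open>j < k\<close> the binomial of the divided derivative vanishes, for
    \<open>j \<ge> M + k\<close> the Heisenberg mode does.\<close>
  have zA: "?A (int j) w = 0" if "j < k \<or> j \<ge> M + k" for j
  proof (cases "j < k")
    case True
    have "(of_int (int j) :: complex) gchoose k = of_nat (j choose k)"
      unfolding binomial_gbinomial by simp
    also have "\<dots> = 0" using True by (simp add: binomial_eq_0)
    finally have "(of_int (int j) :: complex) gchoose k = 0" .
    then show ?thesis unfolding A by simp
  next
    case False
    then have jk: "int j - int k = int (j - k)" "j - k \<ge> M" using that by auto
    then have "heisb i (int j - int k) w = 0" using z2[OF jk(2)] by (simp only:)
    then show ?thesis unfolding A by (simp only: fock.scale_zero_right)
  qed
  have s2: "Sum_any ?f2 = (\<Sum>j<M + k. ?f2 j)"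
    by (rule Sum_any_eq_sum) (simp add: zA B0)
  have s3: "(\<Sum>j<M + k. ?f2 j) = (\<Sum>j<M. ?f2 (j + k))"
  proof -
    have "(\<Sum>j<M + k. ?f2 j) = (\<Sum>j\<in>{k..<M + k}. ?f2 j)"
      by (rule sum.mono_neutral_right) (auto simp: zA B0)
    also have "\<dots> = (\<Sum>j<M. ?f2 (j + k))"
      by (rule sum.reindex_bij_witness[of _ "\<lambda>j. j + k" "\<lambda>j. j - k"]) auto
    finally show ?thesis .
  qed
  let ?b = "\<lambda>j. (of_nat ((j + k) choose k) :: complex)"
  have F1: "F (?f1 j) = ?b j \<odot> h i (- int k - 1 - int j) (Y v (n + int j) (F w))" for j
  proof -
    have "- 1 - int j - int k = - int k - 1 - int j" by simp
    then show ?thesis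
      unfolding FA[OF B(1)[OF w]] gbinomial_minus_one_minus B(2)[OF w] by (simp only:)
  qed
  have F2: "F (?f2 (j + k)) = ((-1) ^ k * ?b j) \<odot> Y v (n + (- int k - 1) - int j) (h i (int j) (F w))" for j
  proof -
    have i1: "n - 1 - int (j + k) = n + (- int k - 1) - int j" "int (j + k) - int k = int j" by simp_all
    have "(of_int (int (j + k)) gchoose k :: complex) = ?b j"
      using binomial_gbinomial[of "j + k" k, where 'a = complex] by simp
    then show ?thesis
      unfolding B(2)[OF AN[OF w]] FA[OF w] i1 using v FC by (simp only: mode_scale_right h_in)
  qed
  have "F (R n w) = (\<Sum>j<M. ?b j \<odot> h i (- int k - 1 - int j) (Y v (n + int j) (F w)) +
      ((-1) ^ k * ?b j) \<odot> Y v (n + (- int k - 1) - int j) (h i (int j) (F w)))"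
    unfolding R_def normal_product_def s1 s2 s3 F_add F_sum F1 F2 sum.distrib ..
  also have "\<dots> = (\<Sum>j<M. ((-1) ^ j * (of_int (- int k - 1) gchoose j)) \<odot>
     (h i (- int k - 1 - int j) (Y v (n + int j) (F w)) - ((-1) powi (- int k - 1)) \<odot> Y v (n + (- int k - 1) - int j) (h i (int j) (F w))))"
    unfolding gbinomial_minus_one_minus minus_one_powi_neg
    by (intro sum.cong refl) (simp add: scale_right_distrib mult.commute)
  also have "\<dots> = Sum_any (\<lambda>j::nat. ((-1) ^ j * (of_int (- int k - 1) gchoose j)) \<odot>
     (h i (- int k - 1 - int j) (Y v (n + int j) (F w)) - ((-1) powi (- int k - 1)) \<odot> Y v (n + (- int k - 1) - int j) (h i (int j) (F w))))"
  proof (rule Sum_any_eq_sum[symmetric])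
    fix j assume j: "M \<le> j"
    have "Y v (n + int j) (F w) = 0" using B(2)[OF w, of "n + int j"] z1[OF j] by simp
    moreover have "h i (int j) (F w) = 0" using F_heisb[OF w, of i "int j"] z2[OF j] by simp
    ultimately show "((-1) ^ j * (of_int (- int k - 1) gchoose j)) \<odot>
     (h i (- int k - 1 - int j) (Y v (n + int j) (F w)) - ((-1) powi (- int k - 1)) \<odot> Y v (n + (- int k - 1) - int j) (h i (int j) (F w))) = 0"
      using v by (simp only: mode_zero_right[OF t_car] mode_zero_right[OF v] scale_zero_right diff_zero)
  qed
  also have "\<dots> = Y (h i (- int k - 1) v) n (F w)" by (rule iterate[OF t_car v FC, symmetric])
  finally show "F (R n w) = Y (h i (- int k - 1) v) n (F w)" .
qed

lemma F_lattice_field: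
  assumes a: "a \<in> N" and w: "w \<in> FN"
  shows "F (lattice_field del (P, a) n w) = Y (Fb (P, a)) n (F w)"
proof -
  let ?L = "\<lambda>xs. foldr (\<lambda>(i, k) F. normal_product (deriv_field k (heis (axis i 1))) F) xs (exp_mode del a)"
  have "(\<forall>n. \<forall>w\<in>FN. ?L xs n w \<in> FN \<and> F (?L xs n w) = Y (cre xs (ev a)) n (F w))" for xs
  proof (induction xs)
    case Nil
    then show ?case using F_exp_mode[OF a] FN_exp_mode[OF a] by simp
  next
    case (Cons x xs)
    obtain i k where x: "x = (i, k)" by force
    have vC: "cre xs (ev a) \<in> car" by (rule cre_car[OF ev(5)[OF a]])
    show ?case
    proof (intro allI ballI conjI)
      fix n w assume w: "w \<in> FN"
      have B: "\<And>n w. w \<in> FN \<Longrightarrow> ?L xs n w \<in> FN" "\<And>n w. w \<in> FN \<Longrightarrow> F (?L xs n w) = Y (cre xs (ev a)) n (F w)"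
        using Cons by blast+
      show "?L (x # xs) n w \<in> FN" "F (?L (x # xs) n w) = Y (cre (x # xs) (ev a)) n (F w)"
        using F_normal_product[OF vC w B, where k=k and i=i and n=n] by (simp_all add: x)
    qed
  qed
  then show ?thesis using w unfolding lattice_field_def Fb_def crem_def by simp
qed

lemma F_mode:
  assumes u: "u \<in> FN" and w: "w \<in> FN"
  shows "F (fock_lift (\<lambda>b. lattice_field del b n w) u) = Y (F u) n (F w)"
proof -
  have "F (fock_lift (\<lambda>b. lattice_field del b n w) u) = (\<Sum>b\<in>Poly_Mapping.keys u. Poly_Mapping.lookup u b \<odot> Y (Fb b) n (F w))"
    unfolding F_lift
  proof (intro sum.cong refl)
    fix b assume b: "b \<in> Poly_Mapping.keys u"
    obtain P a where P: "b = (P, a)" by force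
    then have "a \<in> N" using b u by (auto simp: FN_def)
    then show "Poly_Mapping.lookup u b \<odot> F (lattice_field del b n w) = Poly_Mapping.lookup u b \<odot> Y (Fb b) n (F w)"
      unfolding P using F_lattice_field w by simp
  qed
  also have "\<dots> = Y (F u) n (F w)"
  proof -
    have "Fb b \<in> car" if "b \<in> Poly_Mapping.keys u" for b
      using that u Fb_car by (cases b) (auto simp: FN_def)
    then show ?thesis unfolding F_def[of u] using F_car[OF w]
      by (simp add: mode_sum_left car_scale mode_scale_left)
  qed
  finally show ?thesis .
qed

lemma lattice_mode_FN:
  assumes u: "u \<in> FN" and w: "w \<in> FN"
  shows "fock_lift (\<lambda>b. lattice_field del b n w) u \<in> FN"
proof (rule FN_lift[OF u])
  fix P a assume a: "a \<in> N"
  let ?L = "\<lambda>xs. foldr (\<lambda>(i, k) F. normal_product (deriv_field k (heis (axis i 1))) F) xs (exp_mode del a)"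
  have "\<forall>n. \<forall>w\<in>FN. ?L xs n w \<in> FN" for xs
  proof (induction xs)
    case Nil
    then show ?case using FN_exp_mode[OF a] by simp
  next
    case (Cons x xs)
    then show ?case
      by (cases x) (auto simp: normal_product_def deriv_field_def intro!: FN_add FN_Sum_any FN_scale FN_heis)
  qed
  then show "lattice_field del (P, a) n w \<in> FN" using w unfolding lattice_field_def by simp
qed

theorem iso_lattice_voa: "voa_isomorphic V (lattice_voa N del)"
proof -
  interpret pr: vector_space_pair "fock_scale :: complex \<Rightarrow> 'n fock \<Rightarrow> _" "vscale V" ..
  have lin: "Vector_Spaces.linear fock_scale (vscale V) F"
    by unfold_locales (simp_all add: F_add F_scale)
  have inj: "inj_on F FN"
  proof (rule inj_onI)
    fix x y assume xy: "x \<in> FN" "y \<in> FN" "F x = F y"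
    then have "x - y = 0" by (intro F_inj FN_diff) (simp_all add: F_diff)
    then show "x = y" by simp
  qed
  \<comment> \<open>An isomorphism has to be linear on the ambient space, so a linear left inverse
    of \<open>F\<close> takes the place of the inverse bijection between the carriers.\<close>
  obtain g where g: "Vector_Spaces.linear (vscale V) fock_scale g" "\<forall>v\<in>FN. g (F v) = v"
    using pr.linear_exists_left_inverse_on[OF lin FN_sub inj] by blast
  have Fg: "F (g v) = v \<and> g v \<in> FN" if "v \<in> car" for v
    using that F_surj g(2) by (metis (no_types, lifting) image_iff)
  have carN: "vcar (lattice_voa N del) = FN" by (simp add: lattice_voa_def FN_def)
  have conf: "F (conf (lattice_voa N del)) = conf V"
  proof -
    have "2 \<odot> F (conf (lattice_voa N del)) = (\<Sum>i\<in>UNIV. h i (-1) (t i))"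
      by (simp add: lattice_voa_def F_sum scale_sum_right Fb_def ev_0 vac_in creation t_car)
    then have "2 \<odot> F (conf (lattice_voa N del)) = 2 \<odot> conf V" by (simp add: conf_t)
    then show ?thesis by (simp add: scale_cancel_left)
  qed
  have vac: "F (vac (lattice_voa N del)) = vac V" by (simp add: lattice_voa_def Fb_def ev_0)
  show ?thesis
    unfolding voa_isomorphic_def
  proof (intro exI[of _ g] conjI ballI allI)
    show "Vector_Spaces.linear (vscale V) (vscale (lattice_voa N del)) g" using g by (simp add: lattice_voa_def)
    show "bij_betw g car (vcar (lattice_voa N del))"
      unfolding carN by (rule bij_betw_byWitness[where f' = F]) (use Fg g F_car in auto)
    have "conf (lattice_voa N del) \<in> FN" "vac (lattice_voa N del) \<in> FN"
      by (auto simp: lattice_voa_def intro!: FN_sum FN_single N_0)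
    then show "g (vac V) = vac (lattice_voa N del)" "g (conf V) = conf (lattice_voa N del)"
      using g(2) conf vac by metis+
    fix u v n assume uv: "u \<in> car" "v \<in> car"
    let ?m = "fock_lift (\<lambda>b. lattice_field del b n (g v)) (g u)"
    have "F ?m = Y u n v" using F_mode[of "g u" "g v" n] Fg uv by simp
    moreover have "?m \<in> FN" using lattice_mode_FN Fg uv by blast
    ultimately have "g (Y u n v) = ?m" using g(2) by metis
    then show "g (Y u n v) = vmode (lattice_voa N del) (g u) n (g v)" by (simp add: lattice_voa_def)
  qed
qed

section \<open>The cocycle identities\<close>

lemma floor_inner_add:
  assumes "a \<in> N" "b \<in> N" "g \<in> N"
  shows "\<lfloor>(a + b) \<bullet> g\<rfloor> = \<lfloor>a \<bullet> g\<rfloor> + \<lfloor>b \<bullet> g\<rfloor>" "\<lfloor>g \<bullet> (a + b)\<rfloor> = \<lfloor>g \<bullet> a\<rfloor> + \<lfloor>g \<bullet> b\<rfloor>"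
proof -
  have "(a + b) \<bullet> g = of_int (\<lfloor>a \<bullet> g\<rfloor> + \<lfloor>b \<bullet> g\<rfloor>)"
    using inner_int[OF assms(1,3)] inner_int[OF assms(2,3)] by (simp add: inner_add_left)
  then show "\<lfloor>(a + b) \<bullet> g\<rfloor> = \<lfloor>a \<bullet> g\<rfloor> + \<lfloor>b \<bullet> g\<rfloor>" by (metis floor_of_int)
  then show "\<lfloor>g \<bullet> (a + b)\<rfloor> = \<lfloor>g \<bullet> a\<rfloor> + \<lfloor>g \<bullet> b\<rfloor>" by (simp add: inner_commute)
qed

text \<open>By \<open>ev_ev_mode\<close> all products of the two lowest vectors depend linearly on
  \<open>del a b\<close>, and by simplicity they do not all vanish.\<close>

lemma del_nonzero:
  assumes ab: "a \<in> N" "b \<in> N"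
  shows "del a b \<noteq> 0"
proof
  assume 0: "del a b = 0"
  have "Y (ev a) n (ev b) = 0" for n
  proof (cases "n \<ge> - \<lfloor>a \<bullet> b\<rfloor>")
    case True
    then show ?thesis by (rule ev_ev_zero[OF ab])
  next
    case False
    then have n: "n = - \<lfloor>a \<bullet> b\<rfloor> - 1 - int (nat (- \<lfloor>a \<bullet> b\<rfloor> - 1 - n))" by simp
    show ?thesis
      by (subst n) (simp only: ev_ev_mode[OF ab] 0 single_zero fock_linear_0[OF fock_linear_expm] F_0)
  qed
  then show False using mode_nonzero[of "ev a" "ev b"] ev ab by blast
qed

text \<open>The Borcherds identity at extreme indices: every sum shrinks to \<open>j = 0\<close>,
  and \<open>p\<close> is just large enough to remove the term in which \<open>ev a\<close> acts
  first on \<open>ev g\<close>.\<close>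

lemma del_assoc:
  assumes abg: "a \<in> N" "b \<in> N" "g \<in> N"
  shows "del a b * del (a + b) g = del b g * del a (b + g)"
proof -
  define l p q where "l = - \<lfloor>a \<bullet> b\<rfloor> - 1" and "p = - \<lfloor>a \<bullet> g\<rfloor>" and "q = - \<lfloor>b \<bullet> g\<rfloor> - 1"
  have ab: "a + b \<in> N" and bg: "b + g \<in> N" using abg N_add by auto
  have "(\<Sum>j<1. (of_int p gchoose j) \<odot> Y (Y (ev a) (l + int j) (ev b)) (p + q - int j) (ev g)) =
    (\<Sum>j<1. ((-1) ^ j * (of_int l gchoose j)) \<odot> (Y (ev a) (p + l - int j) (Y (ev b) (q + int j) (ev g))
         - ((-1) powi l) \<odot> Y (ev b) (q + l - int j) (Y (ev a) (p + int j) (ev g))))"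
    by (rule borcherds_fin[OF ev(5)[OF abg(1)] ev(5)[OF abg(2)] ev(5)[OF abg(3)]])
      (auto intro!: ev_ev_zero abg simp: l_def p_def q_def)
  then have "Y (Y (ev a) l (ev b)) (p + q) (ev g) = Y (ev a) (p + l) (Y (ev b) q (ev g))"
    using ev_ev_zero[OF abg(1,3), of p] ev(5)[OF abg(2)] by (simp add: p_def)
  also have "Y (ev a) l (ev b) = del a b \<odot> ev (a + b)" unfolding l_def by (rule del[OF abg(1,2)])
  also have "Y (ev b) q (ev g) = del b g \<odot> ev (b + g)" unfolding q_def by (rule del[OF abg(2,3)])
  also have "p + q = - \<lfloor>(a + b) \<bullet> g\<rfloor> - 1" by (simp add: p_def q_def floor_inner_add abg)
  also have "p + l = - \<lfloor>a \<bullet> (b + g)\<rfloor> - 1" by (simp add: p_def l_def floor_inner_add abg)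
  finally have "(del a b * del (a + b) g) \<odot> ev (a + b + g) = (del b g * del a (b + g)) \<odot> ev (a + b + g)"
    using del[OF ab abg(3)] del[OF abg(1) bg] ev(5) ab bg abg
    by (simp add: mode_scale_left mode_scale_right add.assoc)
  then show ?thesis using ev(3)[OF N_add[OF ab abg(3)]] by (simp add: scale_cancel_right)
qed

text \<open>Skew-symmetry of leading terms, read off from the Borcherds identity on the vacuum. From
  the index \<open>l\<close> on the products of \<open>ev a\<close> with \<open>ev b\<close> vanish,
  so the side with iterated products is zero.\<close>

lemma del_commute:
  assumes ab: "a \<in> N" "b \<in> N"
  shows "del a b = (-1) powi \<lfloor>a \<bullet> b\<rfloor> * del b a"
proof -
  define l where "l = - \<lfloor>a \<bullet> b\<rfloor>"
  have C: "ev a \<in> car" "ev b \<in> car" using ev ab by auto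
  have "(\<Sum>j<1. (of_int (-1) gchoose j) \<odot> Y (Y (ev a) (l + int j) (ev b)) (-1 + -1 - int j) (vac V)) =
    (\<Sum>j<1. ((-1) ^ j * (of_int l gchoose j)) \<odot> (Y (ev a) (-1 + l - int j) (Y (ev b) (-1 + int j) (vac V))
         - ((-1) powi l) \<odot> Y (ev b) (-1 + l - int j) (Y (ev a) (-1 + int j) (vac V))))"
    by (rule borcherds_fin[OF C vac_in]) (auto intro!: ev_ev_zero ab creation_reg C simp: l_def)
  moreover have "Y (ev a) l (ev b) = 0" by (rule ev_ev_zero[OF ab]) (simp add: l_def)
  ultimately have "Y (ev a) (l - 1) (ev b) = ((-1) powi l) \<odot> Y (ev b) (l - 1) (ev a)"
    using C by (simp add: creation vac_in add.commute)
  also have "Y (ev a) (l - 1) (ev b) = del a b \<odot> ev (a + b)" unfolding l_def by (rule del[OF ab])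
  also have "Y (ev b) (l - 1) (ev a) = del b a \<odot> ev (a + b)"
    using del[OF ab(2,1)] by (simp add: l_def inner_commute add.commute)
  finally have "del a b \<odot> ev (a + b) = ((-1) powi l * del b a) \<odot> ev (a + b)" by simp
  then have "del a b = (-1) powi l * del b a" using ev(3)[OF N_add[OF ab]] by (simp add: scale_cancel_right)
  moreover have "(-1::complex) powi l = (-1) powi \<lfloor>a \<bullet> b\<rfloor>"
    unfolding l_def by (simp add: power_int_minus power_int_minus_left split: if_splits)
  ultimately show ?thesis by simp
qed

lemma del_twisting: "twisting_cocycle N del"
proof -
  have "del a 0 = 1 \<and> del 0 a = 1" if a: "a \<in> N" for a
  proof -
    have "ev a = del a 0 \<odot> ev a" using del[OF a N_0] creation[OF ev(5)[OF a]] by (simp add: ev_0)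
    then have "1 \<odot> ev a = del a 0 \<odot> ev a" by simp
    then have "del a 0 = 1" using ev(3)[OF a] by (metis scale_cancel_right)
    moreover have "ev a = del 0 a \<odot> ev a" using del[OF N_0 a] ev(5)[OF a] by (simp add: ev_0 vac_mode)
    then have "1 \<odot> ev a = del 0 a \<odot> ev a" by simp
    then have "del 0 a = 1" using ev(3)[OF a] by (metis scale_cancel_right)
    ultimately show ?thesis by blast
  qed
  then show ?thesis
    unfolding twisting_cocycle_def using del_nonzero del_assoc del_commute by blast
qed

end

section \<open>The weight lattice of a holomorphic VOA\<close>

text \<open>Fewer than \<open>CARD('n)\<close> complex linear conditions have a nonzero solution.
  They are treated as real conditions on x and ix, and conjugating the solution turns the real inner
  product into the real part of \<open>bil\<close>.\<close>

lemma bil_zero_exists: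
  fixes S :: "(complex^'n) set"
  assumes "finite S" "card S < CARD('n)"
  shows "\<exists>mu. mu \<noteq> 0 \<and> (\<forall>x\<in>S. bil mu x = 0)"
proof -
  let ?S = "S \<union> (\<lambda>x. \<i> *s x) ` S"
  have "dim ?S \<le> card ?S" by (rule dim_le_card') (use assms in auto)
  also have "\<dots> \<le> card S + card ((\<lambda>x. \<i> *s x) ` S)" by (rule card_Un_le)
  also have "\<dots> \<le> 2 * card S" using card_image_le[OF assms(1)] by simp
  also have "\<dots> < DIM(complex^'n)" using assms(2) by simp
  finally obtain y :: "complex^'n" where y: "y \<noteq> 0" "\<And>x. x \<in> span ?S \<Longrightarrow> orthogonal y x"
    using orthogonal_to_subspace_exists[of ?S] by blast
  define mu where "mu = (\<chi> i. cnj (y $ i))"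
  have re: "Re (bil mu x) = y \<bullet> x" for x
    unfolding bil_def mu_def inner_vec_def by (simp add: inner_complex_def)
  have "bil mu x = 0" if x: "x \<in> S" for x
  proof -
    have "y \<bullet> x = 0" "y \<bullet> (\<i> *s x) = 0" using y(2) x span_base[of _ ?S] by (auto simp: orthogonal_def)
    then have "Re (bil mu x) = 0" "Re (\<i> * bil mu x) = 0" using re[of x] re[of "\<i> *s x"] by (simp_all add: bil_scale_right)
    then show ?thesis by (simp add: complex_eq_iff)
  qed
  moreover have "mu \<noteq> 0" using y(1) by (auto simp: mu_def vec_eq_iff)
  ultimately show ?thesis by blast
qed

lemma self_dual_span:
  assumes "dual_lattice N = N"
  shows "span N = UNIV"
proof (rule ccontr)
  assume "span N \<noteq> UNIV"
  then obtain y where y: "y \<noteq> 0" "\<And>x. x \<in> span N \<Longrightarrow> y \<bullet> x = 0" using span_not_UNIV_orthogonal[of N] by (auto simp: inner_commute)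
  then have "y \<in> dual_lattice N" by (auto simp: dual_lattice_def span_base inner_commute)
  then have "y \<in> span N" using assms span_base by blast
  then show False using y by force
qed

context heisenberg_voa
begin

lemma finite_Lam_norm: "finite {l \<in> Lam. Re (bil l l) / 2 \<le> C}"
proof (rule finite_subset)
  let ?n = "\<lfloor>C\<rfloor>"
  show "{l \<in> Lam. Re (bil l l) / 2 \<le> C} \<subseteq> (\<Union>n\<in>{0..?n}. {l. G l \<inter> wt n \<noteq> {0}})"
  proof safe
    fix l assume l: "l \<in> Lam" "Re (bil l l) / 2 \<le> C"
    obtain k e where e: "e \<in> G l" "e \<in> wt k" "e \<noteq> 0" and k: "bil l l = 2 * of_int k"
      by (rule lowest_vector[OF l(1)]) blast
    have "k \<ge> 0" using G_wt_low[OF e] by linarith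
    moreover have "of_int k \<le> C" using l(2) k by simp
    ultimately have "k \<in> {0..?n}" by (simp add: le_floor_iff)
    moreover have "G l \<inter> wt k \<noteq> {0}" using e by blast
    ultimately show "l \<in> (\<Union>n\<in>{0..?n}. {l. G l \<inter> wt n \<noteq> {0}})" by blast
  qed
  show "finite (\<Union>n\<in>{0..?n}. {l. G l \<inter> wt n \<noteq> {0}})" using finite_labels by blast
qed

lemma Lam_shift:
  assumes "holomorphic_voa V" "\<And>l. l \<in> Lam \<Longrightarrow> bil mu l \<in> \<int>"
    "\<And>C. finite {l \<in> Lam. Re (bil l l) / 2 + Re (bil mu l) \<le> C}"
  shows "mu \<in> Lam"
proof -
  interpret shifted_heisenberg_voa V c t mu by unfold_locales (use assms in auto)
  show ?thesis by (rule shift_in_Lam[OF assms(1)])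
qed

text \<open>A vector orthogonal to \<open>Lam\<close> leaves the finiteness condition unchanged,
  hence is a legitimate shift. It then lies in \<open>Lam\<close>, is orthogonal to itself, and so
  is zero.\<close>

lemma Lam_nondegenerate:
  assumes hol: "holomorphic_voa V" and mu: "\<And>l. l \<in> Lam \<Longrightarrow> bil mu l = 0"
  shows "mu = 0"
proof -
  have L: "mu \<in> Lam"
  proof (rule Lam_shift[OF hol])
    fix C
    have "{l \<in> Lam. Re (bil l l) / 2 + Re (bil mu l) \<le> C} = {l \<in> Lam. Re (bil l l) / 2 \<le> C}" using mu by auto
    then show "finite {l \<in> Lam. Re (bil l l) / 2 + Re (bil mu l) \<le> C}" using finite_Lam_norm by simp
  qed (use mu in auto)
  then show ?thesis using Lam_norm_zero[OF L] mu[OF L] by blast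
qed

lemma Lam_bil_int: "l \<in> Lam \<Longrightarrow> m \<in> Lam \<Longrightarrow> \<exists>k::int. bil l m = of_int k"
proof -
  assume lm: "l \<in> Lam" "m \<in> Lam"
  obtain a b d :: int where "bil l l = 2 * of_int a" "bil m m = 2 * of_int b" "bil (l + m) (l + m) = 2 * of_int d"
    using Lam_norm_nonneg[OF lm(1)] Lam_norm_nonneg[OF lm(2)] Lam_norm_nonneg[OF Lam_add[OF lm]] by (elim exE conjE)
  moreover have "bil (l + m) (l + m) = bil l l + bil m m + 2 * bil l m"
    by (simp add: bil_add_left bil_add_right bil_commute[of m l])
  ultimately have "2 * bil l m = 2 * of_int (d - a - b)" by (simp add: algebra_simps)
  then have "bil l m = of_int (d - a - b)" by (simp only: mult_cancel_left) simp
  then show ?thesis by blast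
qed

lemma Lam_scale_int: "l \<in> Lam \<Longrightarrow> of_int k *s l \<in> Lam"
proof (cases "k \<ge> 0")
  case True
  assume "l \<in> Lam"
  then show ?thesis using Lam_mult[of l "nat k"] True by simp
next
  case False
  assume "l \<in> Lam"
  then have "- (of_nat (nat (- k)) *s l) \<in> Lam" using Lam_mult Lam_neg by blast
  moreover have "- (of_nat (nat (- k)) *s l) = of_int k *s l" using False by (simp add: vec_eq_iff)
  ultimately show ?thesis by simp
qed

lemma Lam_sum: "(\<And>x. x \<in> S \<Longrightarrow> f x \<in> Lam) \<Longrightarrow> sum f S \<in> Lam"
  by (induction S rule: infinite_finite_induct) (auto simp: Lam_0 Lam_add)

definition orthogonal_family :: "(complex^'n) set \<Rightarrow> bool" where
  "orthogonal_family S \<longleftrightarrow> S \<subseteq> Lam - {0} \<and> (\<forall>x\<in>S. \<forall>y\<in>S. x \<noteq> y \<longrightarrow> bil x y = 0)"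

text \<open>Pairing a linear relation with one of its members isolates a coefficient times a nonzero
  norm. The bound guarantees a family of maximal size.\<close>

lemma orthogonal_family_card:
  assumes "orthogonal_family S"
  shows "finite S \<and> card S \<le> CARD('n)"
proof -
  have ind: "vec.independent S"
  proof
    assume "vec.dependent S"
    then obtain U u where U: "finite U" "U \<subseteq> S" "(\<Sum>v\<in>U. u v *s v) = 0" "\<exists>v\<in>U. u v \<noteq> 0"
      unfolding vec.dependent_explicit by blast
    then obtain v where v: "v \<in> U" "u v \<noteq> 0" by blast
    have "0 = bil (\<Sum>x\<in>U. u x *s x) v" using U(3) by simp
    also have "\<dots> = (\<Sum>x\<in>U. u x * bil x v)"
      using U(1) by (induction U rule: finite_induct) (auto simp: bil_add_left bil_scale_left)
    also have "\<dots> = (\<Sum>x\<in>{v}. u x * bil x v)"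
      by (rule sum.mono_neutral_right) (use U v assms in \<open>auto simp: orthogonal_family_def\<close>)
    finally have "bil v v = 0" using v by simp
    then show False using Lam_norm_zero v U(2) assms unfolding orthogonal_family_def by blast
  qed
  then show ?thesis
    using vec.independent_card_le_dim[OF subset_UNIV ind] vec.finiteI_independent[OF ind]
    unfolding vec_dim_card by simp
qed

text \<open>An orthogonal family of maximal size spans: clearing denominators, the component of \<open>l \<in> Lam\<close>
  orthogonal to it would enlarge it.\<close>

lemma orthogonal_basis:
  assumes hol: "holomorphic_voa V"
  obtains u :: "'n \<Rightarrow> complex^'n" where "\<And>i. u i \<in> Lam" "\<And>i. u i \<noteq> 0" "\<And>i j. i \<noteq> j \<Longrightarrow> bil (u i) (u j) = 0"
proof -
  have "orthogonal_family {}" by (simp add: orthogonal_family_def)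
  then obtain S where S: "orthogonal_family S" "\<And>S'. orthogonal_family S' \<Longrightarrow> card S' \<le> card S"
    using ex_has_greatest_nat[of orthogonal_family "{}" card "Suc CARD('n)"] orthogonal_family_card
    by (metis le_imp_less_Suc)
  have fin: "finite S" and le: "card S \<le> CARD('n)" using orthogonal_family_card[OF S(1)] by auto
  have SL: "x \<in> Lam" "x \<noteq> 0" if "x \<in> S" for x using S(1) that by (auto simp: orthogonal_family_def)
  have norm0: "bil x x \<noteq> 0" if "x \<in> S" for x using Lam_norm_zero SL that by blast
  have "card S = CARD('n)"
  proof (rule ccontr)
    assume "card S \<noteq> CARD('n)"
    then obtain mu where mu: "mu \<noteq> 0" "\<And>x. x \<in> S \<Longrightarrow> bil mu x = 0"
      using bil_zero_exists[OF fin] le by fastforce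
    have "bil mu l = 0" if l: "l \<in> Lam" for l
    proof -
      \<comment> \<open>The quotient \<open>e x / d\<close> is the coefficient of \<open>x\<close>
        in the orthogonal projection of \<open>l\<close>; multiplication by \<open>d\<close> makes
        all coefficients integral.\<close>
      define d where "d = (\<Prod>x\<in>S. bil x x)"
      define e where "e = (\<lambda>x. (\<Prod>y\<in>S - {x}. bil y y) * bil l x)"
      have de: "e x * bil x x = d * bil l x" if "x \<in> S" for x
        unfolding d_def e_def using prod.remove[OF fin that, of "\<lambda>x. bil x x"] by simp
      have int: "\<exists>k::int. (\<Prod>x\<in>R. bil x x) = of_int k" if "R \<subseteq> S" for R
      proof -
        have "\<forall>x\<in>R. bil x x \<in> \<int>"
        proof
          fix x assume "x \<in> R"
          then have "x \<in> Lam" using that SL(1) by blast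
          then show "bil x x \<in> \<int>" using Lam_bil_int[of x x] by auto
        qed
        then have "(\<Prod>x\<in>R. bil x x) \<in> \<int>" by (intro Ints_prod) auto
        then show ?thesis by (auto elim: Ints_cases)
      qed
      define y where "y = d *s l - (\<Sum>x\<in>S. e x *s x)"
      have "d *s l \<in> Lam" using int[of S] Lam_scale_int[OF l] unfolding d_def by auto
      moreover have "(\<Sum>x\<in>S. e x *s x) \<in> Lam"
      proof (rule Lam_sum)
        fix x assume x: "x \<in> S"
        obtain k k' :: int where "(\<Prod>y\<in>S - {x}. bil y y) = of_int k" "bil l x = of_int k'"
          using int[of "S - {x}"] Lam_bil_int[OF l SL(1)[OF x]] by blast
        then have "e x = of_int (k * k')" by (simp add: e_def)
        then show "e x *s x \<in> Lam" using Lam_scale_int[OF SL(1)[OF x]] by metis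
      qed
      ultimately have yL: "y \<in> Lam" unfolding y_def by (intro Lam_diff)
      have sumb: "bil (\<Sum>x\<in>R. f x) z = (\<Sum>x\<in>R. bil (f x) z)" for R and f :: "complex^'n \<Rightarrow> complex^'n" and z
        by (induction R rule: infinite_finite_induct) (auto simp: bil_add_left)
      have orth: "bil y x = 0" if x: "x \<in> S" for x
      proof -
        have "(\<Sum>z\<in>S. bil (e z *s z) x) = (\<Sum>z\<in>{x}. bil (e z *s z) x)"
          by (rule sum.mono_neutral_right) (use fin x S(1) in \<open>auto simp: bil_scale_left orthogonal_family_def\<close>)
        then show ?thesis unfolding y_def bil_diff_left sumb using de[OF x] by (simp add: bil_scale_left)
      qed
      have "y = 0"
      proof (rule ccontr)
        assume y0: "y \<noteq> 0"
        have "y \<notin> S" using orth[of y] norm0[of y] by blast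
        moreover have "orthogonal_family (insert y S)"
        proof -
          have "bil x y = 0" if "x \<in> S" for x using orth[OF that] by (subst bil_commute)
          then show ?thesis using S(1) yL y0 orth unfolding orthogonal_family_def by blast
        qed
        ultimately show False using S(2)[of "insert y S"] fin by simp
      qed
      then have "bil (d *s l) mu = bil (\<Sum>x\<in>S. e x *s x) mu" by (simp add: y_def)
      also have "\<dots> = 0" unfolding sumb using mu(2) by (simp add: bil_scale_right bil_commute[of _ mu])
      finally have "d * bil l mu = 0" by (simp add: bil_scale_left)
      moreover have "d \<noteq> 0" unfolding d_def using fin norm0 by simp
      ultimately show ?thesis by (simp add: bil_commute[of mu])
    qed
    then show False using Lam_nondegenerate[OF hol] mu(1) by blast
  qed
  then obtain u where u: "bij_betw u (UNIV :: 'n set) S"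
    using finite_same_card_bij[of "UNIV :: 'n set" S] fin by auto
  show ?thesis
  proof (rule that[of u])
    show "u i \<in> Lam" "u i \<noteq> 0" for i using SL bij_betwE[OF u] by auto
    show "bil (u i) (u j) = 0" if "i \<noteq> j" for i j
      using S(1) that bij_betwE[OF u] bij_betw_imp_inj_on[OF u] unfolding orthogonal_family_def inj_on_def by (metis UNIV_I)
  qed
qed

text \<open>The matrix is orthogonal in the complex bilinear sense, with transpose and no
  conjugation; this is what preserves the products \<open>t_prod\<close> and the Sugawara
  vector.\<close>

lemma basis_change:
  fixes M :: "complex^'n^'n"
  assumes M: "M ** transpose M = mat 1"
  defines "t' \<equiv> \<lambda>i. \<Sum>j\<in>UNIV. M $ i $ j \<odot> t j"
  shows "heisenberg_voa V c t'" "heisenberg_voa.Lam V t' = (\<lambda>l. M *v l) ` Lam"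
proof -
  have M': "transpose M ** M = mat 1" using M matrix_left_right_inverse by blast
  have r: "(\<Sum>k\<in>UNIV. M $ i $ k * M $ j $ k) = (if i = j then 1 else 0)" for i j
    using arg_cong[OF M, of "\<lambda>A. A $ i $ j"] by (simp add: matrix_matrix_mult_def transpose_def mat_def)
  have cl: "(\<Sum>k\<in>UNIV. M $ k $ i * M $ k $ j) = (if i = j then 1 else 0)" for i j
    using arg_cong[OF M', of "\<lambda>A. A $ i $ j"] by (simp add: matrix_matrix_mult_def transpose_def mat_def)
  have t'C: "t' i \<in> car" for i unfolding t'_def by (intro car_sum car_scale t_car)
  have mode: "Y (t' i) n w = (\<Sum>j\<in>UNIV. M $ i $ j \<odot> h j n w)" if "w \<in> car" for i n w
    unfolding t'_def using that by (simp add: mode_sum_left car_scale t_car mode_scale_left)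
  have mm: "Y (t' i) n (t' j) = (\<Sum>k\<in>UNIV. \<Sum>m\<in>UNIV. (M $ i $ k * M $ j $ m) \<odot> h k n (t m))" for i j n
    unfolding mode[OF t'C] by (simp add: t'_def mode_sum_right car_scale t_car mode_scale_right scale_sum_right)
  show H: "heisenberg_voa V c t'"
  proof unfold_locales
    show "t' i \<in> car" for i by (rule t'C)
    show "Y (t' i) n (t' j) = (if n = 1 \<and> i = j then vac V else 0)" if n: "n \<ge> 0" for n i j
    proof -
      have "Y (t' i) n (t' j) = (\<Sum>k\<in>UNIV. \<Sum>m\<in>UNIV. if m = k then (if n = 1 then (M $ i $ k * M $ j $ k) \<odot> vac V else 0) else 0)"
        unfolding mm by (intro sum.cong refl) (use n in \<open>auto simp: t_prod\<close>)
      also have "\<dots> = (\<Sum>k\<in>UNIV. if n = 1 then (M $ i $ k * M $ j $ k) \<odot> vac V else 0)" by simp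
      also have "\<dots> = (if n = 1 \<and> i = j then vac V else 0)"
        by (cases "n = 1") (simp_all add: scale_sum_left[symmetric] r)
      finally show ?thesis .
    qed
    have "(\<Sum>i\<in>UNIV. Y (t' i) (-1) (t' i)) = (\<Sum>k\<in>UNIV. \<Sum>m\<in>UNIV. \<Sum>i\<in>UNIV. (M $ i $ k * M $ i $ m) \<odot> h k (-1) (t m))"
      unfolding mm by (subst sum.swap, rule sum.cong[OF refl], rule sum.swap)
    also have "\<dots> = (\<Sum>k\<in>UNIV. \<Sum>m\<in>UNIV. if k = m then h k (-1) (t m) else 0)"
      unfolding scale_sum_left[symmetric] cl by (intro sum.cong refl) simp
    also have "\<dots> = 2 \<odot> conf V" by (simp add: conf_t)
    finally show "2 \<odot> conf V = (\<Sum>i\<in>UNIV. Y (t' i) (-1) (t' i))" by simp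
  qed
  interpret H: heisenberg_voa V c t' by (rule H)
  have MM: "M *v (transpose M *v l) = l" for l
    by (simp only: matrix_vector_mul_assoc M matrix_vector_mul_lid)
  have 1: "G l \<subseteq> H.G (M *v l)" for l
  proof
    fix w assume w: "w \<in> G l"
    then have wC: "w \<in> car" using G_car by blast
    show "w \<in> H.G (M *v l)"
      unfolding H.G_eq
    proof (intro CollectI conjI allI wC)
      fix i
      show "Y (t' i) 0 w = (M *v l) $ i \<odot> w"
        by (simp add: mode[OF wC] T_G[OF w] matrix_vector_mult_def scale_sum_left)
    qed
  qed
  have 2: "H.G l \<subseteq> G (transpose M *v l)" for l
  proof
    fix w assume w: "w \<in> H.G l"
    then have wC: "w \<in> car" using H.G_car by blast
    show "w \<in> G (transpose M *v l)"
      unfolding G_eq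
    proof (intro CollectI conjI allI wC)
      fix k
      have "(transpose M *v l) $ k \<odot> w = (\<Sum>i\<in>UNIV. M $ i $ k \<odot> Y (t' i) 0 w)"
        by (simp add: H.T_G[OF w] matrix_vector_mult_def transpose_def scale_sum_left)
      also have "\<dots> = (\<Sum>i\<in>UNIV. \<Sum>j\<in>UNIV. (M $ i $ k * M $ i $ j) \<odot> T j w)"
        by (simp add: mode[OF wC] scale_sum_right)
      also have "\<dots> = (\<Sum>j\<in>UNIV. if k = j then T j w else 0)"
        by (subst sum.swap, unfold scale_sum_left[symmetric] cl, intro sum.cong refl) simp
      finally show "T k w = (transpose M *v l) $ k \<odot> w" by simp
    qed
  qed
  show "H.Lam = (\<lambda>l. M *v l) ` Lam"
  proof safe
    fix l assume "l \<in> H.Lam"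
    then obtain a where "a \<in> H.G l" "a \<noteq> 0" using H.Lam_E by blast
    then have "transpose M *v l \<in> Lam" using 2 Lam_I by blast
    then show "l \<in> (\<lambda>l. M *v l) ` Lam" using MM by (metis image_eqI)
  next
    fix l assume "l \<in> Lam"
    then obtain a where "a \<in> G l" "a \<noteq> 0" using Lam_E by blast
    then show "M *v l \<in> H.Lam" using 1 H.Lam_I by blast
  qed
qed

text \<open>The rows of \<open>M\<close> are orthogonal eigenvalues \<open>u i\<close> scaled to
  norm one by the real factors \<open>s i\<close>. In these coordinates a label has the entries
  \<open>s i\<close> times the integer \<open>bil (u i) l\<close>, which are real.\<close>

theorem real_form:
  assumes hol: "holomorphic_voa V"
  shows "\<exists>t' N. lattice_heisenberg_voa V c (t' :: 'n \<Rightarrow> 'v) N"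
proof -
  obtain u where u: "\<And>i. u i \<in> Lam" "\<And>i. u i \<noteq> 0" "\<And>i j :: 'n. i \<noteq> j \<Longrightarrow> bil (u i) (u j) = 0"
    by (rule orthogonal_basis[OF hol]) blast
  have "\<exists>k::int. bil (u i) (u i) = 2 * of_int k \<and> k > 0" for i
    using Lam_norm_nonneg[OF u(1)[of i]] Lam_norm_zero[OF u(1)[of i]] u(2)[of i] by (metis linorder_not_less mult_zero_right of_int_0 order_antisym)
  then obtain k :: "'n \<Rightarrow> int" where k: "\<And>i. bil (u i) (u i) = 2 * of_int (k i)" "\<And>i. k i > 0" by metis
  define s where "s = (\<lambda>i. 1 / sqrt (2 * of_int (k i)))"
  define M :: "complex^'n^'n" where "M = (\<chi> i j. of_real (s i) * u i $ j)"
  have "M ** transpose M = mat 1"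
  proof -
    have "(M ** transpose M) $ i $ j = of_real (s i * s j) * bil (u i) (u j)" for i j
      by (simp add: M_def matrix_matrix_mult_def transpose_def bil_def sum_distrib_left mult.assoc mult.left_commute)
    moreover have "of_real (s i * s i) * bil (u i) (u i) = 1" for i
    proof -
      have "s i * s i = 1 / (2 * of_int (k i))" unfolding s_def using k(2)[of i] by simp
      moreover have "complex_of_int (k i) \<noteq> 0" using k(2)[of i] by simp
      ultimately show ?thesis by (simp add: k(1))
    qed
    ultimately show ?thesis using u(3) by (simp add: vec_eq_iff mat_def)
  qed
  note bc = basis_change[OF this]
  define t' where "t' = (\<lambda>i. \<Sum>j\<in>UNIV. M $ i $ j \<odot> t j)"
  interpret H: heisenberg_voa V c t' unfolding t'_def by (rule bc(1))
  have L: "H.Lam = (\<lambda>l. M *v l) ` Lam" unfolding t'_def by (rule bc(2))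
  define N where "N = {x. cvec x \<in> H.Lam}"
  have "H.Lam = cvec ` N"
  proof
    show "cvec ` N \<subseteq> H.Lam" by (auto simp: N_def)
    show "H.Lam \<subseteq> cvec ` N"
    proof
      fix m assume m: "m \<in> H.Lam"
      then obtain l where l: "l \<in> Lam" "m = M *v l" using L by blast
      have "\<exists>r::real. m $ i = of_real r" for i
      proof -
        obtain z :: int where "bil (u i) l = of_int z" using Lam_bil_int[OF u(1) l(1)] by blast
        moreover have "m $ i = of_real (s i) * bil (u i) l"
          by (simp add: l(2) matrix_vector_mult_def M_def bil_def sum_distrib_left mult.assoc)
        ultimately have "m $ i = of_real (s i * of_int z)" by simp
        then show ?thesis by blast
      qed
      then obtain r where "\<And>i. m $ i = of_real (r i)" by metis
      then have "m = cvec (\<chi> i. r i)" by (simp add: vec_eq_iff)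
      then show "m \<in> cvec ` N" using m by (auto simp: N_def)
    qed
  qed
  then have "lattice_heisenberg_voa V c t' N" by unfold_locales
  then show ?thesis by blast
qed

end

lemma det_Ints:
  fixes A :: "real^'n^'n"
  assumes "\<And>i j. A $ i $ j \<in> \<int>"
  shows "det A \<in> \<int>"
  unfolding det_def by (intro Ints_sum Ints_mult Ints_prod assms) auto

text \<open>Among the bases contained in \<open>N\<close> choose one with the smallest Gram
  determinant, a positive integer. If a vector of \<open>N\<close> had a nonintegral coordinate,
  Cramer's rule shows that putting its vector of fractional parts in place of a basis vector would
  multiply the determinant by a number strictly between 0 and 1.\<close>

lemma integral_subgroup_full_lattice:
  fixes N :: "(real^'n) set"
  assumes zero: "0 \<in> N" and diff: "\<And>x y. x \<in> N \<Longrightarrow> y \<in> N \<Longrightarrow> x - y \<in> N"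
    and int: "\<And>x y. x \<in> N \<Longrightarrow> y \<in> N \<Longrightarrow> x \<bullet> y \<in> \<int>" and span: "span N = UNIV"
  shows "full_lattice N"
proof -
  have neg: "- x \<in> N" if "x \<in> N" for x using diff[OF zero that] by simp
  have add: "x + y \<in> N" if "x \<in> N" "y \<in> N" for x y using diff[OF that(1) neg[OF that(2)]] by simp
  have nat: "of_nat n *\<^sub>R x \<in> N" if "x \<in> N" for n and x
    by (induction n) (auto simp: zero that add algebra_simps)
  have scale: "of_int k *\<^sub>R x \<in> N" if "x \<in> N" for k x
  proof (cases "k \<ge> 0")
    case True
    then show ?thesis using nat[OF that, of "nat k"] by simp
  next
    case False
    then show ?thesis using neg[OF nat[OF that, of "nat (- k)"]] by simp
  qed
  have sumN: "sum f S \<in> N" if "\<And>x. x \<in> S \<Longrightarrow> f x \<in> N" for f :: "'b \<Rightarrow> real^'n" and S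
    using that by (induction S rule: infinite_finite_induct) (auto simp: zero add)
  define P where "P = (\<lambda>A :: real^'n^'n. (\<forall>i. row i A \<in> N) \<and> det A \<noteq> 0)"
  have gram: "\<exists>k::nat. (det A)\<^sup>2 = of_nat k \<and> k > 0" if "P A" for A
  proof -
    have "det (A ** transpose A) \<in> \<int>"
    proof (rule det_Ints)
      fix i j
      have "(A ** transpose A) $ i $ j = row i A \<bullet> row j A"
        by (simp add: matrix_matrix_mult_def transpose_def row_def inner_vec_def)
      then show "(A ** transpose A) $ i $ j \<in> \<int>" using int that by (simp add: P_def)
    qed
    moreover have eq: "det (A ** transpose A) = (det A)\<^sup>2" by (simp add: det_mul power2_eq_square)
    ultimately obtain z :: int where z: "(det A)\<^sup>2 = of_int z" by (auto elim: Ints_cases)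
    moreover have "(det A)\<^sup>2 > 0" using that by (simp add: P_def)
    ultimately have "z > 0" by simp
    then show ?thesis using z by (intro exI[of _ "nat z"]) auto
  qed
  have ex: "\<exists>A. P A"
  proof -
    obtain B where B: "B \<subseteq> N" "independent B" "N \<subseteq> span B" "card B = dim N" using basis_exists by blast
    have "card B = CARD('n)" using B(4) span by (metis DIM_cart DIM_real dim_UNIV dim_span mult_1_right)
    moreover have "finite B" using B(2) by (rule finiteI_independent)
    ultimately obtain u where u: "bij_betw u (UNIV :: 'n set) B"
      using finite_same_card_bij[of "UNIV :: 'n set" B] by auto
    define A :: "real^'n^'n" where "A = (\<chi> i. u i)"
    have row: "row i A = u i" for i by (simp add: A_def row_def vec_eq_iff)
    have "rows A = B" unfolding rows_def row using u by (auto simp: bij_betw_def)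
    moreover have "span B = UNIV" using B(3) span span_minimal[of N "span B"] by auto
    ultimately have "\<exists>C. C ** A = mat 1" by (simp add: matrix_left_invertible_span_rows)
    then have "det A \<noteq> 0" by (simp add: invertible_left_inverse[symmetric] invertible_det_nz)
    then show ?thesis using u B(1) row by (auto simp: P_def bij_betw_def)
  qed
  then obtain A where A: "P A" "\<And>A'. P A' \<Longrightarrow> nat \<lfloor>(det A)\<^sup>2\<rfloor> \<le> nat \<lfloor>(det A')\<^sup>2\<rfloor>"
    using ex_has_least_nat[of P _ "\<lambda>A. nat \<lfloor>(det A)\<^sup>2\<rfloor>"] by blast
  have rowN: "row i A \<in> N" for i using A(1) by (simp add: P_def)
  have d0: "det A \<noteq> 0" using A(1) by (simp add: P_def)
  have inv: "\<exists>C. C ** A = mat 1" using d0 by (simp add: invertible_left_inverse[symmetric] invertible_det_nz)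
  have spanB: "span (rows A) = UNIV" using inv by (simp add: matrix_left_invertible_span_rows)
  have inj: "inj (\<lambda>i. row i A)"
    using d0 det_identical_rows[of _ _ A] by (auto intro!: injI)
  have rows: "rows A = range (\<lambda>i. row i A)" by (auto simp: rows_def)
  have fin: "finite (rows A)" unfolding rows by simp
  have ind: "independent (rows A)"
  proof (rule card_le_dim_spanning[of _ UNIV])
    show "card (rows A) \<le> dim (UNIV :: (real^'n) set)" unfolding rows using card_image_le[of "UNIV :: 'n set" "\<lambda>i. row i A"] by simp
  qed (use spanB fin in auto)
  have sums: "(\<Sum>b\<in>rows A. f b *\<^sub>R b) = (\<Sum>i\<in>UNIV. f (row i A) *\<^sub>R row i A)" for f
    unfolding rows by (simp add: sum.reindex[OF inj])
  have "N = {(\<Sum>b\<in>rows A. of_int (k b) *\<^sub>R b) |k::real^'n \<Rightarrow> int. True}"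
  proof safe
    fix x assume x: "x \<in> N"
    have "x \<in> span (rows A)" using spanB by simp
    then obtain f where "x = (\<Sum>b\<in>rows A. f b *\<^sub>R b)" using span_finite[OF fin] by auto
    then have xf: "x = (\<Sum>i\<in>UNIV. f (row i A) *\<^sub>R row i A)" by (simp add: sums)
    define y where "y = x - (\<Sum>i\<in>UNIV. of_int \<lfloor>f (row i A)\<rfloor> *\<^sub>R row i A)"
    have yN: "y \<in> N" unfolding y_def by (intro diff x sumN scale rowN)
    define r :: "real^'n" where "r = (\<chi> i. frac (f (row i A)))"
    have y: "y = (\<Sum>i\<in>UNIV. r $ i *s row i A)"
      unfolding y_def xf sum_subtractf[symmetric]
      by (intro sum.cong refl) (simp add: r_def frac_def scaleR_diff_left[symmetric] scalar_mult_eq_scaleR)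
    have "f (row i A) = of_int \<lfloor>f (row i A)\<rfloor>" for i
    proof (rule ccontr)
      assume "f (row i A) \<noteq> of_int \<lfloor>f (row i A)\<rfloor>"
      then have ri: "0 < r $ i" "r $ i < 1" using frac_lt_1[of "f (row i A)"] frac_ge_0[of "f (row i A)"]
        by (auto simp: r_def frac_def less_le)
      define A' :: "real^'n^'n" where "A' = (\<chi> j. if j = i then \<Sum>i\<in>UNIV. r $ i *s row i A else row j A)"
      have detA': "det A' = r $ i * det A" unfolding A'_def by (rule cramer_lemma_transpose)
      have "row j A' \<in> N" for j
      proof -
        have "row j A' = (if j = i then y else row j A)" unfolding y by (simp add: A'_def row_def vec_eq_iff)
        then show ?thesis using yN rowN by simp
      qed
      then have PA': "P A'" using detA' d0 ri by (simp add: P_def)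
      obtain k k' :: nat where k: "(det A)\<^sup>2 = of_nat k" "(det A')\<^sup>2 = of_nat k'" using gram A(1) PA' by blast
      have "(r $ i)\<^sup>2 < 1" using ri by (simp add: power_less_one_iff)
      then have "(det A')\<^sup>2 < (det A)\<^sup>2" using d0 by (simp add: detA' power_mult_distrib)
      then show False using A(2)[OF PA'] k by simp
    qed
    then show "\<exists>k. x = (\<Sum>b\<in>rows A. of_int (k b) *\<^sub>R b) \<and> True"
      by (intro exI[of _ "\<lambda>b. \<lfloor>f b\<rfloor>"]) (simp add: sums xf)
  next
    fix k :: "real^'n \<Rightarrow> int"
    show "(\<Sum>b\<in>rows A. of_int (k b) *\<^sub>R b) \<in> N"
      by (intro sumN scale) (auto simp: rows rowN)
  qed
  then show ?thesis unfolding full_lattice_def using ind spanB by blast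
qed

context lattice_heisenberg_voa
begin

lemma dual_N:
  assumes hol: "holomorphic_voa V"
  shows "dual_lattice N = N"
proof
  show "N \<subseteq> dual_lattice N"
  proof
    fix y assume y: "y \<in> N"
    have "x \<bullet> y \<in> \<int>" if "x \<in> N" for x
      by (subst inner_int[OF that y]) (rule Ints_of_int)
    then show "y \<in> dual_lattice N" by (simp add: dual_lattice_def)
  qed
  show "dual_lattice N \<subseteq> N"
  proof
    fix y assume y: "y \<in> dual_lattice N"
    have "cvec y \<in> Lam"
    proof (rule Lam_shift[OF hol])
      fix l assume "l \<in> Lam"
      then obtain x where x: "x \<in> N" "l = cvec x" using Lam_N by blast
      then have "y \<bullet> x \<in> \<int>" using y by (simp add: dual_lattice_def inner_commute)
      then show "bil (cvec y) l \<in> \<int>" unfolding x bil_cvec by (auto elim: Ints_cases)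
    next
      fix C
      \<comment> \<open>Completing the square: the bound on
        \<open>x \<bullet> x / 2 + x \<bullet> y\<close> bounds the norm of \<open>x + y\<close>,
        and the triangle inequality bounds \<open>x\<close>.\<close>
      define r where "r = norm y + sqrt \<bar>2 * C + y \<bullet> y\<bar>"
      have "{l \<in> Lam. Re (bil l l) / 2 + Re (bil (cvec y) l) \<le> C} \<subseteq> {l \<in> Lam. Re (bil l l) / 2 \<le> r\<^sup>2 / 2}"
      proof safe
        fix l assume l: "l \<in> Lam" "Re (bil l l) / 2 + Re (bil (cvec y) l) \<le> C"
        obtain x where x: "x \<in> N" "l = cvec x" using l(1) Lam_N by blast
        have "(norm (x + y))\<^sup>2 = x \<bullet> x + 2 * (x \<bullet> y) + y \<bullet> y"
          by (simp add: power2_norm_eq_inner inner_add inner_commute)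
        also have "\<dots> \<le> 2 * C + y \<bullet> y" using l(2) by (simp add: x bil_cvec inner_commute)
        finally have "norm (x + y) \<le> sqrt \<bar>2 * C + y \<bullet> y\<bar>" by (simp add: real_le_rsqrt)
        then have "norm x \<le> r" using norm_triangle_ineq4[of "x + y" y] by (simp add: r_def)
        then have "x \<bullet> x \<le> r\<^sup>2" by (metis norm_ge_zero power2_norm_eq_inner power_mono)
        then show "Re (bil l l) / 2 \<le> r\<^sup>2 / 2" by (simp add: x bil_cvec)
      qed
      then show "finite {l \<in> Lam. Re (bil l l) / 2 + Re (bil (cvec y) l) \<le> C}"
        using finite_Lam_norm finite_subset by blast
    qed
    then show "y \<in> N" by (simp add: N_Lam)
  qed
qed

lemma even_lattice_N:
  assumes hol: "holomorphic_voa V"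
  shows "even_lattice N"
proof -
  have dual: "dual_lattice N = N" by (rule dual_N[OF hol])
  have "full_lattice N"
  proof (rule integral_subgroup_full_lattice[OF N_0 N_diff _ self_dual_span[OF dual]])
    show "x \<bullet> y \<in> \<int>" if "x \<in> N" "y \<in> N" for x y
      by (subst inner_int[OF that]) (rule Ints_of_int)
  qed
  moreover have "\<forall>x\<in>N. \<exists>k::int. x \<bullet> x = 2 * of_int k" using qn by blast
  ultimately show ?thesis unfolding even_lattice_def by blast
qed

end

theorem (in heisenberg_voa) holomorphic_is_lattice_voa:
  assumes hol: "holomorphic_voa V"
  shows "\<exists>(N :: (real^'n) set) \<delta>. even_lattice N \<and> dual_lattice N = N \<and> twisting_cocycle N \<delta> \<and> voa_isomorphic V (lattice_voa N \<delta>)"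
proof -
  obtain t' :: "'n \<Rightarrow> 'v" and N where "lattice_heisenberg_voa V c t' N" using real_form[OF hol] by blast
  then interpret K: lattice_heisenberg_voa V c t' N .
  show ?thesis using K.even_lattice_N[OF hol] K.dual_N[OF hol] K.del_twisting K.iso_lattice_voa by blast
qed

section \<open>Elements of order three in a Weyl group\<close>

definition reflect :: "'a::euclidean_space \<Rightarrow> 'a \<Rightarrow> 'a" where "reflect a x = x - (x \<bullet> a) *\<^sub>R a"

lemma reflect_linear: "linear (reflect a)"
  unfolding reflect_def by (intro linearI) (simp_all add: inner_add_left algebra_simps)

lemma reflect_neg: "reflect (- a) = reflect a" by (simp add: reflect_def fun_eq_iff)

lemma reflect_inner: "a \<bullet> a = 2 \<Longrightarrow> reflect a x \<bullet> reflect a y = x \<bullet> y"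
  by (simp add: reflect_def inner_diff inner_commute)

lemma reflect_refl: "a \<bullet> a = 2 \<Longrightarrow> reflect a (reflect a x) = x"
  by (simp add: reflect_def inner_diff algebra_simps)

lemma reflect_conj:
  assumes "linear w" "\<And>x y. w x \<bullet> w y = x \<bullet> y"
  shows "reflect (w b) (w x) = w (reflect b x)"
  using assms by (simp add: reflect_def linear_diff linear_scale)

definition roots :: "'a::euclidean_space set \<Rightarrow> 'a set" where "roots L = {a \<in> L. a \<bullet> a = 2}"

text \<open>Finiteness of \<open>roots L\<close> supports the induction on heights and the choice of
  a generic vector below.\<close>

locale integral_lattice =
  fixes L :: "'a::euclidean_space set"
  assumes diff_in: "x \<in> L \<Longrightarrow> y \<in> L \<Longrightarrow> x - y \<in> L"
    and inner_Ints: "x \<in> L \<Longrightarrow> y \<in> L \<Longrightarrow> x \<bullet> y \<in> \<int>"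
    and finite_roots: "finite (roots L)"
begin

abbreviation R :: "'a set" where "R \<equiv> roots L"

lemma R_norm: "a \<in> R \<Longrightarrow> a \<bullet> a = 2" by (simp add: roots_def)
lemma R_int: "a \<in> R \<Longrightarrow> b \<in> R \<Longrightarrow> \<exists>k::int. a \<bullet> b = of_int k"
  using inner_Ints[of a b] by (auto simp: roots_def elim: Ints_cases)
lemma neg_in: "x \<in> L \<Longrightarrow> - x \<in> L" using diff_in[of "x - x" x] diff_in[of x x] by simp
lemma add_in: "x \<in> L \<Longrightarrow> y \<in> L \<Longrightarrow> x + y \<in> L" using diff_in[of x "- y"] neg_in by simp
lemma R_neg: "a \<in> R \<Longrightarrow> - a \<in> R" using neg_in by (simp add: roots_def)
lemma R_add: "a \<in> R \<Longrightarrow> b \<in> R \<Longrightarrow> a \<bullet> b = -1 \<Longrightarrow> a + b \<in> R"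
  using add_in by (simp add: roots_def inner_add inner_commute)

definition wfun :: "'a list \<Rightarrow> 'a \<Rightarrow> 'a" where "wfun xs = foldr (\<lambda>a g. reflect a \<circ> g) xs id"

lemma wfun_simps [simp]: "wfun [] = id" "wfun (a # xs) = reflect a \<circ> wfun xs"
  by (simp_all add: wfun_def)

lemma wfun_append: "wfun (xs @ ys) = wfun xs \<circ> wfun ys"
  by (induction xs) (simp_all add: comp_assoc)

lemma wfun_linear: "linear (wfun xs)"
proof (induction xs)
  case (Cons a xs)
  then show ?case unfolding wfun_simps by (intro linear_compose reflect_linear)
next
  case Nil
  show ?case unfolding wfun_simps by (rule linear_id)
qed

lemma wfun_inner: "set xs \<subseteq> R \<Longrightarrow> wfun xs x \<bullet> wfun xs y = x \<bullet> y"
  by (induction xs) (auto simp: reflect_inner R_norm)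

lemma weyl_wfun: "g \<in> weyl_group L \<Longrightarrow> \<exists>xs. set xs \<subseteq> R \<and> g = wfun xs"
proof (induction rule: weyl_group.induct)
  case weyl_id
  show ?case by (intro exI[of _ "[]"]) simp
next
  case (weyl_reflection g a)
  then obtain xs where "set xs \<subseteq> R" "g = wfun xs" by blast
  moreover have "(\<lambda>x. x - (x \<bullet> a) *\<^sub>R a) = reflect a" by (simp add: reflect_def fun_eq_iff)
  ultimately show ?case using weyl_reflection by (intro exI[of _ "a # xs"]) (auto simp: roots_def)
qed

lemma weyl_reflect: "g \<in> weyl_group L \<Longrightarrow> a \<in> R \<Longrightarrow> reflect a \<circ> g \<in> weyl_group L"
  using weyl_group.weyl_reflection[of g L a] by (simp add: roots_def reflect_def[abs_def])

lemma weyl_isometry: "g \<in> weyl_group L \<Longrightarrow> linear g \<and> (\<forall>x y. g x \<bullet> g y = x \<bullet> y)"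
  using weyl_wfun[of g] wfun_linear wfun_inner by blast

lemma weyl_L: "g \<in> weyl_group L \<Longrightarrow> x \<in> L \<Longrightarrow> g x \<in> L"
proof (induction rule: weyl_group.induct)
  case (weyl_reflection g a)
  have scale: "of_nat n *\<^sub>R a \<in> L" for n
  proof (induction n)
    case 0
    then show ?case using diff_in[OF weyl_reflection(2) weyl_reflection(2)] by simp
  next
    case (Suc n)
    then show ?case using add_in[OF weyl_reflection(2) Suc] by (simp add: algebra_simps)
  qed
  obtain k :: int where k: "g x \<bullet> a = of_int k" using inner_Ints[of "g x" a] weyl_reflection by (auto elim: Ints_cases)
  have "of_int k *\<^sub>R a \<in> L"
  proof (cases "k \<ge> 0")
    case True
    then show ?thesis using scale[of "nat k"] by simp
  next
    case False
    then show ?thesis using neg_in[OF scale[of "nat (- k)"]] by simp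
  qed
  then show ?case using weyl_reflection k diff_in by simp
qed simp

text \<open>A vector off all reflecting hyperplanes has trivial stabiliser: a word in the simple
  reflections that preserves the positive roots can be shortened by two letters.\<close>

context
  fixes v :: 'a
  assumes regular: "\<And>a. a \<in> R \<Longrightarrow> v \<bullet> a \<noteq> 0"
begin

definition pos :: "'a \<Rightarrow> bool" where "pos a \<longleftrightarrow> a \<in> R \<and> v \<bullet> a > 0"

definition simple_root :: "'a \<Rightarrow> bool" where
  "simple_root a \<longleftrightarrow> pos a \<and> \<not> (\<exists>b c. pos b \<and> pos c \<and> a = b + c)"

text \<open>Positive definiteness leaves only -1, 0 and 1 for the inner product of \<open>b\<close>
  and \<open>s\<close>. In the last case, if \<open>b - s\<close> were negative,
  \<open>s = b + (s - b)\<close> would be a sum of positive roots.\<close>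

lemma reflect_simple:
  assumes s: "simple_root s" and b: "pos b" "b \<noteq> s"
  shows "pos (reflect s b)"
proof -
  have R: "s \<in> R" "b \<in> R" and vp: "v \<bullet> s > 0" "v \<bullet> b > 0" using s b by (auto simp: simple_root_def pos_def)
  obtain k :: int where k: "b \<bullet> s = of_int k" using R_int R by blast
  have "0 < (b - s) \<bullet> (b - s)" using b(2) by simp
  then have "b \<bullet> s < 2" using R_norm R by (simp add: inner_diff inner_commute)
  then have k1: "k \<le> 1" using k by simp
  have "b + s \<noteq> 0" using vp by (metis add_pos_pos inner_add_right inner_zero_right less_irrefl)
  then have "0 < (b + s) \<bullet> (b + s)" by simp
  then have "b \<bullet> s > -2" using R_norm R by (simp add: inner_add inner_commute)
  then have k2: "k \<ge> -1" using k by simp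
  consider "k = -1" | "k = 0" | "k = 1" using k1 k2 by linarith
  then show ?thesis
  proof cases
    case 1
    then have "reflect s b = b + s" by (simp add: reflect_def k)
    then show ?thesis using R_add[OF R(2,1)] k 1 vp by (simp add: pos_def inner_add_right)
  next
    case 2
    then show ?thesis using b by (simp add: reflect_def k)
  next
    case 3
    then have eq: "reflect s b = b - s" by (simp add: reflect_def k)
    have bs: "b - s \<in> R" using R_add[OF R(2) R_neg[OF R(1)]] k 3 by simp
    have "\<not> v \<bullet> (b - s) < 0"
    proof
      assume "v \<bullet> (b - s) < 0"
      then have "pos (s - b)" using R_neg[OF bs] by (simp add: pos_def inner_diff_right)
      then show False using s b(1) unfolding simple_root_def by (metis add_diff_cancel_left' add.commute diff_add_cancel)
    qed
    then show ?thesis using eq bs regular[OF bs] by (simp add: pos_def)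
  qed
qed

text \<open>Induction on the number of positive roots of smaller height, the inner product with
  \<open>v\<close>. If \<open>b = p + q\<close> then \<open>p \<bullet> q = -1\<close>, so
  \<open>b\<close> is the image of \<open>q\<close> under the reflection in \<open>p\<close>, and
  its reflection is the corresponding conjugate of \<open>reflect q\<close>.\<close>

lemma reflect_pos_word: "pos b \<Longrightarrow> \<exists>xs. (\<forall>s\<in>set xs. simple_root s) \<and> reflect b = wfun xs"
proof (induction "card {c. pos c \<and> v \<bullet> c < v \<bullet> b}" arbitrary: b rule: less_induct)
  case less
  show ?case
  proof (cases "simple_root b")
    case True
    then show ?thesis by (intro exI[of _ "[b]"]) simp
  next
    case False
    then obtain p q where pq: "pos p" "pos q" "b = p + q" using less.prems by (auto simp: simple_root_def)
    have fin: "finite {c. pos c \<and> v \<bullet> c < v \<bullet> b}" using finite_roots by (rule rev_finite_subset) (auto simp: pos_def)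
    have dec: "card {c. pos c \<and> v \<bullet> c < v \<bullet> x} < card {c. pos c \<and> v \<bullet> c < v \<bullet> b}" if "pos x" "v \<bullet> x < v \<bullet> b" for x
      by (rule psubset_card_mono[OF fin]) (use that in auto)
    have "v \<bullet> p < v \<bullet> b" "v \<bullet> q < v \<bullet> b" using pq by (simp_all add: pos_def inner_add_right)
    then obtain xs ys where xs: "\<forall>s\<in>set xs. simple_root s" "reflect p = wfun xs" and ys: "\<forall>s\<in>set ys. simple_root s" "reflect q = wfun ys"
      using less.hyps[OF dec[OF pq(1)] pq(1)] less.hyps[OF dec[OF pq(2)] pq(2)] by blast
    have R: "p \<in> R" "q \<in> R" "b \<in> R" using pq less.prems by (auto simp: pos_def)
    have "p \<bullet> q = -1" using R_norm[OF R(3)] R_norm[OF R(1)] R_norm[OF R(2)] unfolding pq(3) by (simp add: inner_add inner_commute)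
    then have "b = reflect p q" by (simp add: reflect_def pq(3) inner_commute)
    have "reflect b x = reflect p (reflect q (reflect p x))" for x
      using reflect_conj[OF reflect_linear reflect_inner[OF R_norm[OF R(1)]], of q "reflect p x"] reflect_refl[OF R_norm[OF R(1)]]
      by (simp add: \<open>b = reflect p q\<close>)
    then have "reflect b = wfun (xs @ ys @ xs)" using xs ys by (simp add: wfun_append fun_eq_iff)
    then show ?thesis using xs ys by (intro exI[of _ "xs @ ys @ xs"]) auto
  qed
qed

lemma reflect_word: "b \<in> R \<Longrightarrow> \<exists>xs. (\<forall>s\<in>set xs. simple_root s) \<and> reflect b = wfun xs"
proof (cases "v \<bullet> b > 0")
  case True
  assume "b \<in> R"
  then show ?thesis using reflect_pos_word True by (simp add: pos_def)
next
  case False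
  assume b: "b \<in> R"
  then have "pos (- b)" using False regular[OF b] R_neg by (simp add: pos_def)
  then show ?thesis using reflect_pos_word reflect_neg by metis
qed

lemma weyl_word: "g \<in> weyl_group L \<Longrightarrow> \<exists>xs. (\<forall>s\<in>set xs. simple_root s) \<and> g = wfun xs"
proof -
  assume "g \<in> weyl_group L"
  then obtain xs where xs: "set xs \<subseteq> R" "g = wfun xs" using weyl_wfun by blast
  have "\<exists>ys. (\<forall>s\<in>set ys. simple_root s) \<and> wfun xs = wfun ys" using xs(1)
  proof (induction xs)
    case Nil
    show ?case by (intro exI[of _ "[]"]) simp
  next
    case (Cons x xs)
    then obtain ys zs where "\<forall>s\<in>set ys. simple_root s" "wfun xs = wfun ys" "\<forall>s\<in>set zs. simple_root s" "reflect x = wfun zs"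
      using reflect_word[of x] by auto
    then show ?case by (intro exI[of _ "zs @ ys"]) (auto simp: wfun_append)
  qed
  then show ?thesis using xs by simp
qed

lemma word_sign_change:
  assumes "pos s" "\<not> pos (wfun ys s)"
  shows "\<exists>y1 r y2. ys = y1 @ r # y2 \<and> pos (wfun y2 s) \<and> \<not> pos (reflect r (wfun y2 s))"
  using assms
proof (induction ys)
  case (Cons y ys)
  show ?case
  proof (cases "pos (wfun ys s)")
    case True
    then show ?thesis using Cons.prems by (intro exI[of _ "[]"] exI[of _ y] exI[of _ ys]) simp
  next
    case False
    then obtain y1 r y2 where "ys = y1 @ r # y2" "pos (wfun y2 s)" "\<not> pos (reflect r (wfun y2 s))" using Cons by blast
    then show ?thesis by (intro exI[of _ "y # y1"] exI[of _ r] exI[of _ y2]) simp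
  qed
qed simp

lemma positive_word_trivial:
  assumes "\<forall>s\<in>set xs. simple_root s" "\<And>b. pos b \<Longrightarrow> pos (wfun xs b)"
  shows "wfun xs = id"
  using assms
proof (induction "length xs" arbitrary: xs rule: less_induct)
  case less
  show ?case
  proof (cases xs rule: rev_cases)
    case Nil
    then show ?thesis by simp
  next
    case (snoc ys s)
    have s: "simple_root s" and ys: "\<forall>r\<in>set ys. simple_root r" using less.prems(1) snoc by auto
    then have ps: "pos s" by (simp add: simple_root_def)
    have sR: "s \<in> R" using ps by (simp add: pos_def)
    have rs: "reflect s s = - s" using R_norm[OF sR] by (simp add: reflect_def algebra_simps scaleR_2)
    have "pos (wfun xs s)" using less.prems(2) ps by blast
    then have "pos (- wfun ys s)"
      using snoc rs linear_neg[OF wfun_linear] by (simp add: wfun_append)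
    then have "\<not> pos (wfun ys s)" by (simp add: pos_def)
    then obtain y1 r y2 where y: "ys = y1 @ r # y2" "pos (wfun y2 s)" "\<not> pos (reflect r (wfun y2 s))"
      using word_sign_change[OF ps] by blast
    \<comment> \<open>A simple reflection makes only its own root negative, so at the sign change
      \<open>s\<close> has been moved to \<open>r\<close>; the letters \<open>r\<close> and
      \<open>s\<close> then cancel.\<close>
    have "wfun y2 s = r" using reflect_simple[of r "wfun y2 s"] y ys by auto
    have y2R: "set y2 \<subseteq> R" using ys y(1) by (auto simp: simple_root_def pos_def)
    have "reflect r (wfun y2 x) = wfun y2 (reflect s x)" for x
      using reflect_conj[OF wfun_linear wfun_inner[OF y2R], of s x] \<open>wfun y2 s = r\<close> by simp
    then have eq: "wfun xs = wfun (y1 @ y2)"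
      using reflect_refl[OF R_norm[OF sR]] by (simp add: snoc y(1) wfun_append fun_eq_iff)
    have "wfun (y1 @ y2) = id"
      by (rule less.hyps) (use snoc y(1) ys less.prems(2) eq in auto)
    then show ?thesis using eq by simp
  qed
qed

lemma regular_stabiliser_trivial:
  assumes g: "g \<in> weyl_group L" and gv: "g v = v"
  shows "g = id"
proof -
  obtain xs where xs: "\<forall>s\<in>set xs. simple_root s" "g = wfun xs" using weyl_word[OF g] by blast
  have "pos (wfun xs b)" if "pos b" for b
  proof -
    have "v \<bullet> g b = v \<bullet> b" using weyl_isometry[OF g] gv by metis
    moreover have "g b \<in> R" using that weyl_isometry[OF g] weyl_L[OF g] by (auto simp: pos_def roots_def)
    ultimately show ?thesis using that xs(2) by (simp add: pos_def)
  qed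
  then show ?thesis using positive_word_trivial[OF xs(1)] xs(2) by simp
qed

end

text \<open>A multiple of \<open>f\<close> is added to \<open>v\<close>; each vector of the finite
  set excludes at most one value of the factor \<open>e\<close>.\<close>

lemma generic_vector:
  assumes F: "subspace F" and "finite S"
  shows "\<exists>v\<in>F. \<forall>a\<in>S. v \<bullet> a = 0 \<longrightarrow> (\<forall>f\<in>F. f \<bullet> a = 0)"
  using assms(2)
proof (induction S rule: finite_induct)
  case empty
  then show ?case using subspace_0[OF F] by blast
next
  case (insert a S)
  then obtain v where v: "v \<in> F" "\<forall>b\<in>S. v \<bullet> b = 0 \<longrightarrow> (\<forall>f\<in>F. f \<bullet> b = 0)" by blast
  show ?case
  proof (cases "\<forall>f\<in>F. f \<bullet> a = 0")
    case True
    then show ?thesis using v by blast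
  next
    case False
    then obtain f where f: "f \<in> F" "f \<bullet> a \<noteq> 0" by blast
    have "finite ((\<lambda>b. - (v \<bullet> b) / (f \<bullet> b)) ` insert a S)" using insert by simp
    then obtain e :: real where e: "e \<notin> (\<lambda>b. - (v \<bullet> b) / (f \<bullet> b)) ` insert a S"
      using ex_new_if_finite[OF infinite_UNIV_char_0] by blast
    let ?v = "v + e *\<^sub>R f"
    have "(\<forall>f\<in>F. f \<bullet> b = 0)" if b: "b \<in> insert a S" "?v \<bullet> b = 0" for b
    proof (cases "f \<bullet> b = 0")
      case True
      then show ?thesis using b f(2) v(2) by (auto simp: inner_add_left)
    next
      case False
      then have "e = - (v \<bullet> b) / (f \<bullet> b)" using b(2) by (simp add: inner_add_left field_simps)
      then show ?thesis using e b(1) by blast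
    qed
    moreover have "?v \<in> F" using v f F by (intro subspace_add subspace_scale)
    ultimately show ?thesis by blast
  qed
qed

text \<open>If no root were orthogonal to a generic fixed vector, its stabiliser would be trivial;
  so some root is orthogonal to the whole fixed space. The sum over the orbit of this root is fixed,
  hence orthogonal to each of its summands, hence zero.\<close>

lemma moved_root:
  assumes g: "g \<in> weyl_group L" "g \<noteq> id" "\<And>x. g (g (g x)) = x"
  shows "\<exists>a\<in>R. (\<forall>x. g x = x \<longrightarrow> x \<bullet> a = 0) \<and> a + g a + g (g a) = 0"
proof -
  let ?F = "{x. g x = x}"
  have lin: "linear g" and iso: "\<And>x y. g x \<bullet> g y = x \<bullet> y" using weyl_isometry[OF g(1)] by auto
  have F: "subspace ?F" using lin by (intro subspaceI) (auto simp: linear_0 linear_add linear_scale)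
  obtain v where v: "v \<in> ?F" "\<forall>a\<in>R. v \<bullet> a = 0 \<longrightarrow> (\<forall>f\<in>?F. f \<bullet> a = 0)"
    using generic_vector[OF F finite_roots] by blast
  have "\<exists>a\<in>R. v \<bullet> a = 0"
  proof (rule ccontr)
    assume "\<not> ?thesis"
    then have "\<And>a. a \<in> R \<Longrightarrow> v \<bullet> a \<noteq> 0" by blast
    then show False using regular_stabiliser_trivial[OF _ g(1)] v(1) g(2) by blast
  qed
  then obtain a where a: "a \<in> R" "\<forall>f\<in>?F. f \<bullet> a = 0" using v(2) by blast
  let ?s = "a + g a + g (g a)"
  have "g ?s = ?s" using lin g(3) by (simp add: linear_add algebra_simps)
  then have s: "?s \<bullet> a = 0" using a(2) by blast
  have "?s \<bullet> g a = ?s \<bullet> a" "?s \<bullet> g (g a) = ?s \<bullet> a" using iso \<open>g ?s = ?s\<close> by metis+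
  then have "?s \<bullet> ?s = 0" using s by (simp add: inner_add_right)
  then show ?thesis using a by auto
qed

text \<open>Induction on the codimension of the fixed space. The root from \<open>moved_root\<close>
  and its image span a plane that \<open>g\<close> rotates by a third of a turn; composing with two
  reflections undoes the rotation and leaves \<open>g\<close> as it is on the orthogonal
  complement.\<close>

theorem A2_decomposition:
  assumes "g \<in> weyl_group L" "\<And>x. g (g (g x)) = x"
  shows "\<exists>A. finite A \<and> A \<subseteq> R \<and> (\<forall>a\<in>A. a + g a + g (g a) = 0) \<and>
    (\<forall>a\<in>A. \<forall>b\<in>A. a \<noteq> b \<longrightarrow> a \<bullet> b = 0 \<and> a \<bullet> g b = 0) \<and>
    (\<forall>x. (\<forall>a\<in>A. x \<bullet> a = 0 \<and> x \<bullet> g a = 0) \<longrightarrow> g x = x)"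
  using assms
proof (induction "DIM('a) - dim {x. g x = x}" arbitrary: g rule: less_induct)
  case less
  have lin: "linear g" and iso: "\<And>x y. g x \<bullet> g y = x \<bullet> y" using weyl_isometry[OF less.prems(1)] by auto
  show ?case
  proof (cases "g = id")
    case True
    then show ?thesis by (intro exI[of _ "{}"]) simp
  next
    case False
    then obtain b where b: "b \<in> R" "\<And>x. g x = x \<Longrightarrow> x \<bullet> b = 0" "b + g b + g (g b) = 0"
      using moved_root[OF less.prems(1) _ less.prems(2)] by blast
    define c where "c = g b"
    have gc: "g c = - b - c" using b(3) by (simp add: c_def algebra_simps eq_neg_iff_add_eq_0)
    have bb: "b \<bullet> b = 2" "c \<bullet> c = 2" using R_norm[OF b(1)] iso by (simp_all add: c_def)
    have "(- b - c) \<bullet> (- b - c) = 2" using iso[of c c] gc bb by simp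
    then have bc: "b \<bullet> c = -1" using bb by (simp add: inner_diff inner_commute)
    have cR: "c \<in> R" using bb weyl_L[OF less.prems(1)] b(1) by (simp add: roots_def c_def)
    define g' where "g' = reflect c \<circ> (reflect b \<circ> g)"
    have g'W: "g' \<in> weyl_group L" unfolding g'_def by (intro weyl_reflect less.prems b cR)
    have lin': "linear g'" and iso': "\<And>x y. g' x \<bullet> g' y = x \<bullet> y" using weyl_isometry[OF g'W] by auto
    have g'b: "g' b = b" using bc bb by (simp add: g'_def c_def[symmetric] reflect_def inner_commute inner_add inner_diff)
    have g'c: "g' c = c" using bc bb by (simp add: g'_def gc reflect_def inner_commute inner_add inner_diff algebra_simps scaleR_2)
    have g'x: "g' x = g x" if "x \<bullet> b = 0" "x \<bullet> c = 0" for x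
    proof -
      have "g x \<bullet> c = 0" using iso[of x b] that by (simp add: c_def)
      moreover have "g x \<bullet> b = 0" using iso[of x c] that calculation by (simp add: gc inner_diff_right)
      ultimately show ?thesis by (simp add: g'_def reflect_def)
    qed
    have perp: "g x \<bullet> b = 0 \<and> g x \<bullet> c = 0" if "x \<bullet> b = 0" "x \<bullet> c = 0" for x
    proof -
      have "g x \<bullet> c = 0" using iso[of x b] that by (simp add: c_def)
      moreover have "g x \<bullet> b = 0" using iso[of x c] that calculation by (simp add: gc inner_diff_right)
      ultimately show ?thesis by simp
    qed
    have g'3: "g' (g' (g' x)) = x" for x
    proof -
      \<comment> \<open>The orthogonal projection of \<open>x\<close> to the plane of
        \<open>b\<close> and \<open>c\<close>; the coefficients come from the inverse Gram matrix of
        A_2.\<close>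
      define p where "p = ((2 * (x \<bullet> b) + x \<bullet> c) / 3) *\<^sub>R b + ((x \<bullet> b + 2 * (x \<bullet> c)) / 3) *\<^sub>R c"
      have p: "g' p = p" using lin' g'b g'c by (simp add: p_def linear_add linear_scale)
      have y: "(x - p) \<bullet> b = 0" "(x - p) \<bullet> c = 0"
        using bb bc by (simp_all add: p_def inner_diff_left inner_add_left inner_commute[of c b] field_simps)
      have "g' (g' (g' (x - p))) = x - p"
        using g'x[OF y] g'x perp[OF y] perp less.prems(2) by metis
      then show ?thesis using lin' p by (simp add: linear_diff)
    qed
    have fixsub: "{x. g x = x} \<subseteq> {x. g' x = x}"
    proof safe
      fix x assume gx: "g x = x"
      then have "x \<bullet> b = 0" using b(2) by blast
      moreover have "x \<bullet> c = 0" using iso[of x b] gx calculation by (simp add: c_def)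
      ultimately show "g' x = x" using g'x gx by simp
    qed
    have sub: "subspace {x. g x = x}" "subspace {x. g' x = x}"
      using lin lin' by (auto intro!: subspaceI simp: linear_0 linear_add linear_scale)
    have "b \<notin> {x. g x = x}" using b(2)[of b] bb by auto
    then have "{x. g x = x} \<subset> {x. g' x = x}" using fixsub g'b by blast
    then have "dim {x. g x = x} < dim {x. g' x = x}"
      using sub by (metis dim_psubset span_eq_iff)
    moreover have "dim {x. g' x = x} \<le> DIM('a)" by (rule dim_subset_UNIV)
    ultimately have "DIM('a) - dim {x. g' x = x} < DIM('a) - dim {x. g x = x}" by linarith
    from less.hyps[OF this g'W g'3] obtain A where A: "finite A" "A \<subseteq> R" "\<forall>a\<in>A. a + g' a + g' (g' a) = 0"
      "\<forall>a\<in>A. \<forall>d\<in>A. a \<noteq> d \<longrightarrow> a \<bullet> d = 0 \<and> a \<bullet> g' d = 0"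
      "\<forall>x. (\<forall>a\<in>A. x \<bullet> a = 0 \<and> x \<bullet> g' a = 0) \<longrightarrow> g' x = x" by (elim exE conjE)
    \<comment> \<open>A fixed vector pairs equally with the three members of an orbit whose sum is
      zero. Since \<open>b\<close> and \<open>c\<close> are fixed by \<open>g'\<close>, the set
      \<open>A\<close> is orthogonal to the new plane.\<close>
    have ortho: "x \<bullet> a = 0" if "a \<in> A" "g' x = x" for x a
    proof -
      have "x \<bullet> g' a = x \<bullet> a" "x \<bullet> g' (g' a) = x \<bullet> a" using iso' that(2) by metis+
      moreover have "x \<bullet> (a + g' a + g' (g' a)) = 0" using A(3) that(1) by simp
      ultimately show ?thesis by (simp add: inner_add_right)
    qed
    have Ab: "a \<bullet> b = 0" "a \<bullet> c = 0" if "a \<in> A" for a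
      using ortho[OF that g'b] ortho[OF that g'c] by (simp_all add: inner_commute)
    have gA: "g' a = g a" "g' (g' a) = g (g a)" if "a \<in> A" for a
      using g'x[OF Ab[OF that]] g'x perp[OF Ab[OF that]] by metis+
    show ?thesis
    proof (intro exI[of _ "insert b A"] conjI ballI allI impI)
      show "a + g a + g (g a) = 0" if "a \<in> insert b A" for a
        using that b(3) A(3) gA by auto
      fix a d assume ad: "a \<in> insert b A" "d \<in> insert b A" "a \<noteq> d"
      have gd: "b \<bullet> g d = 0" if "d \<in> A" for d using perp[OF Ab[OF that]] by (simp add: inner_commute)
      show "a \<bullet> d = 0" "a \<bullet> g d = 0"
        using ad A(4) Ab gA gd inner_commute[of b d] by (auto simp: c_def)
    next
      fix x assume x: "\<forall>a\<in>insert b A. x \<bullet> a = 0 \<and> x \<bullet> g a = 0"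
      then have "g' x = x" using spec[OF A(5), of x] gA by auto
      moreover have "g' x = g x" using x by (intro g'x) (auto simp: c_def)
      ultimately show "g x = x" by simp
    qed (use A(1,2) b(1) in auto)
  qed
qed

end

section \<open>A fixed Heisenberg subalgebra of the lattice VOA\<close>

text \<open>A vector is determined by its integral inner products with \<open>B\<close>, and
  Cauchy-Schwarz confines these to finitely many values.\<close>

lemma finite_bounded_integral:
  fixes L :: "'a::euclidean_space set"
  assumes B: "finite B" "B \<subseteq> L" "span B = UNIV" and int: "\<And>x y. x \<in> L \<Longrightarrow> y \<in> L \<Longrightarrow> x \<bullet> y \<in> \<int>"
  shows "finite {x \<in> L. x \<bullet> x = r}"
proof -
  define f where "f = (\<lambda>x::'a. \<lambda>b\<in>B. \<lfloor>x \<bullet> b\<rfloor>)"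
  define K where "K = (\<lambda>b::'a. \<lceil>sqrt \<bar>r\<bar> * norm b\<rceil>)"
  let ?S = "{x \<in> L. x \<bullet> x = r}"
  have fl: "of_int \<lfloor>x \<bullet> b\<rfloor> = x \<bullet> b" if "x \<in> L" "b \<in> B" for x b
    using int[of x b] that B(2) by (auto elim!: Ints_cases)
  have "f ` ?S \<subseteq> Pi\<^sub>E B (\<lambda>b. {- K b..K b})"
  proof (rule image_subsetI)
    fix x assume "x \<in> ?S"
    then have x: "x \<in> L" "x \<bullet> x = r" by auto
    show "f x \<in> Pi\<^sub>E B (\<lambda>b. {- K b..K b})"
      unfolding f_def
    proof (rule restrict_PiE_iff[THEN iffD2], rule ballI)
      fix b assume b: "b \<in> B"
      have "norm x = sqrt \<bar>r\<bar>" using x(2) by (simp add: norm_eq_sqrt_inner abs_of_nonneg flip: x(2))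
      then have "\<bar>x \<bullet> b\<bar> \<le> sqrt \<bar>r\<bar> * norm b" using Cauchy_Schwarz_ineq2[of x b] by simp
      then have "\<bar>real_of_int \<lfloor>x \<bullet> b\<rfloor>\<bar> \<le> of_int (K b)" unfolding fl[OF x(1) b] K_def by linarith
      then have "\<bar>\<lfloor>x \<bullet> b\<rfloor>\<bar> \<le> K b" by linarith
      then show "\<lfloor>x \<bullet> b\<rfloor> \<in> {- K b..K b}" by auto
    qed
  qed
  moreover have "finite (Pi\<^sub>E B (\<lambda>b. {- K b..K b}))" using B(1) by (intro finite_PiE) auto
  ultimately have "finite (f ` ?S)" by (rule finite_subset)
  moreover have "inj_on f ?S"
  proof (rule inj_onI)
    fix x y assume xy: "x \<in> ?S" "y \<in> ?S" "f x = f y"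
    have "(x - y) \<bullet> b = 0" if b: "b \<in> B" for b
    proof -
      have "\<lfloor>x \<bullet> b\<rfloor> = \<lfloor>y \<bullet> b\<rfloor>" using fun_cong[OF xy(3), of b] b by (simp add: f_def)
      then have "x \<bullet> b = y \<bullet> b" using fl[of x b] fl[of y b] xy(1,2) b by (metis (lifting) mem_Collect_eq)
      then show ?thesis by (simp add: inner_diff_left)
    qed
    then have "orthogonal (x - y) z" if "z \<in> span B" for z
      using that by (intro orthogonal_to_span[of z B]) (auto simp: orthogonal_def)
    then have "(x - y) \<bullet> (x - y) = 0" using B(3) by (simp add: orthogonal_def)
    then show "x = y" by simp
  qed
  ultimately show ?thesis by (rule finite_imageD)
qed

lemma niemeier_integral:
  fixes L :: "'a::euclidean_space set"
  assumes "even_lattice L" "dual_lattice L = L"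
  shows "integral_lattice L" "0 \<in> L"
proof -
  obtain B where B: "independent B" "span B = UNIV" and L: "L = {(\<Sum>b\<in>B. of_int (k b) *\<^sub>R b) |k::'a \<Rightarrow> int. True}"
    using assms(1) unfolding even_lattice_def full_lattice_def by blast
  have fin: "finite B" using B(1) by (rule finiteI_independent)
  have int: "x \<bullet> y \<in> \<int>" if "x \<in> L" "y \<in> L" for x y
  proof -
    have "y \<in> dual_lattice L" using that assms(2) by simp
    then show ?thesis using that(1) by (simp add: dual_lattice_def)
  qed
  have BL: "B \<subseteq> L"
  proof
    fix b assume b: "b \<in> B"
    have "(\<Sum>c\<in>B. of_int (if c = b then 1 else 0) *\<^sub>R c) = (\<Sum>c\<in>B. if c = b then b else 0)"
      by (intro sum.cong refl) auto
    also have "\<dots> = b" using b fin by simp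
    finally show "b \<in> L" unfolding L by (intro CollectI exI[of _ "\<lambda>c. if c = b then 1 else 0"]) simp
  qed
  have diff: "x - y \<in> L" if "x \<in> L" "y \<in> L" for x y
  proof -
    obtain k k' :: "'a \<Rightarrow> int" where "x = (\<Sum>b\<in>B. of_int (k b) *\<^sub>R b)" "y = (\<Sum>b\<in>B. of_int (k' b) *\<^sub>R b)"
      using \<open>x \<in> L\<close> \<open>y \<in> L\<close> L by blast
    then have "x - y = (\<Sum>b\<in>B. of_int (k b - k' b) *\<^sub>R b)" by (simp add: sum_subtractf algebra_simps)
    then show ?thesis unfolding L by (intro CollectI exI[of _ "\<lambda>b. k b - k' b"]) simp
  qed
  show "integral_lattice L"
    by unfold_locales (use diff int finite_bounded_integral[OF fin BL B(2) int] in \<open>auto simp: roots_def\<close>)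
  show "0 \<in> L" unfolding L by (intro CollectI exI[of _ "\<lambda>_. 0"]) simp
qed

lemma heis_sum: "heis (\<Sum>x\<in>S. f x *\<^sub>R a x) m v = (\<Sum>x\<in>S. fock_scale (of_real (f x)) (heis (a x) m v))"
  unfolding heis_def
  by (simp add: sum_component of_real_sum fock.scale_sum_left fock.scale_sum_right) (rule sum.swap)

lemma heis_0: "heis 0 m v = 0" by (simp add: heis_def)
lemma heis_add: "heis (a + b) m v = heis a m v + heis b m v"
  by (simp add: heis_def fock.scale_left_distrib sum.distrib)
lemma heis_minus: "heis (- a) m v = - heis a m v"
  by (simp add: heis_def sum_negf)

abbreviation fvac :: "'n::finite fock" where "fvac \<equiv> Poly_Mapping.single ({#}, 0) 1"

definition hv :: "real^'n::finite \<Rightarrow> 'n fock" where "hv a = heis a (-1) fvac"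
definition ex :: "real^'n \<Rightarrow> 'n fock" where "ex a = Poly_Mapping.single ({#}, a) 1"

lemma hv_eq: "hv a = (\<Sum>i\<in>UNIV. Poly_Mapping.single ({#(i, 0)#}, 0) (of_real (a $ i)))"
  unfolding hv_def heis_def by (simp add: heis_basis_def)

lemma hv_fcre: "hv a = (\<Sum>i\<in>UNIV. fock_scale (of_real (a $ i)) (fcre i 0 fvac))"
  unfolding hv_def heis_def by simp

definition fock_over :: "(real^'n) set \<Rightarrow> ('n::finite) fock set" where
  "fock_over L = {v. \<forall>b\<in>Poly_Mapping.keys v. snd b \<in> L}"

lemma fock_over_sub: "fock.subspace (fock_over L)"
proof (rule fock.subspaceI)
  show "x + y \<in> fock_over L" if "x \<in> fock_over L" "y \<in> fock_over L" for x y
    using that Poly_Mapping.keys_add[of x y] unfolding fock_over_def by blast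
  show "fock_scale a x \<in> fock_over L" if "x \<in> fock_over L" for a x
    using that unfolding fock_over_def by (auto simp: in_keys_iff)
qed (simp add: fock_over_def)

lemma fock_over_single: "a \<in> L \<Longrightarrow> Poly_Mapping.single (P, a) x \<in> fock_over L"
  by (simp add: fock_over_def)

lemma fock_over_heisb:
  assumes "v \<in> fock_over L"
  shows "heisb i m v \<in> fock_over L"
  unfolding fock_lift_def
proof (intro fock.subspace_sum[OF fock_over_sub] fock.subspace_scale[OF fock_over_sub])
  fix b assume b: "b \<in> Poly_Mapping.keys v"
  obtain P a where P: "b = (P, a)" by force
  then have "a \<in> L" using b assms by (auto simp: fock_over_def)
  then show "heis_basis i m b \<in> fock_over L"
    unfolding P heis_basis_def by (auto intro: fock_over_single)
qed

text \<open>The products required from the lattice VOA involve only combinations of the vectors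
  \<open>hv a\<close> and \<open>ex a\<close>, and are computed from the explicit modes.\<close>

locale cocycle_lattice = integral_lattice L
  for L :: "(real^'n::finite) set" +
  fixes \<epsilon> :: "real^'n \<Rightarrow> real^'n \<Rightarrow> complex"
  assumes cocycle: "twisting_cocycle L \<epsilon>" and zero_in: "0 \<in> L"
begin

abbreviation VM :: "'n fock \<Rightarrow> int \<Rightarrow> 'n fock \<Rightarrow> 'n fock" where "VM \<equiv> vmode (lattice_voa L \<epsilon>)"

lemma VM_eq: "VM u n w = fock_lift (\<lambda>b. lattice_field \<epsilon> b n w) u" by (simp add: lattice_voa_def)

lemma VM_add_left: "VM (u + u') n w = VM u n w + VM u' n w" by (simp add: VM_eq fock_lift_add)
lemma VM_scale_left: "VM (fock_scale a u) n w = fock_scale a (VM u n w)" by (simp add: VM_eq fock_lift_scale)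
lemma VM_diff_left: "VM (u - u') n w = VM u n w - VM u' n w"
  using VM_add_left[of "u - u'" u' n w] by simp

lemma VM_ex: "VM (ex a) n w = exp_mode \<epsilon> a n w"
proof -
  have "mset_list {#} = ([] :: ('n \<times> nat) list)"
    using someI_ex[OF ex_mset[of "{#} :: ('n \<times> nat) multiset"]] by (simp add: mset_list_def)
  then show ?thesis by (simp add: VM_eq ex_def lattice_field_def)
qed

lemma fock_linear_exp_mode: "fock_linear (exp_mode \<epsilon> a n)" unfolding exp_mode_def by (rule fock_linear_lift)

lemmas VM_ex_add = fock_linear_add[OF fock_linear_exp_mode, folded VM_ex]
lemmas VM_ex_scale = fock_linear_scale[OF fock_linear_exp_mode, folded VM_ex]
lemmas VM_ex_diff = fock_linear_diff[OF fock_linear_exp_mode, folded VM_ex]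

lemma expm_0: "k > 0 \<Longrightarrow> expm 0 k v = 0" by (cases k) (simp_all add: heis_0)
lemma expp_0: "k > 0 \<Longrightarrow> expp 0 k v = 0" by (cases k) (simp_all add: heis_0)

lemma exp_mode_0:
  assumes "w \<in> fock_over L"
  shows "exp_mode \<epsilon> 0 n w = (if n = -1 then w else 0)"
proof (rule fock_linear_eq[OF fock_linear_exp_mode, where B = "\<lambda>w. if n = -1 then w else 0"])
  show "fock_linear (\<lambda>w. if n = -1 then w else 0)" by (simp add: fock_linear_def)
  fix b assume b: "b \<in> Poly_Mapping.keys w"
  obtain P a where P: "b = (P, a)" by force
  have "a \<in> L" using assms b P by (auto simp: fock_over_def)
  then have e: "\<epsilon> 0 a = 1" using cocycle by (simp add: twisting_cocycle_def)
  have "exp_mode \<epsilon> 0 n (Poly_Mapping.single b 1) = Sum_any (exp_term \<epsilon> 0 n (P, a))" unfolding P by (rule exp_mode_single)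
  also have "\<dots> = exp_term \<epsilon> 0 n (P, a) 0"
    by (rule Sum_any_eq_0th) (simp add: exp_term_def Let_def expp_0 fock_linear_0[OF fock_linear_expm])
  also have "\<dots> = (if n = -1 then Poly_Mapping.single b 1 else 0)"
  proof (cases "n < -1")
    case True
    then have "nat (- n - 1) > 0" by simp
    then have "expm 0 (nat (- n - 1)) (Poly_Mapping.single (P, a) (1::complex)) = 0" by (rule expm_0)
    then show ?thesis using True by (simp add: exp_term_def Let_def e)
  qed (auto simp: exp_term_def Let_def e P)
  finally show "exp_mode \<epsilon> 0 n (Poly_Mapping.single b 1) = (if n = -1 then Poly_Mapping.single b 1 else 0)" .
qed

text \<open>A normally ordered product with the identity field: one of the two sums yields the
  negative modes, the other the nonnegative ones.\<close>

lemma lattice_field_h: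
  assumes w: "w \<in> fock_over L"
  shows "lattice_field \<epsilon> ({#(i, 0)#}, 0) n w = heisb i n w"
proof -
  have "mset (mset_list {#(i, 0)#}) = {#(i, 0)#}" unfolding mset_list_def by (rule someI_ex[OF ex_mset])
  then have l: "mset_list {#(i, 0)#} = [(i, 0)]" by (simp add: mset_single_iff_right)
  have d: "deriv_field 0 (heis (axis i 1)) m x = heisb i m x" for m x
    by (simp add: deriv_field_def heis_axis)
  have 1: "heisb i (- 1 - int j) (exp_mode \<epsilon> 0 (n + int j) w) = (if j = nat (- 1 - n) then if n < 0 then heisb i n w else 0 else 0)" for j
    unfolding exp_mode_0[OF w] by (auto simp: fock_linear_0[OF fock_linear_lift])
  have 2: "exp_mode \<epsilon> 0 (n - 1 - int j) (heisb i (int j) w) = (if j = nat n then if n \<ge> 0 then heisb i n w else 0 else 0)" for j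
    unfolding exp_mode_0[OF fock_over_heisb[OF w]] by auto
  show ?thesis
    unfolding lattice_field_def split l normal_product_def
    by (simp add: d 1 2 normal_product_def)
qed

lemma VM_hv:
  assumes "w \<in> fock_over L"
  shows "VM (hv a) n w = heis a n w"
  unfolding VM_eq hv_eq fock_linear_sum[OF fock_linear_lift] fock_lift_single lattice_field_h[OF assms] heis_def ..

lemma ex_over: "a \<in> L \<Longrightarrow> ex a \<in> fock_over L" unfolding ex_def by (rule fock_over_single)

lemma hv_over: "hv a \<in> fock_over L"
  unfolding hv_eq by (intro fock.subspace_sum[OF fock_over_sub] fock_over_single zero_in)

lemma heis_fvac: "n \<ge> 0 \<Longrightarrow> heis a n fvac = 0"
  unfolding heis_def by (cases "n = 0") (simp_all add: heis_basis_def)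

lemma VM_hv_hv: "n \<ge> 0 \<Longrightarrow> VM (hv a) n (hv b) = (if n = 1 then fock_scale (of_real (a \<bullet> b)) fvac else 0)"
proof -
  assume n: "n \<ge> 0"
  have "VM (hv a) n (hv b) = heis a n (hv b)" by (rule VM_hv[OF hv_over])
  also have "\<dots> = (\<Sum>i\<in>UNIV. fock_scale (of_real (b $ i)) (heis a n (fcre i 0 fvac)))"
    unfolding hv_fcre by (simp only: fock_linear_sum[OF fock_linear_heis] fock_linear_scale[OF fock_linear_heis])
  also have "\<dots> = (\<Sum>i\<in>UNIV. if n = 1 then fock_scale (of_real (a $ i * b $ i)) fvac else 0)"
  proof (intro sum.cong refl)
    fix i
    show "fock_scale (of_real (b $ i)) (heis a n (fcre i 0 fvac)) = (if n = 1 then fock_scale (of_real (a $ i * b $ i)) fvac else 0)"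
    proof (cases "n = 0")
      case True
      have "heis a 0 (fcre i 0 fvac) = 0" unfolding fcre_single heis_def by (simp add: heis_basis_def)
      then show ?thesis using True by simp
    next
      case False
      then have "heis a n (fcre i 0 fvac) = fcre i 0 (heis a n fvac) + (if n = int 0 + 1 then fock_scale (of_int n * of_real (a $ i)) fvac else 0)"
        using n by (intro heis_fcre_pos) simp
      then show ?thesis using n by (simp add: heis_fvac fock_linear_0[OF fock_linear_lift] mult.commute)
    qed
  qed
  also have "\<dots> = (if n = 1 then fock_scale (of_real (a \<bullet> b)) fvac else 0)"
    by (cases "n = 1") (simp_all add: inner_vec_def fock.scale_sum_left del: fock_scale_single)
  finally show ?thesis .
qed

lemma VM_hv_ex: "n \<ge> 0 \<Longrightarrow> b \<in> L \<Longrightarrow> a \<bullet> b = 0 \<Longrightarrow> VM (hv a) n (ex b) = 0"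
proof -
  assume n: "n \<ge> 0" and b: "b \<in> L" and ab: "a \<bullet> b = 0"
  have "VM (hv a) n (ex b) = heis a n (ex b)" by (rule VM_hv[OF ex_over[OF b]])
  also have "\<dots> = 0"
  proof (cases "n = 0")
    case True
    have "heis a 0 (ex b) = (\<Sum>i\<in>UNIV. fock_scale (of_real (a $ i * b $ i)) (ex b))"
      unfolding heis_def ex_def by (simp add: heis_basis_def)
    also have "\<dots> = fock_scale (of_real (a \<bullet> b)) (ex b)"
      unfolding fock.scale_sum_left[symmetric] of_real_sum[symmetric] by (simp add: inner_vec_def)
    finally show ?thesis using True ab by simp
  next
    case False
    then show ?thesis unfolding ex_def using n by (intro heis_pos_vacuum) simp
  qed
  finally show ?thesis .
qed

lemma VM_ex_fvac: "n \<ge> 0 \<Longrightarrow> VM (ex a) n fvac = 0"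
  unfolding VM_ex exp_mode_vacuum by (simp add: Let_def)

lemma VM_ex_hv:
  assumes n: "n \<ge> 0" and ab: "a \<bullet> b = 0"
  shows "VM (ex a) n (hv b) = 0"
proof -
  have "VM (ex a) n (hv b) = (\<Sum>i\<in>UNIV. fock_scale (of_real (b $ i)) (VM (ex a) n (fcre i 0 fvac)))"
    unfolding hv_fcre VM_ex by (simp only: fock_linear_sum[OF fock_linear_exp_mode] fock_linear_scale[OF fock_linear_exp_mode])
  also have "\<dots> = (\<Sum>i\<in>UNIV. - fock_scale (of_real (a $ i * b $ i)) (VM (ex a) (n - 1) fvac))"
  proof (intro sum.cong refl)
    fix i
    have "VM (ex a) n (fcre i 0 fvac) = - fock_scale (of_real (a $ i)) (VM (ex a) (n - 1) fvac)"
      using VM_ex_fvac[OF n, of a] unfolding VM_ex exp_mode_fcre by (simp add: fock_linear_0[OF fock_linear_lift])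
    then show "fock_scale (of_real (b $ i)) (VM (ex a) n (fcre i 0 fvac)) = - fock_scale (of_real (a $ i * b $ i)) (VM (ex a) (n - 1) fvac)"
      by (simp add: mult.commute)
  qed
  also have "\<dots> = - fock_scale (of_real (a \<bullet> b)) (VM (ex a) (n - 1) fvac)"
    unfolding sum_negf fock.scale_sum_left[symmetric] of_real_sum[symmetric] by (simp add: inner_vec_def)
  finally show ?thesis using ab by simp
qed

lemma VM_ex_ex:
  assumes "a \<bullet> b = of_int k"
  shows "VM (ex a) n (ex b) = (if - k - n - 1 < 0 then 0 else expm a (nat (- k - n - 1)) (Poly_Mapping.single ({#}, a + b) (\<epsilon> a b)))"
  unfolding VM_ex unfolding ex_def exp_mode_vacuum by (simp add: assms Let_def)

lemma VM_ex_ex_pos: "n \<ge> -1 \<Longrightarrow> a \<bullet> b = 1 \<Longrightarrow> VM (ex a) n (ex b) = 0"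
  using VM_ex_ex[of a b 1 n] by simp

lemma VM_ex_ex_nonneg: "n \<ge> 0 \<Longrightarrow> a \<bullet> b = of_int k \<Longrightarrow> k \<ge> 0 \<Longrightarrow> VM (ex a) n (ex b) = 0"
  using VM_ex_ex[of a b k n] by simp

lemma VM_ex_ex_neg1: "n \<ge> 0 \<Longrightarrow> a \<bullet> b = -1 \<Longrightarrow> VM (ex a) n (ex b) = (if n = 0 then Poly_Mapping.single ({#}, a + b) (\<epsilon> a b) else 0)"
  using VM_ex_ex[of a b "-1" n] by simp

text \<open>With inner product -2 the mode \<open>n\<close> picks the coefficient of order
  \<open>1 - n\<close> in the exponential of creation operators, that is, order 0, 1 and 2 for the
  modes 1, 0 and -1.\<close>

lemma VM_ex_ex_opposite:
  assumes "a \<bullet> a = 2"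
  shows "n \<ge> 0 \<Longrightarrow> VM (ex a) n (ex (- a)) =
      (if n = 1 then fock_scale (\<epsilon> a (- a)) fvac else if n = 0 then fock_scale (\<epsilon> a (- a)) (hv a) else 0)"
    "VM (ex a) (-1) (ex (- a)) = fock_scale (\<epsilon> a (- a) / 2) (heis a (-1) (hv a) + heis a (-2) fvac)"
proof -
  have k: "a \<bullet> (- a) = of_int (- 2)" using assms by simp
  have s: "Poly_Mapping.single ({#}, 0) x = fock_scale x (fvac :: 'n fock)" for x by simp
  have lin: "heis a m (fock_scale x v) = fock_scale x (heis a m v)" for m x v by (rule fock_linear_scale[OF fock_linear_heis])
  show "VM (ex a) n (ex (- a)) = (if n = 1 then fock_scale (\<epsilon> a (- a)) fvac else if n = 0 then fock_scale (\<epsilon> a (- a)) (hv a) else 0)"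
    if "n \<ge> 0"
  proof -
    have "n = 0 \<or> n = 1 \<or> n \<ge> 2" using that by linarith
    then consider "n = 0" | "n = 1" | "n \<ge> 2" by blast
    then show ?thesis
    proof cases
      case 1
      then show ?thesis using VM_ex_ex[OF k, of n] lin[of "-1" "\<epsilon> a (- a)" fvac] by (simp add: hv_def)
    next
      case 2
      then show ?thesis using VM_ex_ex[OF k, of n] by simp
    next
      case 3
      then show ?thesis using VM_ex_ex[OF k, of n] by simp
    qed
  qed
  have "VM (ex a) (-1) (ex (- a)) = expm a 2 (fock_scale (\<epsilon> a (- a)) fvac)"
    using VM_ex_ex[OF k, of "-1"] by simp
  also have "\<dots> = fock_scale (\<epsilon> a (- a)) (expm a 2 fvac)" by (rule fock_linear_scale[OF fock_linear_expm])
  also have "expm a 2 fvac = fock_scale (1/2) (heis a (-1) (hv a) + heis a (-2) fvac)"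
    by (simp add: numeral_2_eq_2 hv_def del: fock_scale_single)
  finally show "VM (ex a) (-1) (ex (- a)) = fock_scale (\<epsilon> a (- a) / 2) (heis a (-1) (hv a) + heis a (-2) fvac)"
    by simp
qed

lemma cocycle_commute: "a \<in> L \<Longrightarrow> b \<in> L \<Longrightarrow> a \<bullet> b = of_int k \<Longrightarrow> \<epsilon> a b = (-1) powi k * \<epsilon> b a"
  using cocycle unfolding twisting_cocycle_def by (metis floor_of_int)

end

text \<open>The hypothesis says that the weighted vectors resolve the identity. Its trace counts the
  dimension, and the same tensor identity applied to creation operators gives twice the conformal
  vector.\<close>

lemma frame_identities:
  fixes v :: "'s \<Rightarrow> real^'n::finite"
  assumes S: "finite S" and fr: "\<And>x y. x \<bullet> y = (\<Sum>s\<in>S. c s * (x \<bullet> v s) * (y \<bullet> v s))"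
  shows "(\<Sum>s\<in>S. c s * (v s \<bullet> v s)) = CARD('n)"
    and "(\<Sum>s\<in>S. fock_scale (of_real (c s)) (heis (v s) (-1) (hv (v s)))) = (\<Sum>j\<in>UNIV. heisb j (-1) (heisb j (-1) fvac))"
proof -
  have fr': "(\<Sum>s\<in>S. c s * (v s $ j) * (v s $ k)) = (if j = k then 1 else 0)" for j k
  proof -
    have "axis k 1 $ j = (\<Sum>s\<in>S. c s * (v s $ j) * (v s $ k))"
      using fr[of "axis j 1" "axis k 1"] by (simp add: inner_axis')
    then show ?thesis by (simp add: axis_def)
  qed
  have "(\<Sum>s\<in>S. c s * (v s \<bullet> v s)) = (\<Sum>s\<in>S. \<Sum>j\<in>UNIV. c s * (v s $ j) * (v s $ j))"
    by (simp add: inner_vec_def sum_distrib_left mult.assoc)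
  also have "\<dots> = (\<Sum>j\<in>(UNIV::'n set). 1)" by (subst sum.swap) (simp add: fr')
  finally show "(\<Sum>s\<in>S. c s * (v s \<bullet> v s)) = CARD('n)" by simp
  define q where "q j k = heisb j (-1) (heisb k (-1) fvac)" for j k :: 'n
  have sq: "heis x (-1) (hv x) = (\<Sum>j\<in>UNIV. \<Sum>k\<in>UNIV. fock_scale (of_real (x $ j * x $ k)) (q j k))" for x :: "real^'n"
    unfolding hv_def heis_def q_def
    by (simp add: fock_linear_sum[OF fock_linear_lift] fock_linear_scale[OF fock_linear_lift] fock.scale_sum_right del: fock_lift_single)
  have "(\<Sum>s\<in>S. fock_scale (of_real (c s)) (heis (v s) (-1) (hv (v s))))
      = (\<Sum>s\<in>S. \<Sum>j\<in>UNIV. \<Sum>k\<in>UNIV. fock_scale (of_real (c s * (v s $ j) * (v s $ k))) (q j k))"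
    unfolding sq by (simp add: fock.scale_sum_right mult.assoc)
  also have "\<dots> = (\<Sum>j\<in>UNIV. \<Sum>s\<in>S. \<Sum>k\<in>UNIV. fock_scale (of_real (c s * (v s $ j) * (v s $ k))) (q j k))"
    by (rule sum.swap)
  also have "\<dots> = (\<Sum>j\<in>UNIV. \<Sum>k\<in>UNIV. \<Sum>s\<in>S. fock_scale (of_real (c s * (v s $ j) * (v s $ k))) (q j k))"
    by (intro sum.cong[OF refl] sum.swap)
  also have "\<dots> = (\<Sum>j\<in>UNIV. \<Sum>k\<in>UNIV. if j = k then q j k else 0)"
    unfolding fock.scale_sum_left[symmetric] of_real_sum[symmetric] fr' by (intro sum.cong[OF refl]) simp
  also have "\<dots> = (\<Sum>j\<in>UNIV. q j j)" by simp
  finally show "(\<Sum>s\<in>S. fock_scale (of_real (c s)) (heis (v s) (-1) (hv (v s)))) = (\<Sum>j\<in>UNIV. heisb j (-1) (heisb j (-1) fvac))"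
    unfolding q_def .
qed

locale orbit_lattice = cocycle_lattice L \<epsilon>
  for L :: "(real^'n::finite) set" and \<epsilon> +
  fixes \<tau> :: "real^'n \<Rightarrow> real^'n"
  assumes tau_orth: "orthogonal_transformation \<tau>" and tau_L: "\<tau> ` L = L"
    and tau_3: "\<tau> (\<tau> (\<tau> x)) = x" and tau_inv: "invariant_cocycle L \<tau> \<epsilon>"
begin

lemma tau_linear: "linear \<tau>" using tau_orth by (simp add: orthogonal_transformation_def)
lemma tau_inner: "\<tau> x \<bullet> \<tau> y = x \<bullet> y" using tau_orth by (simp add: orthogonal_transformation_def)
lemma tau_in: "a \<in> L \<Longrightarrow> \<tau> a \<in> L" using tau_L by blast
lemma tau_minus: "\<tau> (- x) = - \<tau> x" by (rule linear_neg[OF tau_linear])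
lemma tau_inner_shift: "\<tau> x \<bullet> y = x \<bullet> \<tau> (\<tau> y)"
  using tau_inner[of x "\<tau> (\<tau> y)"] by (simp add: tau_3)
lemma tau_eps: "a \<in> L \<Longrightarrow> b \<in> L \<Longrightarrow> \<epsilon> (\<tau> a) (\<tau> b) = \<epsilon> a b"
  using tau_inv by (simp add: invariant_cocycle_def)

text \<open>Three roots at mutual angles of 120 degrees; with their negatives they form a root
  system of type A_2.\<close>

definition A2_root :: "real^'n \<Rightarrow> bool" where
  "A2_root a \<longleftrightarrow> a \<in> L \<and> a \<bullet> a = 2 \<and> a + \<tau> a + \<tau> (\<tau> a) = 0"

lemma A2_root_minus: "A2_root a \<Longrightarrow> A2_root (- a)"
proof -
  assume a: "A2_root a"
  have "- a + \<tau> (- a) + \<tau> (\<tau> (- a)) = - (a + \<tau> a + \<tau> (\<tau> a))" by (simp add: tau_minus)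
  then show ?thesis using a unfolding A2_root_def by (simp add: neg_in)
qed

lemma A2_root_inner:
  assumes "A2_root a"
  shows "a \<bullet> a = 2" "\<tau> a \<bullet> \<tau> a = 2" "\<tau> (\<tau> a) \<bullet> \<tau> (\<tau> a) = 2"
    "a \<bullet> \<tau> a = -1" "a \<bullet> \<tau> (\<tau> a) = -1" "\<tau> a \<bullet> a = -1" "\<tau> a \<bullet> \<tau> (\<tau> a) = -1"
    "\<tau> (\<tau> a) \<bullet> a = -1" "\<tau> (\<tau> a) \<bullet> \<tau> a = -1"
proof -
  have a: "a \<bullet> a = 2" and s: "a + \<tau> a + \<tau> (\<tau> a) = 0" using assms by (auto simp: A2_root_def)
  have "a \<bullet> \<tau> (\<tau> a) = \<tau> a \<bullet> a" by (simp add: tau_inner_shift)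
  moreover have "a \<bullet> (a + \<tau> a + \<tau> (\<tau> a)) = 0" by (simp add: s)
  ultimately have e: "a \<bullet> \<tau> a = -1" "a \<bullet> \<tau> (\<tau> a) = -1" using a by (simp_all add: inner_add_right inner_commute)
  show "a \<bullet> a = 2" "\<tau> a \<bullet> \<tau> a = 2" "\<tau> (\<tau> a) \<bullet> \<tau> (\<tau> a) = 2"
    "a \<bullet> \<tau> a = -1" "a \<bullet> \<tau> (\<tau> a) = -1" "\<tau> a \<bullet> a = -1" "\<tau> a \<bullet> \<tau> (\<tau> a) = -1"
    "\<tau> (\<tau> a) \<bullet> a = -1" "\<tau> (\<tau> a) \<bullet> \<tau> a = -1"
    using a e by (simp_all add: tau_inner inner_commute)
qed

definition Eo :: "real^'n \<Rightarrow> 'n fock" where "Eo a = ex a + ex (\<tau> a) + ex (\<tau> (\<tau> a))"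

lemma Eo_over: "a \<in> L \<Longrightarrow> Eo a \<in> fock_over L"
  unfolding Eo_def by (intro fock.subspace_add[OF fock_over_sub] ex_over tau_in)

lemma VM_Eo_Eo_expand: "VM (Eo a) n (Eo b) =
    (VM (ex a) n (ex b) + VM (ex a) n (ex (\<tau> b)) + VM (ex a) n (ex (\<tau> (\<tau> b)))) +
    (VM (ex (\<tau> a)) n (ex b) + VM (ex (\<tau> a)) n (ex (\<tau> b)) + VM (ex (\<tau> a)) n (ex (\<tau> (\<tau> b)))) +
    (VM (ex (\<tau> (\<tau> a))) n (ex b) + VM (ex (\<tau> (\<tau> a))) n (ex (\<tau> b)) + VM (ex (\<tau> (\<tau> a))) n (ex (\<tau> (\<tau> b))))"
  unfolding Eo_def VM_add_left VM_ex_add ..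

lemma VM_Eo_orthogonal:
  assumes n: "n \<ge> 0" and z: "a \<bullet> b = 0" "a \<bullet> \<tau> b = 0" "\<tau> a \<bullet> b = 0"
  shows "VM (Eo a) n (Eo b) = 0"
proof -
  have z': "a \<bullet> \<tau> (\<tau> b) = 0" "\<tau> a \<bullet> \<tau> b = 0" "\<tau> a \<bullet> \<tau> (\<tau> b) = 0"
    "\<tau> (\<tau> a) \<bullet> b = 0" "\<tau> (\<tau> a) \<bullet> \<tau> b = 0" "\<tau> (\<tau> a) \<bullet> \<tau> (\<tau> b) = 0"
    using z by (simp_all add: tau_inner tau_inner_shift[of a] tau_inner_shift[of "\<tau> a"] tau_3)
  have "VM (ex x) n (ex y) = 0" if "x \<bullet> y = 0" for x y
    using that n by (intro VM_ex_ex_nonneg[where k = 0]) simp_all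
  then show ?thesis unfolding VM_Eo_Eo_expand by (simp add: z z')
qed

text \<open>A root multiplied with itself gives zero in these modes. Two different roots of the
  orbit have inner product -1, where the cocycle is antisymmetric, so the cross terms cancel in
  pairs.\<close>

lemma VM_Eo_same:
  assumes n: "n \<ge> 0" and a: "A2_root a"
  shows "VM (Eo a) n (Eo a) = 0"
proof -
  note i = A2_root_inner[OF a]
  have aL: "a \<in> L" "\<tau> a \<in> L" "\<tau> (\<tau> a) \<in> L" using a tau_in by (auto simp: A2_root_def)
  have d: "VM (ex x) n (ex x) = 0" if "x \<bullet> x = 2" for x
    using that n by (intro VM_ex_ex_nonneg[where k = 2]) simp_all
  have c: "VM (ex x) n (ex y) + VM (ex y) n (ex x) = 0" if "x \<in> L" "y \<in> L" "x \<bullet> y = -1" for x y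
  proof -
    have "\<epsilon> x y = - \<epsilon> y x" using cocycle_commute[of x y "-1"] that by simp
    then show ?thesis
      using VM_ex_ex_neg1[OF n, of x y] VM_ex_ex_neg1[OF n, of y x] that
      by (simp add: inner_commute add.commute single_uminus flip: single_add)
  qed
  have "VM (Eo a) n (Eo a) = (VM (ex a) n (ex a) + VM (ex (\<tau> a)) n (ex (\<tau> a)) + VM (ex (\<tau> (\<tau> a))) n (ex (\<tau> (\<tau> a))))
      + (VM (ex a) n (ex (\<tau> a)) + VM (ex (\<tau> a)) n (ex a)) + (VM (ex a) n (ex (\<tau> (\<tau> a))) + VM (ex (\<tau> (\<tau> a))) n (ex a))
      + (VM (ex (\<tau> a)) n (ex (\<tau> (\<tau> a))) + VM (ex (\<tau> (\<tau> a))) n (ex (\<tau> a)))"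
    unfolding VM_Eo_Eo_expand by (simp only: ac_simps)
  then show ?thesis using c aL i by (simp add: d)
qed

text \<open>The six cross terms have inner product 1, so they vanish from the mode -1 on.\<close>

lemma VM_Eo_opposite_expand:
  assumes n: "n \<ge> -1" and a: "A2_root a"
  shows "VM (Eo a) n (Eo (- a)) = VM (ex a) n (ex (- a)) + VM (ex (\<tau> a)) n (ex (- \<tau> a)) + VM (ex (\<tau> (\<tau> a))) n (ex (- \<tau> (\<tau> a)))"
proof -
  note i = A2_root_inner[OF a]
  have "VM (ex x) n (ex (- y)) = 0" if "x \<bullet> y = -1" for x y
    using that n by (intro VM_ex_ex_pos) simp_all
  then show ?thesis unfolding VM_Eo_Eo_expand by (simp add: tau_minus i)
qed

lemma tau_eps_opposite:
  assumes "A2_root a"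
  shows "\<epsilon> (\<tau> a) (- \<tau> a) = \<epsilon> a (- a)" "\<epsilon> (\<tau> (\<tau> a)) (- \<tau> (\<tau> a)) = \<epsilon> a (- a)"
proof -
  have aL: "a \<in> L" "- a \<in> L" "\<tau> a \<in> L" "- \<tau> a \<in> L" using assms tau_in neg_in by (auto simp: A2_root_def)
  show "\<epsilon> (\<tau> a) (- \<tau> a) = \<epsilon> a (- a)" using tau_eps[OF aL(1,2)] by (simp add: tau_minus)
  then show "\<epsilon> (\<tau> (\<tau> a)) (- \<tau> (\<tau> a)) = \<epsilon> a (- a)" using tau_eps[OF aL(3,4)] by (simp add: tau_minus)
qed

lemma hv_add: "hv (a + b) = hv a + hv b" by (simp add: hv_def heis_add del: fock_lift_single)

text \<open>Invariance of the cocycle gives the three opposite pairs the same coefficient. The mode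
  0 is then proportional to the sum of \<open>hv\<close> over the orbit, which is zero; this is why
  the orbit sums commute.\<close>

lemma VM_Eo_opposite:
  assumes n: "n \<ge> 0" and a: "A2_root a"
  shows "VM (Eo a) n (Eo (- a)) = (if n = 1 then fock_scale (3 * \<epsilon> a (- a)) fvac else 0)"
proof -
  note i = A2_root_inner[OF a] and e = tau_eps_opposite[OF a]
  have s: "a + \<tau> a + \<tau> (\<tau> a) = 0" using a by (simp add: A2_root_def)
  have "hv a + hv (\<tau> a) + hv (\<tau> (\<tau> a)) = 0" unfolding hv_add[symmetric] s by (simp add: hv_def heis_0)
  then have h: "fock_scale z (hv a) + fock_scale z (hv (\<tau> a)) + fock_scale z (hv (\<tau> (\<tau> a))) = 0" for z
    by (metis fock.scale_right_distrib fock.scale_zero_right)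
  have three: "fock_scale z v + fock_scale z v + fock_scale z v = fock_scale (3 * z) v" for z and v :: "'n fock"
    by (simp flip: fock.scale_left_distrib)
  have "n \<ge> -1" using n by simp
  show ?thesis
    unfolding VM_Eo_opposite_expand[OF \<open>n \<ge> -1\<close> a] VM_ex_ex_opposite(1)[OF i(1) n] VM_ex_ex_opposite(1)[OF i(2) n]
      VM_ex_ex_opposite(1)[OF i(3) n] e
    by (auto simp only: h three if_True if_False add_0_left zero_neq_one one_neq_zero split: if_split)
qed

definition sq :: "real^'n \<Rightarrow> 'n fock" where "sq a = heis a (-1) (hv a)"

lemma sq_minus: "sq (- a) = sq a"
  unfolding sq_def hv_def heis_minus by (simp add: fock_linear_minus[OF fock_linear_heis] del: fock_lift_single)

text \<open>As in the mode 0, the linear terms with mode -2 sum to zero over the orbit and only the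
  squares remain.\<close>

lemma VM_Eo_opposite_neg1:
  assumes a: "A2_root a"
  shows "VM (Eo a) (-1) (Eo (- a)) = fock_scale (\<epsilon> a (- a) / 2) (sq a + sq (\<tau> a) + sq (\<tau> (\<tau> a)))"
proof -
  note i = A2_root_inner[OF a] and e = tau_eps_opposite[OF a]
  have s: "a + \<tau> a + \<tau> (\<tau> a) = 0" using a by (simp add: A2_root_def)
  have h: "heis a (-2) fvac + heis (\<tau> a) (-2) fvac + heis (\<tau> (\<tau> a)) (-2) fvac = 0"
    unfolding heis_add[symmetric] s by (simp add: heis_0)
  have "VM (Eo a) (-1) (Eo (- a)) = fock_scale (\<epsilon> a (- a) / 2) (heis a (-1) (hv a) + heis a (-2) fvac)
      + fock_scale (\<epsilon> a (- a) / 2) (heis (\<tau> a) (-1) (hv (\<tau> a)) + heis (\<tau> a) (-2) fvac)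
      + fock_scale (\<epsilon> a (- a) / 2) (heis (\<tau> (\<tau> a)) (-1) (hv (\<tau> (\<tau> a))) + heis (\<tau> (\<tau> a)) (-2) fvac)"
    unfolding VM_Eo_opposite_expand[OF order_refl a] VM_ex_ex_opposite(2)[OF i(1)] VM_ex_ex_opposite(2)[OF i(2)]
      VM_ex_ex_opposite(2)[OF i(3)] e ..
  also have "\<dots> = fock_scale (\<epsilon> a (- a) / 2) ((sq a + sq (\<tau> a) + sq (\<tau> (\<tau> a))) +
      (heis a (-2) fvac + heis (\<tau> a) (-2) fvac + heis (\<tau> (\<tau> a)) (-2) fvac))"
    unfolding sq_def fock.scale_right_distrib by (simp only: ac_simps)
  finally show ?thesis unfolding h by simp
qed

lemma eps_opposite_sym:
  assumes "A2_root a"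
  shows "\<epsilon> (- a) a = \<epsilon> a (- a)" "\<epsilon> a (- a) \<noteq> 0"
proof -
  have aL: "a \<in> L" "- a \<in> L" "a \<bullet> a = 2" using assms neg_in by (auto simp: A2_root_def)
  show "\<epsilon> (- a) a = \<epsilon> a (- a)" using cocycle_commute[OF aL(2,1), of "-2"] aL(3) by (simp add: power_int_def)
  show "\<epsilon> a (- a) \<noteq> 0" using cocycle aL(1,2) unfolding twisting_cocycle_def by blast
qed

text \<open>\<open>E\<^sub>a\<close> pairs with \<open>E\<^bsub>-a\<^esub>\<close> to \<open>3 \<epsilon>(a,-a)\<close>, and each generator \<open>E\<^sub>a \<plusminus> E\<^bsub>-a\<^esub>\<close> uses this pairing twice.\<close>

definition kap :: "real^'n \<Rightarrow> complex" where "kap a = 1 / csqrt (6 * \<epsilon> a (- a))"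

lemma kap_square:
  assumes "A2_root a"
  shows "kap a * kap a * (6 * \<epsilon> a (- a)) = 1"
proof -
  define e where "e = 6 * \<epsilon> a (- a)"
  have "csqrt e * csqrt e = e" using power2_csqrt[of e] by (simp only: power2_eq_square)
  moreover have "e \<noteq> 0" using eps_opposite_sym(2)[OF assms] by (simp add: e_def)
  ultimately show ?thesis unfolding kap_def e_def[symmetric] by (metis divide_self_if mult.right_neutral times_divide_times_eq times_divide_eq_left mult_1)
qed

text \<open>The left summand of the index type lists directions orthogonal to the planes, the right
  one two vectors for each plane. The sum and the difference of \<open>Eo a\<close> and
  \<open>Eo (- a)\<close> have squares of opposite sign, which the factor \<i> corrects.\<close>

definition gen :: "(real^'n) + (real^'n) \<times> bool \<Rightarrow> 'n fock" where
  "gen = case_sum hv (\<lambda>(a, b). if b then fock_scale (kap a) (Eo a + Eo (- a))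
     else fock_scale (\<i> * kap a) (Eo a - Eo (- a)))"

lemma VM_Eo_add: "VM (Eo a) n (v + w) = VM (Eo a) n v + VM (Eo a) n w"
  unfolding Eo_def VM_add_left VM_ex_add by (simp only: ac_simps)
lemma VM_Eo_diff: "VM (Eo a) n (v - w) = VM (Eo a) n v - VM (Eo a) n w"
  unfolding Eo_def VM_add_left VM_ex_diff by (simp add: algebra_simps)
lemma VM_Eo_scale: "VM (Eo a) n (fock_scale z w) = fock_scale z (VM (Eo a) n w)"
  unfolding Eo_def VM_add_left VM_ex_scale fock.scale_right_distrib ..

lemmas VM_gen_simps = VM_scale_left VM_add_left VM_diff_left VM_Eo_add VM_Eo_diff VM_Eo_scale

lemma VM_gen_expand:
  "VM (gen (Inr (a, True))) n (gen (Inr (a, True))) = fock_scale (kap a * kap a)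
     (VM (Eo a) n (Eo a) + VM (Eo (- a)) n (Eo (- a)) + (VM (Eo a) n (Eo (- a)) + VM (Eo (- a)) n (Eo a)))"
  "VM (gen (Inr (a, True))) n (gen (Inr (a, False))) = fock_scale (\<i> * kap a * kap a)
     (VM (Eo a) n (Eo a) - VM (Eo (- a)) n (Eo (- a)) + (VM (Eo (- a)) n (Eo a) - VM (Eo a) n (Eo (- a))))"
  "VM (gen (Inr (a, False))) n (gen (Inr (a, True))) = fock_scale (\<i> * kap a * kap a)
     (VM (Eo a) n (Eo a) - VM (Eo (- a)) n (Eo (- a)) + (VM (Eo a) n (Eo (- a)) - VM (Eo (- a)) n (Eo a)))"
  "VM (gen (Inr (a, False))) n (gen (Inr (a, False))) = fock_scale (- (kap a * kap a))
     (VM (Eo a) n (Eo a) + VM (Eo (- a)) n (Eo (- a)) - (VM (Eo a) n (Eo (- a)) + VM (Eo (- a)) n (Eo a)))"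
  by (rule poly_mapping_eqI, simp add: gen_def VM_gen_simps lookup_add lookup_minus, simp add: algebra_simps)+

lemma VM_gen_same:
  assumes n: "n \<ge> 0" and a: "A2_root a"
  shows "VM (gen (Inr (a, b))) n (gen (Inr (a, b'))) = (if n = 1 \<and> b = b' then fvac else 0)"
proof -
  note a' = A2_root_minus[OF a]
  note s = VM_Eo_same[OF n a] VM_Eo_same[OF n a'] VM_Eo_opposite[OF n a] VM_Eo_opposite[OF n a', simplified minus_minus eps_opposite_sym(1)[OF a]]
  have k: "kap a * kap a * (3 * \<epsilon> a (- a) + 3 * \<epsilon> a (- a)) = 1" using kap_square[OF a] by (simp add: algebra_simps)
  have f: "fock_scale x fvac + fock_scale y fvac = fock_scale (x + y) (fvac :: 'n fock)" for x y
    by (rule fock.scale_left_distrib[symmetric])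
  show ?thesis
    by (cases b; cases b'; simp only: VM_gen_expand s; cases "n = 1")
       (simp_all only: if_True if_False simp_thms f add_0_left add_0_right diff_self diff_0 fock.scale_zero_right fock.scale_scale k fock.scale_one
          fock.scale_minus_right minus_minus fock.scale_minus_left minus_mult_left[symmetric])
qed

lemma VM_gen_orthogonal:
  assumes n: "n \<ge> 0" and z: "a \<bullet> b = 0" "a \<bullet> \<tau> b = 0" "\<tau> a \<bullet> b = 0"
  shows "VM (gen (Inr (a, i))) n (gen (Inr (b, j))) = 0"
proof -
  have "VM (Eo a) n (Eo b) = 0" "VM (Eo a) n (Eo (- b)) = 0" "VM (Eo (- a)) n (Eo b) = 0" "VM (Eo (- a)) n (Eo (- b)) = 0"
    using z by (intro VM_Eo_orthogonal[OF n]; simp add: tau_minus)+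
  then show ?thesis unfolding gen_def by (simp add: VM_gen_simps)
qed

lemma VM_gen_mixed:
  assumes n: "n \<ge> 0" and a: "a \<in> L" and z: "v \<bullet> a = 0" "v \<bullet> \<tau> a = 0" "v \<bullet> \<tau> (\<tau> a) = 0"
  shows "VM (gen (Inl v)) n (gen (Inr (a, i))) = 0" "VM (gen (Inr (a, i))) n (gen (Inl v)) = 0"
proof -
  have L: "a \<in> L" "\<tau> a \<in> L" "\<tau> (\<tau> a) \<in> L" "- a \<in> L" "- \<tau> a \<in> L" "- \<tau> (\<tau> a) \<in> L"
    using a tau_in neg_in by auto
  have lin: "fock_linear (heis v n)" by (rule fock_linear_heis)
  have h: "heis v n (ex b) = 0" if "b \<in> L" "v \<bullet> b = 0" for b
    using VM_hv_ex[OF n that] VM_hv[OF ex_over[OF that(1)]] by simp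
  have E: "heis v n (Eo a) = 0" "heis v n (Eo (- a)) = 0"
    unfolding Eo_def fock_linear_add[OF lin] tau_minus using h L z by simp_all
  have "gen (Inr (a, i)) \<in> fock_over L"
    unfolding gen_def using Eo_over[OF L(1)] Eo_over[OF L(4)]
    by (auto intro!: fock.subspace_scale[OF fock_over_sub] fock.subspace_add[OF fock_over_sub] fock.subspace_diff[OF fock_over_sub])
  then have "VM (gen (Inl v)) n (gen (Inr (a, i))) = heis v n (gen (Inr (a, i)))"
    by (simp add: gen_def VM_hv)
  also have "\<dots> = 0"
    unfolding gen_def using E by (simp add: fock_linear_scale[OF lin] fock_linear_add[OF lin] fock_linear_diff[OF lin])
  finally show "VM (gen (Inl v)) n (gen (Inr (a, i))) = 0" .
  have "VM (Eo a) n (hv v) = 0" "VM (Eo (- a)) n (hv v) = 0"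
    unfolding Eo_def VM_add_left tau_minus using VM_ex_hv[OF n] z by (simp_all add: inner_commute)
  then show "VM (gen (Inr (a, i))) n (gen (Inl v)) = 0"
    unfolding gen_def by (simp add: VM_gen_simps)
qed

text \<open>The products of \<open>Eo a\<close> with itself enter the two squares with opposite
  signs and cancel; the products of opposite orbit sums remain. The constant 1/3 is the value of
  \<open>2 * kap a * kap a * \<epsilon> a (- a)\<close>.\<close>

lemma VM_gen_neg1:
  assumes a: "A2_root a"
  shows "VM (gen (Inr (a, True))) (-1) (gen (Inr (a, True))) + VM (gen (Inr (a, False))) (-1) (gen (Inr (a, False)))
     = fock_scale (1/3) (sq a + sq (\<tau> a) + sq (\<tau> (\<tau> a)))"
proof -
  note a' = A2_root_minus[OF a]
  let ?k = "kap a * kap a" and ?Q = "sq a + sq (\<tau> a) + sq (\<tau> (\<tau> a))"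
  define P S where "P = VM (Eo a) (-1) (Eo a) + VM (Eo (- a)) (-1) (Eo (- a))"
    and "S = VM (Eo a) (-1) (Eo (- a)) + VM (Eo (- a)) (-1) (Eo a)"
  have S: "S = fock_scale (\<epsilon> a (- a)) ?Q"
    unfolding S_def VM_Eo_opposite_neg1[OF a] VM_Eo_opposite_neg1[OF a', simplified minus_minus eps_opposite_sym(1)[OF a] tau_minus sq_minus]
    by (simp flip: fock.scale_left_distrib)
  have "VM (gen (Inr (a, True))) (-1) (gen (Inr (a, True))) = fock_scale ?k (P + S)"
    "VM (gen (Inr (a, False))) (-1) (gen (Inr (a, False))) = fock_scale (- ?k) (P - S)"
    unfolding VM_gen_expand P_def S_def by (rule refl)+
  moreover have "fock_scale ?k (P + S) + fock_scale (- ?k) (P - S) = fock_scale (?k + ?k) S"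
  proof -
    have "x + y + (- x - - y) = y + y" for x y :: "'n fock" by simp
    then show ?thesis
      by (simp only: fock.scale_right_distrib fock.scale_right_diff_distrib fock.scale_left_distrib fock.scale_minus_left)
  qed
  moreover have "(?k + ?k) * \<epsilon> a (- a) = 1 / 3" using kap_square[OF a] by (simp add: algebra_simps)
  ultimately show ?thesis by (simp add: S)
qed

end

context orbit_lattice
begin

lemma induced_aut_ex: "induced_aut \<tau> (ex a) = ex (\<tau> a)"
proof -
  have "mset_list {#} = ([] :: ('n \<times> nat) list)"
    using someI_ex[OF ex_mset[of "{#} :: ('n \<times> nat) multiset"]] by (simp add: mset_list_def)
  then show ?thesis by (simp add: induced_aut_def ex_def)
qed

lemma fock_linear_induced_aut: "fock_linear (induced_aut \<tau>)"
  unfolding induced_aut_def by (rule fock_linear_lift)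

lemma induced_aut_hv: "induced_aut \<tau> (hv v) = hv (\<tau> v)"
proof -
  have l: "mset_list {#(i, 0)#} = [(i :: 'n, 0 :: nat)]" for i
  proof -
    have "mset (mset_list {#(i, 0 :: nat)#}) = {#(i, 0)#}" unfolding mset_list_def by (rule someI_ex[OF ex_mset])
    then show ?thesis by (simp add: mset_single_iff_right)
  qed
  have i: "induced_aut \<tau> (Poly_Mapping.single ({#(i, 0)#}, 0) x) = fock_scale x (heis (\<tau> (axis i 1)) (-1) fvac)" for i x
    unfolding induced_aut_def by (simp add: l linear_0[OF tau_linear] del: fock_scale_single)
  have "\<tau> v = \<tau> (\<Sum>i\<in>UNIV. (v $ i) *\<^sub>R axis i 1)"
    using basis_expansion[of v] by (simp add: scalar_mult_eq_scaleR)
  also have "\<dots> = (\<Sum>i\<in>UNIV. (v $ i) *\<^sub>R \<tau> (axis i 1))"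
    by (simp add: linear_sum[OF tau_linear] linear_scale[OF tau_linear])
  finally have e: "\<tau> v = (\<Sum>i\<in>UNIV. (v $ i) *\<^sub>R \<tau> (axis i 1))" .
  show ?thesis
    unfolding hv_eq[of v] fock_linear_sum[OF fock_linear_induced_aut] i
    unfolding hv_def e heis_sum ..
qed

lemma induced_aut_Eo: "induced_aut \<tau> (Eo a) = Eo a"
  unfolding Eo_def fock_linear_add[OF fock_linear_induced_aut] induced_aut_ex tau_3 by (simp only: ac_simps)

lemma induced_aut_gen:
  "\<tau> v = v \<Longrightarrow> induced_aut \<tau> (gen (Inl v)) = gen (Inl v)"
  "induced_aut \<tau> (gen (Inr p)) = gen (Inr p)"
proof -
  show "\<tau> v = v \<Longrightarrow> induced_aut \<tau> (gen (Inl v)) = gen (Inl v)" by (simp add: gen_def induced_aut_hv)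
  note lin = fock_linear_induced_aut
  show "induced_aut \<tau> (gen (Inr p)) = gen (Inr p)"
    by (cases p) (simp add: gen_def fock_linear_scale[OF lin] fock_linear_add[OF lin] fock_linear_diff[OF lin] induced_aut_Eo)
qed

lemma gen_over:
  "gen (Inl v) \<in> fock_over L" "a \<in> L \<Longrightarrow> gen (Inr (a, b)) \<in> fock_over L"
  using Eo_over[of a] Eo_over[of "- a"] neg_in[of a]
  by (auto simp: gen_def hv_over intro!: fock.subspace_scale[OF fock_over_sub] fock.subspace_add[OF fock_over_sub] fock.subspace_diff[OF fock_over_sub])

text \<open>Three vectors of norm 2 at angles of 120 degrees form a tight frame of their plane with
  constant 3, hence the weight 1/3. With an orthonormal basis of the complement they satisfy the
  hypothesis of \<open>frame_identities\<close>.\<close>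

theorem orbit_frame:
  assumes A: "finite A" "\<And>a. a \<in> A \<Longrightarrow> A2_root a"
    and orth: "\<And>a b. a \<in> A \<Longrightarrow> b \<in> A \<Longrightarrow> a \<noteq> b \<Longrightarrow> a \<bullet> b = 0 \<and> a \<bullet> \<tau> b = 0"
  obtains B where "finite B" "pairwise orthogonal B" "\<And>v. v \<in> B \<Longrightarrow> v \<bullet> v = 1"
    "\<And>v a. v \<in> B \<Longrightarrow> a \<in> A \<Longrightarrow> v \<bullet> a = 0 \<and> v \<bullet> \<tau> a = 0 \<and> v \<bullet> \<tau> (\<tau> a) = 0"
    "card B + 2 * card A = CARD('n)"
    "(\<Sum>v\<in>B. sq v) + (\<Sum>a\<in>A. fock_scale (1/3) (sq a + sq (\<tau> a) + sq (\<tau> (\<tau> a)))) = (\<Sum>j\<in>UNIV. heisb j (-1) (heisb j (-1) fvac))"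
proof -
  define F where "F = {x. \<forall>a\<in>A. x \<bullet> a = 0 \<and> x \<bullet> \<tau> a = 0}"
  have subF: "subspace F" unfolding F_def subspace_def by (auto simp: inner_add_left)
  obtain B where B: "B \<subseteq> F" "pairwise orthogonal B" "\<And>x. x \<in> B \<Longrightarrow> norm x = 1" "independent B" "span B = F"
    by (rule orthonormal_basis_subspace[OF subF]) (assumption | rule that)+
  have finB: "finite B" using B(4) by (rule finiteI_independent)
  have sum0: "x \<bullet> a + x \<bullet> \<tau> a + x \<bullet> \<tau> (\<tau> a) = 0" if "a \<in> A" for a x
  proof -
    have "x \<bullet> (a + \<tau> a + \<tau> (\<tau> a)) = 0" using A(2)[OF that] by (simp add: A2_root_def)
    then show ?thesis by (simp add: inner_add_right)
  qed
  have Bp: "v \<bullet> a = 0 \<and> v \<bullet> \<tau> a = 0 \<and> v \<bullet> \<tau> (\<tau> a) = 0" if "v \<in> B" "a \<in> A" for v a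
  proof -
    have "v \<bullet> a = 0" "v \<bullet> \<tau> a = 0" using subsetD[OF B(1) that(1)] that(2) unfolding F_def by blast+
    then show ?thesis using sum0[OF that(2), of v] by simp
  qed
  define p where "p a x = (1/3) *\<^sub>R ((x \<bullet> a) *\<^sub>R a + (x \<bullet> \<tau> a) *\<^sub>R \<tau> a + (x \<bullet> \<tau> (\<tau> a)) *\<^sub>R \<tau> (\<tau> a))" for a x
  have other: "p a x \<bullet> b = 0 \<and> p a x \<bullet> \<tau> b = 0" if "a \<in> A" "b \<in> A" "a \<noteq> b" for a b x
  proof -
    have z: "a \<bullet> b = 0" "a \<bullet> \<tau> b = 0" "\<tau> a \<bullet> b = 0" using orth[of a b] orth[of b a] that by (auto simp: inner_commute)
    have "\<tau> (\<tau> a) \<bullet> b = 0" "\<tau> a \<bullet> \<tau> b = 0" "\<tau> (\<tau> a) \<bullet> \<tau> b = 0"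
      using z by (simp_all add: tau_inner tau_inner_shift[of a] tau_inner_shift[of "\<tau> a"] tau_3)
    then show ?thesis using z by (simp add: p_def inner_add_left)
  qed
  have own: "p a x \<bullet> a = x \<bullet> a \<and> p a x \<bullet> \<tau> a = x \<bullet> \<tau> a" if "a \<in> A" for a x
    using sum0[OF that, of x] A2_root_inner[OF A(2)[OF that]] by (simp add: p_def inner_add_left)
  define r where "r x = x - (\<Sum>a\<in>A. p a x)" for x
  have rF: "r x \<in> F" for x
    unfolding F_def
  proof (intro CollectI ballI)
    fix b assume b: "b \<in> A"
    have "(\<Sum>a\<in>A. p a x \<bullet> b) = (\<Sum>a\<in>A. if a = b then x \<bullet> b else 0)"
      "(\<Sum>a\<in>A. p a x \<bullet> \<tau> b) = (\<Sum>a\<in>A. if a = b then x \<bullet> \<tau> b else 0)"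
      using other own b by (intro sum.cong[OF refl]; simp)+
    then show "r x \<bullet> b = 0 \<and> r x \<bullet> \<tau> b = 0"
      using b A(1) by (simp add: r_def inner_diff_left inner_sum_left)
  qed
  have Bn: "v \<bullet> v = 1" if "v \<in> B" for v using B(3)[OF that] by (simp add: dot_square_norm)
  have fr: "x \<bullet> y = (\<Sum>v\<in>B. (x \<bullet> v) * (y \<bullet> v)) + (\<Sum>a\<in>A. (1/3) * ((x \<bullet> a) * (y \<bullet> a) + (x \<bullet> \<tau> a) * (y \<bullet> \<tau> a) + (x \<bullet> \<tau> (\<tau> a)) * (y \<bullet> \<tau> (\<tau> a))))" for x y
  proof -
    have rv: "r x \<bullet> v = x \<bullet> v" if v: "v \<in> B" for v
    proof -
      have "p a x \<bullet> v = 0" if "a \<in> A" for a using Bp[OF v that] by (simp add: p_def inner_add_right inner_commute[of _ v])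
      then show ?thesis by (simp add: r_def inner_diff_left inner_sum_left)
    qed
    have "(\<Sum>v\<in>B. (r x \<bullet> v) *\<^sub>R v) = r x"
      using B(2,3,5) rF finB by (intro orthonormal_basis_expand) auto
    then have "r x = (\<Sum>v\<in>B. (x \<bullet> v) *\<^sub>R v)" using rv by simp
    moreover have "x \<bullet> y = r x \<bullet> y + (\<Sum>a\<in>A. p a x \<bullet> y)" by (simp add: r_def inner_diff_left inner_sum_left)
    ultimately show ?thesis by (simp add: inner_sum_right p_def inner_add_right inner_commute[of _ y])
  qed
  define S where "S = B <+> A \<times> {..<3::nat}"
  define c :: "(real^'n) + (real^'n) \<times> nat \<Rightarrow> real" where "c = case_sum (\<lambda>_. 1) (\<lambda>_. 1/3)"
  define w :: "(real^'n) + (real^'n) \<times> nat \<Rightarrow> real^'n" where "w = case_sum id (\<lambda>(a, i). (\<tau> ^^ i) a)"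
  have split: "sum f S = (\<Sum>v\<in>B. f (Inl v)) + (\<Sum>a\<in>A. f (Inr (a, 0)) + f (Inr (a, 1)) + f (Inr (a, 2)))" for f :: "_ \<Rightarrow> 'b::comm_monoid_add"
  proof -
    have "sum f S = (\<Sum>v\<in>B. f (Inl v)) + (\<Sum>q\<in>A \<times> {..<3}. f (Inr q))"
      unfolding S_def using finB A(1) by (simp add: sum.Plus comp_def)
    also have "(\<Sum>q\<in>A \<times> {..<3}. f (Inr q)) = (\<Sum>a\<in>A. \<Sum>i<3. f (Inr (a, i)))"
      by (simp add: sum.cartesian_product case_prod_beta')
    finally show ?thesis by (simp add: numeral_3_eq_3 numeral_2_eq_2)
  qed
  have ws [simp]: "w (Inl v) = v" "c (Inl v) = 1" "c (Inr q) = 1/3" "w (Inr (a, 0)) = a" "w (Inr (a, 1)) = \<tau> a" "w (Inr (a, 2)) = \<tau> (\<tau> a)" for v q a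
    by (simp_all add: w_def c_def numeral_2_eq_2)
  have finS: "finite S" unfolding S_def using finB A(1) by simp
  have frS: "x \<bullet> y = (\<Sum>s\<in>S. c s * (x \<bullet> w s) * (y \<bullet> w s))" for x y
    unfolding split ws fr[of x y] by (simp add: algebra_simps)
  have "(\<Sum>s\<in>S. c s * (w s \<bullet> w s)) = card B + (\<Sum>a\<in>A. 2)"
    unfolding split ws using Bn A2_root_inner(1-3)[OF A(2)] by simp
  then have "real (card B + 2 * card A) = CARD('n)"
    using frame_identities(1)[OF finS frS] by simp
  then have card: "card B + 2 * card A = CARD('n)" by (simp only: of_nat_eq_iff)
  have sqs: "(\<Sum>v\<in>B. sq v) + (\<Sum>a\<in>A. fock_scale (1/3) (sq a + sq (\<tau> a) + sq (\<tau> (\<tau> a)))) = (\<Sum>j\<in>UNIV. heisb j (-1) (heisb j (-1) fvac))"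
    using frame_identities(2)[OF finS frS] unfolding split ws sq_def[symmetric] by (simp add: fock.scale_right_distrib)
  show ?thesis using that[OF finB B(2) Bn Bp card sqs] .
qed

lemma conf_heis: "fock_scale 2 (conf (lattice_voa L \<epsilon>)) = (\<Sum>j\<in>UNIV. heisb j (-1) (heisb j (-1) fvac))"
  unfolding lattice_voa_def by (simp add: fock.scale_sum_right heis_basis_def)

text \<open>A basis vector of the complement contributes one generator and each plane two, by the
  dimension count exactly one for each index. The complement is fixed by \<open>\<tau>\<close> by
  the last hypothesis, and the orbit sums are fixed by construction.\<close>

theorem orbit_heisenberg:
  assumes A: "finite A" "\<And>a. a \<in> A \<Longrightarrow> A2_root a"
    and orth: "\<And>a b. a \<in> A \<Longrightarrow> b \<in> A \<Longrightarrow> a \<noteq> b \<Longrightarrow> a \<bullet> b = 0 \<and> a \<bullet> \<tau> b = 0"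
    and fixd: "\<And>x. (\<And>a. a \<in> A \<Longrightarrow> x \<bullet> a = 0 \<and> x \<bullet> \<tau> a = 0) \<Longrightarrow> \<tau> x = x"
  obtains s :: "'n \<Rightarrow> 'n fock" where "\<And>i. s i \<in> fixed_points (lattice_voa L \<epsilon>) (induced_aut \<tau>)"
    "\<And>i j n. n \<ge> 0 \<Longrightarrow> VM (s i) n (s j) = (if n = 1 \<and> i = j then vac (lattice_voa L \<epsilon>) else 0)"
    "vscale (lattice_voa L \<epsilon>) 2 (conf (lattice_voa L \<epsilon>)) = (\<Sum>i\<in>UNIV. VM (s i) (-1) (s i))"
proof -
  obtain B where B: "finite B" "pairwise orthogonal B" "\<And>v. v \<in> B \<Longrightarrow> v \<bullet> v = 1"
    "\<And>v a. v \<in> B \<Longrightarrow> a \<in> A \<Longrightarrow> v \<bullet> a = 0 \<and> v \<bullet> \<tau> a = 0 \<and> v \<bullet> \<tau> (\<tau> a) = 0"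
    "card B + 2 * card A = CARD('n)"
    "(\<Sum>v\<in>B. sq v) + (\<Sum>a\<in>A. fock_scale (1/3) (sq a + sq (\<tau> a) + sq (\<tau> (\<tau> a)))) = (\<Sum>j\<in>UNIV. heisb j (-1) (heisb j (-1) fvac))"
    using orbit_frame[OF A orth] by blast
  define I where "I = B <+> A \<times> (UNIV :: bool set)"
  have "finite I" "card I = CARD('n)" unfolding I_def using A(1) B(1,5) by (simp_all add: card_Plus card_cartesian_product)
  then obtain k :: "'n \<Rightarrow> _" where k: "bij_betw k UNIV I"
    using finite_same_card_bij[of "UNIV :: 'n set" I] by auto
  have kI: "k i \<in> I" for i using k by (auto simp: bij_betw_def)
  have kin: "k i = k j \<longleftrightarrow> i = j" for i j using k by (auto simp: bij_betw_def inj_on_def)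
  have aL: "a \<in> L" if "a \<in> A" for a using A(2)[OF that] by (simp add: A2_root_def)
  have prod: "VM (gen x) n (gen y) = (if n = 1 \<and> x = y then fvac else 0)" if n: "n \<ge> 0" and x: "x \<in> I" and y: "y \<in> I" for x y n
  proof -
    consider (1) v v' where "x = Inl v" "y = Inl v'" "v \<in> B" "v' \<in> B"
      | (2) v a b where "x = Inl v" "y = Inr (a, b)" "v \<in> B" "a \<in> A"
      | (3) v a b where "y = Inl v" "x = Inr (a, b)" "v \<in> B" "a \<in> A"
      | (4) a b a' b' where "x = Inr (a, b)" "y = Inr (a', b')" "a \<in> A" "a' \<in> A"
      using x y unfolding I_def by blast
    then show ?thesis
    proof cases
      case 1
      have "v \<bullet> v' = (if v = v' then 1 else 0)" using B(2,3) 1(3,4) by (auto simp: pairwise_def orthogonal_def)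
      then show ?thesis using VM_hv_hv[OF n, of v v'] B(3)[OF 1(4)] 1 by (simp add: gen_def)
    next
      case 2
      then show ?thesis using VM_gen_mixed(1)[OF n aL] B(4) by simp
    next
      case 3
      then show ?thesis using VM_gen_mixed(2)[OF n aL] B(4) by simp
    next
      case 4
      show ?thesis
      proof (cases "a = a'")
        case True
        then show ?thesis using VM_gen_same[OF n A(2)[OF 4(3)]] 4 by simp
      next
        case False
        then show ?thesis using VM_gen_orthogonal[OF n] orth[of a a'] orth[of a' a] 4 by (simp add: inner_commute)
      qed
    qed
  qed
  show ?thesis
  proof (rule that[of "\<lambda>i. gen (k i)"])
    show "gen (k i) \<in> fixed_points (lattice_voa L \<epsilon>) (induced_aut \<tau>)" for i
    proof -
      have fx: "\<tau> v = v" if "v \<in> B" for v using B(4)[OF that] by (intro fixd) blast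
      have "gen (k i) \<in> fock_over L" "induced_aut \<tau> (gen (k i)) = gen (k i)"
        using kI[of i] unfolding I_def by (auto simp: gen_over aL induced_aut_gen fx)
      then show ?thesis by (simp add: fixed_points_def lattice_voa_def fock_over_def)
    qed
    show "VM (gen (k i)) n (gen (k j)) = (if n = 1 \<and> i = j then vac (lattice_voa L \<epsilon>) else 0)" if "n \<ge> 0" for i j n
      using prod[OF that kI kI, of i j] by (simp add: kin lattice_voa_def)
    have "(\<Sum>i\<in>UNIV. VM (gen (k i)) (-1) (gen (k i))) = (\<Sum>x\<in>I. VM (gen x) (-1) (gen x))"
      by (rule sum.reindex_bij_betw[OF k])
    also have "\<dots> = (\<Sum>v\<in>B. VM (gen (Inl v)) (-1) (gen (Inl v))) + (\<Sum>a\<in>A. \<Sum>b\<in>UNIV. VM (gen (Inr (a, b))) (-1) (gen (Inr (a, b))))"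
      unfolding I_def using A(1) B(1) by (simp add: sum.Plus sum.cartesian_product comp_def case_prod_beta')
    also have "\<dots> = (\<Sum>v\<in>B. sq v) + (\<Sum>a\<in>A. fock_scale (1/3) (sq a + sq (\<tau> a) + sq (\<tau> (\<tau> a))))"
    proof (intro arg_cong2[of _ _ _ _ "(+)"] sum.cong[OF refl])
      show "VM (gen (Inl v)) (-1) (gen (Inl v)) = sq v" for v by (simp add: gen_def VM_hv[OF hv_over] sq_def)
      show "(\<Sum>b\<in>UNIV. VM (gen (Inr (a, b))) (-1) (gen (Inr (a, b)))) = fock_scale (1/3) (sq a + sq (\<tau> a) + sq (\<tau> (\<tau> a)))" if "a \<in> A" for a
        unfolding UNIV_bool using VM_gen_neg1[OF A(2)[OF that]] by (simp add: add.commute)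
    qed
    also have "\<dots> = fock_scale 2 (conf (lattice_voa L \<epsilon>))" unfolding B(6) conf_heis ..
    also have "\<dots> = vscale (lattice_voa L \<epsilon>) 2 (conf (lattice_voa L \<epsilon>))" by (simp add: lattice_voa_def)
    finally show "vscale (lattice_voa L \<epsilon>) 2 (conf (lattice_voa L \<epsilon>)) = (\<Sum>i\<in>UNIV. VM (gen (k i)) (-1) (gen (k i)))" ..
  qed
qed

end

section \<open>The orbifold\<close>

lemma holomorphic_simple_voa:
  assumes "vertex_operator_algebra V c" "holomorphic_voa V"
  shows "simple_voa V c"
proof -
  interpret vertex_operator_algebra V c by fact
  have irr: "irreducible_twisted_module V id 1 (adjoint_module V)" using assms(2) by (simp add: holomorphic_voa_def)
  show ?thesis
  proof unfold_locales
    show "vcar V \<noteq> {0}" using irr by (simp add: irreducible_twisted_module_def adjoint_module_def)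
    fix N assume N: "subspace N" "N \<subseteq> vcar V" and cl: "\<And>u n w. u \<in> vcar V \<Longrightarrow> w \<in> N \<Longrightarrow> vmode V u n w \<in> N"
    have "submodule V (adjoint_module V) N"
      unfolding submodule_def adjoint_module_def using N cl subspace_0[OF N(1)] by simp
    then show "N = {0} \<or> N = vcar V" using irr unfolding irreducible_twisted_module_def by (simp add: adjoint_module_def)
  qed
qed

lemma twisted_module_mode_0: "twisted_module V g T M \<Longrightarrow> u \<in> vcar V \<Longrightarrow> mmode M u n 0 = 0"
proof -
  assume tm: "twisted_module V g T M" and u: "u \<in> vcar V"
  interpret twisted_module V g T M by fact
  have "0 \<in> mcar M" by (rule subspace_0[OF subspace_mcar])
  then show ?thesis using act_scale_right[OF u, of 0 n 0] by simp
qed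

lemma twisted_module_scale_0: "twisted_module V g T M \<Longrightarrow> mscale M a 0 = 0"
proof -
  assume "twisted_module V g T M"
  interpret twisted_module V g T M by fact
  show ?thesis by simp
qed

lemma twisted_module_integral_part_0: "twisted_module V g T M \<Longrightarrow> 0 \<in> integral_part V M"
proof -
  assume "twisted_module V g T M"
  interpret twisted_module V g T M by fact
  show ?thesis unfolding integral_part_def by (rule span_zero)
qed

theorem weyl_fixed_heisenberg:
  fixes L :: "(real^'n::finite) set"
  assumes nie: "even_lattice L" "dual_lattice L = L" and tau: "\<tau> \<in> lattice_aut L" "\<tau> ^^ 3 = id"
    and eps: "twisting_cocycle L \<epsilon>" "invariant_cocycle L \<tau> \<epsilon>" and weyl: "\<tau> \<in> weyl_group L"
  obtains s :: "'n \<Rightarrow> 'n fock" where "\<And>i. s i \<in> fixed_points (lattice_voa L \<epsilon>) (induced_aut \<tau>)"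
    "\<And>i j n. n \<ge> 0 \<Longrightarrow> vmode (lattice_voa L \<epsilon>) (s i) n (s j) = (if n = 1 \<and> i = j then vac (lattice_voa L \<epsilon>) else 0)"
    "vscale (lattice_voa L \<epsilon>) 2 (conf (lattice_voa L \<epsilon>)) = (\<Sum>i\<in>UNIV. vmode (lattice_voa L \<epsilon>) (s i) (-1) (s i))"
proof -
  interpret integral_lattice L by (rule niemeier_integral(1)[OF nie])
  have t3: "\<tau> (\<tau> (\<tau> x)) = x" for x
    using fun_cong[OF tau(2), of x] by (simp add: numeral_3_eq_3)
  interpret orbit_lattice L \<epsilon> \<tau>
    by unfold_locales (use tau(1) eps niemeier_integral(2)[OF nie] t3 in \<open>auto simp: lattice_aut_def\<close>)
  obtain A where A: "finite A" "A \<subseteq> R" "\<forall>a\<in>A. a + \<tau> a + \<tau> (\<tau> a) = 0"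
    "\<forall>a\<in>A. \<forall>b\<in>A. a \<noteq> b \<longrightarrow> a \<bullet> b = 0 \<and> a \<bullet> \<tau> b = 0" "\<forall>x. (\<forall>a\<in>A. x \<bullet> a = 0 \<and> x \<bullet> \<tau> a = 0) \<longrightarrow> \<tau> x = x"
    using A2_decomposition[OF weyl t3] by (elim exE conjE)
  have A2: "A2_root a" if "a \<in> A" for a using A(2,3) that by (auto simp: A2_root_def roots_def)
  show thesis
  proof (rule orbit_heisenberg[OF A(1) A2])
    show "a \<bullet> b = 0 \<and> a \<bullet> \<tau> b = 0" if "a \<in> A" "b \<in> A" "a \<noteq> b" for a b using A(4) that by blast
    show "\<tau> x = x" if "\<And>a. a \<in> A \<Longrightarrow> x \<bullet> a = 0 \<and> x \<bullet> \<tau> a = 0" for x using A(5) that by blast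
  qed (assumption | rule that)+
qed

theorem theorem1:
  fixes L :: "(real^24) set" and \<tau> :: "real^24 \<Rightarrow> real^24"
    and \<epsilon> :: "real^24 \<Rightarrow> real^24 \<Rightarrow> complex"
    and M1 :: "(24 fock, 'm1::ab_group_add) vmodule"
    and M2 :: "(24 fock, 'm2::ab_group_add) vmodule"
    and W :: "(24 fock \<times> 'm1 \<times> 'm2) voa"
  assumes "niemeier_lattice L"
    and "\<tau> \<in> lattice_aut L" and "\<tau> \<noteq> id" and "\<tau> ^^ 3 = id"
    and "6 dvd lattice_rank (fixed_sublattice L \<tau>)"
    and "twisting_cocycle L \<epsilon>" and "invariant_cocycle L \<tau> \<epsilon>"
    and "irreducible_twisted_module (lattice_voa L \<epsilon>) (induced_aut \<tau>) 3 M1"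
    and "irreducible_twisted_module (lattice_voa L \<epsilon>) (induced_aut \<tau> ^^ 2) 3 M2"
    and "miyamoto_orbifold (lattice_voa L \<epsilon>) (induced_aut \<tau>) M1 M2 W"
    and "\<tau> \<in> weyl_group L"
  shows "\<exists>N \<delta>. niemeier_lattice N \<and> twisting_cocycle N \<delta> \<and> voa_isomorphic W (lattice_voa N \<delta>)"
proof -
  let ?V = "lattice_voa L \<epsilon>" and ?g = "induced_aut \<tau>"
  have nie: "even_lattice L" "dual_lattice L = L" using assms(1) by (simp_all add: niemeier_lattice_def)
  obtain s :: "24 \<Rightarrow> 24 fock" where s: "\<And>i. s i \<in> fixed_points ?V ?g"
    "\<And>i j n. n \<ge> 0 \<Longrightarrow> vmode ?V (s i) n (s j) = (if n = 1 \<and> i = j then vac ?V else 0)"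
    "vscale ?V 2 (conf ?V) = (\<Sum>i\<in>UNIV. vmode ?V (s i) (-1) (s i))"
    by (rule weyl_fixed_heisenberg[OF nie assms(2,4,6,7,11)]) (assumption | rule that)+
  have tw: "twisted_module ?V ?g 3 M1" "twisted_module ?V (?g ^^ 2) 3 M2"
    using assms(8,9) by (simp_all add: irreducible_twisted_module_def)
  note m = assms(10)[unfolded miyamoto_orbifold_def]
  have Wcar: "vcar W = fixed_points ?V ?g \<times> integral_part ?V M1 \<times> integral_part ?V M2"
    and Wscale: "vscale W a (x, y, z) = (vscale ?V a x, mscale M1 a y, mscale M2 a z)"
    and Wvac: "vac W = (vac ?V, 0, 0)" and Wconf: "conf W = (conf ?V, 0, 0)"
    and Wvoa: "vertex_operator_algebra W 24" and Whol: "holomorphic_voa W"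
    for a x y z using m by auto
  have Wmode: "\<forall>u \<in> fixed_points ?V ?g. \<forall>(x, y, z) \<in> vcar W. \<forall>n. vmode W (u, 0, 0) n (x, y, z) =
      (vmode ?V u n x, mmode M1 u (of_int n) y, mmode M2 u (of_int n) z)" using m by blast
  \<comment> \<open>Vectors of the untwisted sector: their zero components in the twisted modules
    stay zero under the modes, so their products are those of the lattice VOA.\<close>
  define t where "t i = (s i, 0 :: 'm1, 0 :: 'm2)" for i
  have t_car: "t i \<in> vcar W" for i
    unfolding t_def Wcar using s(1) tw by (simp add: twisted_module_integral_part_0)
  have t_mode: "vmode W (t i) n (t j) = (vmode ?V (s i) n (s j), 0, 0)" for i j n
  proof -
    have sV: "s i \<in> vcar ?V" using s(1)[of i] by (simp add: fixed_points_def)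
    have "vmode W (s i, 0, 0) n (s j, 0, 0) = (vmode ?V (s i) n (s j), mmode M1 (s i) (of_int n) 0, mmode M2 (s i) (of_int n) 0)"
      using bspec[OF bspec[OF Wmode s(1)[of i]] t_car[of j]] by (simp add: t_def)
    then show ?thesis
      unfolding t_def using twisted_module_mode_0[OF tw(1) sV] twisted_module_mode_0[OF tw(2) sV] by simp
  qed
  interpret simple_voa W 24 by (rule holomorphic_simple_voa[OF Wvoa Whol])
  note zero = twisted_module_scale_0[OF tw(1)] twisted_module_scale_0[OF tw(2)]
  interpret heisenberg_voa W 24 t
  proof
    show "t i \<in> vcar W" for i by (rule t_car)
    show "vmode W (t i) n (t j) = (if n = 1 \<and> i = j then vac W else 0)" if "n \<ge> 0" for n i j
      unfolding t_mode Wvac s(2)[OF that] by (simp add: zero_prod_def)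
    have "(\<Sum>i\<in>UNIV. vmode W (t i) (-1) (t i)) = (\<Sum>i\<in>UNIV. vmode ?V (s i) (-1) (s i), 0, 0)"
      unfolding t_mode by (simp add: sum_prod)
    then show "vscale W 2 (conf W) = (\<Sum>i\<in>UNIV. vmode W (t i) (-1) (t i))"
      unfolding Wconf Wscale s(3) zero by simp
  qed
  show ?thesis using holomorphic_is_lattice_voa[OF Whol] unfolding niemeier_lattice_def by blast
qed

end
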